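(* Let $\mathcal{S}$ be a weakly homogeneous polytopal cut and project scheme (possibly with a polytopal labelling partition of its window), with associated cut and project set $\Lambda$. Then the following are equivalent: (1) $\Lambda$ is linearly repetitive (LR); (2) $\mathcal{S}$ has low complexity (property C) and is Diophantine (property D).
   Context: SCHEMES. A ($k$-to-$d$) polytopal cut and project scheme $\mathcal{S}$ consists of a $k$-dimensional real vector space $\mathbb{E}$ (total space), complementary subspaces $\mathbb{E}_\vee$ (physical space, dimension $d\ge 1$) and $\mathbb{E}_<$ (internal space, dimension $n=k-d\ge 1$) with $\mathbb{E}=\mathbb{E}_\vee\oplus\mathbb{E}_<$, a lattice $\Gamma<\mathbb{E}$ and a (non-empty) polytopal window $W\subset\mathbb{E}_<$. The projections to $\mathbb{E}_\vee,\mathbb{E}_<$ are written $x\mapsto x_\vee$, $x\mapsto x_<$ (also for subsets). A set $W$ is polytopal if it is compact, the closure of its interior, and $\partial W$ is contained in the union of a finite set $\mathscr{H}$ of properly supporting hyperplanes (affine, codimension 1); $H$ is properly supporting if there are $w_H\in H$, an open neighbourhood $U_H$ of $w_H$ and a closed half-space $H^+$ of $H$ with $W\cap U_H=H^+\cap U_H$. (Equivalently $W$ is a finite union of convex polytopes with non-empty interior; $\mathscr H$ is then exactly the set of properly supporting hyperplanes.) The window may carry a labelling $W=\bigcup_i W_i$ with each $W_i$ polytopal and distinct $W_i$ meeting at most on their boundaries; then $\mathscr{H}$ denotes the union of the sets of supporting hyperplanes of the $W_i$. For $H\in\mathscr H$, $V(H)=H-H$ is the parallel subspace; $\mathscr{H}_0=\{V(H):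 H\in\mathscr{H}\}$. Standing assumptions: both projections are injective on $\Gamma$; $\Gamma_<$ is dense in $\mathbb{E}_<$; the scheme is non-singular, i.e. $\gamma_<\notin\partial W$ (resp. $\notin\partial W_i$ for all $i$) for all $\gamma\in\Gamma$. For $x=\gamma_\vee\in\Gamma_\vee$ put $x^\star=\gamma_<$. The cut and project set is $\Lambda=\{x\in\Gamma_\vee: x^\star\in W\}$, where $x$ has label $i$ if $x^\star\in W_i$ in the labelled case. PATCHES. Fix norms on $\mathbb{E}_\vee,\mathbb{E}_<$. For $x\in\Lambda$ the $r$-patch $P_r(x)$ is $\Lambda\cap B_r(x)$ (closed ball, with labels) with marked centre $x$; $r$-patches are identified if they agree up to a translation taking centre to centre. $p(r)$ is the number of $r$-patches. Property C (low complexity): there is $C>0$ with $p(r)\le Cr^d$ for all sufficiently large $r$. LR: there is $C>0$ such that for all sufficiently large $r$, every $Cr$-patch of $\Lambda$ contains every $r$-patch (up to translation). WEAK HOMOGENEITY. There is $N\in\mathbb{N}$ and, for each $H\in\mathscr{H}$, some $\gamma_H\in\frac1N\Gamma$ with $\bigcap_{H\in\mathscr{H}}(H-(\gamma_H)_<)\neq\emptyset$. STABILISERS AND DECOMPOSITIONS. For $V\in\mathscr{H}_0$, $\Gamma^V=\{\gamma\in\Gamma:\gamma_<\in V\}$, $\mathrm{rk}(V)=\mathrm{rk}(\Gamma^V)$; for $S\subseteq\mathscr{H}_0$, $\Gamma^S=\bigcap_{V\in S}\Gamma^V$ and $X_S=\bigcap_{V\in S}V$ (with $\Gamma^\emptyset=\Gamma$,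 $X_\emptyset=\mathbb{E}_<$). A decomposition is a collection $Q=\{S_1,\dots,S_\ell\}$ of strict subsets of $\mathscr{H}_0$ such that each $V\in\mathscr{H}_0$ fails to lie in exactly one $S_i$, and $\mathbb{E}_<=X_1+\cdots+X_\ell$ with $X_i=X_{S_i}$ (the sum is then direct). Put $\Gamma_i=\Gamma^{S_i}$, $k_i=\mathrm{rk}(\Gamma_i)$, $n_i=\dim X_i$, $d_i=k_i-n_i$, $\delta_i=d_i/n_i$. Call $Q$ a CSR decomposition if $\Gamma_1+\cdots+\Gamma_\ell$ has finite index in $\Gamma$ and, for all $i$ and all $V\in\mathscr{H}_0\setminus S_i$, $\mathrm{rk}(\Gamma^V\cap\Gamma_i)=k_i-\delta_i-1$. If C holds then a CSR decomposition exists; if moreover all $V\in\mathscr H_0$ have equal rank, the trivial decomposition $\{\emptyset\}$ is one. DIOPHANTINE. Let $G\cong\mathbb{Z}^k$ be a subgroup of an $n$-dimensional real vector space $X$ with norm $\|\cdot\|$, and $\eta(g)=\max_i|g_i|$ the norm on $G$ from an isomorphism $G\cong\mathbb{Z}^k$, $g\mapsto (g_1,\dots,g_k)$. $G$ is Diophantine in $X$ if there is $c>0$ with $\|g\|\ge c\,\eta(g)^{-\delta}$ for all $0\ne g\in G$, where $\delta=(k-n)/n$. (Independent of the choices of norms.) Property D: with respect to a CSR decomposition, each $(\Gamma_i)_<$ is Diophantine in $X_i$ (as a rank $k_i$ subgroup of the $n_i$-dimensional space $X_i$). In the constant stabiliser rank case, with the trivial decomposition, this says $\Gamma_<$ is Diophantine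 in $\mathbb{E}_<$. (Property D does not depend on which CSR decomposition is chosen.) *)

theory Defs
  imports "HOL-Analysis.Analysis"
begin

section \<open>Abelian groups inside a real vector space, as modules over the integers\<close>

global_interpretation zmod: module "\<lambda>(m::int) (x::'a::real_vector). of_int m *\<^sub>R x"
  by unfold_locales (simp_all add: algebra_simps)

text \<open>Here \<open>zmod.subspace G\<close> says that \<open>G\<close> is an additive subgroup, and \<open>zmod.span B = G\<close>
  together with \<open>zmod.independent B\<close> says that \<open>G\<close> is free abelian with basis \<open>B\<close>.\<close>

definition is_lattice :: "'a::euclidean_space set \<Rightarrow> bool" where
  "is_lattice G \<longleftrightarrow> zmod.subspace G \<and> discrete G \<and> span G = UNIV"

text \<open>The rank of an abelian group of finite rank. It is only applied to subgroups of a lattice,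
  where the cardinalities are bounded by the dimension of the space.\<close>

definition zrank :: "'a::real_vector set \<Rightarrow> nat" where
  "zrank G = Max (card ` {B. finite B \<and> B \<subseteq> G \<and> zmod.independent B})"

definition finite_index :: "'a::real_vector set \<Rightarrow> 'a set \<Rightarrow> bool" where
  "finite_index D G \<longleftrightarrow> D \<subseteq> G \<and> finite ((\<lambda>g. (+) g ` D) ` G)"

definition norm_on :: "'a::real_vector set \<Rightarrow> ('a \<Rightarrow> real) \<Rightarrow> bool" where
  "norm_on E nrm \<longleftrightarrow>
     (\<forall>x\<in>E. 0 \<le> nrm x \<and> (nrm x = 0 \<longleftrightarrow> x = 0)) \<and>
     (\<forall>x\<in>E. \<forall>c. nrm (c *\<^sub>R x) = \<bar>c\<bar> * nrm x) \<and>
     (\<forall>x\<in>E. \<forall>y\<in>E. nrm (x + y) \<le> nrm x + nrm y)"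

text \<open>\<open>zcoord_norm B g\<close> is the maximum norm of the coordinate vector of \<open>g\<close> with respect to the
  integral basis \<open>B\<close>, that is, with respect to one isomorphism of the group with
  \<open>\<int>\<^sup>k\<close>, \<open>k = card B\<close>. Different bases give equivalent norms, so the existential
  quantifier over \<open>B\<close> in \<open>diophantine_in\<close> could equally be a universal one.\<close>

definition zcoord_norm :: "'a::real_vector set \<Rightarrow> 'a \<Rightarrow> int" where
  "zcoord_norm B g = Max ((\<lambda>b. \<bar>zmod.representation B g b\<bar>) ` B)"

definition diophantine_in :: "('a::euclidean_space \<Rightarrow> real) \<Rightarrow> 'a set \<Rightarrow> 'a set \<Rightarrow> bool" where
  "diophantine_in nrm G X \<longleftrightarrow>
     G \<subseteq> X \<and>
     (\<exists>B. finite B \<and> zmod.independent B \<and> zmod.span B = G \<and>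
        (let \<delta> = (real (card B) - real (dim X)) / real (dim X)
         in \<exists>c>0. \<forall>g\<in>G - {0}. nrm g \<ge> c * of_int (zcoord_norm B g) powr (- \<delta>)))"


section \<open>Polytopal sets in a subspace\<close>

text \<open>All topological notions are relative to the subspace \<open>E\<close>.
  Hyperplanes of \<open>E\<close> are affine of codimension one in \<open>E\<close>. Replacing \<open>(a, b)\<close> by
  \<open>(-a, -b)\<close> exchanges the two closed half-spaces bounded by a hyperplane.\<close>

definition halfspace_of :: "'a::euclidean_space set \<Rightarrow> 'a set \<Rightarrow> 'a set \<Rightarrow> bool" where
  "halfspace_of E H Hp \<longleftrightarrow>
     (\<exists>a\<in>E. \<exists>b. a \<noteq> 0 \<and> H = {x \<in> E. a \<bullet> x = b} \<and> Hp = {x \<in> E. a \<bullet> x \<le> b})"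

definition properly_supporting :: "'a::euclidean_space set \<Rightarrow> 'a set \<Rightarrow> 'a set \<Rightarrow> bool" where
  "properly_supporting E W H \<longleftrightarrow>
     (\<exists>Hp w U. halfspace_of E H Hp \<and> w \<in> H \<and> openin (top_of_set E) U \<and> w \<in> U \<and>
        W \<inter> U = Hp \<inter> U)"

definition polytopal :: "'a::euclidean_space set \<Rightarrow> 'a set \<Rightarrow> bool" where
  "polytopal E W \<longleftrightarrow>
     W \<subseteq> E \<and> compact W \<and>
     W = top_of_set E closure_of (top_of_set E interior_of W) \<and>
     (\<exists>\<H>. finite \<H> \<and> (\<forall>H\<in>\<H>. properly_supporting E W H) \<and>
        top_of_set E frontier_of W \<subseteq> \<Union>\<H>)"

definition direction :: "'a::real_vector set \<Rightarrow> 'a set" where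
  "direction H = {x - y | x y. x \<in> H \<and> y \<in> H}"


section \<open>Cut and project schemes\<close>

text \<open>A scheme whose window carries no labelling is one with a single label \<open>i\<close> and
  \<open>piece S i = window S\<close>.\<close>

record ('a, 'l) cps =
  phys :: "'a set"
  internal :: "'a set"
  lattice :: "'a set"
  window :: "'a set"
  labels :: "'l set"
  piece :: "'l \<Rightarrow> 'a set"

definition proj_phys :: "('a::euclidean_space, 'l) cps \<Rightarrow> 'a \<Rightarrow> 'a" where
  "proj_phys S x = (THE v. v \<in> phys S \<and> x - v \<in> internal S)"

definition proj_int :: "('a::euclidean_space, 'l) cps \<Rightarrow> 'a \<Rightarrow> 'a" where
  "proj_int S x = (THE w. w \<in> internal S \<and> x - w \<in> phys S)"

definition polytopal_cps :: "('a::euclidean_space, 'l) cps \<Rightarrow> bool" where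
  "polytopal_cps S \<longleftrightarrow>
     subspace (phys S) \<and> subspace (internal S) \<and>
     phys S \<inter> internal S = {0} \<and> phys S + internal S = UNIV \<and>
     dim (phys S) \<ge> 1 \<and> dim (internal S) \<ge> 1 \<and>
     is_lattice (lattice S) \<and>
     window S \<noteq> {} \<and> polytopal (internal S) (window S) \<and>
     finite (labels S) \<and>
     (\<forall>i\<in>labels S. polytopal (internal S) (piece S i)) \<and>
     window S = (\<Union>i\<in>labels S. piece S i) \<and>
     (\<forall>i\<in>labels S. \<forall>j\<in>labels S. i \<noteq> j \<longrightarrow>
        piece S i \<inter> piece S j \<subseteq>
          top_of_set (internal S) frontier_of (piece S i) \<inter>
          top_of_set (internal S) frontier_of (piece S j)) \<and>
     inj_on (proj_phys S) (lattice S) \<and> inj_on (proj_int S) (lattice S) \<and>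
     internal S \<subseteq> closure (proj_int S ` lattice S) \<and>
     (\<forall>\<gamma>\<in>lattice S. \<forall>i\<in>labels S.
        proj_int S \<gamma> \<notin> top_of_set (internal S) frontier_of (piece S i))"

text \<open>The star map is only meaningful on the projection of the lattice to the physical space.\<close>

definition star :: "('a::euclidean_space, 'l) cps \<Rightarrow> 'a \<Rightarrow> 'a" where
  "star S x = proj_int S (THE \<gamma>. \<gamma> \<in> lattice S \<and> proj_phys S \<gamma> = x)"

definition cut_project_set :: "('a::euclidean_space, 'l) cps \<Rightarrow> 'a set" where
  "cut_project_set S = {x \<in> proj_phys S ` lattice S. star S x \<in> window S}"

definition hyperplanes :: "('a::euclidean_space, 'l) cps \<Rightarrow> 'a set set" where
  "hyperplanes S = {H. \<exists>i\<in>labels S. properly_supporting (internal S) (piece S i) H}"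

definition directions :: "('a::euclidean_space, 'l) cps \<Rightarrow> 'a set set" where
  "directions S = direction ` hyperplanes S"

definition weakly_homogeneous :: "('a::euclidean_space, 'l) cps \<Rightarrow> bool" where
  "weakly_homogeneous S \<longleftrightarrow>
     (\<exists>(N::nat) g. N > 0 \<and>
        (\<forall>H\<in>hyperplanes S. g H \<in> (\<lambda>\<gamma>. (1 / real N) *\<^sub>R \<gamma>) ` lattice S) \<and>
        (\<Inter>H\<in>hyperplanes S. (\<lambda>x. x - proj_int S (g H)) ` H) \<noteq> {})"


section \<open>Patches\<close>

text \<open>A patch is the set of its points paired with their labels; the centre is kept as a
  separate argument.\<close>

definition patch :: "('a::euclidean_space, 'l) cps \<Rightarrow> ('a \<Rightarrow> real) \<Rightarrow> real \<Rightarrow> 'a \<Rightarrow> ('a \<times> 'l) set" where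
  "patch S nrm r x =
     {(y, i). y \<in> cut_project_set S \<and> nrm (y - x) \<le> r \<and> i \<in> labels S \<and> star S y \<in> piece S i}"

definition same_patch :: "('a::euclidean_space, 'l) cps \<Rightarrow> ('a \<Rightarrow> real) \<Rightarrow> real \<Rightarrow> 'a \<Rightarrow> 'a \<Rightarrow> bool" where
  "same_patch S nrm r x y \<longleftrightarrow>
     (\<lambda>(z, i). (z + (y - x), i)) ` patch S nrm r x = patch S nrm r y"

text \<open>The quotient is finite for every scheme, by finite local complexity.\<close>

definition num_patches :: "('a::euclidean_space, 'l) cps \<Rightarrow> ('a \<Rightarrow> real) \<Rightarrow> real \<Rightarrow> nat" where
  "num_patches S nrm r =
     card (cut_project_set S //
       {(x, y). x \<in> cut_project_set S \<and> y \<in> cut_project_set S \<and> same_patch S nrm r x y})"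

definition low_complexity :: "('a::euclidean_space, 'l) cps \<Rightarrow> ('a \<Rightarrow> real) \<Rightarrow> bool" where
  "low_complexity S nrm \<longleftrightarrow>
     (\<exists>C>0. \<forall>\<^sub>F r in at_top. real (num_patches S nrm r) \<le> C * r ^ dim (phys S))"

definition linearly_repetitive :: "('a::euclidean_space, 'l) cps \<Rightarrow> ('a \<Rightarrow> real) \<Rightarrow> bool" where
  "linearly_repetitive S nrm \<longleftrightarrow>
     (\<exists>C>0. \<forall>\<^sub>F r in at_top. \<forall>y\<in>cut_project_set S. \<forall>x\<in>cut_project_set S.
        \<exists>z\<in>cut_project_set S. same_patch S nrm r x z \<and> patch S nrm r z \<subseteq> patch S nrm (C * r) y)"


section \<open>Stabilisers and decompositions\<close>

definition stab :: "('a::euclidean_space, 'l) cps \<Rightarrow> 'a set set \<Rightarrow> 'a set" where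
  "stab S T = {\<gamma> \<in> lattice S. \<forall>V\<in>T. proj_int S \<gamma> \<in> V}"

definition common_space :: "('a::euclidean_space, 'l) cps \<Rightarrow> 'a set set \<Rightarrow> 'a set" where
  "common_space S T = internal S \<inter> \<Inter>T"

text \<open>Sums over a collection of sets are Minkowski sums. Indexing by the members of \<open>Q\<close>
  loses nothing: a subset occurring twice would be a strict one, and an element it misses would
  be missed twice.\<close>

definition decomposition :: "('a::euclidean_space, 'l) cps \<Rightarrow> 'a set set set \<Rightarrow> bool" where
  "decomposition S Q \<longleftrightarrow>
     finite Q \<and> (\<forall>T\<in>Q. T \<subset> directions S) \<and>
     (\<forall>V\<in>directions S. \<exists>!T. T \<in> Q \<and> V \<notin> T) \<and>
     internal S = (\<Sum>T\<in>Q. common_space S T)"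

definition delta :: "('a::euclidean_space, 'l) cps \<Rightarrow> 'a set set \<Rightarrow> real" where
  "delta S T =
     (real (zrank (stab S T)) - real (dim (common_space S T))) / real (dim (common_space S T))"

definition csr_decomposition :: "('a::euclidean_space, 'l) cps \<Rightarrow> 'a set set set \<Rightarrow> bool" where
  "csr_decomposition S Q \<longleftrightarrow>
     decomposition S Q \<and>
     finite_index (\<Sum>T\<in>Q. stab S T) (lattice S) \<and>
     (\<forall>T\<in>Q. \<forall>V\<in>directions S - T.
        real (zrank (stab S {V} \<inter> stab S T)) = real (zrank (stab S T)) - delta S T - 1)"

definition diophantine_cps :: "('a::euclidean_space, 'l) cps \<Rightarrow> ('a \<Rightarrow> real) \<Rightarrow> bool" where
  "diophantine_cps S nrm \<longleftrightarrow>
     (\<exists>Q. csr_decomposition S Q \<and>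
        (\<forall>T\<in>Q. diophantine_in nrm (proj_int S ` stab S T) (common_space S T)))"

end

(* Both sides are shown to be equivalent to a third condition. Let sv V be the corank in the lattice
   of the stabiliser of a hyperplane direction V, and fl V the linear functional with kernel V on
   the internal space. The condition says that sv V adds up to the rank k of the lattice over every
   flag, that is, over every minimal set of directions with trivial intersection, and that
   |fl V g| is at least of order |g|^(1 - sv V) on the lattice points g with fl V g nonzero.

   From linear repetitivity: parallelepipeds cut out by translates of the hyperplanes of a flag can
   be recognised by patches of radius r, so they are met by lattice points within distance O(r).
   Hence their volumes are at least of order r^(-d), while a lack of rank or a lattice point close
   to a direction would give smaller ones. Low complexity holds since a patch of radius O(r)
   contains all patches of radius r, one for each of its O(r^d) points.

   To linear repetitivity: patches of radius r correspond to cells cut out by translates of the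
   hyperplanes. By weak homogeneity the vertices of these cells are projections of lattice points,
   up to a common translation and a bounded denominator, so they keep away from the hyperplanes
   they do not lie on. Therefore each cell contains a box, with a side of order r^(1 - sv V) for each V,
   and a transference argument finds lattice points in this box within distance O(r).

   With the Diophantine property: grouping the directions by the value of sv gives a CSR
   decomposition. A lattice point has, up to a bounded factor, a component in the stabiliser of each
   block, whose norm is comparable to the largest of the functionals of a flag; conversely, fl V is
   evaluated on the component in the line on which the other functionals of a flag vanish. *)

theory Submission
  imports Defs
begin

section \<open>Families of linear functionals\<close>

text \<open>The exponents fit because over a flag the numbers \<open>sv V - 1\<close> add up to k -
  n = d. Hence a box with sides of order r in the physical space and of order r^(1 -
  \<open>sv V\<close>) along the functionals has volume of constant order, and counting and covering
  arguments lose only constants. Two obstacles shape the proof. Linear repetitivity compares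
  patches, not positions: a repeated patch tells on which side of a facet a point lies only if its
  internal position is already close to the original one, and compactness of the window provides
  this. Conversely, cells may be thin and irregular, and their width is accessible only through
  their vertices. Full rank controls these: a fixed multiple of any lattice point splits into
  components on the lines of a flag, so hyperplanes whose levels come from the lattice meet in
  rational lattice points. Ranks are computed as real dimensions, which is legitimate for subgroups
  of the discrete lattice but not for their projections to the internal space.\<close>

lemma linear_family_bound:
  fixes \<phi> :: "'i \<Rightarrow> 'a::euclidean_space \<Rightarrow> real"
  assumes I: "finite I" and lin: "\<And>i. i \<in> I \<Longrightarrow> linear (\<phi> i)" and F: "subspace F"
    and inj: "\<And>x. x \<in> F \<Longrightarrow> (\<And>i. i \<in> I \<Longrightarrow> \<phi> i x = 0) \<Longrightarrow> x = 0"
  shows "\<exists>C>0. \<forall>x\<in>F. \<forall>t\<ge>0. (\<forall>i\<in>I. \<bar>\<phi> i x\<bar> \<le> t) \<longrightarrow> norm x \<le> C * t"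
proof -
  let ?K = "F \<inter> sphere 0 1"
  let ?g = "\<lambda>x. \<Sum>i\<in>I. \<bar>\<phi> i x\<bar>"
  have K: "compact ?K"
    by (intro closed_Int_compact closed_subspace F) simp
  have cont: "continuous_on ?K ?g"
    by (intro continuous_intros linear_continuous_on) (use lin in \<open>auto simp: linear_conv_bounded_linear\<close>)
  obtain e where e: "e > 0" "\<And>x. x \<in> ?K \<Longrightarrow> e \<le> ?g x"
  proof (cases "?K = {}")
    case True
    then show ?thesis using that[of 1] by auto
  next
    case False
    obtain x where x: "x \<in> ?K" "\<And>y. y \<in> ?K \<Longrightarrow> ?g x \<le> ?g y"
      using continuous_attains_inf[OF K False cont] by blast
    have "?g x \<noteq> 0"
    proof
      assume "?g x = 0"
      then have "\<forall>i\<in>I. \<phi> i x = 0"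
        using I by (subst (asm) sum_nonneg_eq_0_iff) auto
      then have "x = 0" using inj x(1) by blast
      then show False using x(1) by auto
    qed
    moreover have "?g x \<ge> 0" by (intro sum_nonneg) auto
    ultimately have "?g x > 0" by linarith
    then show ?thesis using that[of "?g x"] x(2) by blast
  qed
  \<comment> \<open>On the unit sphere of \<open>F\<close> the sum of the absolute values is at
    least \<open>e\<close>, by compactness. The summand 1 keeps the constant positive when
    \<open>I\<close> is empty.\<close>
  have "norm x \<le> (real (card I) + 1) / e * t"
    if x: "x \<in> F" "t \<ge> 0" "\<forall>i\<in>I. \<bar>\<phi> i x\<bar> \<le> t" for x t
  proof (cases "x = 0")
    case True
    then show ?thesis using that e by auto
  next
    case False
    define u where "u = (1 / norm x) *\<^sub>R x"
    have u: "u \<in> ?K" using False x(1) F by (auto simp: u_def subspace_scale)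
    have "e * norm x \<le> ?g u * norm x" using e(2)[OF u] by (simp add: mult_right_mono)
    also have "\<dots> = (\<Sum>i\<in>I. \<bar>\<phi> i x\<bar>)"
      unfolding sum_distrib_right u_def
      by (intro sum.cong refl) (use False lin in \<open>simp add: linear_cmul abs_mult\<close>)
    also have "\<dots> \<le> (\<Sum>i\<in>I. t)" using x by (intro sum_mono) auto
    also have "\<dots> \<le> (real (card I) + 1) * t" using x by (simp add: algebra_simps)
    finally show ?thesis using e(1) by (simp add: field_simps)
  qed
  then show ?thesis using e(1)
    by (intro exI[of _ "(real (card I) + 1) / e"]) (auto simp: field_simps)
qed

text \<open>Sort the points into the cells of a grid with sides \<open>\<rho> i\<close>: two points
  of one cell differ by less than \<open>\<rho> i\<close> in every functional and so coincide. The
  summand 2 accounts for rounding at the two ends of the range.\<close>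

lemma packing_bound:
  fixes \<phi> :: "'i \<Rightarrow> 'a::real_vector \<Rightarrow> real"
  assumes I: "finite I" and lin: "\<And>i. i \<in> I \<Longrightarrow> linear (\<phi> i)"
    and \<rho>: "\<And>i. i \<in> I \<Longrightarrow> \<rho> i > 0" and R: "\<And>i. i \<in> I \<Longrightarrow> R i \<ge> 0"
    and bound: "\<And>i x. i \<in> I \<Longrightarrow> x \<in> X \<Longrightarrow> \<bar>\<phi> i x\<bar> \<le> R i"
    and sep: "\<And>x y. x \<in> X \<Longrightarrow> y \<in> X \<Longrightarrow> (\<And>i. i \<in> I \<Longrightarrow> \<bar>\<phi> i (x - y)\<bar> < \<rho> i) \<Longrightarrow> x = y"
  shows "finite X" "real (card X) \<le> (\<Prod>i\<in>I. 2 * R i / \<rho> i + 2)"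
proof -
  define f where "f = (\<lambda>x. restrict (\<lambda>i. \<lfloor>\<phi> i x / \<rho> i\<rfloor>) I)"
  define P where "P = Pi\<^sub>E I (\<lambda>i. {\<lfloor>- (R i / \<rho> i)\<rfloor>..\<lfloor>R i / \<rho> i\<rfloor>})"
  have finP: "finite P" unfolding P_def using I by (intro finite_PiE) auto
  have sub: "f ` X \<subseteq> P"
  proof
    fix y assume "y \<in> f ` X"
    then obtain x where x: "x \<in> X" "y = f x" by auto
    have "- (R i / \<rho> i) \<le> \<phi> i x / \<rho> i \<and> \<phi> i x / \<rho> i \<le> R i / \<rho> i" if "i \<in> I" for i
      using bound[OF that x(1)] \<rho>[OF that] by (auto simp: field_simps abs_le_iff)
    then show "y \<in> P" unfolding x(2) f_def P_def
      by (auto intro!: floor_mono)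
  qed
  have inj: "inj_on f X"
  proof (rule inj_onI)
    fix x y assume xy: "x \<in> X" "y \<in> X" "f x = f y"
    show "x = y"
    proof (rule sep[OF xy(1,2)])
      fix i assume i: "i \<in> I"
      then have "\<lfloor>\<phi> i x / \<rho> i\<rfloor> = \<lfloor>\<phi> i y / \<rho> i\<rfloor>"
        using fun_cong[OF xy(3), of i] by (simp add: f_def)
      then have "\<bar>\<phi> i x / \<rho> i - \<phi> i y / \<rho> i\<bar> < 1" by linarith
      then have "\<bar>(\<phi> i x - \<phi> i y) / \<rho> i\<bar> < 1" by (simp add: diff_divide_distrib)
      then show "\<bar>\<phi> i (x - y)\<bar> < \<rho> i"
        using \<rho>[OF i] lin[OF i] by (simp add: linear_diff field_simps)
    qed
  qed
  show "finite X" using finP sub inj by (meson finite_imageD finite_subset)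
  have "card X = card (f ` X)" by (simp add: card_image inj)
  also have "\<dots> \<le> card P" by (rule card_mono[OF finP sub])
  also have "\<dots> = (\<Prod>i\<in>I. card {\<lfloor>- (R i / \<rho> i)\<rfloor>..\<lfloor>R i / \<rho> i\<rfloor>})"
    unfolding P_def by (rule card_PiE[OF I])
  finally have "real (card X) \<le> (\<Prod>i\<in>I. real (card {\<lfloor>- (R i / \<rho> i)\<rfloor>..\<lfloor>R i / \<rho> i\<rfloor>}))"
    by (metis of_nat_le_iff of_nat_prod)
  also have "\<dots> \<le> (\<Prod>i\<in>I. 2 * R i / \<rho> i + 2)"
  proof (rule prod_mono, intro conjI)
    fix i assume i: "i \<in> I"
    have "R i / \<rho> i \<ge> 0" using R[OF i] \<rho>[OF i] by simp
    then show "real (card {\<lfloor>- (R i / \<rho> i)\<rfloor>..\<lfloor>R i / \<rho> i\<rfloor>}) \<le> 2 * R i / \<rho> i + 2"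
      by (simp, linarith)
  qed auto
  finally show "real (card X) \<le> (\<Prod>i\<in>I. 2 * R i / \<rho> i + 2)" .
qed

text \<open>The constant comes from the coefficients of \<open>v\<close> in terms of
  \<open>T\<close>. The lemma carries bounds from the functionals of a flag over to the remaining
  directions.\<close>

lemma span_inner_bound:
  fixes v :: "'c::real_inner"
  assumes "finite T" "v \<in> span T"
  shows "\<exists>D>0. \<forall>x. \<forall>t\<ge>0. (\<forall>a\<in>T. \<bar>a \<bullet> x\<bar> \<le> t) \<longrightarrow> \<bar>v \<bullet> x\<bar> \<le> D * t"
proof -
  obtain u where u: "v = (\<Sum>a\<in>T. u a *\<^sub>R a)" using assms real_vector.span_finite[OF assms(1)] by auto
  have "\<bar>v \<bullet> x\<bar> \<le> (1 + (\<Sum>a\<in>T. \<bar>u a\<bar>)) * t" if t: "t \<ge> 0" "\<forall>a\<in>T. \<bar>a \<bullet> x\<bar> \<le> t" for x t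
  proof -
    have "\<bar>v \<bullet> x\<bar> = \<bar>\<Sum>a\<in>T. u a * (a \<bullet> x)\<bar>" by (simp add: u inner_sum_left)
    also have "\<dots> \<le> (\<Sum>a\<in>T. \<bar>u a * (a \<bullet> x)\<bar>)" by (rule sum_abs)
    also have "\<dots> \<le> (\<Sum>a\<in>T. \<bar>u a\<bar> * t)" using t(2) by (intro sum_mono) (auto simp: abs_mult intro!: mult_left_mono)
    also have "\<dots> \<le> (1 + (\<Sum>a\<in>T. \<bar>u a\<bar>)) * t" using t(1) by (simp add: sum_distrib_right distrib_right)
    finally show ?thesis .
  qed
  moreover have "1 + (\<Sum>a\<in>T. \<bar>u a\<bar>) > 0" by (simp add: add_pos_nonneg sum_nonneg)
  ultimately show ?thesis by blast
qed

section \<open>Discrete subgroups\<close>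

lemma zsubspace_add: "zmod.subspace G \<Longrightarrow> x \<in> G \<Longrightarrow> y \<in> G \<Longrightarrow> x + y \<in> G"
  by (rule zmod.subspace_add)

lemma zsubspace_diff: "zmod.subspace G \<Longrightarrow> x \<in> G \<Longrightarrow> y \<in> G \<Longrightarrow> x - y \<in> G"
  by (rule zmod.subspace_diff)

lemma zsubspace_of_nat:
  fixes x :: "'a::real_vector"
  shows "zmod.subspace G \<Longrightarrow> x \<in> G \<Longrightarrow> real m *\<^sub>R x \<in> G"
  using zmod.subspace_scale[of G x "int m"] by simp

lemma discrete_subgroup_separated:
  fixes G :: "'a::euclidean_space set"
  assumes "zmod.subspace G" "discrete G"
  obtains e where "e > 0" "\<And>g. g \<in> G \<Longrightarrow> norm g < e \<Longrightarrow> g = 0"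
proof -
  have "0 isolated_in G"
    using assms by (simp add: discrete_def zmod.subspace_0)
  then obtain e where "e > 0" "\<forall>y\<in>G. dist 0 y < e \<longrightarrow> 0 = y"
    by (auto simp: isolated_in_dist_Ex_iff)
  then show ?thesis using that[of e] by auto
qed

lemma discrete_subgroup_finite:
  fixes G :: "'a::euclidean_space set"
  assumes "zmod.subspace G" "discrete G"
  shows "finite {g \<in> G. norm g \<le> R}"
proof -
  obtain e where e: "e > 0" "\<And>g. g \<in> G \<Longrightarrow> norm g < e \<Longrightarrow> g = 0"
    using discrete_subgroup_separated[OF assms] by blast
  have "uniform_discrete G"
    unfolding uniform_discrete_def
    using e zsubspace_diff[OF assms(1)] by (intro exI[of _ e]) (force simp: dist_norm)
  then have "uniform_discrete {g \<in> G. norm g \<le> R}"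
    by (rule uniform_discrete_subset) auto
  moreover have "bounded {g \<in> G. norm g \<le> R}"
    by (auto simp: bounded_iff)
  ultimately show ?thesis
    using uniform_discrete_finite_iff by blast
qed

text \<open>Each coordinate function extends to a linear functional on the whole space and is
  therefore bounded.\<close>

lemma representation_bound:
  fixes B :: "'a::euclidean_space set"
  assumes "independent B"
  obtains C where "C > 0" "\<And>x b. x \<in> span B \<Longrightarrow> b \<in> B \<Longrightarrow> \<bar>representation B x b\<bar> \<le> C * norm x"
proof -
  have fin: "finite B" using assms by (simp add: finiteI_independent)
  have "\<exists>C. \<forall>x\<in>span B. \<bar>representation B x b\<bar> \<le> C * norm x" if b: "b \<in> B" for b
  proof -
    obtain g where g: "linear g" "\<And>v. v \<in> B \<Longrightarrow> g v = (if v = b then 1 else 0 :: real)"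
      using linear_independent_extend[OF assms, of "\<lambda>v. if v = b then 1 else 0"] by blast
    have "g x = representation B x b" if x: "x \<in> span B" for x
    proof -
      have "x = (\<Sum>v\<in>B. representation B x v *\<^sub>R v)"
        using real_vector.sum_representation_eq[OF assms x fin] by simp
      then have "g x = g (\<Sum>v\<in>B. representation B x v *\<^sub>R v)" by simp
      also have "\<dots> = (\<Sum>v\<in>B. representation B x v * g v)"
        using g(1) by (simp add: linear_sum linear_cmul)
      also have "\<dots> = representation B x b"
        using g(2) b fin by (simp add: sum.remove[of B b])
      finally show ?thesis .
    qed
    moreover obtain C where "\<And>x. norm (g x) \<le> C * norm x"
      using linear_bounded[OF g(1)] by auto
    ultimately show ?thesis by (metis real_norm_def)
  qed
  then obtain C where C: "\<And>b x. b \<in> B \<Longrightarrow> x \<in> span B \<Longrightarrow> \<bar>representation B x b\<bar> \<le> C b * norm x"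
    by metis
  have "\<bar>representation B x b\<bar> \<le> (1 + (\<Sum>b\<in>B. \<bar>C b\<bar>)) * norm x" if "x \<in> span B" "b \<in> B" for x b
  proof -
    have "C b \<le> \<bar>C b\<bar>" by simp
    also have "\<dots> \<le> (\<Sum>b\<in>B. \<bar>C b\<bar>)" using that fin by (intro member_le_sum) auto
    finally have "C b * norm x \<le> (1 + (\<Sum>b\<in>B. \<bar>C b\<bar>)) * norm x"
      by (intro mult_right_mono) auto
    then show ?thesis using C[OF that(2,1)] by linarith
  qed
  moreover have "1 + (\<Sum>b\<in>B. \<bar>C b\<bar>) > 0"
    by (smt (verit) sum_nonneg abs_ge_zero)
  ultimately show ?thesis using that by blast
qed

lemma integral_combination_in:
  fixes G :: "'a::real_vector set"
  assumes "zmod.subspace G" "B \<subseteq> G" "\<And>b. b \<in> B \<Longrightarrow> c b \<in> \<int>"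
  shows "(\<Sum>b\<in>B. c b *\<^sub>R b) \<in> G"
proof (rule zmod.subspace_sum[OF assms(1)])
  fix b assume b: "b \<in> B"
  then obtain m where "c b = of_int m" using assms(3) Ints_cases by metis
  then show "c b *\<^sub>R b \<in> G" using zmod.subspace_scale[OF assms(1), of b m] assms(2) b by auto
qed

text \<open>\<open>h\<close> is the representative of \<open>g\<close> in the parallelepiped spanned
  by the real basis \<open>B\<close>. In a discrete group only finitely many \<open>h\<close> can
  occur, and this finiteness drives the lemmas that follow.\<close>

lemma fractional_part_bounded:
  fixes B :: "'a::euclidean_space set"
  assumes "zmod.subspace G" "B \<subseteq> G" "independent B" "g \<in> G" "g \<in> span B"
  defines "h \<equiv> (\<Sum>b\<in>B. frac (representation B g b) *\<^sub>R b)"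
  shows "h \<in> G" "norm h \<le> (\<Sum>b\<in>B. norm b)"
    and "g - h = (\<Sum>b\<in>B. of_int \<lfloor>representation B g b\<rfloor> *\<^sub>R b)"
proof -
  have fin: "finite B" using assms by (simp add: finiteI_independent)
  have g: "g = (\<Sum>b\<in>B. representation B g b *\<^sub>R b)"
    using real_vector.sum_representation_eq[OF assms(3,5) fin] by simp
  show *: "g - h = (\<Sum>b\<in>B. of_int \<lfloor>representation B g b\<rfloor> *\<^sub>R b)"
    unfolding h_def frac_def scaleR_diff_left sum_subtractf g[symmetric] by simp
  have "g - h \<in> G"
    unfolding * by (rule integral_combination_in[OF assms(1,2)]) auto
  then show "h \<in> G" using zsubspace_diff[OF assms(1) assms(4), of "g - h"] by simp
  show "norm h \<le> (\<Sum>b\<in>B. norm b)"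
    unfolding h_def by (intro order_trans[OF norm_sum] sum_mono)
      (auto simp: frac_ge_0 intro!: mult_left_le_one_le less_imp_le[OF frac_lt_1])
qed

text \<open>Pigeonhole: among the multiples of \<open>g\<close> by 0, ..., \<open>card F\<close> two
  have the same fractional part, so their difference has integral coordinates. That difference is at
  most \<open>card F\<close> and divides its factorial, which therefore works for all
  \<open>g\<close> at once.\<close>

lemma integral_multiple_exists:
  fixes G :: "'a::euclidean_space set"
  assumes G: "zmod.subspace G" "discrete G" and B: "B \<subseteq> G" "independent B"
  shows "\<exists>M::nat>0. \<forall>g\<in>G \<inter> span B. \<forall>b\<in>B. representation B (real M *\<^sub>R g) b \<in> \<int>"
proof -
  have fin: "finite B" using B by (simp add: finiteI_independent)
  define F where "F = {g \<in> G. norm g \<le> (\<Sum>b\<in>B. norm b)}"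
  have finF: "finite F" unfolding F_def by (rule discrete_subgroup_finite[OF G])
  have "representation B (real (fact (card F)) *\<^sub>R g) b \<in> \<int>"
    if g: "g \<in> G" "g \<in> span B" and b: "b \<in> B" for g b
  proof -
    define h where "h = (\<lambda>m::nat. \<Sum>b\<in>B. frac (representation B (real m *\<^sub>R g) b) *\<^sub>R b)"
    have hF: "h m \<in> F" for m
      unfolding h_def F_def
      using fractional_part_bounded[OF G(1) B, of "real m *\<^sub>R g"] g
      by (auto simp: zsubspace_of_nat[OF G(1)] real_vector.span_scale)
    have "\<not> inj_on h {0..card F}"
    proof
      assume "inj_on h {0..card F}"
      then have "card {0..card F} \<le> card F"
        using card_inj_on_le[of h "{0..card F}" F] hF finF by blast
      then show False by simp
    qed
    then obtain m1 m2 where m: "m1 < m2" "m2 \<le> card F" "h m1 = h m2"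
      unfolding inj_on_def by (metis atLeastAtMost_iff linorder_neqE_nat)
    have rep: "representation B (real m *\<^sub>R g) b = real m * representation B g b" for m
      by (simp add: real_vector.representation_scale[OF B(2) g(2)])
    have "frac (representation B (real m1 *\<^sub>R g) b) = frac (representation B (real m2 *\<^sub>R g) b)"
    proof -
      have "(\<Sum>b\<in>B. (frac (representation B (real m1 *\<^sub>R g) b) - frac (representation B (real m2 *\<^sub>R g) b)) *\<^sub>R b) = 0"
        using m(3) by (simp add: h_def scaleR_diff_left sum_subtractf)
      from real_vector.independentD[OF B(2) fin subset_refl this b]
      show ?thesis by simp
    qed
    then have "real m2 * representation B g b - real m1 * representation B g b
        = of_int (\<lfloor>real m2 * representation B g b\<rfloor> - \<lfloor>real m1 * representation B g b\<rfloor>)"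
      unfolding rep frac_def by simp
    then have "real m2 * representation B g b - real m1 * representation B g b \<in> \<int>"
      by (metis Ints_of_int)
    then have *: "real (m2 - m1) * representation B g b \<in> \<int>"
      using m(1) by (simp add: of_nat_diff left_diff_distrib)
    have "m2 - m1 dvd fact (card F)"
      using m by (intro dvd_fact) auto
    then obtain q where q: "fact (card F) = (m2 - m1) * q" by (elim dvdE)
    have "representation B (real (fact (card F)) *\<^sub>R g) b
        = real q * (real (m2 - m1) * representation B g b)"
      unfolding rep q by simp
    also have "\<dots> \<in> \<int>" by (rule Ints_mult[OF Ints_of_nat *])
    finally show ?thesis .
  qed
  then show ?thesis by (intro exI[of _ "fact (card F)"]) auto
qed

lemma independent_imp_zindependent:
  fixes B :: "'a::real_vector set"
  assumes "independent B"
  shows "zmod.independent B"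
proof
  assume "zmod.dependent B"
  then obtain t u v where *: "finite t" "t \<subseteq> B" "(\<Sum>x\<in>t. of_int (u x) *\<^sub>R x) = 0" "v \<in> t" "u v \<noteq> (0::int)"
    using zmod.independent_explicit_module[of B] by metis
  show False
    using real_vector.independentD[OF assms *(1-4)] *(5) by simp
qed

text \<open>Discreteness is essential: 1 and the square root of 2 are independent over the integers
  but not over the reals. Here a real relation expresses some \<open>b\<close> through an
  independent set, and a suitable multiple of \<open>b\<close> then has integral
  coefficients.\<close>

lemma zindependent_imp_independent:
  fixes B :: "'a::euclidean_space set"
  assumes G: "zmod.subspace G" "discrete G" and B: "B \<subseteq> G" "zmod.independent B"
  shows "independent B"
proof
  assume "dependent B"
  then obtain b where b: "b \<in> B" "b \<in> span (B - {b})"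
    unfolding real_vector.dependent_def by blast
  obtain B1 where B1: "B1 \<subseteq> B - {b}" "independent B1" "B - {b} \<subseteq> span B1"
    using maximal_independent_subset by metis
  have bs: "b \<in> span B1"
    using b(2) B1(3) by (metis real_vector.span_minimal real_vector.subspace_span subsetD)
  have fin: "finite B1" using B1 by (simp add: finiteI_independent)
  obtain M :: nat where M: "M > 0" "\<And>g c. g \<in> G \<Longrightarrow> g \<in> span B1 \<Longrightarrow> c \<in> B1 \<Longrightarrow> representation B1 (real M *\<^sub>R g) c \<in> \<int>"
    using integral_multiple_exists[OF G, of B1] B1 B(1) by blast
  have "\<forall>c\<in>B1. \<exists>m::int. representation B1 (real M *\<^sub>R b) c = of_int m"
    using M(2) bs b(1) B(1) by (meson Ints_cases subsetD)
  then obtain z :: "'a \<Rightarrow> int" where z: "\<And>c. c \<in> B1 \<Longrightarrow> representation B1 (real M *\<^sub>R b) c = of_int (z c)"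
    by metis
  have "real M *\<^sub>R b = (\<Sum>c\<in>B1. representation B1 (real M *\<^sub>R b) c *\<^sub>R c)"
    using real_vector.sum_representation_eq[OF B1(2) _ fin subset_refl, of "real M *\<^sub>R b"] bs
    by (simp add: real_vector.span_scale)
  also have "\<dots> = (\<Sum>c\<in>B1. of_int (z c) *\<^sub>R c)" using z by simp
  finally have eq: "real M *\<^sub>R b = (\<Sum>c\<in>B1. of_int (z c) *\<^sub>R c)" .
  define u where "u = (\<lambda>c. if c = b then int M else - z c)"
  have nb: "b \<notin> B1" using B1 by auto
  have "(\<Sum>c\<in>insert b B1. of_int (u c) *\<^sub>R c) = real M *\<^sub>R b + (\<Sum>c\<in>B1. of_int (u c) *\<^sub>R c)"
    using nb fin by (simp add: u_def)
  also have "(\<Sum>c\<in>B1. of_int (u c) *\<^sub>R c) = - (\<Sum>c\<in>B1. of_int (z c) *\<^sub>R c)"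
    unfolding sum_negf[symmetric] using nb by (intro sum.cong) (auto simp: u_def)
  finally have "(\<Sum>c\<in>insert b B1. of_int (u c) *\<^sub>R c) = 0" using eq by simp
  from zmod.independentD[OF B(2) _ _ this, of b] have "u b = 0"
    using fin b B1 by auto
  then show False using M(1) by (simp add: u_def)
qed

text \<open>The two notions of independence agree inside a discrete group, so the maximum is taken
  over a bounded set and attained by a real basis. From here on ranks are handled as
  dimensions.\<close>

lemma zrank_eq_dim:
  fixes G :: "'a::euclidean_space set"
  assumes G: "zmod.subspace G" "discrete G" and A: "A \<subseteq> G"
  shows "zrank A = dim A"
proof -
  let ?S = "card ` {B. finite B \<and> B \<subseteq> A \<and> zmod.independent B}"
  obtain B where B: "B \<subseteq> A" "independent B" "A \<subseteq> span B" "card B = dim A"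
    using basis_exists by metis
  have 1: "dim A \<in> ?S"
    using B finiteI_independent independent_imp_zindependent by (intro image_eqI[of _ _ B]) auto
  have 2: "x \<le> dim A" if "x \<in> ?S" for x
    using that A zindependent_imp_independent[OF G] by (auto intro!: independent_card_le_dim)
  have "finite ?S" using 2 by (meson finite_nat_set_iff_bounded_le)
  then show ?thesis unfolding zrank_def using 1 2 by (intro Max_eqI) auto
qed

text \<open>Extend a basis of the intersection to bases of \<open>A\<close> and of \<open>B\<close>.
  Their union is tested for independence over the integers, because only an integral relation
  produces an element of both groups.\<close>

lemma dim_inter_subgroups:
  fixes G :: "'a::euclidean_space set"
  assumes G: "zmod.subspace G" "discrete G"
    and A: "A \<subseteq> G" "zmod.subspace A" and B: "B \<subseteq> G" "zmod.subspace B"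
  shows "dim A + dim B \<le> dim (A \<inter> B) + dim (A \<union> B)"
proof -
  obtain C where C: "C \<subseteq> A \<inter> B" "independent C" "A \<inter> B \<subseteq> span C"
    using maximal_independent_subset by metis
  obtain CA where CA: "C \<subseteq> CA" "CA \<subseteq> A" "independent CA" "A \<subseteq> span CA"
    using maximal_independent_subset_extend[of C A] C by auto
  obtain CB where CB: "C \<subseteq> CB" "CB \<subseteq> B" "independent CB" "B \<subseteq> span CB"
    using maximal_independent_subset_extend[of C B] C by auto
  have finA: "finite CA" and finB: "finite CB" using CA CB by (auto simp: finiteI_independent)
  have key: "v \<in> C" if v: "v \<in> CB" "v \<in> span C" for v
  proof (rule ccontr)
    assume "v \<notin> C"
    then have "v \<in> span (CB - {v})"
      using v CB(1) by (metis insert_Diff real_vector.span_mono subsetD subset_insert)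
    then show False using CB(3) v(1) unfolding real_vector.dependent_def by blast
  qed
  have int: "CA \<inter> CB = C"
    using CA CB C key by blast
  have "zmod.independent (CA \<union> CB)"
  proof
    assume "zmod.dependent (CA \<union> CB)"
    then obtain u v where u: "(\<Sum>x\<in>CA \<union> CB. of_int (u x) *\<^sub>R x) = 0" "v \<in> CA \<union> CB" "u v \<noteq> (0::int)"
      using zmod.dependent_finite[of "CA \<union> CB"] finA finB by auto
    \<comment> \<open>The part of the relation supported on \<open>CA\<close>. Its integral
      coefficients put it in \<open>A\<close>, and the relation rewrites it through
      \<open>CB\<close>, which puts it in \<open>B\<close>; hence it lies in the span of
      \<open>C\<close>.\<close>
    define y where "y = (\<Sum>x\<in>CA. of_int (u x) *\<^sub>R x)"
    have "(\<Sum>x\<in>CA \<union> CB. of_int (u x) *\<^sub>R x) = y + (\<Sum>x\<in>CB - C. of_int (u x) *\<^sub>R x)"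
    proof -
      have "CA \<union> CB = CA \<union> (CB - C)" "CA \<inter> (CB - C) = {}" using int by auto
      then show ?thesis unfolding y_def using finA finB by (simp add: sum.union_disjoint)
    qed
    then have y: "y = - (\<Sum>x\<in>CB - C. of_int (u x) *\<^sub>R x)" using u(1) by (simp add: eq_neg_iff_add_eq_0)
    have "y \<in> A" unfolding y_def
      by (rule integral_combination_in[OF A(2) CA(2)]) auto
    moreover have "y \<in> B" unfolding y
      by (intro zmod.subspace_neg[OF B(2)] integral_combination_in[OF B(2)]) (use CB in auto)
    ultimately have "y \<in> span C" using C(3) by auto
    then have "y = (\<Sum>x\<in>C. representation C y x *\<^sub>R x)"
      using real_vector.sum_representation_eq[OF C(2) _ _ subset_refl] finA CA(1) finite_subset by metis
    then have "(\<Sum>x\<in>C. representation C y x *\<^sub>R x) + (\<Sum>x\<in>CB - C. of_int (u x) *\<^sub>R x) = 0"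
      using y by simp
    then have "(\<Sum>x\<in>CB. (if x \<in> C then representation C y x else of_int (u x)) *\<^sub>R x) = 0"
      using sum.subset_diff[OF CB(1) finB, of "\<lambda>x. (if x \<in> C then representation C y x else of_int (u x)) *\<^sub>R x"]
      by (simp add: add.commute)
    from real_vector.independentD[OF CB(3) finB subset_refl this]
    have uB: "u x = 0" if "x \<in> CB - C" for x using that by force
    then have "y = 0" unfolding y by simp
    then have "u x = 0" if "x \<in> CA" for x
      using real_vector.independentD[OF CA(3) finA subset_refl, of "\<lambda>x. of_int (u x)"] that
      unfolding y_def by force
    then show False using u(2,3) uB int by blast
  qed
  then have ind: "independent (CA \<union> CB)"
    using zindependent_imp_independent[OF G, of "CA \<union> CB"] CA CB A B by blast
  have "card CA = dim A" "card CB = dim B" "card C = dim (A \<inter> B)"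
    using CA CB C by (auto intro!: basis_card_eq_dim)
  moreover have "card (CA \<union> CB) \<le> dim (A \<union> B)"
    using ind CA CB by (intro independent_card_le_dim) auto
  moreover have "card (CA \<union> CB) + card C = card CA + card CB"
    using card_Un_Int[OF finA finB] int by simp
  ultimately show ?thesis by linarith
qed


section \<open>Integral bases and subgroups of finite index\<close>

text \<open>Induction on the dimension: the kernel \<open>L\<close> of one coordinate function
  \<open>h\<close> has a basis, and one more vector suffices if the values of \<open>h\<close> on
  \<open>G\<close> are the integral multiples of a least positive value.\<close>

lemma zbasis_exists:
  fixes G :: "'a::euclidean_space set"
  assumes "zmod.subspace G" "discrete G"
  shows "\<exists>B. finite B \<and> B \<subseteq> G \<and> independent B \<and> zmod.span B = G"
  using assms
proof (induction "dim G" arbitrary: G)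
  case 0
  then have "G = {0}" using zmod.subspace_0 by fastforce
  then show ?case using real_vector.independent_empty by (intro exI[of _ "{}"]) auto
next
  case (Suc n)
  note G = Suc.prems
  obtain B where B: "B \<subseteq> G" "independent B" "G \<subseteq> span B" "card B = dim G"
    using basis_exists by metis
  have finB: "finite B" using B by (simp add: finiteI_independent)
  obtain b where b: "b \<in> B" using B(4) Suc.hyps(2) by (metis card.empty ex_in_conv nat.distinct(1))
  define B' where "B' = B - {b}"
  have B': "B' \<subseteq> B" "independent B'" "card B' = n"
    using B b finB Suc.hyps(2) real_vector.independent_mono[OF B(2), of "B - {b}"] by (auto simp: B'_def)
  define L where "L = G \<inter> span B'"
  have L: "zmod.subspace L" "discrete L"
    unfolding L_def using G(1) G(2) real_vector.subspace_span[of B']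
    by (auto simp: zmod.subspace_def subspace_def intro: discrete_subset)
  have "dim L = n"
    using B' B(1) dim_unique[of B' L n] by (auto simp: L_def intro: real_vector.span_base)
  then obtain B0 where B0: "finite B0" "B0 \<subseteq> L" "independent B0" "zmod.span B0 = L"
    using Suc.hyps(1)[of L] L by auto
  define h where "h = (\<lambda>x. representation B x b)"
  have h_diff: "h (x - y) = h x - h y" if "x \<in> G" "y \<in> G" for x y
    using real_vector.representation_diff[OF B(2), of y x] that B(3) by (simp add: h_def subsetD)
  have h_scale: "h (c *\<^sub>R x) = c * h x" if "x \<in> G" for x c
    using that B by (auto simp: h_def real_vector.representation_scale)
  have h_span: "h x = 0" if "x \<in> span B'" for x
    using real_vector.representation_extend[OF B(2) that B'(1)] real_vector.representation_ne_zero[of B' x b]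
    by (auto simp: h_def B'_def)
  have h0: "x \<in> L" if "x \<in> G" "h x = 0" for x
  proof -
    have "x = (\<Sum>v\<in>B. representation B x v *\<^sub>R v)"
      using real_vector.sum_representation_eq[OF B(2) _ finB subset_refl] that B(3) by auto
    also have "\<dots> = (\<Sum>v\<in>B'. representation B x v *\<^sub>R v)"
      using that(2) b finB by (simp add: B'_def h_def sum.remove[of B b])
    also have "\<dots> \<in> span B'"
      by (intro real_vector.span_sum real_vector.span_scale real_vector.span_base)
    finally show ?thesis using that by (simp add: L_def)
  qed
  define K where "K = (\<Sum>b\<in>B. norm b)"
  \<comment> \<open>Only bounded group elements are considered, so \<open>P\<close> is finite. It
    contains 1, the value at \<open>b\<close>, so its minimum exists and is at most 1.\<close>
  define P where "P = h ` {g \<in> G. norm g \<le> K} \<inter> {0<..}"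
  have finP: "finite P" unfolding P_def using discrete_subgroup_finite[OF G] by blast
  have hb: "h b = 1" using b B(2) by (simp add: h_def real_vector.representation_basis)
  have "norm b \<le> K" unfolding K_def using b finB by (intro member_le_sum) auto
  then have oneP: "1 \<in> P" unfolding P_def using b B(1) hb by (force intro!: image_eqI[of _ _ b])
  have "Min P \<in> P" using finP oneP by (intro Min_in) auto
  then obtain v where v: "v \<in> G" "norm v \<le> K" "h v = Min P" "h v > 0"
    unfolding P_def by auto
  have v1: "h v \<le> 1" unfolding v(3) using finP oneP by simp
  have quot: "\<exists>q::int. g - of_int q *\<^sub>R v \<in> L" if g: "g \<in> G" for g
  proof -
    define q where "q = \<lfloor>h g / h v\<rfloor>"
    define g' where "g' = g - of_int q *\<^sub>R v"
    have qv: "of_int q *\<^sub>R v \<in> G" using zmod.subspace_scale[OF G(1) v(1), of q] by simp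
    have g'G: "g' \<in> G" unfolding g'_def by (rule zsubspace_diff[OF G(1) g qv])
    have hg': "h g' = h g - of_int q * h v"
      unfolding g'_def using h_diff[OF g qv] h_scale[OF v(1)] by simp
    have ge: "0 \<le> h g'" "h g' < h v"
      using floor_divide_lower[OF v(4), of "h g"] floor_divide_upper[OF v(4), of "h g"]
      unfolding hg' q_def by (auto simp: algebra_simps)
    \<comment> \<open>The remainder lies between 0 and \<open>h v\<close>, which is at most 1, so it
      equals its own fractional part. Reducing the other coordinates gives a bounded element with
      the same value of \<open>h\<close>, against the minimality of \<open>h v\<close>.\<close>
    have "h g' = 0"
    proof (rule ccontr)
      assume ne: "h g' \<noteq> 0"
      define g2 where "g2 = (\<Sum>b\<in>B. frac (representation B g' b) *\<^sub>R b)"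
      have g2: "g2 \<in> G" "norm g2 \<le> K"
        using fractional_part_bounded[OF G(1) B(1,2) g'G] g'G B(3) unfolding g2_def K_def by auto
      have "h g2 = frac (h g')"
        unfolding h_def g2_def
        using real_vector.representation_sum[of B B "\<lambda>c. frac (representation B g' c) *\<^sub>R c"] B(2) b finB
        by (simp add: real_vector.representation_scale real_vector.span_base real_vector.span_scale
            real_vector.representation_basis if_distrib[of "\<lambda>x. _ * x"] sum.If_cases cong: if_cong)
      also have "\<dots> = h g'" using ge v1 by (simp add: frac_eq)
      finally have "h g' \<in> P" using g2 ge ne unfolding P_def by (intro IntI image_eqI[of _ _ g2]) auto
      then have "Min P \<le> h g'" using finP by simp
      then show False using ge v(3) by simp
    qed
    then show ?thesis using h0[OF g'G] unfolding g'_def by blast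
  qed
  have span: "zmod.span (insert v B0) = G"
  proof
    show "zmod.span (insert v B0) \<subseteq> G"
      using v(1) B0(2) G(1) by (intro zmod.span_minimal) (auto simp: L_def)
    show "G \<subseteq> zmod.span (insert v B0)"
      unfolding zmod.span_insert B0(4) using quot by auto
  qed
  have "v \<notin> span B0"
  proof
    assume "v \<in> span B0"
    moreover have "span B0 \<subseteq> span B'"
      using B0(2) by (intro real_vector.span_minimal) (auto simp: L_def)
    ultimately show False using h_span v(4) by fastforce
  qed
  then have "independent (insert v B0)"
    using B0(3) by (metis real_vector.independent_insert)
  then show ?case
    using B0 v(1) span by (intro exI[of _ "insert v B0"]) (auto simp: L_def)
qed

text \<open>The multiples by \<open>M\<close> of a real basis of \<open>G\<close> lie in
  \<open>D\<close>, and reducing modulo them moves a representative of every coset into the finite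
  set \<open>F\<close>.\<close>

lemma finite_index_if_multiples:
  fixes G :: "'a::euclidean_space set"
  assumes G: "zmod.subspace G" "discrete G" and D: "zmod.subspace D" "D \<subseteq> G"
    and M: "M > 0" "\<And>g. g \<in> G \<Longrightarrow> real M *\<^sub>R g \<in> D"
  shows "finite_index D G"
proof -
  obtain B where B: "B \<subseteq> G" "independent B" "G \<subseteq> span B"
    using maximal_independent_subset by metis
  define B' where "B' = (\<lambda>b. real M *\<^sub>R b) ` B"
  have lin: "linear (\<lambda>x::'a. real M *\<^sub>R x)" by (rule linear_scaleR)
  have inj: "inj (\<lambda>x::'a. real M *\<^sub>R x)" using M(1) by (auto simp: inj_def)
  have "span B' = (\<lambda>b. real M *\<^sub>R b) ` span B"
    unfolding B'_def using linear_span_image[OF lin] by blast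
  also have "\<dots> = span B"
  proof (intro equalityI image_subsetI subsetI)
    fix x assume "x \<in> span B"
    then show "x \<in> (\<lambda>b. real M *\<^sub>R b) ` span B"
      using M(1) by (intro image_eqI[of _ _ "(1 / real M) *\<^sub>R x"]) (auto simp: real_vector.span_scale)
  qed (simp add: real_vector.span_scale)
  finally have B': "B' \<subseteq> D" "independent B'" "span B' = span B"
    using B(1,2) M linear_independent_injective_image[OF lin B(2) inj_on_subset[OF inj]]
    by (auto simp: B'_def)
  define F where "F = {g \<in> G. norm g \<le> (\<Sum>b\<in>B'. norm b)}"
  have finF: "finite F" unfolding F_def by (rule discrete_subgroup_finite[OF G])
  have sub: "(\<lambda>g. (+) g ` D) ` G \<subseteq> (\<lambda>g. (+) g ` D) ` F"
  proof (rule image_subsetI)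
    fix g assume g: "g \<in> G"
    define h where "h = (\<Sum>b\<in>B'. frac (representation B' g b) *\<^sub>R b)"
    have h: "h \<in> F" "g - h = (\<Sum>b\<in>B'. of_int \<lfloor>representation B' g b\<rfloor> *\<^sub>R b)"
      using fractional_part_bounded[OF G(1) _ B'(2) g] B' B(3) g D unfolding h_def F_def by auto
    have "g - h \<in> D"
      unfolding h(2) by (rule integral_combination_in[OF D(1) B'(1)]) auto
    then have "(+) g ` D = (+) h ` D"
    proof (intro equalityI image_subsetI)
      fix x assume "g - h \<in> D" "x \<in> D"
      then show "g + x \<in> (+) h ` D"
        using zsubspace_add[OF D(1), of "g - h" x] by (intro image_eqI[of _ _ "g - h + x"]) auto
    next
      fix x assume "g - h \<in> D" "x \<in> D"
      then show "h + x \<in> (+) g ` D"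
        using zsubspace_diff[OF D(1), of x "g - h"] by (intro image_eqI[of _ _ "x - (g - h)"]) auto
    qed
    then show "(+) g ` D \<in> (\<lambda>g. (+) g ` D) ` F" using h(1) by blast
  qed
  then show ?thesis unfolding finite_index_def using D(2) finite_subset[OF sub finite_imageI[OF finF]] by simp
qed

text \<open>Two distinct multiples of \<open>g\<close> share a coset, so a nonzero multiple of
  \<open>g\<close> lies in \<open>D\<close>.\<close>

lemma finite_index_span:
  fixes G :: "'a::euclidean_space set"
  assumes G: "zmod.subspace G" and D: "finite_index D G" "zmod.subspace D"
  shows "G \<subseteq> span D"
proof
  fix g assume g: "g \<in> G"
  have fin: "finite ((\<lambda>g. (+) g ` D) ` G)"
    using D(1) by (simp add: finite_index_def)
  have "\<not> inj (\<lambda>m::nat. (+) (real m *\<^sub>R g) ` D)"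
  proof
    assume "inj (\<lambda>m::nat. (+) (real m *\<^sub>R g) ` D)"
    then have "infinite (range (\<lambda>m::nat. (+) (real m *\<^sub>R g) ` D))"
      by (simp add: finite_image_iff)
    moreover have "range (\<lambda>m::nat. (+) (real m *\<^sub>R g) ` D) \<subseteq> (\<lambda>g. (+) g ` D) ` G"
      using zsubspace_of_nat[OF G g] by auto
    ultimately show False using fin finite_subset by blast
  qed
  then obtain m1 m2 :: nat where m: "m1 \<noteq> m2" "(+) (real m1 *\<^sub>R g) ` D = (+) (real m2 *\<^sub>R g) ` D"
    by (auto simp: inj_def)
  have "real m1 *\<^sub>R g + 0 \<in> (+) (real m1 *\<^sub>R g) ` D"
    using zmod.subspace_0[OF D(2)] by (rule imageI)
  then obtain x where x: "x \<in> D" "real m1 *\<^sub>R g = real m2 *\<^sub>R g + x"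
    unfolding m(2) by auto
  then have "x = (real m1 - real m2) *\<^sub>R g" by (simp add: scaleR_diff_left)
  then have "g = (1 / (real m1 - real m2)) *\<^sub>R x" using m(1) by simp
  then show "g \<in> span D" using x(1) by (metis real_vector.span_base real_vector.span_scale)
qed

lemma dim_superadditive:
  fixes G :: "'a::euclidean_space set"
  assumes G: "zmod.subspace G" "discrete G"
    and A: "A \<subseteq> G" "zmod.subspace A" and B: "B \<subseteq> G" "zmod.subspace B"
    and "A \<inter> B \<subseteq> {0}" and C: "A \<subseteq> C" "B \<subseteq> C"
  shows "dim A + dim B \<le> dim C"
proof -
  have "dim (A \<inter> B) = 0" using assms(7) by (simp add: dim_eq_0)
  moreover have "dim (A \<union> B) \<le> dim C" using C by (intro dim_subset) auto
  ultimately show ?thesis using dim_inter_subgroups[OF G A B] by linarith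
qed

text \<open>A lower bound \<open>e\<close> for the norms of nonzero elements, transported to the
  functionals by \<open>linear_family_bound\<close>, gives one separation \<open>\<rho>\<close> for
  all of them, and the packing bound applies.\<close>

lemma lattice_count_bound:
  fixes G :: "'a::euclidean_space set" and \<phi> :: "'i \<Rightarrow> 'a \<Rightarrow> real"
  assumes G: "zmod.subspace G" "discrete G" and F: "subspace F" "G \<subseteq> F"
    and I: "finite I" and lin: "\<And>i. i \<in> I \<Longrightarrow> linear (\<phi> i)"
    and inj: "\<And>x. x \<in> F \<Longrightarrow> (\<And>i. i \<in> I \<Longrightarrow> \<phi> i x = 0) \<Longrightarrow> x = 0"
  shows "\<exists>C>0. \<forall>R. (\<forall>i\<in>I. R i \<ge> 0) \<longrightarrow> finite {g\<in>G. \<forall>i\<in>I. \<bar>\<phi> i g\<bar> \<le> R i} \<and>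
    real (card {g\<in>G. \<forall>i\<in>I. \<bar>\<phi> i g\<bar> \<le> R i}) \<le> (\<Prod>i\<in>I. C * R i + 2)"
proof -
  obtain e where e: "e > 0" "\<And>g. g \<in> G \<Longrightarrow> norm g < e \<Longrightarrow> g = 0"
    using discrete_subgroup_separated[OF G] by blast
  have "\<exists>C>0. \<forall>x\<in>F. \<forall>t\<ge>0. (\<forall>i\<in>I. \<bar>\<phi> i x\<bar> \<le> t) \<longrightarrow> norm x \<le> C * t"
    by (rule linear_family_bound) (use I lin F(1) inj in auto)
  then obtain C where C: "C > 0" "\<And>x t. x \<in> F \<Longrightarrow> t \<ge> 0 \<Longrightarrow> (\<And>i. i \<in> I \<Longrightarrow> \<bar>\<phi> i x\<bar> \<le> t) \<Longrightarrow> norm x \<le> C * t"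
    by blast
  define \<rho> where "\<rho> = e / (2 * C)"
  have \<rho>: "\<rho> > 0" using e C by (simp add: \<rho>_def)
  have sep: "x = y" if "x \<in> G" "y \<in> G" "\<And>i. i \<in> I \<Longrightarrow> \<bar>\<phi> i (x - y)\<bar> < \<rho>" for x y
  proof -
    have xy: "x - y \<in> G" using zsubspace_diff[OF G(1)] that by blast
    have "norm (x - y) \<le> C * \<rho>"
      using C(2)[of "x - y" \<rho>] xy F(2) that(3) \<rho> less_imp_le by blast
    also have "\<dots> < e" using e C by (simp add: \<rho>_def)
    finally show ?thesis using e(2)[OF xy] by simp
  qed
  have "finite {g\<in>G. \<forall>i\<in>I. \<bar>\<phi> i g\<bar> \<le> R i} \<and>
    real (card {g\<in>G. \<forall>i\<in>I. \<bar>\<phi> i g\<bar> \<le> R i}) \<le> (\<Prod>i\<in>I. (2 / \<rho>) * R i + 2)" if R: "\<forall>i\<in>I. R i \<ge> 0" for R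
    using packing_bound[of I \<phi> "\<lambda>_. \<rho>" R "{g\<in>G. \<forall>i\<in>I. \<bar>\<phi> i g\<bar> \<le> R i}"] I lin \<rho> R sep by auto
  then show ?thesis using \<rho> by (intro exI[of _ "2 / \<rho>"]) auto
qed


section \<open>Pigeonhole, duality, generic points and norms\<close>

text \<open>If all gaps exceeded \<open>8 * K / card A\<close>, packing would give
  \<open>card A \<le> card A / 4 + 2\<close>, hence \<open>card A = 2\<close>. In that case the
  claimed bound is \<open>4 * K\<close>, while the two points are at most \<open>2 * K\<close>
  apart.\<close>

lemma close_pair_exists:
  fixes A :: "real set"
  assumes "finite A" "card A \<ge> 2" "\<And>a. a \<in> A \<Longrightarrow> \<bar>a\<bar> \<le> K"
  shows "\<exists>a\<in>A. \<exists>b\<in>A. a < b \<and> b - a \<le> 8 * K / real (card A)"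
proof (rule ccontr)
  assume neg: "\<not> ?thesis"
  define \<rho> where "\<rho> = 8 * K / real (card A)"
  obtain a where "a \<in> A" using assms(2) by (metis card.empty ex_in_conv not_numeral_le_zero)
  have "K > 0"
  proof (rule ccontr)
    assume "\<not> K > 0"
    then have "A \<subseteq> {0}" using assms(3) by force
    then have "card A \<le> card {0::real}" by (intro card_mono) auto
    then show False using assms(2) by simp
  qed
  then have \<rho>: "\<rho> > 0" unfolding \<rho>_def using assms(2) by simp
  have "real (card A) \<le> (\<Prod>i\<in>{()}. 2 * K / \<rho> + 2)"
  proof (rule packing_bound(2)[where \<phi> = "\<lambda>_ x. x" and X = A])
    fix x y assume xy: "x \<in> A" "y \<in> A" "\<And>i. i \<in> {()} \<Longrightarrow> \<bar>x - y\<bar> < \<rho>"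
    then show "x = y" using neg unfolding \<rho>_def by (metis (no_types, opaque_lifting) abs_minus_commute abs_of_pos
      diff_gt_0_iff_gt less_imp_le linorder_less_linear singletonI)
  qed (use assms \<rho> \<open>K > 0\<close> in \<open>auto simp: linear_iff\<close>)
  also have "\<dots> = real (card A) / 4 + 2" using \<open>K > 0\<close> assms(2) by (simp add: \<rho>_def)
  finally have "real (card A) < 3" by linarith
  then have c: "card A = 2" using assms(2) by linarith
  then obtain x y where xy: "A = {x, y}" "x \<noteq> y" by (auto simp: card_2_iff)
  then have "\<bar>x - y\<bar> \<le> 4 * K" using assms(3)[of x] assms(3)[of y] by auto
  then show False using neg xy c by (cases "x < y") auto
qed

text \<open>A functional with the prescribed values is represented by a vector via the adjoint;
  projecting this vector to the span of \<open>A\<close> changes none of the values.\<close>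

lemma dual_vector_exists:
  fixes A :: "'a::euclidean_space set"
  assumes "independent A"
  shows "\<exists>x\<in>span A. \<forall>a\<in>A. a \<bullet> x = c a"
proof -
  obtain g where g: "linear g" "\<And>v. v \<in> A \<Longrightarrow> g v = (c v :: real)"
    using linear_independent_extend[OF assms, of c] by blast
  define y where "y = adjoint g 1"
  have y: "v \<bullet> y = g v" for v
    using adjoint_works[OF g(1), of v 1] by (simp add: y_def)
  obtain p q where pq: "p \<in> span A" "\<And>w. w \<in> span A \<Longrightarrow> orthogonal q w" "y = p + q"
    using orthogonal_subspace_decomp_exists[of A y] by metis
  have "a \<bullet> p = c a" if "a \<in> A" for a
    using y[of a] g(2)[OF that] pq(2)[OF real_vector.span_base[OF that]] pq(3)
    by (simp add: inner_add_right orthogonal_def inner_commute)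
  then show ?thesis using pq(1) by blast
qed

text \<open>Hyperplanes are avoided one at a time: a small push off the new one keeps the point off
  those already avoided.\<close>

lemma generic_point_exists:
  fixes V :: "'a::euclidean_space set" and w :: 'a
  assumes V: "subspace V" and "finite J"
    and "\<And>a b. (a, b) \<in> J \<Longrightarrow> \<exists>v\<in>V. a \<bullet> (w + v) \<noteq> (b::real)" and "e > 0"
  shows "\<exists>v\<in>V. norm v < e \<and> (\<forall>(a, b)\<in>J. a \<bullet> (w + v) \<noteq> b)"
  using assms(2,3,4)
proof (induction J arbitrary: e rule: finite_induct)
  case empty
  then show ?case using subspace_0[OF V] by (intro bexI[of _ 0]) auto
next
  case (insert p J)
  obtain a b where p: "p = (a, b)" by (cases p)
  have "\<exists>v\<in>V. norm v < e \<and> (\<forall>(a, b)\<in>J. a \<bullet> (w + v) \<noteq> b)"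
    using insert.prems by (intro insert.IH) auto
  then obtain v where v: "v \<in> V" "norm v < e" "\<And>a b. (a, b) \<in> J \<Longrightarrow> a \<bullet> (w + v) \<noteq> b"
    by blast
  show ?case
  proof (cases "a \<bullet> (w + v) = b")
    case False
    then show ?thesis using v p by (intro bexI[of _ v]) auto
  next
    case True
    obtain u where u: "u \<in> V" "a \<bullet> (w + u) \<noteq> b" using insert.prems(1)[of a b] p by auto
    \<comment> \<open>The direction from the current point, which lies on the new hyperplane, to a
      point off it; every nonzero step along \<open>d\<close> leaves that hyperplane.\<close>
    define d where "d = u - v"
    have d: "d \<in> V" "a \<bullet> d \<noteq> 0"
      using u v True subspace_diff[OF V] by (auto simp: d_def inner_simps)
    have "\<forall>\<^sub>F t in at_right (0::real). norm (v + t *\<^sub>R d) < e"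
    proof (rule order_tendstoD)
      show "((\<lambda>t. norm (v + t *\<^sub>R d)) \<longlongrightarrow> norm (v + 0 *\<^sub>R d)) (at_right 0)"
        by (intro tendsto_intros)
    qed (use v in simp)
    moreover have "\<forall>\<^sub>F t in at_right (0::real). a' \<bullet> (w + (v + t *\<^sub>R d)) \<noteq> b'" if "(a', b') \<in> J" for a' b'
    proof (rule tendsto_imp_eventually_ne)
      show "((\<lambda>t. a' \<bullet> (w + (v + t *\<^sub>R d))) \<longlongrightarrow> a' \<bullet> (w + (v + 0 *\<^sub>R d))) (at_right 0)"
        by (intro tendsto_intros)
    qed (use v(3)[OF that] in simp)
    then have "\<forall>\<^sub>F t in at_right (0::real). \<forall>p\<in>J. (fst p) \<bullet> (w + (v + t *\<^sub>R d)) \<noteq> snd p"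
      using insert.hyps(1) by (intro eventually_ball_finite) auto
    moreover have "\<forall>\<^sub>F t in at_right (0::real). t > 0" by (rule eventually_at_right_less)
    ultimately have "\<forall>\<^sub>F t in at_right (0::real). norm (v + t *\<^sub>R d) < e \<and>
        (\<forall>p\<in>J. (fst p) \<bullet> (w + (v + t *\<^sub>R d)) \<noteq> snd p) \<and> t > 0"
      by (intro eventually_conj)
    then obtain t :: real where t: "norm (v + t *\<^sub>R d) < e"
        "\<forall>p\<in>J. (fst p) \<bullet> (w + (v + t *\<^sub>R d)) \<noteq> snd p" "t > 0"
      using eventually_happens'[OF trivial_limit_at_right_real] by blast
    have "a \<bullet> (w + (v + t *\<^sub>R d)) \<noteq> b"
      using True d t(3) by (auto simp: inner_simps)
    then show ?thesis
      using t d v(1) p subspace_add[OF V] subspace_scale[OF V]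
      by (intro bexI[of _ "v + t *\<^sub>R d"]) auto
  qed
qed

text \<open>Equivalence of norms in finite dimension: a basis gives the upper bound, the upper bound
  makes \<open>nrm\<close> continuous on \<open>E\<close>, and its minimum on the unit sphere gives
  the lower bound.\<close>

lemma norm_on_equivalent:
  fixes E :: "'a::euclidean_space set"
  assumes E: "subspace E" and nrm: "norm_on E nrm"
  obtains c C where "c > 0" "C > 0" "\<And>x. x \<in> E \<Longrightarrow> c * norm x \<le> nrm x" "\<And>x. x \<in> E \<Longrightarrow> nrm x \<le> C * norm x"
proof -
  have nn: "nrm x \<ge> 0" and z: "nrm x = 0 \<longleftrightarrow> x = 0" and sc: "nrm (a *\<^sub>R x) = \<bar>a\<bar> * nrm x" if "x \<in> E" for x a
    using nrm that by (auto simp: norm_on_def)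
  have tri: "nrm (x + y) \<le> nrm x + nrm y" if "x \<in> E" "y \<in> E" for x y
    using nrm that by (auto simp: norm_on_def)
  obtain B where B: "B \<subseteq> E" "independent B" "E \<subseteq> span B"
    using maximal_independent_subset by metis
  have fin: "finite B" using B by (simp add: finiteI_independent)
  obtain C where C: "C > 0" "\<And>x b. x \<in> span B \<Longrightarrow> b \<in> B \<Longrightarrow> \<bar>representation B x b\<bar> \<le> C * norm x"
    using representation_bound[OF B(2)] by metis
  have nsum: "nrm (\<Sum>b\<in>T. f b) \<le> (\<Sum>b\<in>T. nrm (f b))" if "finite T" "\<And>b. b \<in> T \<Longrightarrow> f b \<in> E" for T and f :: "'a \<Rightarrow> 'a"
    using that
  proof (induction T rule: finite_induct)
    case empty
    then show ?case using z[OF subspace_0[OF E]] by simp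
  next
    case (insert a T)
    then have "nrm (f a + (\<Sum>b\<in>T. f b)) \<le> nrm (f a) + nrm (\<Sum>b\<in>T. f b)"
      by (intro tri subspace_sum[OF E]) auto
    then show ?case using insert by auto
  qed
  define D where "D = C * (\<Sum>b\<in>B. nrm b) + 1"
  have D: "D > 0" unfolding D_def using C(1) nn B(1) by (intro add_nonneg_pos mult_nonneg_nonneg sum_nonneg) auto
  have up: "nrm x \<le> D * norm x" if x: "x \<in> E" for x
  proof -
    have "x = (\<Sum>b\<in>B. representation B x b *\<^sub>R b)"
      using real_vector.sum_representation_eq[OF B(2) _ fin subset_refl, of x] B(3) x by auto
    then have "nrm x = nrm (\<Sum>b\<in>B. representation B x b *\<^sub>R b)" by simp
    also have "\<dots> \<le> (\<Sum>b\<in>B. nrm (representation B x b *\<^sub>R b))"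
      using B(1) subspace_scale[OF E] by (intro nsum[OF fin]) auto
    also have "\<dots> \<le> (\<Sum>b\<in>B. (C * norm x) * nrm b)"
    proof (rule sum_mono)
      fix b assume b: "b \<in> B"
      then have "b \<in> E" using B(1) by auto
      then show "nrm (representation B x b *\<^sub>R b) \<le> (C * norm x) * nrm b"
        using C(2)[of x b] b B(3) x nn by (auto simp: sc intro!: mult_right_mono)
    qed
    also have "\<dots> \<le> D * norm x" unfolding D_def by (simp add: sum_distrib_left[symmetric] algebra_simps)
    finally show ?thesis .
  qed
  have lip: "\<bar>nrm x - nrm y\<bar> \<le> D * norm (x - y)" if "x \<in> E" "y \<in> E" for x y
  proof -
    have d: "x - y \<in> E" "y - x \<in> E" using that subspace_diff[OF E] by auto
    show ?thesis
      using tri[OF d(1) that(2)] tri[OF d(2) that(1)] up[OF d(1)] up[OF d(2)]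
      by (simp add: norm_minus_commute abs_le_iff)
  qed
  let ?K = "E \<inter> sphere 0 1"
  have K: "compact ?K" by (intro closed_Int_compact closed_subspace E) simp
  have cont: "continuous_on ?K nrm"
    unfolding continuous_on_iff
  proof (intro ballI allI impI)
    fix x e assume x: "x \<in> ?K" and e: "(0::real) < e"
    show "\<exists>d>0. \<forall>x'\<in>?K. dist x' x < d \<longrightarrow> dist (nrm x') (nrm x) < e"
    proof (intro exI[of _ "e / D"] conjI ballI impI)
      fix x' assume x': "x' \<in> ?K" "dist x' x < e / D"
      have "\<bar>nrm x' - nrm x\<bar> \<le> D * norm (x' - x)" using lip x x' by auto
      also have "\<dots> < e" using x'(2) D by (simp add: dist_norm field_simps)
      finally show "dist (nrm x') (nrm x) < e" by (simp add: dist_real_def)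
    qed (use e D in simp)
  qed
  obtain c where c: "c > 0" "\<And>x. x \<in> ?K \<Longrightarrow> c \<le> nrm x"
  proof (cases "?K = {}")
    case True
    then show ?thesis using that[of 1] by auto
  next
    case False
    obtain x where x: "x \<in> ?K" "\<And>y. y \<in> ?K \<Longrightarrow> nrm x \<le> nrm y"
      using continuous_attains_inf[OF K False cont] by blast
    then have "nrm x > 0" using nn[of x] z[of x] by force
    then show ?thesis using that[of "nrm x"] x(2) by blast
  qed
  have "c * norm x \<le> nrm x" if x: "x \<in> E" for x
  proof (cases "x = 0")
    case True
    then show ?thesis using nn[OF x] by simp
  next
    case False
    have "(1 / norm x) *\<^sub>R x \<in> ?K" using False x subspace_scale[OF E] by auto
    from c(2)[OF this] show ?thesis using False sc[OF x] by (simp add: field_simps)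
  qed
  then show ?thesis using that c(1) D up by blast
qed


text \<open>The next lemma replaces Minkowski's second theorem. Along a segment from the lattice to a
  point far away from it there are points at every intermediate distance, and the boxes around
  these points are disjoint modulo the lattice; by volume there are only boundedly many.\<close>

lemma lattice_covering_radius:
  fixes G :: "'a::euclidean_space set" and \<phi> :: "'i \<Rightarrow> 'a \<Rightarrow> real"
  assumes G: "zmod.subspace G" "span G = UNIV"
    and I: "finite I" "card I = DIM('a)" and lin: "\<And>i. i \<in> I \<Longrightarrow> linear (\<phi> i)" and \<kappa>: "\<kappa> > 0"
  shows "\<exists>C>0. \<forall>\<rho>. (\<forall>i\<in>I. \<rho> i > 0) \<longrightarrow> (\<Prod>i\<in>I. \<rho> i) \<ge> \<kappa> \<longrightarrow>
    (\<forall>g\<in>G. (\<forall>i\<in>I. \<bar>\<phi> i g\<bar> < \<rho> i) \<longrightarrow> g = 0) \<longrightarrow> (\<forall>x. \<exists>g\<in>G. \<forall>i\<in>I. \<bar>\<phi> i (x - g)\<bar> \<le> C * \<rho> i)"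
proof -
  define k where "k = DIM('a)"
  have Ine: "I \<noteq> {}" using I DIM_positive[where 'a = 'a] by auto
  obtain B where B: "B \<subseteq> G" "independent B" "G \<subseteq> span B"
    using maximal_independent_subset by metis
  have finB: "finite B" using B by (simp add: finiteI_independent)
  have "span G \<subseteq> span B" using B(3) by (rule real_vector.span_minimal) simp
  then have cardB: "card B = k" using basis_card_eq_dim[of B UNIV] B(2) G(2) by (simp add: k_def)
  define c where "c = 1 + (\<Sum>i\<in>I. \<Sum>b\<in>B. \<bar>\<phi> i b\<bar>)"
  have c1: "c \<ge> 1" unfolding c_def by (simp add: sum_nonneg)
  have c: "(\<Sum>b\<in>B. \<bar>\<phi> i b\<bar>) \<le> c" if "i \<in> I" for i
  proof -
    have "(\<Sum>b\<in>B. \<bar>\<phi> i b\<bar>) \<le> (\<Sum>i\<in>I. \<Sum>b\<in>B. \<bar>\<phi> i b\<bar>)"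
      using that I(1) by (intro member_le_sum[of i I "\<lambda>i. \<Sum>b\<in>B. \<bar>\<phi> i b\<bar>"]) (auto intro: sum_nonneg)
    then show ?thesis by (simp add: c_def)
  qed
  \<comment> \<open>Below, each of the \<open>k\<close> factors of the packing bound is at most
    \<open>6 * c * real m / \<rho> i\<close>, and the product of the \<open>\<rho> i\<close> is at
    least \<open>\<kappa>\<close>.\<close>
  define C where "C = (6 * c) ^ k / \<kappa>"
  have C: "C > 0" using c1 \<kappa> by (simp add: C_def)
  have main: "\<exists>g\<in>G. \<forall>i\<in>I. \<bar>\<phi> i (x - g)\<bar> \<le> C * \<rho> i"
    if \<rho>: "\<forall>i\<in>I. \<rho> i > 0" and prod: "(\<Prod>i\<in>I. \<rho> i) \<ge> \<kappa>"
      and sep: "\<forall>g\<in>G. (\<forall>i\<in>I. \<bar>\<phi> i g\<bar> < \<rho> i) \<longrightarrow> g = 0" for \<rho> x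
  proof -
    \<comment> \<open>The norm whose unit ball is the box with half-sides \<open>\<rho> i\<close>;
      \<open>D\<close> is then the distance to \<open>G\<close> in this norm.\<close>
    define N where "N = (\<lambda>y. Max ((\<lambda>i. \<bar>\<phi> i y\<bar> / \<rho> i) ` I))"
    have N_le: "N y \<le> t \<longleftrightarrow> (\<forall>i\<in>I. \<bar>\<phi> i y\<bar> \<le> t * \<rho> i)" for y t
      unfolding N_def using I(1) Ine \<rho> by (auto simp: field_simps)
    have N_less: "N y < t \<longleftrightarrow> (\<forall>i\<in>I. \<bar>\<phi> i y\<bar> < t * \<rho> i)" for y t
      unfolding N_def using I(1) Ine \<rho> by (auto simp: field_simps)
    have N_ge: "\<bar>\<phi> i y\<bar> \<le> N y * \<rho> i" if "i \<in> I" for i y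
      using N_le[of y "N y"] that by auto
    have N_nonneg: "N y \<ge> 0" for y
    proof -
      obtain i where i: "i \<in> I" using Ine by auto
      have "0 \<le> N y * \<rho> i" using N_ge[OF i, of y] by linarith
      then show ?thesis using \<rho> i by (auto simp: zero_le_mult_iff)
    qed
    have N_tri: "N (y + z) \<le> N y + N z" for y z
      unfolding N_le
    proof
      fix i assume i: "i \<in> I"
      have "\<bar>\<phi> i (y + z)\<bar> \<le> \<bar>\<phi> i y\<bar> + \<bar>\<phi> i z\<bar>" using lin[OF i] by (simp add: linear_add)
      also have "\<dots> \<le> (N y + N z) * \<rho> i" using N_ge[OF i, of y] N_ge[OF i, of z] by (simp add: algebra_simps)
      finally show "\<bar>\<phi> i (y + z)\<bar> \<le> (N y + N z) * \<rho> i" .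
    qed
    have N_scale: "N (t *\<^sub>R y) \<le> \<bar>t\<bar> * N y" for t y
      unfolding N_le
    proof
      fix i assume i: "i \<in> I"
      have "\<bar>t\<bar> * \<bar>\<phi> i y\<bar> \<le> \<bar>t\<bar> * (N y * \<rho> i)" using N_ge[OF i, of y] by (intro mult_left_mono) auto
      then show "\<bar>\<phi> i (t *\<^sub>R y)\<bar> \<le> \<bar>t\<bar> * N y * \<rho> i" using lin[OF i] by (simp add: linear_cmul abs_mult)
    qed
    define D where "D = (\<lambda>y. INF g\<in>G. N (y - g))"
    have Dz: "D z = (INF g\<in>G. N (z - g))" for z by (simp add: D_def)
    have Gne: "G \<noteq> {}" and G0: "0 \<in> G" using zmod.subspace_0[OF G(1)] by auto
    have bdd: "bdd_below ((\<lambda>g. N (y - g)) ` G)" for y using N_nonneg by (intro bdd_belowI[of _ 0]) auto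
    have D_le: "D y \<le> N (y - g)" if "g \<in> G" for y g
      unfolding D_def by (rule cINF_lower[OF bdd that])
    have D_nonneg: "D y \<ge> 0" for y
      unfolding D_def using N_nonneg by (intro cINF_greatest[OF Gne]) auto
    have D_lip: "D y \<le> D z + N (y - z)" for y z
    proof -
      have "D y - N (y - z) \<le> D z"
        unfolding Dz[of z]
      proof (rule cINF_greatest[OF Gne])
        fix g assume g: "g \<in> G"
        have "D y \<le> N (y - g)" by (rule D_le[OF g])
        also have "\<dots> \<le> N (y - z) + N (z - g)" using N_tri[of "y - z" "z - g"] by simp
        finally show "D y - N (y - z) \<le> N (z - g)" by simp
      qed
      then show ?thesis by simp
    qed
    have D_per: "D (y + g) = D y" if g: "g \<in> G" for y g
    proof -
      have 1: "D (y + g) \<le> D y" if g: "g \<in> G" for y g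
        unfolding Dz[of y]
      proof (rule cINF_greatest[OF Gne])
        fix h assume h: "h \<in> G"
        show "D (y + g) \<le> N (y - h)"
          using D_le[of "g + h" "y + g"] zsubspace_add[OF G(1) g h] by simp
      qed
      show ?thesis using 1[OF g, of y] 1[of "- g" "y + g"] zmod.subspace_neg[OF G(1) g] by simp
    qed
    have D0: "D 0 = 0"
      using D_le[OF G0, of 0] D_nonneg[of 0] N_le[of 0 0] lin by (auto simp: linear_0)
    have cont: "continuous_on {0..1} (\<lambda>t. D (t *\<^sub>R x))"
      unfolding continuous_on_iff
    proof (intro ballI allI impI)
      fix t e :: real assume "t \<in> {0..1}" "e > 0"
      show "\<exists>d>0. \<forall>t'\<in>{0..1}. dist t' t < d \<longrightarrow> dist (D (t' *\<^sub>R x)) (D (t *\<^sub>R x)) < e"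
      proof (intro exI[of _ "e / (1 + N x)"] conjI ballI impI)
        show "0 < e / (1 + N x)" using \<open>e > 0\<close> N_nonneg[of x] by simp
        fix t' assume t': "dist t' t < e / (1 + N x)"
        have "\<bar>D (t' *\<^sub>R x) - D (t *\<^sub>R x)\<bar> \<le> \<bar>t' - t\<bar> * N x"
          using D_lip[of "t' *\<^sub>R x" "t *\<^sub>R x"] D_lip[of "t *\<^sub>R x" "t' *\<^sub>R x"]
            N_scale[of "t' - t" x] N_scale[of "t - t'" x]
          by (simp add: scaleR_diff_left abs_minus_commute)
        also have "\<dots> \<le> \<bar>t' - t\<bar> * (1 + N x)" by (intro mult_left_mono) auto
        also have "\<dots> < e" using t' N_nonneg[of x] by (simp add: dist_real_def field_simps)
        finally show "dist (D (t' *\<^sub>R x)) (D (t *\<^sub>R x)) < e" by (simp add: dist_real_def)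
      qed
    qed
    define J where "J = nat \<lfloor>D x\<rfloor>"
    have JD: "real J \<le> D x" "D x < real J + 1" using D_nonneg[of x] by (auto simp: J_def)
    \<comment> \<open>By continuity the distance to \<open>G\<close> takes every integer value up to
      \<open>J\<close> on the segment from 0 to \<open>x\<close>.\<close>
    have "\<exists>t. 0 \<le> t \<and> t \<le> 1 \<and> D (t *\<^sub>R x) = real j" if "j \<le> J" for j
      using IVT'[of "\<lambda>t. D (t *\<^sub>R x)" 0 "real j" 1] cont D0 JD(1) that by auto
    then obtain t where t: "\<And>j. j \<le> J \<Longrightarrow> D (t j *\<^sub>R x) = real j" by metis
    define p where "p = (\<lambda>j. t j *\<^sub>R x)"
    define P where "P = 1 + (\<Sum>i\<in>I. \<Sum>j\<le>J. \<bar>\<phi> i (p j)\<bar>)"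
    have P1: "P \<ge> 1" unfolding P_def by (simp add: sum_nonneg)
    have P: "\<bar>\<phi> i (p j)\<bar> \<le> P" if "i \<in> I" "j \<le> J" for i j
    proof -
      have "\<bar>\<phi> i (p j)\<bar> \<le> (\<Sum>j\<le>J. \<bar>\<phi> i (p j)\<bar>)"
        using that by (intro member_le_sum[of j "{..J}" "\<lambda>j. \<bar>\<phi> i (p j)\<bar>"]) auto
      also have "\<dots> \<le> (\<Sum>i\<in>I. \<Sum>j\<le>J. \<bar>\<phi> i (p j)\<bar>)"
        using that I(1) by (intro member_le_sum[of i I "\<lambda>i. \<Sum>j\<le>J. \<bar>\<phi> i (p j)\<bar>"]) (auto intro: sum_nonneg)
      finally show ?thesis by (simp add: P_def)
    qed
    define R where "R = (\<Sum>i\<in>I. \<rho> i)"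
    \<comment> \<open>So large that the points \<open>p j\<close> and the box sides are absorbed by
      the extent of the block of lattice points below. Both sides of the final count then have order
      \<open>m ^ k\<close>, and \<open>J\<close> stays bounded.\<close>
    define m where "m = nat \<lceil>P + R\<rceil>"
    have Rge: "\<rho> i \<le> R" if "i \<in> I" for i
      unfolding R_def using that I(1) \<rho> by (intro member_le_sum) (auto intro: less_imp_le)
    have R0: "R \<ge> 0" unfolding R_def using \<rho> by (intro sum_nonneg) (auto intro: less_imp_le)
    have m: "real m \<ge> P + R" unfolding m_def by (simp add: le_nat_iff real_nat_ceiling_ge)
    have m1: "real m \<ge> 1" using m P1 R0 by linarith
    define \<F> where "\<F> = Pi\<^sub>E B (\<lambda>_. {0..m})"
    define s where "s = (\<lambda>f :: 'a \<Rightarrow> nat. \<Sum>b\<in>B. real (f b) *\<^sub>R b)"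
    have sG: "s f \<in> G" for f unfolding s_def by (rule integral_combination_in[OF G(1) B(1)]) auto
    have s_inj: "f = g" if "f \<in> \<F>" "g \<in> \<F>" "s f = s g" for f g
    proof -
      have "(\<Sum>b\<in>B. (real (f b) - real (g b)) *\<^sub>R b) = 0"
        using that(3) by (simp add: s_def scaleR_diff_left sum_subtractf)
      then have "real (f b) - real (g b) = 0" if "b \<in> B" for b
        using real_vector.independentD[OF B(2) finB subset_refl _ that, of "\<lambda>b. real (f b) - real (g b)"] by blast
      then show ?thesis using that(1,2) unfolding \<F>_def by (intro PiE_ext) auto
    qed
    have s_bd: "\<bar>\<phi> i (s f)\<bar> \<le> real m * c" if "i \<in> I" "f \<in> \<F>" for i f
    proof -
      have "\<bar>\<phi> i (s f)\<bar> = \<bar>\<Sum>b\<in>B. real (f b) * \<phi> i b\<bar>"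
        unfolding s_def using lin[OF that(1)] by (simp add: linear_sum linear_cmul)
      also have "\<dots> \<le> (\<Sum>b\<in>B. \<bar>real (f b) * \<phi> i b\<bar>)" by (rule sum_abs)
      also have "\<dots> \<le> (\<Sum>b\<in>B. real m * \<bar>\<phi> i b\<bar>)"
        using that(2) by (intro sum_mono) (auto simp: \<F>_def abs_mult PiE_iff intro!: mult_right_mono)
      also have "\<dots> \<le> real m * c"
        unfolding sum_distrib_left[symmetric] using c[OF that(1)] by (intro mult_left_mono) auto
      finally show ?thesis .
    qed
    define q where "q = (\<lambda>(j, f). p j + s f)"
    define Q where "Q = {0..J} \<times> \<F>"
    \<comment> \<open>\<open>D\<close> is invariant under \<open>G\<close>, equals the index at each
      of these points and is Lipschitz with constant 1. So points at distance below 1 have the same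
      index, and then they differ by a lattice point in the open box, which is 0.\<close>
    have q_sep: "u = v" if u: "u \<in> Q" and v: "v \<in> Q" and small: "N (q u - q v) < 1" for u v
    proof -
      obtain j f where uj: "u = (j, f)" by (cases u)
      obtain j' f' where vj: "v = (j', f')" by (cases v)
      have jj: "j \<le> J" "j' \<le> J" "f \<in> \<F>" "f' \<in> \<F>" using u v by (auto simp: Q_def uj vj)
      have Dq: "D (q u) = real j" "D (q v) = real j'"
        using D_per[OF sG] t jj by (auto simp: q_def uj vj p_def)
      have "N (q v - q u) = N (q u - q v)"
        using N_scale[of "-1" "q u - q v"] N_scale[of "-1" "q v - q u"] by simp
      then have "\<bar>real j - real j'\<bar> < 1"
        using D_lip[of "q u" "q v"] D_lip[of "q v" "q u"] small Dq by linarith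
      then have jeq: "j = j'" by linarith
      have "N (s f - s f') < 1" using small by (simp add: q_def uj vj jeq)
      then have "s f - s f' = 0"
        by (intro sep[rule_format] zsubspace_diff[OF G(1) sG sG]) (simp add: N_less)
      then show ?thesis using s_inj jj jeq uj vj by simp
    qed
    have q_inj: "inj_on q Q"
      using q_sep N_le[of 0 0] lin by (intro inj_onI q_sep) (auto simp: linear_0 intro: le_less_trans[of _ 0])
    have "real (card (q ` Q)) \<le> (\<Prod>i\<in>I. 2 * (real m * c + P) / \<rho> i + 2)"
    proof (rule packing_bound(2)[of I \<phi> \<rho>])
      show "0 \<le> real m * c + P" using c1 P1 by simp
      show "\<bar>\<phi> i x\<bar> \<le> real m * c + P" if i: "i \<in> I" and x: "x \<in> q ` Q" for i x
      proof -
        obtain j f where jf: "j \<le> J" "f \<in> \<F>" "x = p j + s f" using x by (auto simp: Q_def q_def)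
        show ?thesis using P[OF i jf(1)] s_bd[OF i jf(2)] lin[OF i]
          unfolding jf(3) by (simp add: linear_add)
      qed
      show "x = y" if xy: "x \<in> q ` Q" "y \<in> q ` Q" "\<And>i. i \<in> I \<Longrightarrow> \<bar>\<phi> i (x - y)\<bar> < \<rho> i" for x y
      proof -
        obtain u v where uv: "u \<in> Q" "v \<in> Q" "x = q u" "y = q v" using xy(1,2) by blast
        have "N (q u - q v) < 1" using xy(3) uv by (simp add: N_less)
        then show ?thesis using q_sep uv by blast
      qed
    qed (use I \<rho> lin in auto)
    also have "\<dots> \<le> (\<Prod>i\<in>I. (6 * c * real m) / \<rho> i)"
    proof (rule prod_mono, intro conjI)
      fix i assume i: "i \<in> I"
      have \<rho>i: "\<rho> i > 0" "\<rho> i \<le> R" using \<rho> i Rge by auto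
      show "0 \<le> 2 * (real m * c + P) / \<rho> i + 2" using \<rho>i c1 P1 by simp
      have mc: "real m * c \<ge> real m" using c1 m1 mult_left_mono[of 1 c "real m"] by simp
      have "2 * (real m * c + P) + 2 * \<rho> i \<le> 6 * c * real m"
      proof -
        define X where "X = real m * c"
        have X6: "6 * c * real m = 6 * X" by (simp add: X_def)
        have "P + \<rho> i \<le> X" "X \<ge> 0" using m mc \<rho>i P1 R0 unfolding X_def[symmetric] by auto
        then show ?thesis unfolding X6 X_def[symmetric] by (simp add: algebra_simps)
      qed
      then have "(2 * (real m * c + P) + 2 * \<rho> i) / \<rho> i \<le> (6 * c * real m) / \<rho> i"
        using \<rho>i by (intro divide_right_mono) auto
      then show "2 * (real m * c + P) / \<rho> i + 2 \<le> (6 * c * real m) / \<rho> i"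
        using \<rho>i by (simp add: add_divide_distrib)
    qed
    also have "\<dots> = (6 * c * real m) ^ k / (\<Prod>i\<in>I. \<rho> i)"
      by (simp add: prod_dividef I k_def)
    also have "\<dots> \<le> (6 * c * real m) ^ k / \<kappa>"
      using prod \<kappa> c1 by (intro divide_left_mono) auto
    also have "\<dots> = C * real m ^ k" by (simp add: C_def power_mult_distrib)
    also have "card (q ` Q) = (J + 1) * (m + 1) ^ k"
      using card_image[OF q_inj] finB cardB by (simp add: Q_def \<F>_def card_cartesian_product card_PiE)
    finally have "real (J + 1) * real (m + 1) ^ k \<le> C * real m ^ k" by (simp only: of_nat_mult of_nat_power)
    moreover have "real m ^ k \<le> real (m + 1) ^ k" by (intro power_mono) auto
    ultimately have "real (J + 1) * real (m + 1) ^ k \<le> C * real (m + 1) ^ k"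
      using C by (meson mult_left_mono less_imp_le order_trans)
    then have "real (J + 1) \<le> C" by (simp del: of_nat_Suc add: mult_le_cancel_right)
    then have "D x < C" using JD(2) by simp
    then obtain g where "g \<in> G" "N (x - g) < C"
      unfolding D_def using cINF_less_iff[OF Gne bdd] by auto
    then show ?thesis using N_le[of "x - g" C] by auto
  qed
  show ?thesis using C main by blast
qed

section \<open>Minkowski sums of subgroups and of subspaces\<close>

lemma sum_zsubspace:
  fixes F :: "'i \<Rightarrow> 'a::real_vector set"
  assumes "finite Q" "\<And>T. T \<in> Q \<Longrightarrow> zmod.subspace (F T)"
  shows "zmod.subspace (sum F Q)" "\<And>T. T \<in> Q \<Longrightarrow> F T \<subseteq> sum F Q"
    and "\<And>G. zmod.subspace G \<Longrightarrow> (\<And>T. T \<in> Q \<Longrightarrow> F T \<subseteq> G) \<Longrightarrow> sum F Q \<subseteq> G"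
proof -
  note alt = set_sum_alt[OF assms(1), of F]
  have mem: "x \<in> sum F Q \<longleftrightarrow> (\<exists>s. x = sum s Q \<and> (\<forall>T\<in>Q. s T \<in> F T))" for x
    unfolding alt by auto
  show "zmod.subspace (sum F Q)"
    unfolding zmod.subspace_def
  proof (intro conjI ballI allI)
    show "0 \<in> sum F Q"
      unfolding mem using assms(2) by (intro exI[of _ "\<lambda>_. 0"]) (auto simp: zmod.subspace_0)
  next
    fix x y assume "x \<in> sum F Q" "y \<in> sum F Q"
    then obtain s t where "x = sum s Q" "\<forall>T\<in>Q. s T \<in> F T" "y = sum t Q" "\<forall>T\<in>Q. t T \<in> F T"
      unfolding mem by blast
    then show "x + y \<in> sum F Q"
      unfolding mem using assms(2)
      by (intro exI[of _ "\<lambda>T. s T + t T"]) (auto simp: sum.distrib zmod.subspace_add)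
  next
    fix x and m :: int assume "x \<in> sum F Q"
    then obtain s where "x = sum s Q" "\<forall>T\<in>Q. s T \<in> F T" unfolding mem by blast
    then show "of_int m *\<^sub>R x \<in> sum F Q"
      unfolding mem using assms(2)
      by (intro exI[of _ "\<lambda>T. of_int m *\<^sub>R s T"]) (auto simp: scaleR_sum_right zmod.subspace_scale)
  qed
  show "F T \<subseteq> sum F Q" if "T \<in> Q" for T
  proof
    fix x assume "x \<in> F T"
    then show "x \<in> sum F Q"
      unfolding mem using assms that
      by (intro exI[of _ "\<lambda>T'. if T' = T then x else 0"]) (auto simp: zmod.subspace_0)
  qed
  show "sum F Q \<subseteq> G" if "zmod.subspace G" "\<And>T. T \<in> Q \<Longrightarrow> F T \<subseteq> G" for G
  proof
    fix x assume "x \<in> sum F Q"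
    then obtain s where "x = sum s Q" "\<forall>T\<in>Q. s T \<in> F T" unfolding mem by blast
    then show "x \<in> G" using that zmod.subspace_sum[OF that(1), of Q s] by blast
  qed
qed

lemma subspace_imp_zsubspace: "subspace A \<Longrightarrow> zmod.subspace A"
  by (auto simp: subspace_def zmod.subspace_def)

lemma dim_sum_le:
  fixes F :: "'i \<Rightarrow> 'a::euclidean_space set"
  assumes "finite Q" "\<And>T. T \<in> Q \<Longrightarrow> subspace (F T)"
  shows "subspace (sum F Q) \<and> dim (sum F Q) \<le> (\<Sum>T\<in>Q. dim (F T))"
  using assms
proof (induction Q rule: finite_induct)
  case empty
  then show ?case by (simp add: subspace_def)
next
  case (insert T Q)
  have sub: "subspace (F T)" "subspace (sum F Q)" using insert by auto
  have eq: "F T + sum F Q = {x + y |x y. x \<in> F T \<and> y \<in> sum F Q}"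
    by (auto simp: set_plus_def)
  have "dim (F T + sum F Q) + dim (F T \<inter> sum F Q) = dim (F T) + dim (sum F Q)"
    unfolding eq by (rule dim_sums_Int[OF sub])
  moreover have "subspace (F T + sum F Q)" unfolding eq by (rule subspace_sums[OF sub])
  ultimately show ?case using insert by auto
qed

lemma representation_sum_coeff:
  fixes B :: "'a::real_vector set"
  assumes "independent B" "finite B" "b \<in> B"
  shows "representation B (\<Sum>v\<in>B. c v *\<^sub>R v) b = c b"
proof -
  let ?x = "\<Sum>v\<in>B. c v *\<^sub>R v"
  have "?x \<in> span B" by (intro real_vector.span_sum real_vector.span_scale real_vector.span_base)
  then have "(\<Sum>v\<in>B. representation B ?x v *\<^sub>R v) = ?x"
    by (rule real_vector.sum_representation_eq[OF assms(1) _ assms(2) subset_refl])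
  then have "(\<Sum>v\<in>B. (representation B ?x v - c v) *\<^sub>R v) = 0"
    by (simp add: scaleR_diff_left sum_subtractf)
  from real_vector.independentD[OF assms(1,2) subset_refl this assms(3)] show ?thesis by simp
qed

section \<open>Cells of hyperplane arrangements\<close>

text \<open>Some vertex of the closed cell lies off any given facet. The gap condition makes it stay away
  from that facet by a definite amount, and averaging such vertices over all facets gives a point
  which stays away from every facet.\<close>

lemma cell_inner_point:
  fixes n :: "'v \<Rightarrow> 'a::euclidean_space" and A :: "'v \<Rightarrow> real set"
  assumes E: "subspace E" and D: "finite D" "D \<noteq> {}" and finA: "\<And>V. V \<in> D \<Longrightarrow> finite (A V)"
    and q: "q \<in> E" "\<And>V a. V \<in> D \<Longrightarrow> a \<in> A V \<Longrightarrow> n V \<bullet> q \<noteq> a"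
    and bdd: "bounded {p \<in> E. \<forall>V\<in>D. \<forall>a\<in>A V. (a < n V \<bullet> q \<longrightarrow> a \<le> n V \<bullet> p) \<and> (n V \<bullet> q < a \<longrightarrow> n V \<bullet> p \<le> a)}"
    and gap: "\<And>v V a. v \<in> E \<Longrightarrow> (\<And>x. x \<in> E \<Longrightarrow> (\<And>V. V \<in> D \<Longrightarrow> n V \<bullet> v \<in> A V \<Longrightarrow> n V \<bullet> x = 0) \<Longrightarrow> x = 0) \<Longrightarrow>
        V \<in> D \<Longrightarrow> a \<in> A V \<Longrightarrow> n V \<bullet> v = a \<or> \<epsilon> V \<le> \<bar>n V \<bullet> v - a\<bar>"
  shows "\<exists>p\<in>E. \<forall>V\<in>D. \<forall>a\<in>A V. (a < n V \<bullet> q \<longrightarrow> a + \<epsilon> V / real (2 * card D) \<le> n V \<bullet> p) \<and>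
     (n V \<bullet> q < a \<longrightarrow> n V \<bullet> p \<le> a - \<epsilon> V / real (2 * card D))"
proof -
  define C where "C = {p \<in> E. \<forall>V\<in>D. \<forall>a\<in>A V. (a < n V \<bullet> q \<longrightarrow> a \<le> n V \<bullet> p) \<and> (n V \<bullet> q < a \<longrightarrow> n V \<bullet> p \<le> a)}"
  have Ceq: "C = E \<inter> (\<Inter>V\<in>D. \<Inter>a\<in>A V. {p. (a < n V \<bullet> q \<longrightarrow> a \<le> n V \<bullet> p) \<and> (n V \<bullet> q < a \<longrightarrow> n V \<bullet> p \<le> a)})"
    by (auto simp: C_def)
  have closed1: "closed {p. (P \<longrightarrow> a \<le> m \<bullet> p) \<and> (Q \<longrightarrow> m \<bullet> p \<le> a)}" for P Q a and m :: 'a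
    by (cases P; cases Q) (auto intro!: closed_Collect_conj closed_halfspace_ge closed_halfspace_le simp: closed_halfspace_ge closed_halfspace_le)
  have convex1: "convex {p. (P \<longrightarrow> a \<le> m \<bullet> p) \<and> (Q \<longrightarrow> m \<bullet> p \<le> a)}" for P Q a and m :: 'a
  proof -
    have "{p. (P \<longrightarrow> a \<le> m \<bullet> p) \<and> (Q \<longrightarrow> m \<bullet> p \<le> a)} = (if P then {p. m \<bullet> p \<ge> a} else UNIV) \<inter> (if Q then {p. m \<bullet> p \<le> a} else UNIV)"
      by auto
    then show ?thesis by (simp add: convex_Int convex_halfspace_le convex_halfspace_ge)
  qed
  have "closed C" unfolding Ceq
    by (intro closed_Int closed_INT ballI closed1 closed_subspace E)
  then have compC: "compact C" using bdd by (simp add: compact_eq_bounded_closed C_def)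
  have convC: "convex C" unfolding Ceq
    by (intro convex_Int convex_INT convex1 subspace_imp_convex E)
  have qC: "q \<in> C" using q(1) by (auto simp: C_def)
  have CE: "C \<subseteq> E" by (auto simp: C_def)
  \<comment> \<open>The gap condition applies to extreme points of \<open>C\<close>. If a nonzero
    \<open>x\<close> were annihilated by all functionals active at \<open>v\<close>, the inactive
    constraints would survive small moves along \<open>x\<close> and \<open>- x\<close>, and
    \<open>v\<close> would be interior to a segment in \<open>C\<close>.\<close>
  have extreme_gap: "n V \<bullet> v = a \<or> \<epsilon> V \<le> \<bar>n V \<bullet> v - a\<bar>"
    if v: "v extreme_point_of C" and V: "V \<in> D" and a: "a \<in> A V" for v V a
  proof (rule gap[OF _ _ V a])
    have vC: "v \<in> C" using v by (simp add: extreme_point_of_def)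
    then show vE: "v \<in> E" using CE by blast
    fix x assume x: "x \<in> E" "\<And>V. V \<in> D \<Longrightarrow> n V \<bullet> v \<in> A V \<Longrightarrow> n V \<bullet> x = 0"
    show "x = 0"
    proof (rule ccontr)
      assume "x \<noteq> 0"
      have ev: "\<forall>\<^sub>F t in at_right (0::real). \<forall>V\<in>D. \<forall>a\<in>A V. (a < n V \<bullet> q \<longrightarrow> a \<le> n V \<bullet> (v + t *\<^sub>R (\<sigma> *\<^sub>R x))) \<and>
           (n V \<bullet> q < a \<longrightarrow> n V \<bullet> (v + t *\<^sub>R (\<sigma> *\<^sub>R x)) \<le> a)" for \<sigma>
      proof (intro eventually_ball_finite ballI D(1) finA)
        fix V a assume V: "V \<in> D" and a: "a \<in> A V"
        have va: "(a < n V \<bullet> q \<longrightarrow> a \<le> n V \<bullet> v) \<and> (n V \<bullet> q < a \<longrightarrow> n V \<bullet> v \<le> a)" using vC V a by (auto simp: C_def)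
        show "\<forall>\<^sub>F t in at_right 0. (a < n V \<bullet> q \<longrightarrow> a \<le> n V \<bullet> (v + t *\<^sub>R (\<sigma> *\<^sub>R x))) \<and>
           (n V \<bullet> q < a \<longrightarrow> n V \<bullet> (v + t *\<^sub>R (\<sigma> *\<^sub>R x)) \<le> a)"
        proof (cases "n V \<bullet> v \<in> A V")
          case True
          then show ?thesis using va x(2)[OF V True] by (simp add: inner_add_right)
        next
          case False
          then have ne: "n V \<bullet> v \<noteq> a" using a by blast
          have lim: "((\<lambda>t. n V \<bullet> (v + t *\<^sub>R (\<sigma> *\<^sub>R x))) \<longlongrightarrow> n V \<bullet> (v + 0 *\<^sub>R (\<sigma> *\<^sub>R x))) (at_right 0)"
            by (intro tendsto_intros)
          consider "n V \<bullet> v < a" | "a < n V \<bullet> v" using ne by linarith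
          then show ?thesis
          proof cases
            case 1
            then have "\<forall>\<^sub>F t in at_right 0. n V \<bullet> (v + t *\<^sub>R (\<sigma> *\<^sub>R x)) < a"
              using order_tendstoD(2)[OF lim, of a] by simp
            then show ?thesis by (rule eventually_mono) (use va 1 in auto)
          next
            case 2
            then have "\<forall>\<^sub>F t in at_right 0. a < n V \<bullet> (v + t *\<^sub>R (\<sigma> *\<^sub>R x))"
              using order_tendstoD(1)[OF lim, of a] by simp
            then show ?thesis by (rule eventually_mono) (use va 2 in auto)
          qed
        qed
      qed
      have "\<forall>\<^sub>F t in at_right (0::real). t > 0" by (rule eventually_at_right_less)
      then obtain t :: real where t: "t > 0"
        "\<forall>V\<in>D. \<forall>a\<in>A V. (a < n V \<bullet> q \<longrightarrow> a \<le> n V \<bullet> (v + t *\<^sub>R (1 *\<^sub>R x))) \<and> (n V \<bullet> q < a \<longrightarrow> n V \<bullet> (v + t *\<^sub>R (1 *\<^sub>R x)) \<le> a)"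
        "\<forall>V\<in>D. \<forall>a\<in>A V. (a < n V \<bullet> q \<longrightarrow> a \<le> n V \<bullet> (v + t *\<^sub>R ((-1) *\<^sub>R x))) \<and> (n V \<bullet> q < a \<longrightarrow> n V \<bullet> (v + t *\<^sub>R ((-1) *\<^sub>R x)) \<le> a)"
        using eventually_happens'[OF trivial_limit_at_right_real eventually_conj[OF _ eventually_conj[OF ev[of 1] ev[of "-1"]]]] by blast
      have "v + t *\<^sub>R x \<in> C" "v - t *\<^sub>R x \<in> C"
        using t(2,3) subspace_add[OF E vE subspace_scale[OF E x(1), of t]] subspace_diff[OF E vE subspace_scale[OF E x(1), of t]]
        by (simp_all add: C_def)
      moreover have "v \<in> open_segment (v + t *\<^sub>R x) (v - t *\<^sub>R x)"
        unfolding in_segment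
        using t(1) \<open>x \<noteq> 0\<close> by (intro conjI exI[of _ "1 / 2"]) (auto simp: algebra_simps eq_neg_iff_add_eq_0 simp flip: scaleR_add_left)
      ultimately show False using v unfolding extreme_point_of_def by blast
    qed
  qed
  \<comment> \<open>By the theorem of Krein, Milman and Minkowski \<open>C\<close> is the hull of
    its extreme points; if all of them lay on the hyperplane, so would \<open>q\<close>.\<close>
  have exists_off: "\<exists>v. v extreme_point_of C \<and> m \<bullet> v \<noteq> a" if ne: "m \<bullet> q \<noteq> a" for m a
  proof (rule ccontr)
    assume "\<not> ?thesis"
    then have "{x. x extreme_point_of C} \<subseteq> {x. m \<bullet> x = a}" by blast
    moreover have "convex {x. m \<bullet> x = a}" by (rule convex_hyperplane)
    ultimately have "convex hull {x. x extreme_point_of C} \<subseteq> {x. m \<bullet> x = a}" by (rule hull_minimal)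
    then have "C \<subseteq> {x. m \<bullet> x = a}" using Krein_Milman_Minkowski[OF compC convC] by simp
    then show False using qC ne by blast
  qed
  have lower: "\<exists>v\<in>C. \<forall>a\<in>A V. a < n V \<bullet> q \<longrightarrow> a + \<epsilon> V \<le> n V \<bullet> v" if V: "V \<in> D" for V
  proof (cases "{a \<in> A V. a < n V \<bullet> q} = {}")
    case True
    then show ?thesis using qC by blast
  next
    case False
    \<comment> \<open>The nearest level below \<open>q\<close>; a vertex that clears it by
      \<open>\<epsilon> V\<close> clears all lower levels as well.\<close>
    define m where "m = Max {a \<in> A V. a < n V \<bullet> q}"
    have fin: "finite {a \<in> A V. a < n V \<bullet> q}" using finA[OF V] by simp
    have m: "m \<in> A V" "m < n V \<bullet> q" using Max_in[OF fin False] by (auto simp: m_def)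
    obtain v where v: "v extreme_point_of C" "n V \<bullet> v \<noteq> m" using exists_off[of "n V" m] m(2) by auto
    have vC: "v \<in> C" using v(1) by (simp add: extreme_point_of_def)
    have "m \<le> n V \<bullet> v" using vC V m by (auto simp: C_def)
    then have "m + \<epsilon> V \<le> n V \<bullet> v" using extreme_gap[OF v(1) V m(1)] v(2) by linarith
    moreover have "a \<le> m" if "a \<in> A V" "a < n V \<bullet> q" for a
      unfolding m_def using fin that by (intro Max_ge) auto
    ultimately show ?thesis using vC by (intro bexI[of _ v]) force+
  qed
  have upper: "\<exists>v\<in>C. \<forall>a\<in>A V. n V \<bullet> q < a \<longrightarrow> n V \<bullet> v \<le> a - \<epsilon> V" if V: "V \<in> D" for V
  proof (cases "{a \<in> A V. n V \<bullet> q < a} = {}")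
    case True
    then show ?thesis using qC by blast
  next
    case False
    define m where "m = Min {a \<in> A V. n V \<bullet> q < a}"
    have fin: "finite {a \<in> A V. n V \<bullet> q < a}" using finA[OF V] by simp
    have m: "m \<in> A V" "n V \<bullet> q < m" using Min_in[OF fin False] by (auto simp: m_def)
    obtain v where v: "v extreme_point_of C" "n V \<bullet> v \<noteq> m" using exists_off[of "n V" m] m(2) by auto
    have vC: "v \<in> C" using v(1) by (simp add: extreme_point_of_def)
    have "n V \<bullet> v \<le> m" using vC V m by (auto simp: C_def)
    then have "n V \<bullet> v \<le> m - \<epsilon> V" using extreme_gap[OF v(1) V m(1)] v(2) by linarith
    moreover have "m \<le> a" if "a \<in> A V" "n V \<bullet> q < a" for a
      unfolding m_def using fin that by (intro Min_le) auto
    ultimately show ?thesis using vC by (intro bexI[of _ v]) force+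
  qed
  obtain v w where v: "\<And>V. V \<in> D \<Longrightarrow> v V \<in> C \<and> (\<forall>a\<in>A V. a < n V \<bullet> q \<longrightarrow> a + \<epsilon> V \<le> n V \<bullet> v V)"
    and w: "\<And>V. V \<in> D \<Longrightarrow> w V \<in> C \<and> (\<forall>a\<in>A V. n V \<bullet> q < a \<longrightarrow> n V \<bullet> w V \<le> a - \<epsilon> V)"
    using lower upper by metis
  define k where "k = real (2 * card D)"
  have k: "k > 0" unfolding k_def using D by (simp add: card_gt_0_iff)
  \<comment> \<open>In this average of \<open>2 * card D\<close> points, every point satisfies all
    the weak inequalities, and for each direction and side one point gains
    \<open>\<epsilon> V\<close>. This is the source of the denominator.\<close>
  define p where "p = (1 / k) *\<^sub>R ((\<Sum>V\<in>D. v V) + (\<Sum>V\<in>D. w V))"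
  have "p \<in> E" unfolding p_def
    using v w CE by (intro subspace_scale[OF E] subspace_add[OF E] subspace_sum[OF E]) auto
  moreover have "(a < n V \<bullet> q \<longrightarrow> a + \<epsilon> V / k \<le> n V \<bullet> p) \<and> (n V \<bullet> q < a \<longrightarrow> n V \<bullet> p \<le> a - \<epsilon> V / k)"
    if V: "V \<in> D" and a: "a \<in> A V" for V a
  proof -
    have np: "n V \<bullet> p = (1 / k) * ((\<Sum>U\<in>D. n V \<bullet> v U) + (\<Sum>U\<in>D. n V \<bullet> w U))"
      by (simp add: p_def inner_add_right inner_sum_right)
    have Cb: "(a < n V \<bullet> q \<longrightarrow> a \<le> n V \<bullet> x) \<and> (n V \<bullet> q < a \<longrightarrow> n V \<bullet> x \<le> a)" if "x \<in> C" for x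
      using that V a by (auto simp: C_def)
    have cst: "(\<Sum>U\<in>D. b) = real (card D) * b" for b :: real by simp
    have rem: "(\<Sum>U\<in>D. F U) = F V + (\<Sum>U\<in>D - {V}. F U)" for F :: "'v \<Rightarrow> real" by (rule sum.remove[OF D(1) V])
    show ?thesis
    proof (intro conjI impI)
      assume lt: "a < n V \<bullet> q"
      have "(\<Sum>U\<in>D - {V}. a) \<le> (\<Sum>U\<in>D - {V}. n V \<bullet> v U)" using Cb v lt by (intro sum_mono) blast
      then have "(\<Sum>U\<in>D. a) + \<epsilon> V \<le> (\<Sum>U\<in>D. n V \<bullet> v U)" using rem[of "\<lambda>U. a"] rem[of "\<lambda>U. n V \<bullet> v U"] v[OF V, THEN conjunct2, rule_format, OF a lt] by linarith
      moreover have "(\<Sum>U\<in>D. a) \<le> (\<Sum>U\<in>D. n V \<bullet> w U)" using Cb w lt by (intro sum_mono) blast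
      ultimately have "k * a + \<epsilon> V \<le> (\<Sum>U\<in>D. n V \<bullet> v U) + (\<Sum>U\<in>D. n V \<bullet> w U)"
        unfolding cst k_def by (simp add: algebra_simps)
      then have "(k * a + \<epsilon> V) / k \<le> n V \<bullet> p" unfolding np using k by (simp add: divide_right_mono)
      then show "a + \<epsilon> V / k \<le> n V \<bullet> p" using k by (simp add: add_divide_distrib)
    next
      assume lt: "n V \<bullet> q < a"
      have "(\<Sum>U\<in>D - {V}. n V \<bullet> w U) \<le> (\<Sum>U\<in>D - {V}. a)" using Cb w lt by (intro sum_mono) blast
      then have "(\<Sum>U\<in>D. n V \<bullet> w U) \<le> (\<Sum>U\<in>D. a) - \<epsilon> V" using rem[of "\<lambda>U. a"] rem[of "\<lambda>U. n V \<bullet> w U"] w[OF V, THEN conjunct2, rule_format, OF a lt] by linarith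
      moreover have "(\<Sum>U\<in>D. n V \<bullet> v U) \<le> (\<Sum>U\<in>D. a)" using Cb v lt by (intro sum_mono) blast
      ultimately have "(\<Sum>U\<in>D. n V \<bullet> v U) + (\<Sum>U\<in>D. n V \<bullet> w U) \<le> k * a - \<epsilon> V"
        unfolding cst k_def by (simp add: algebra_simps)
      then have "n V \<bullet> p \<le> (k * a - \<epsilon> V) / k" unfolding np using k by (simp add: divide_right_mono)
      then show "n V \<bullet> p \<le> a - \<epsilon> V / k" using k by (simp add: diff_divide_distrib)
    qed
  qed
  ultimately show ?thesis unfolding k_def by blast
qed

section \<open>Cut and project schemes\<close>

locale scheme =
  fixes S :: "('a::euclidean_space, 'l) cps" and nrm :: "'a \<Rightarrow> real"
  assumes cps: "polytopal_cps S" and nrm: "norm_on (phys S) nrm"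
begin

abbreviation "P \<equiv> phys S"
abbreviation "E \<equiv> internal S"
abbreviation "\<Gamma> \<equiv> lattice S"
abbreviation "pv \<equiv> proj_phys S"
abbreviation "pin \<equiv> proj_int S"
abbreviation "W \<equiv> window S"
abbreviation "\<Lambda> \<equiv> cut_project_set S"

lemma subP: "subspace P" and subE: "subspace E" and PE: "P \<inter> E = {0}"
  and PE_UNIV: "P + E = UNIV" and dimP: "dim P \<ge> 1" and dimE: "dim E \<ge> 1"
  and lattice: "is_lattice \<Gamma>" and W_nonempty: "W \<noteq> {}" and W_polytopal: "polytopal E W"
  and finite_labels: "finite (labels S)"
  and piece_polytopal: "i \<in> labels S \<Longrightarrow> polytopal E (piece S i)"
  and W_eq: "W = (\<Union>i\<in>labels S. piece S i)"
  and inj_pv: "inj_on pv \<Gamma>" and inj_pin: "inj_on pin \<Gamma>"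
  and dense_closure: "E \<subseteq> closure (pin ` \<Gamma>)"
  and nonsingular: "\<gamma> \<in> \<Gamma> \<Longrightarrow> i \<in> labels S \<Longrightarrow> pin \<gamma> \<notin> top_of_set E frontier_of piece S i"
  using cps by (auto simp: polytopal_cps_def)

lemma zsub: "zmod.subspace \<Gamma>" and disc: "discrete \<Gamma>" and spanG: "span \<Gamma> = UNIV"
  using lattice by (auto simp: is_lattice_def)

subsection \<open>The projections\<close>

lemma split_unique:
  assumes "v \<in> P" "w \<in> E" "v' \<in> P" "w' \<in> E" "v + w = v' + w'"
  shows "v = v'" "w = w'"
proof -
  have "v - v' = w' - w" using assms(5) by (simp add: algebra_simps)
  then have "v - v' \<in> P \<inter> E" using assms subspace_diff subP subE by (metis IntI)
  then show "v = v'" using PE by auto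
  then show "w = w'" using assms(5) by simp
qed

lemma split_exists: "\<exists>v w. v \<in> P \<and> w \<in> E \<and> x = v + w"
  using PE_UNIV by (metis UNIV_I set_plus_elim)

lemma proj_split: "pv (v + w) = v" "pin (v + w) = w" if "v \<in> P" "w \<in> E"
proof -
  show "pv (v + w) = v"
    unfolding proj_phys_def
  proof (rule the_equality)
    fix u assume u: "u \<in> P \<and> v + w - u \<in> E"
    show "u = v" using split_unique(1)[of u "v + w - u" v w] u that by simp
  qed (use that in auto)
  show "pin (v + w) = w"
    unfolding proj_int_def
  proof (rule the_equality)
    fix u assume u: "u \<in> E \<and> v + w - u \<in> P"
    show "u = w" using split_unique(2)[of "v + w - u" u v w] u that by simp
  qed (use that in auto)
qed

lemma pv_in: "pv x \<in> P" and pin_in: "pin x \<in> E" and pv_pin: "pv x + pin x = x"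
proof -
  obtain v w where "v \<in> P" "w \<in> E" "x = v + w" using split_exists by blast
  then show "pv x \<in> P" "pin x \<in> E" "pv x + pin x = x" using proj_split by auto
qed

lemma pv_E: "x \<in> E \<Longrightarrow> pv x = 0" and pin_E: "x \<in> E \<Longrightarrow> pin x = x"
  and pv_P: "x \<in> P \<Longrightarrow> pv x = x" and pin_P: "x \<in> P \<Longrightarrow> pin x = 0"
  using proj_split[of 0 x] proj_split[of x 0] subspace_0[OF subP] subspace_0[OF subE] by auto

lemma pv_add: "pv (x + y) = pv x + pv y" and pin_add: "pin (x + y) = pin x + pin y"
proof -
  have "x + y = (pv x + pv y) + (pin x + pin y)" using pv_pin[of x] pv_pin[of y] by (simp add: algebra_simps)
  moreover have "pv x + pv y \<in> P" "pin x + pin y \<in> E"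
    by (simp_all add: pv_in pin_in subspace_add subP subE)
  ultimately show "pv (x + y) = pv x + pv y" "pin (x + y) = pin x + pin y"
    using proj_split by auto
qed

lemma pv_scale: "pv (c *\<^sub>R x) = c *\<^sub>R pv x" and pin_scale: "pin (c *\<^sub>R x) = c *\<^sub>R pin x"
proof -
  have "c *\<^sub>R x = c *\<^sub>R pv x + c *\<^sub>R pin x" using pv_pin[of x] by (metis scaleR_add_right)
  moreover have "c *\<^sub>R pv x \<in> P" "c *\<^sub>R pin x \<in> E"
    by (simp_all add: pv_in pin_in subspace_scale subP subE)
  ultimately show "pv (c *\<^sub>R x) = c *\<^sub>R pv x" "pin (c *\<^sub>R x) = c *\<^sub>R pin x"
    using proj_split by auto
qed

lemma linear_pv: "linear pv" and linear_pin: "linear pin"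
  by (auto simp: linear_iff pv_add pin_add pv_scale pin_scale)

lemma pv_diff: "pv (x - y) = pv x - pv y" and pin_diff: "pin (x - y) = pin x - pin y"
  using linear_diff linear_pv linear_pin by auto

lemma pv_0 [simp]: "pv 0 = 0" and pin_0 [simp]: "pin 0 = 0"
  using linear_0 linear_pv linear_pin by auto

lemma pv_minus: "pv (- x) = - pv x" and pin_minus: "pin (- x) = - pin x"
  using linear_neg linear_pv linear_pin by auto

lemma pv_pv [simp]: "pv (pv x) = pv x" and pin_pin [simp]: "pin (pin x) = pin x"
  and pv_pin0 [simp]: "pv (pin x) = 0" and pin_pv0 [simp]: "pin (pv x) = 0"
  using pv_P pin_E pv_E pin_P pv_in pin_in by auto

lemma pin_0D: "\<gamma> \<in> \<Gamma> \<Longrightarrow> pin \<gamma> = 0 \<Longrightarrow> \<gamma> = 0"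
  using inj_pin zmod.subspace_0[OF zsub] by (auto simp: inj_on_def)

lemma pv_inj: "\<gamma> \<in> \<Gamma> \<Longrightarrow> \<gamma>' \<in> \<Gamma> \<Longrightarrow> pv \<gamma> = pv \<gamma>' \<Longrightarrow> \<gamma> = \<gamma>'"
  using inj_pv by (auto simp: inj_on_def)

lemma dim_PE: "dim P + dim E = DIM('a)"
proof -
  have "dim {x + y |x y. x \<in> P \<and> y \<in> E} + dim (P \<inter> E) = dim P + dim E"
    by (rule dim_sums_Int[OF subP subE])
  moreover have "{x + y |x y. x \<in> P \<and> y \<in> E} = UNIV" using split_exists by blast
  ultimately show ?thesis unfolding PE by (simp add: dim_UNIV)
qed

lemma proj_bound:
  obtains C where "C \<ge> 1" "\<And>x. norm (pv x) \<le> C * norm x" "\<And>x. norm (pin x) \<le> C * norm x"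
proof -
  obtain A where A: "\<And>x. norm (pv x) \<le> A * norm x" using linear_bounded[OF linear_pv] by auto
  obtain B where B: "\<And>x. norm (pin x) \<le> B * norm x" using linear_bounded[OF linear_pin] by auto
  define C where "C = max 1 (max A B)"
  have "A * norm x \<le> C * norm x" "B * norm x \<le> C * norm x" for x
    by (auto simp: C_def intro!: mult_right_mono)
  then show ?thesis using A B that[of C] order_trans by (fastforce simp: C_def)
qed

lemma norm_le_split: "norm x \<le> norm (pv x) + norm (pin x)"
  using norm_triangle_ineq[of "pv x" "pin x"] pv_pin by simp

lemma nrm_bounds:
  obtains c C where "c > 0" "C > 0" "\<And>x. c * norm (pv x) \<le> nrm (pv x)" "\<And>x. nrm (pv x) \<le> C * norm (pv x)"
  using norm_on_equivalent[OF subP nrm] pv_in by metis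

lemma nrm_tri: "x \<in> P \<Longrightarrow> y \<in> P \<Longrightarrow> nrm (x + y) \<le> nrm x + nrm y"
  and nrm_0: "nrm 0 = 0"
  using nrm subspace_0[OF subP] by (auto simp: norm_on_def)

subsection \<open>Relative density\<close>

lemma dense:
  assumes "open U" "p \<in> U" "p \<in> E"
  shows "\<exists>\<gamma>\<in>\<Gamma>. pin \<gamma> \<in> U"
  using dense_closure assms(2,3) open_Int_closure_eq_empty[OF assms(1), of "pin ` \<Gamma>"] by blast

lemma lattice_cocompact: "\<exists>D. \<forall>x. \<exists>g\<in>\<Gamma>. norm (x - g) \<le> D"
proof -
  obtain B where B: "B \<subseteq> \<Gamma>" "independent B" "\<Gamma> \<subseteq> span B"
    using maximal_independent_subset by metis
  have fin: "finite B" using B by (simp add: finiteI_independent)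
  have span: "x \<in> span B" for x
    using real_vector.span_minimal[OF B(3)] spanG by auto
  have "\<exists>g\<in>\<Gamma>. norm (x - g) \<le> (\<Sum>b\<in>B. norm b)" for x
  proof
    define g where "g = (\<Sum>b\<in>B. of_int \<lfloor>representation B x b\<rfloor> *\<^sub>R b)"
    show "g \<in> \<Gamma>" unfolding g_def by (rule integral_combination_in[OF zsub B(1)]) auto
    have "x = (\<Sum>b\<in>B. representation B x b *\<^sub>R b)"
      using real_vector.sum_representation_eq[OF B(2) span fin subset_refl] by simp
    then have "x - g = (\<Sum>b\<in>B. frac (representation B x b) *\<^sub>R b)"
      by (simp add: g_def frac_def scaleR_diff_left sum_subtractf)
    then show "norm (x - g) \<le> (\<Sum>b\<in>B. norm b)"
      by (auto intro!: order_trans[OF norm_sum] sum_mono simp: frac_ge_0 mult_left_le_one_le less_imp_le[OF frac_lt_1])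
  qed
  then show ?thesis by blast
qed

text \<open>By density the translates of \<open>U\<close> by projected lattice points cover
  \<open>E\<close>, and finitely many of them cover a ball, so bounded corrections suffice.\<close>

lemma hit_bounded:
  assumes U: "open U" "p0 \<in> U" "p0 \<in> E"
  shows "\<exists>R>0. \<forall>p\<in>E. norm p \<le> K \<longrightarrow> (\<exists>\<gamma>\<in>\<Gamma>. norm (pv \<gamma>) \<le> R \<and> p + pin \<gamma> \<in> U)"
proof -
  have comp: "compact (E \<inter> cball 0 K)"
    by (intro closed_Int_compact closed_subspace subE) simp
  define O' where "O' = (\<lambda>\<gamma>. (\<lambda>p. p + pin \<gamma>) -` U)"
  have op: "open (O' \<gamma>)" for \<gamma>
    unfolding O'_def by (intro continuous_open_vimage U) (auto intro!: continuous_intros)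
  have cover: "E \<inter> cball 0 K \<subseteq> (\<Union>\<gamma>\<in>\<Gamma>. O' \<gamma>)"
  proof
    fix p assume p: "p \<in> E \<inter> cball 0 K"
    have "open ((\<lambda>q. p + q) -` U)"
      by (intro continuous_open_vimage U) (auto intro!: continuous_intros)
    then obtain \<gamma> where "\<gamma> \<in> \<Gamma>" "p + pin \<gamma> \<in> U"
      using dense[of "(\<lambda>q. p + q) -` U" "p0 - p"] U p subspace_diff[OF subE] by auto
    then show "p \<in> (\<Union>\<gamma>\<in>\<Gamma>. O' \<gamma>)" by (auto simp: O'_def)
  qed
  obtain C' where C': "C' \<subseteq> \<Gamma>" "finite C'" "E \<inter> cball 0 K \<subseteq> (\<Union>\<gamma>\<in>C'. O' \<gamma>)"
    using compactE_image[OF comp, of \<Gamma> O'] op cover by metis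
  define R where "R = 1 + (\<Sum>\<gamma>\<in>C'. norm (pv \<gamma>))"
  have "norm (pv \<gamma>) \<le> R" if "\<gamma> \<in> C'" for \<gamma>
    using member_le_sum[of \<gamma> C' "\<lambda>\<gamma>. norm (pv \<gamma>)"] that C'(2) by (simp add: R_def)
  moreover have "R > 0" unfolding R_def by (smt (verit) sum_nonneg norm_ge_zero)
  moreover have "\<exists>\<gamma>\<in>C'. p + pin \<gamma> \<in> U" if p: "p \<in> E" "norm p \<le> K" for p
  proof -
    have "p \<in> (\<Union>\<gamma>\<in>C'. O' \<gamma>)" using C'(3) p by auto
    then show ?thesis by (simp add: O'_def)
  qed
  ultimately show ?thesis
    using C'(1) by (intro exI[of _ R]) blast
qed

text \<open>Lattice points with internal part in \<open>U\<close> are relatively dense in the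
  physical space: take a lattice point near \<open>pv x\<close>, whose internal part is bounded, and
  correct it by \<open>hit_bounded\<close>.\<close>

lemma hit:
  assumes U: "open U" "p0 \<in> U" "p0 \<in> E"
  shows "\<exists>R>0. \<forall>x. \<exists>\<gamma>\<in>\<Gamma>. norm (pv \<gamma> - pv x) \<le> R \<and> pin \<gamma> \<in> U"
proof -
  obtain D where D: "\<And>x. \<exists>g\<in>\<Gamma>. norm (x - g) \<le> D" using lattice_cocompact by blast
  obtain C where C: "C \<ge> 1" "\<And>x. norm (pv x) \<le> C * norm x" "\<And>x. norm (pin x) \<le> C * norm x"
    using proj_bound by metis
  obtain R where R: "R > 0" "\<And>p. p \<in> E \<Longrightarrow> norm p \<le> C * D \<Longrightarrow> \<exists>\<gamma>\<in>\<Gamma>. norm (pv \<gamma>) \<le> R \<and> p + pin \<gamma> \<in> U"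
    using hit_bounded[OF U, of "C * D"] by blast
  have D0: "D \<ge> 0" using D[of 0] by (meson norm_ge_zero order_trans)
  have "\<exists>\<gamma>\<in>\<Gamma>. norm (pv \<gamma> - pv x) \<le> C * D + R \<and> pin \<gamma> \<in> U" for x
  proof -
    obtain g where g: "g \<in> \<Gamma>" "norm (pv x - g) \<le> D" using D by blast
    have le: "norm (pin (pv x - g)) \<le> C * D" "norm (pv (pv x - g)) \<le> C * D"
      using C(2)[of "pv x - g"] C(3)[of "pv x - g"] g(2) C(1) mult_left_mono[OF g(2), of C] by linarith+
    then have "norm (pin g) \<le> C * D" "norm (pv x - pv g) \<le> C * D" by (simp_all add: pin_diff pv_diff)
    then obtain \<gamma> where \<gamma>: "\<gamma> \<in> \<Gamma>" "norm (pv \<gamma>) \<le> R" "pin g + pin \<gamma> \<in> U"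
      using R(2)[OF pin_in] by blast
    have "norm (pv (g + \<gamma>) - pv x) \<le> C * D + R"
      using norm_triangle_ineq4[of "pv \<gamma>" "pv x - pv g"] \<gamma>(2) \<open>norm (pv x - pv g) \<le> C * D\<close>
      by (simp add: pv_add algebra_simps)
    then show ?thesis using \<gamma> g(1) zsubspace_add[OF zsub] by (intro bexI[of _ "g + \<gamma>"]) (auto simp: pin_add)
  qed
  then show ?thesis using R(1) C(1) D0 by (intro exI[of _ "C * D + R"]) (auto intro!: add_nonneg_pos)
qed

subsection \<open>Polytopal sets\<close>

lemma polytopal_closed: "polytopal E A \<Longrightarrow> closed A"
  and polytopal_subset: "polytopal E A \<Longrightarrow> A \<subseteq> E"
  and polytopal_compact: "polytopal E A \<Longrightarrow> compact A"
  by (auto simp: polytopal_def compact_imp_closed)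

lemma interior_of_ball:
  assumes "x \<in> top_of_set E interior_of A"
  shows "\<exists>d>0. \<forall>y\<in>E. norm (y - x) < d \<longrightarrow> y \<in> A"
proof -
  obtain T where T: "openin (top_of_set E) T" "x \<in> T" "T \<subseteq> A"
    using assms by (auto simp: interior_of_def)
  then obtain d where d: "d > 0" "ball x d \<inter> E \<subseteq> T"
    by (auto simp: openin_contains_ball)
  have "y \<in> A" if "y \<in> E" "norm (y - x) < d" for y
  proof -
    have "y \<in> ball x d \<inter> E" using that by (simp add: dist_norm norm_minus_commute)
    then show ?thesis using d(2) T(3) by blast
  qed
  then show ?thesis using d(1) by blast
qed

lemma off_frontier_ball:
  assumes "A \<subseteq> E" "x \<in> A" "x \<notin> top_of_set E frontier_of A"
  shows "\<exists>d>0. \<forall>y\<in>E. norm (y - x) < d \<longrightarrow> y \<in> A"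
proof -
  have "A \<subseteq> top_of_set E closure_of A" using assms(1) by (intro closure_of_subset) auto
  then have "x \<in> top_of_set E interior_of A" using assms by (auto simp: frontier_of_def)
  then show ?thesis by (rule interior_of_ball)
qed

lemma outside_ball:
  fixes A :: "'a set"
  assumes "closed A" "x \<notin> A"
  shows "\<exists>d>0. \<forall>y. norm (y - x) < d \<longrightarrow> y \<notin> A"
proof -
  obtain d where d: "d > 0" "ball x d \<subseteq> - A"
    using assms open_contains_ball[of "- A"] by (auto simp: open_Compl)
  have "y \<notin> A" if "norm (y - x) < d" for y
  proof -
    have "y \<in> ball x d" using that by (simp add: dist_norm norm_minus_commute)
    then show ?thesis using d(2) by blast
  qed
  then show ?thesis using d(1) by blast
qed

lemma polytopal_interior_near:
  assumes "polytopal E A" "x \<in> A" "e > 0"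
  shows "\<exists>y d. y \<in> A \<and> norm (y - x) < e \<and> d > 0 \<and> (\<forall>z\<in>E. norm (z - y) < d \<longrightarrow> z \<in> A)"
proof -
  have "A = top_of_set E closure_of (top_of_set E interior_of A)"
    using assms(1) by (auto simp: polytopal_def)
  then have "x \<in> top_of_set E closure_of (top_of_set E interior_of A)" using assms(2) by simp
  moreover have "openin (top_of_set E) (E \<inter> ball x e)" "x \<in> E \<inter> ball x e"
    using assms polytopal_subset by (auto simp: openin_open)
  ultimately obtain y where y: "y \<in> top_of_set E interior_of A" "y \<in> E \<inter> ball x e"
    unfolding in_closure_of by blast
  have "y \<in> A" using y(1) interior_of_subset[of "top_of_set E" A] by blast
  moreover have "norm (y - x) < e" using y(2) by (simp add: dist_norm norm_minus_commute)
  ultimately show ?thesis using interior_of_ball[OF y(1)] by blast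
qed

lemma connected_no_frontier:
  assumes "connected T" "T \<subseteq> E" "T \<inter> top_of_set E frontier_of A = {}" "x \<in> T" "y \<in> T"
  shows "x \<in> A \<longleftrightarrow> y \<in> A"
proof -
  have "connectedin (top_of_set E) T"
    using assms(1,2) by (simp add: connectedin_subtopology)
  then show ?thesis
    using connectedin_Int_frontier_of[of "top_of_set E" T A] assms by blast
qed

subsection \<open>Supporting hyperplanes\<close>

lemma proportional_normals:
  assumes "a \<in> E" "a' \<in> E" "a \<noteq> 0" "a' \<noteq> 0" "\<And>x. x \<in> E \<Longrightarrow> a' \<bullet> x = 0 \<Longrightarrow> a \<bullet> x = 0"
  obtains l where "l \<noteq> 0" "a = l *\<^sub>R a'"
proof -
  define l where "l = (a \<bullet> a') / (a' \<bullet> a')"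
  define u where "u = a - l *\<^sub>R a'"
  have u: "u \<in> E" unfolding u_def using assms subE by (simp add: subspace_diff subspace_scale)
  have "a' \<bullet> u = 0" using assms(4) by (simp add: u_def l_def inner_simps inner_commute)
  then have "a \<bullet> u = 0" using assms(5) u by blast
  then have "u \<bullet> u = 0" using \<open>a' \<bullet> u = 0\<close> by (simp add: u_def inner_diff_left)
  then have "a = l *\<^sub>R a'" by (simp add: u_def)
  then show ?thesis using that assms(3) by fastforce
qed

lemma direction_hyperplane:
  assumes "a \<in> E" "a \<noteq> 0" "H = {x \<in> E. a \<bullet> x = b}"
  shows "direction H = {x \<in> E. a \<bullet> x = 0}"
proof (intro equalityI subsetI)
  fix x assume "x \<in> direction H"
  then show "x \<in> {x \<in> E. a \<bullet> x = 0}"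
    using assms(3) subspace_diff[OF subE] by (auto simp: direction_def inner_diff_right)
next
  fix x assume x: "x \<in> {x \<in> E. a \<bullet> x = 0}"
  define w where "w = (b / (a \<bullet> a)) *\<^sub>R a"
  have w: "w \<in> E" "a \<bullet> w = b" using assms subspace_scale[OF subE] by (auto simp: w_def)
  then have "x + w \<in> H" "w \<in> H"
    using x assms(3) subspace_add[OF subE] by (auto simp: inner_add_right)
  then show "x \<in> direction H" unfolding direction_def by force
qed

lemma properly_supporting_form:
  assumes "properly_supporting E A H"
  obtains a b w d where "a \<in> E" "a \<noteq> 0" "H = {x \<in> E. a \<bullet> x = b}" "w \<in> E" "a \<bullet> w = b" "d > 0"
    "\<forall>x\<in>E. norm (x - w) < d \<longrightarrow> (x \<in> A \<longleftrightarrow> a \<bullet> x \<le> b)"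
proof -
  obtain Hp w U where h: "halfspace_of E H Hp" "w \<in> H" "openin (top_of_set E) U" "w \<in> U" "A \<inter> U = Hp \<inter> U"
    using assms by (auto simp: properly_supporting_def)
  obtain a b where ab: "a \<in> E" "a \<noteq> 0" "H = {x \<in> E. a \<bullet> x = b}" "Hp = {x \<in> E. a \<bullet> x \<le> b}"
    using h(1) by (auto simp: halfspace_of_def)
  obtain d where d: "d > 0" "ball w d \<inter> E \<subseteq> U" using h(3,4) by (auto simp: openin_contains_ball)
  have "x \<in> A \<longleftrightarrow> a \<bullet> x \<le> b" if x: "x \<in> E" "norm (x - w) < d" for x
  proof -
    have "x \<in> ball w d \<inter> E" using x by (simp add: dist_norm norm_minus_commute)
    then have "x \<in> U" using d(2) by blast
    then show ?thesis using h(5) ab(4) x(1) by blast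
  qed
  then show ?thesis using that ab h(2) d(1) by auto
qed

definition nv :: "'a set \<Rightarrow> 'a" where
  "nv V = (SOME a. a \<in> E \<and> a \<noteq> 0 \<and> V = {x \<in> E. a \<bullet> x = 0})"

text \<open>Composing with \<open>pin\<close> makes this a functional on the total space, which can
  be combined with physical coordinates in counting lattice points.\<close>

definition fl :: "'a set \<Rightarrow> 'a \<Rightarrow> real" where
  "fl V x = nv V \<bullet> pin x"

lemma hyperplane_direction:
  assumes "H \<in> hyperplanes S"
  shows "direction H \<in> directions S"
  using assms by (auto simp: directions_def)

lemma nv_props:
  assumes "V \<in> directions S"
  shows "nv V \<in> E" "nv V \<noteq> 0" "V = {x \<in> E. nv V \<bullet> x = 0}"
proof -
  obtain H i where "i \<in> labels S" "properly_supporting E (piece S i) H" "V = direction H"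
    using assms by (auto simp: directions_def hyperplanes_def)
  moreover obtain a b where "a \<in> E" "a \<noteq> 0" "H = {x \<in> E. a \<bullet> x = b}"
    using properly_supporting_form[OF \<open>properly_supporting E (piece S i) H\<close>] by blast
  ultimately have "\<exists>a. a \<in> E \<and> a \<noteq> 0 \<and> V = {x \<in> E. a \<bullet> x = 0}"
    using direction_hyperplane by blast
  then have "nv V \<in> E \<and> nv V \<noteq> 0 \<and> V = {x \<in> E. nv V \<bullet> x = 0}"
    unfolding nv_def by (rule someI_ex)
  then show "nv V \<in> E" "nv V \<noteq> 0" "V = {x \<in> E. nv V \<bullet> x = 0}" by auto
qed

lemma linear_fl: "linear (fl V)"
  by (auto simp: linear_iff fl_def pin_add pin_scale inner_simps)

lemma fl_add: "fl V (x + y) = fl V x + fl V y" and fl_diff: "fl V (x - y) = fl V x - fl V y"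
  and fl_scale: "fl V (c *\<^sub>R x) = c * fl V x" and fl_0 [simp]: "fl V 0 = 0" and fl_minus: "fl V (- x) = - fl V x"
  and fl_sum: "fl V (sum f A) = (\<Sum>a\<in>A. fl V (f a))"
  using linear_fl[of V] by (auto simp: linear_add linear_diff linear_cmul linear_0 linear_neg linear_sum)

lemma fl_pin [simp]: "fl V (pin x) = fl V x"
  by (simp add: fl_def)

lemma nv_mem: "V \<in> directions S \<Longrightarrow> x \<in> V \<longleftrightarrow> x \<in> E \<and> nv V \<bullet> x = 0"
  by (subst nv_props(3)) auto

lemma fl_E: "x \<in> E \<Longrightarrow> fl V x = nv V \<bullet> x"
  by (simp add: fl_def pin_E)

lemma nv_inj: "V \<in> directions S \<Longrightarrow> V' \<in> directions S \<Longrightarrow> nv V = nv V' \<Longrightarrow> V = V'"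
  by (auto simp: set_eq_iff nv_mem)

lemma in_direction_iff: "V \<in> directions S \<Longrightarrow> pin x \<in> V \<longleftrightarrow> fl V x = 0"
  by (simp add: nv_mem pin_in fl_def)

lemma stab_eq: "T \<subseteq> directions S \<Longrightarrow> stab S T = {\<gamma> \<in> \<Gamma>. \<forall>V\<in>T. fl V \<gamma> = 0}"
  unfolding stab_def by (auto simp: in_direction_iff subset_iff)

lemma common_space_eq: "T \<subseteq> directions S \<Longrightarrow> common_space S T = {x \<in> E. \<forall>V\<in>T. nv V \<bullet> x = 0}"
  unfolding common_space_def by (auto simp: nv_mem subset_iff)

lemma stab_zsub: "T \<subseteq> directions S \<Longrightarrow> zmod.subspace (stab S T)"
  unfolding stab_eq zmod.subspace_def
  using zsub by (auto simp: zmod.subspace_def fl_add fl_scale)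

lemma stab_subset: "stab S T \<subseteq> \<Gamma>"
  by (auto simp: stab_def)

text \<open>One normal vector is fixed for each direction, so the sign of \<open>l\<close> records
  on which side of \<open>H\<close> the piece lies near \<open>w\<close>.\<close>

lemma hyperplane_form:
  assumes "H \<in> hyperplanes S"
  obtains i l b w d where "i \<in> labels S" "l \<noteq> 0" "w \<in> E" "nv (direction H) \<bullet> w = b"
    "\<forall>x. x \<in> H \<longleftrightarrow> x \<in> E \<and> nv (direction H) \<bullet> x = b" "d > 0"
    "\<forall>x\<in>E. norm (x - w) < d \<longrightarrow> (x \<in> piece S i \<longleftrightarrow> l * (nv (direction H) \<bullet> x - b) \<le> 0)"
proof -
  obtain i where i: "i \<in> labels S" "properly_supporting E (piece S i) H"
    using assms by (auto simp: hyperplanes_def)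
  obtain a b w d where ab: "a \<in> E" "a \<noteq> 0" "H = {x \<in> E. a \<bullet> x = b}" "w \<in> E" "a \<bullet> w = b" "d > 0"
    "\<forall>x\<in>E. norm (x - w) < d \<longrightarrow> (x \<in> piece S i \<longleftrightarrow> a \<bullet> x \<le> b)"
    by (rule properly_supporting_form[OF i(2)])
  let ?n = "nv (direction H)"
  have V: "direction H \<in> directions S" by (rule hyperplane_direction[OF assms])
  note n = nv_props[OF V]
  have "{x \<in> E. ?n \<bullet> x = 0} = direction H" by (rule n(3)[symmetric])
  also have "\<dots> = {x \<in> E. a \<bullet> x = 0}" by (rule direction_hyperplane[OF ab(1-3)])
  finally have "a \<bullet> x = 0" if "x \<in> E" "?n \<bullet> x = 0" for x using that by blast
  then obtain l where l: "l \<noteq> 0" "a = l *\<^sub>R ?n"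
    using proportional_normals[OF ab(1) n(1) ab(2) n(2)] by blast
  have ax: "a \<bullet> x - b = l * (?n \<bullet> x - ?n \<bullet> w)" for x
    using l(2) ab(5) by (simp add: right_diff_distrib)
  have iff: "a \<bullet> x = b \<longleftrightarrow> ?n \<bullet> x = ?n \<bullet> w" for x
  proof -
    have "a \<bullet> x = b \<longleftrightarrow> a \<bullet> x - b = 0" by simp
    also have "\<dots> \<longleftrightarrow> ?n \<bullet> x = ?n \<bullet> w" unfolding ax using l(1) by simp
    finally show ?thesis .
  qed
  have H: "\<forall>x. x \<in> H \<longleftrightarrow> x \<in> E \<and> ?n \<bullet> x = ?n \<bullet> w"
    using arg_cong[OF ab(3), of "\<lambda>H. x \<in> H" for x] by (simp add: iff)
  have fin: "\<forall>x\<in>E. norm (x - w) < d \<longrightarrow> (x \<in> piece S i \<longleftrightarrow> l * (?n \<bullet> x - ?n \<bullet> w) \<le> 0)"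
  proof (intro ballI impI)
    fix x assume x: "x \<in> E" "norm (x - w) < d"
    have "a \<bullet> x \<le> b \<longleftrightarrow> a \<bullet> x - b \<le> 0" by simp
    then show "x \<in> piece S i \<longleftrightarrow> l * (?n \<bullet> x - ?n \<bullet> w) \<le> 0"
      unfolding ax using ab(7)[rule_format, OF x] by (rule trans[rotated])
  qed
  show ?thesis
    by (rule that[OF i(1) l(1) ab(4) refl H ab(6) fin])
qed

lemma hyperplane_value:
  assumes "H \<in> hyperplanes S"
  shows "\<exists>b. \<forall>x. x \<in> H \<longleftrightarrow> x \<in> E \<and> nv (direction H) \<bullet> x = b"
  using hyperplane_form[OF assms] by blast

lemma frontier_in_hyperplanes:
  assumes "i \<in> labels S"
  shows "top_of_set E frontier_of (piece S i) \<subseteq> \<Union>(hyperplanes S)"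
  using piece_polytopal[OF assms] assms unfolding polytopal_def hyperplanes_def by fast

text \<open>If \<open>H\<close> is not in the cover, a point of \<open>H\<close> near
  \<open>w\<close> avoids all its members and thus the frontier. Being in \<open>A\<close>, it is an
  interior point, although near it \<open>A\<close> is only a half-space bounded by
  \<open>H\<close>.\<close>

lemma supporting_hyperplane_in_cover:
  assumes A: "polytopal E A" and H: "properly_supporting E A H"
    and \<H>: "finite \<H>" "\<And>H'. H' \<in> \<H> \<Longrightarrow> properly_supporting E A H'"
      "top_of_set E frontier_of A \<subseteq> \<Union>\<H>"
  shows "H \<in> \<H>"
proof (rule ccontr)
  assume notin: "H \<notin> \<H>"
  obtain a b w d where ab: "a \<in> E" "a \<noteq> 0" "H = {x \<in> E. a \<bullet> x = b}" "w \<in> E" "a \<bullet> w = b" "d > 0"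
    "\<forall>x\<in>E. norm (x - w) < d \<longrightarrow> (x \<in> A \<longleftrightarrow> a \<bullet> x \<le> b)"
    by (rule properly_supporting_form[OF H])
  have "\<exists>p. fst p \<in> E \<and> fst p \<noteq> 0 \<and> (\<forall>x. x \<in> H' \<longleftrightarrow> x \<in> E \<and> fst p \<bullet> x = snd p)" if H': "H' \<in> \<H>" for H'
  proof -
    obtain a' b' where "a' \<in> E" "a' \<noteq> 0" "H' = {x \<in> E. a' \<bullet> x = b'}"
      using properly_supporting_form[OF \<H>(2)[OF H']] by blast
    then show ?thesis by (intro exI[of _ "(a', b')"]) auto
  qed
  then obtain p where p: "\<And>H'. H' \<in> \<H> \<Longrightarrow> fst (p H') \<in> E \<and> fst (p H') \<noteq> 0 \<and> (\<forall>x. x \<in> H' \<longleftrightarrow> x \<in> E \<and> fst (p H') \<bullet> x = snd (p H'))"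
    by metis
  define V where "V = {x \<in> E. a \<bullet> x = 0}"
  have V: "subspace V" unfolding V_def using subE by (auto simp: subspace_def inner_simps)
  have "\<exists>v\<in>V. norm v < d \<and> (\<forall>(a', b')\<in>p ` \<H>. a' \<bullet> (w + v) \<noteq> b')"
  proof (rule generic_point_exists[OF V _ _ ab(6)])
    fix a' b' assume "(a', b') \<in> p ` \<H>"
    then obtain H' where H': "H' \<in> \<H>" "p H' = (a', b')" by force
    have a': "a' \<in> E" "a' \<noteq> 0" "\<And>x. x \<in> H' \<longleftrightarrow> x \<in> E \<and> a' \<bullet> x = b'" using p[OF H'(1)] H'(2) by auto
    show "\<exists>v\<in>V. a' \<bullet> (w + v) \<noteq> b'"
    proof (rule ccontr)
      assume "\<not> ?thesis"
      then have all: "a' \<bullet> (w + v) = b'" if "v \<in> V" for v using that by blast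
      have w': "a' \<bullet> w = b'" using all[of 0] subspace_0[OF V] by simp
      then have "a' \<bullet> x = 0" if "x \<in> E" "a \<bullet> x = 0" for x
        using all[of x] that by (simp add: V_def inner_add_right)
      then obtain l where l: "l \<noteq> 0" "a' = l *\<^sub>R a"
        using proportional_normals[OF a'(1) ab(1) a'(2) ab(2)] by blast
      have "H' = H" using l w' ab(5) by (auto simp: set_eq_iff a'(3) ab(3))
      then show False using H'(1) notin by simp
    qed
  qed (use \<H>(1) in auto)
  then obtain v where v: "v \<in> V" "norm v < d" "\<And>H'. H' \<in> \<H> \<Longrightarrow> fst (p H') \<bullet> (w + v) \<noteq> snd (p H')"
    by fastforce
  define x where "x = w + v"
  have x: "x \<in> E" "a \<bullet> x = b" "norm (x - w) < d"
    using v ab subspace_add[OF subE] by (auto simp: x_def V_def inner_add_right)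
  have xA: "x \<in> A" using ab(7)[rule_format, OF x(1,3)] x(2) by simp
  have "x \<notin> \<Union>\<H>"
  proof
    assume "x \<in> \<Union>\<H>"
    then obtain H' where H': "H' \<in> \<H>" "x \<in> H'" by blast
    then show False using v(3)[OF H'(1)] p[OF H'(1)] by (auto simp: x_def)
  qed
  then have "x \<notin> top_of_set E frontier_of A" using \<H>(3) by blast
  then obtain e where e: "e > 0" "\<And>y. y \<in> E \<Longrightarrow> norm (y - x) < e \<Longrightarrow> y \<in> A"
    using off_frontier_ball[OF polytopal_subset[OF A] xA] by blast
  define m where "m = min e (d - norm (x - w))"
  have m: "m > 0" "m \<le> e" "m \<le> d - norm (x - w)" using e(1) x(3) by (auto simp: m_def)
  \<comment> \<open>A step of length \<open>m / 2\<close> along the outer normal: short enough to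
    stay inside \<open>A\<close> by interiority and inside the ball about \<open>w\<close> where
    \<open>A\<close> is a half-space.\<close>
  define y where "y = x + (m / (2 * norm a)) *\<^sub>R a"
  have nyx: "norm (y - x) = m / 2" using ab(2) m by (simp add: y_def)
  have yE: "y \<in> E" using x(1) ab(1) by (simp add: y_def subspace_add subspace_scale subE)
  have "y \<in> A" using e(2)[OF yE] nyx m by linarith
  moreover have "norm (y - w) < d"
    using norm_triangle_ineq[of "y - x" "x - w"] nyx m by simp
  ultimately have "a \<bullet> y \<le> b" using ab(7)[rule_format, OF yE] by blast
  moreover have "a \<bullet> y = b + (m / (2 * norm a)) * (a \<bullet> a)" using x(2) by (simp add: y_def inner_add_right)
  moreover have "(m / (2 * norm a)) * (a \<bullet> a) > 0" using m ab(2) by simp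
  ultimately show False by linarith
qed

lemma finite_hyperplanes: "finite (hyperplanes S)"
proof -
  have "finite {H. properly_supporting E (piece S i) H}" if i: "i \<in> labels S" for i
  proof -
    obtain \<H> where \<H>: "finite \<H>" "\<And>H'. H' \<in> \<H> \<Longrightarrow> properly_supporting E (piece S i) H'"
      "top_of_set E frontier_of (piece S i) \<subseteq> \<Union>\<H>"
      using piece_polytopal[OF i] unfolding polytopal_def by blast
    have "{H. properly_supporting E (piece S i) H} \<subseteq> \<H>"
      using supporting_hyperplane_in_cover[OF piece_polytopal[OF i] _ \<H>] by blast
    then show ?thesis using \<H>(1) finite_subset by blast
  qed
  moreover have "hyperplanes S = (\<Union>i\<in>labels S. {H. properly_supporting E (piece S i) H})"
    by (auto simp: hyperplanes_def)
  ultimately show ?thesis using finite_labels by simp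
qed

lemma finite_directions: "finite (directions S)"
  using finite_hyperplanes by (simp add: directions_def)

text \<open>A line in direction \<open>u\<close> is parallel to every hyperplane. Through a generic
  interior point of a piece it avoids all of them, so it never meets the frontier and stays in the
  piece, against boundedness.\<close>

lemma directions_separate:
  assumes u: "u \<in> E" "\<And>V. V \<in> directions S \<Longrightarrow> nv V \<bullet> u = 0"
  shows "u = 0"
proof (rule ccontr)
  assume "u \<noteq> 0"
  obtain w i where i: "i \<in> labels S" "w \<in> piece S i" using W_nonempty W_eq by blast
  note poly = piece_polytopal[OF i(1)]
  obtain y d where y: "y \<in> piece S i" "d > 0" "\<And>z. z \<in> E \<Longrightarrow> norm (z - y) < d \<Longrightarrow> z \<in> piece S i"
    using polytopal_interior_near[OF poly i(2), of 1] by auto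
  have yE: "y \<in> E" using y(1) polytopal_subset[OF poly] by auto
  define J where "J = {(nv (direction H), nv (direction H) \<bullet> w) |H w. H \<in> hyperplanes S \<and> w \<in> H}"
  have val: "nv (direction H) \<bullet> w = nv (direction H) \<bullet> w'" if "H \<in> hyperplanes S" "w \<in> H" "w' \<in> H" for H w w'
    using hyperplane_value[OF that(1)] that(2,3) by auto
  have "J \<subseteq> (\<lambda>H. (nv (direction H), nv (direction H) \<bullet> (SOME w. w \<in> H))) ` hyperplanes S"
  proof
    fix j assume "j \<in> J"
    then obtain H w where "j = (nv (direction H), nv (direction H) \<bullet> w)" "H \<in> hyperplanes S" "w \<in> H"
      by (auto simp: J_def)
    then show "j \<in> (\<lambda>H. (nv (direction H), nv (direction H) \<bullet> (SOME w. w \<in> H))) ` hyperplanes S"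
      using val[of H w "SOME w. w \<in> H"] someI[of "\<lambda>w. w \<in> H" w] by auto
  qed
  then have finJ: "finite J" using finite_hyperplanes finite_surj by blast
  have "\<exists>v\<in>E. norm v < d \<and> (\<forall>(a, b)\<in>J. a \<bullet> (y + v) \<noteq> b)"
  proof (rule generic_point_exists[OF subE finJ _ y(2)])
    fix a b assume "(a, b) \<in> J"
    then obtain H where H: "H \<in> hyperplanes S" "a = nv (direction H)" by (auto simp: J_def)
    have a: "a \<in> E" "a \<noteq> 0" using nv_props[OF hyperplane_direction[OF H(1)]] H(2) by auto
    show "\<exists>v\<in>E. a \<bullet> (y + v) \<noteq> b"
    proof (cases "a \<bullet> y = b")
      case True
      then show ?thesis using a by (intro bexI[of _ a]) (auto simp: inner_add_right)
    next
      case False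
      then show ?thesis using subspace_0[OF subE] by (intro bexI[of _ 0]) auto
    qed
  qed
  then obtain v where v: "v \<in> E" "norm v < d" "\<And>a b. (a, b) \<in> J \<Longrightarrow> a \<bullet> (y + v) \<noteq> b" by blast
  define q where "q = y + v"
  have q: "q \<in> E" "q \<in> piece S i"
    using y(3)[of q] v yE subspace_add[OF subE] by (auto simp: q_def)
  define T where "T = (\<lambda>t::real. q + t *\<^sub>R u) ` UNIV"
  have "connected T" unfolding T_def
    by (intro connected_continuous_image continuous_intros connected_UNIV)
  moreover have "T \<subseteq> E" unfolding T_def using q(1) u(1) subspace_add[OF subE] subspace_scale[OF subE] by auto
  moreover have "T \<inter> top_of_set E frontier_of (piece S i) = {}"
  proof -
    have False if "q + t *\<^sub>R u \<in> H" "H \<in> hyperplanes S" for t H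
    proof -
      have "(nv (direction H), nv (direction H) \<bullet> (q + t *\<^sub>R u)) \<in> J" using that by (auto simp: J_def)
      from v(3)[OF this] show False
        using u(2)[OF hyperplane_direction[OF that(2)]] by (simp add: q_def inner_add_right)
    qed
    then have "x \<notin> \<Union>(hyperplanes S)" if "x \<in> T" for x using that by (auto simp: T_def)
    then show ?thesis using frontier_in_hyperplanes[OF i(1)] by blast
  qed
  moreover have "q \<in> T" unfolding T_def by (rule image_eqI[of _ _ 0]) auto
  ultimately have sub: "T \<subseteq> piece S i" using connected_no_frontier q(2) by blast
  obtain B where B: "\<And>x. x \<in> piece S i \<Longrightarrow> norm x \<le> B"
    using compact_imp_bounded[OF polytopal_compact[OF poly]] by (auto simp: bounded_iff)
  define t where "t = (B + norm q + 1) / norm u"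
  have "norm q \<le> B" using B q(2) by blast
  then have tn: "norm (t *\<^sub>R u) = B + norm q + 1" using \<open>u \<noteq> 0\<close> by (simp add: t_def) (smt (verit) norm_ge_zero)
  have "norm (q + t *\<^sub>R u) \<le> B" using sub B by (auto simp: T_def)
  then show False using tn norm_triangle_ineq4[of "q + t *\<^sub>R u" q] by simp
qed

section \<open>Flags and ranks\<close>


definition flag :: "'a set set \<Rightarrow> bool" where
  "flag f \<longleftrightarrow> f \<subseteq> directions S \<and> independent (nv ` f) \<and> span (nv ` f) = E"

text \<open>The real dimension stands for the rank of the stabiliser, and the subtraction does not
  truncate (\<open>sv_dim\<close>).\<close>

definition sv :: "'a set \<Rightarrow> nat" where
  "sv V = DIM('a) - dim (stab S {V})"

lemma nv_inj_on: "f \<subseteq> directions S \<Longrightarrow> inj_on nv f"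
  using nv_inj by (auto simp: inj_on_def)

lemma flag_sub: "flag f \<Longrightarrow> f \<subseteq> directions S"
  by (simp add: flag_def)

lemma flag_finite: "flag f \<Longrightarrow> finite f"
  using flag_sub finite_directions finite_subset by blast

lemma flag_card: "flag f \<Longrightarrow> card f = dim E"
proof -
  assume f: "flag f"
  then have "card f = card (nv ` f)" using card_image[OF nv_inj_on] by (simp add: flag_def)
  also have "\<dots> = dim E" using f basis_card_eq_dim[of "nv ` f" E] real_vector.span_superset[of "nv ` f"]
    by (simp add: flag_def)
  finally show ?thesis .
qed

lemma flag_separates:
  assumes "flag f" "x \<in> E" "\<And>V. V \<in> f \<Longrightarrow> nv V \<bullet> x = 0"
  shows "x = 0"
proof -
  have "subspace {y. y \<bullet> x = 0}" by (auto simp: subspace_def inner_simps)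
  then have "span (nv ` f) \<subseteq> {y. y \<bullet> x = 0}" using assms(3) by (intro real_vector.span_minimal) auto
  then have "x \<bullet> x = 0" using assms(1,2) by (auto simp: flag_def)
  then show ?thesis by simp
qed

lemma flag_fl_zero: "flag f \<Longrightarrow> \<gamma> \<in> \<Gamma> \<Longrightarrow> (\<And>V. V \<in> f \<Longrightarrow> fl V \<gamma> = 0) \<Longrightarrow> \<gamma> = 0"
  using flag_separates[of f "pin \<gamma>"] pin_in pin_0D by (simp add: fl_def)

text \<open>By separation the normals of \<open>D\<close> span \<open>E\<close>, and an independent
  set extends to a basis within a spanning set. Besides flags through one direction, this yields
  flags among the hyperplanes that meet in a vertex.\<close>

lemma flag_extension:
  assumes T: "T \<subseteq> D" "D \<subseteq> directions S" "independent (nv ` T)"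
    and sep: "\<And>x. x \<in> E \<Longrightarrow> (\<And>V. V \<in> D \<Longrightarrow> nv V \<bullet> x = 0) \<Longrightarrow> x = 0"
  shows "\<exists>f. flag f \<and> T \<subseteq> f \<and> f \<subseteq> D"
proof -
  have DE: "nv ` D \<subseteq> E" using T(2) nv_props(1) by auto
  have spanE: "span E = E" using subE by simp
  have spanD: "span (nv ` D) = E"
  proof (rule ccontr)
    assume "span (nv ` D) \<noteq> E"
    moreover have "span (nv ` D) \<subseteq> E" using DE subE by (rule real_vector.span_minimal)
    ultimately have "span (nv ` D) \<subset> span E" unfolding spanE by auto
    then obtain x where x: "x \<noteq> 0" "x \<in> span E" "\<And>y. y \<in> span (nv ` D) \<Longrightarrow> orthogonal x y"
      using orthogonal_to_subspace_exists_gen by metis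
    have "x \<in> E" using x(2) unfolding spanE .
    moreover have "nv V \<bullet> x = 0" if "V \<in> D" for V
      using x(3)[of "nv V"] that by (simp add: real_vector.span_base orthogonal_def inner_commute)
    ultimately show False using sep x(1) by blast
  qed
  obtain B where B: "nv ` T \<subseteq> B" "B \<subseteq> nv ` D" "independent B" "nv ` D \<subseteq> span B"
    using maximal_independent_subset_extend[of "nv ` T" "nv ` D"] T by blast
  define f where "f = {V \<in> D. nv V \<in> B}"
  have fB: "nv ` f = B" using B(2) by (auto simp: f_def)
  have "span B = E"
  proof
    show "span B \<subseteq> E" using B(2) DE subE by (intro real_vector.span_minimal) auto
    show "E \<subseteq> span B" unfolding spanD[symmetric] using B(4) by (intro real_vector.span_minimal) auto
  qed
  then have "flag f" unfolding flag_def fB using B(3) T(2) by (auto simp: f_def)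
  then show ?thesis using T(1) B(1) by (intro exI[of _ f]) (auto simp: f_def)
qed

lemma flag_containing:
  assumes "V \<in> directions S"
  shows "\<exists>f. flag f \<and> V \<in> f"
  using flag_extension[of "{V}" "directions S"] assms directions_separate nv_props(2)[OF assms] by auto

lemma flag_exists: "\<exists>f. flag f"
  using flag_extension[of "{}" "directions S"] directions_separate real_vector.independent_empty by auto

lemma flag_nonempty: "flag f \<Longrightarrow> f \<noteq> {}"
  by (metis flag_card card.empty dimE not_one_le_zero)

lemma flag_norm_bound:
  assumes "flag f"
  obtains C where "C > 0" "\<And>x t. t \<ge> 0 \<Longrightarrow> (\<And>V. V \<in> f \<Longrightarrow> \<bar>fl V x\<bar> \<le> t) \<Longrightarrow> norm (pin x) \<le> C * t"
proof -
  have "\<exists>C>0. \<forall>x\<in>E. \<forall>t\<ge>0. (\<forall>V\<in>f. \<bar>fl V x\<bar> \<le> t) \<longrightarrow> norm x \<le> C * t"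
    by (rule linear_family_bound[OF flag_finite[OF assms] linear_fl subE])
      (use flag_separates[OF assms] in \<open>auto simp: fl_E\<close>)
  then obtain C where C: "C > 0" "\<forall>x\<in>E. \<forall>t\<ge>0. (\<forall>V\<in>f. \<bar>fl V x\<bar> \<le> t) \<longrightarrow> norm x \<le> C * t" by blast
  have "norm (pin x) \<le> C * t" if "t \<ge> 0" "\<And>V. V \<in> f \<Longrightarrow> \<bar>fl V x\<bar> \<le> t" for x t
    using C(2)[rule_format, of "pin x" t] that pin_in by auto
  then show ?thesis using that C(1) by blast
qed

lemma fl_bound:
  obtains C where "C > 0" "\<And>V x. V \<in> directions S \<Longrightarrow> \<bar>fl V x\<bar> \<le> C * norm (pin x)" "\<And>V x. V \<in> directions S \<Longrightarrow> \<bar>fl V x\<bar> \<le> C * norm x"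
proof -
  obtain A where A: "A \<ge> 1" "\<And>x. norm (pin x) \<le> A * norm x" using proj_bound by metis
  define N where "N = 1 + (\<Sum>V\<in>directions S. norm (nv V))"
  have N1: "N \<ge> 1" by (simp add: N_def sum_nonneg)
  have le: "\<bar>fl V x\<bar> \<le> N * norm (pin x)" if "V \<in> directions S" for V x
  proof -
    have "norm (nv V) \<le> N"
      unfolding N_def using member_le_sum[of V "directions S" "\<lambda>V. norm (nv V)"] that finite_directions by simp
    then have "norm (nv V) * norm (pin x) \<le> N * norm (pin x)" by (intro mult_right_mono) auto
    then show ?thesis unfolding fl_def using Cauchy_Schwarz_ineq2[of "nv V" "pin x"] by linarith
  qed
  have "\<bar>fl V x\<bar> \<le> (N * A) * norm (pin x)" "\<bar>fl V x\<bar> \<le> (N * A) * norm x" if "V \<in> directions S" for V x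
  proof -
    have "N * norm (pin x) \<le> N * (A * norm x)" using A(2)[of x] N1 by (intro mult_left_mono) auto
    then show "\<bar>fl V x\<bar> \<le> (N * A) * norm x" using le[OF that, of x] by (simp add: mult.assoc)
    have "N * 1 \<le> N * A" using A(1) N1 by (intro mult_left_mono) auto
    then have "N * norm (pin x) \<le> (N * A) * norm (pin x)" by (intro mult_right_mono) auto
    then show "\<bar>fl V x\<bar> \<le> (N * A) * norm (pin x)" using le[OF that, of x] by linarith
  qed
  moreover have "N * A > 0" using N1 A(1) by simp
  ultimately show ?thesis using that by blast
qed

lemma stab_flag: "flag f \<Longrightarrow> stab S f \<subseteq> {0}"
  using flag_fl_zero stab_eq[OF flag_sub] by auto

lemma stab_Un: "stab S (T \<union> T') = stab S T \<inter> stab S T'"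
  by (auto simp: stab_def)

lemma stab_empty: "stab S {} = \<Gamma>"
  by (auto simp: stab_def)

lemma dim_lattice: "dim \<Gamma> = DIM('a)"
  using spanG by (metis dim_UNIV dim_span)

lemma dim_stab_le: "dim (stab S T) \<le> DIM('a)"
  by (metis dim_UNIV dim_subset subset_UNIV)

lemma sv_dim: "sv V + dim (stab S {V}) = DIM('a)"
  using dim_stab_le[of "{V}"] by (simp add: sv_def)

text \<open>Coranks are subadditive: intersecting with one more stabiliser lowers the rank by at
  most \<open>sv V\<close>.\<close>

lemma codim_stab:
  assumes "T \<subseteq> directions S"
  shows "DIM('a) \<le> dim (stab S T) + (\<Sum>V\<in>T. sv V)"
proof -
  have "finite T" using assms finite_directions finite_subset by blast
  then show ?thesis using assms
  proof (induction T rule: finite_induct)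
    case empty
    then show ?case by (simp add: stab_empty dim_lattice)
  next
    case (insert V T)
    have z: "zmod.subspace (stab S {V})" "zmod.subspace (stab S T)" using insert.prems stab_zsub by auto
    have "dim (stab S {V}) + dim (stab S T) \<le> dim (stab S {V} \<inter> stab S T) + dim (stab S {V} \<union> stab S T)"
      by (rule dim_inter_subgroups[OF zsub disc stab_subset z(1) stab_subset z(2)])
    also have "dim (stab S {V} \<union> stab S T) \<le> DIM('a)"
      by (metis dim_UNIV dim_subset subset_UNIV)
    also have "stab S {V} \<inter> stab S T = stab S (insert V T)"
      using stab_Un[of "{V}" T] by simp
    finally have "dim (stab S {V}) + dim (stab S T) \<le> dim (stab S (insert V T)) + DIM('a)" by simp
    moreover have "DIM('a) \<le> dim (stab S T) + (\<Sum>V\<in>T. sv V)" using insert by auto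
    ultimately show ?case using insert(1,2) sv_dim[of V] by simp
  qed
qed

text \<open>A lattice point stabilised by a whole flag is 0, so the two stabilisers are independent,
  and both lie in the stabiliser of the common directions.\<close>

lemma stab_superadditive:
  assumes "flag f" "T1 \<union> T2 = f"
  shows "dim (stab S T1) + dim (stab S T2) \<le> dim (stab S (T1 \<inter> T2))"
proof (rule dim_superadditive[OF zsub disc stab_subset _ stab_subset])
  show "zmod.subspace (stab S T1)" "zmod.subspace (stab S T2)"
    using assms flag_sub by (auto intro!: stab_zsub)
  show "stab S T1 \<inter> stab S T2 \<subseteq> {0}"
    using stab_flag[OF assms(1)] unfolding stab_Un[symmetric] assms(2) .
qed (auto simp: stab_def)

section \<open>The intermediate condition and its consequences\<close>

definition full_rank :: bool where
  "full_rank \<longleftrightarrow> (\<forall>f. flag f \<longrightarrow> (\<Sum>V\<in>f. sv V) = DIM('a))"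

text \<open>\<open>fl V\<close> embeds the quotient of the lattice by the stabiliser, a group of
  rank \<open>sv V\<close>, in the reals; \<open>sv V - 1\<close> is the Dirichlet exponent of such
  a group. Truncation does not occur, by \<open>sv_pos\<close>.\<close>

definition badly_approximable :: "'a set \<Rightarrow> bool" where
  "badly_approximable V \<longleftrightarrow> (\<exists>c>0. \<forall>\<gamma>\<in>\<Gamma>. fl V \<gamma> \<noteq> 0 \<longrightarrow> c \<le> \<bar>fl V \<gamma>\<bar> * norm \<gamma> ^ (sv V - 1))"

text \<open>Subadditivity of coranks bounds the ranks for \<open>T\<close> and \<open>f - T\<close>
  from below by numbers with sum k, and superadditivity bounds the sum of these ranks by k, so
  equality holds in both.\<close>

lemma full_rank_dim:
  assumes "full_rank" "flag f" "T \<subseteq> f"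
  shows "dim (stab S T) = (\<Sum>V\<in>f - T. sv V)"
proof -
  have fin: "finite f" by (rule flag_finite[OF assms(2)])
  have sum: "(\<Sum>V\<in>f - T. sv V) + (\<Sum>V\<in>T. sv V) = DIM('a)"
    using assms sum.subset_diff[OF assms(3) fin, of sv] by (simp add: full_rank_def)
  have "DIM('a) \<le> dim (stab S T) + (\<Sum>V\<in>T. sv V)"
    "DIM('a) \<le> dim (stab S (f - T)) + (\<Sum>V\<in>f - T. sv V)"
    using assms flag_sub by (auto intro!: codim_stab)
  moreover have "dim (stab S T) + dim (stab S (f - T)) \<le> DIM('a)"
    using stab_superadditive[OF assms(2), of T "f - T"] assms(3) dim_stab_le order_trans by (metis Un_Diff_cancel sup.absorb2)
  ultimately show ?thesis using sum by linarith
qed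

text \<open>For \<open>V\<close> in \<open>f\<close> the stabiliser of \<open>f - {V}\<close>
  projects into the line on which the other functionals vanish, and it has rank \<open>sv V\<close>.
  These groups are independent with ranks adding up to k, so their bases span the space; a fixed
  multiple then gives integral coordinates, and linearity bounds the components.\<close>

lemma line_decomposition:
  assumes "full_rank" "flag f"
  obtains M :: nat and C :: real where "M > 0" "C > 0"
    "\<And>\<gamma>. \<gamma> \<in> \<Gamma> \<Longrightarrow> \<exists>h. (\<forall>V\<in>f. h V \<in> stab S (f - {V}) \<and> norm (h V) \<le> C * norm \<gamma>) \<and>
      real M *\<^sub>R \<gamma> = (\<Sum>V\<in>f. h V)"
proof -
  have fin: "finite f" by (rule flag_finite[OF assms(2)])
  have "\<exists>B. B \<subseteq> stab S (f - {V}) \<and> independent B \<and> card B = sv V" if "V \<in> f" for V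
  proof -
    obtain B where B: "B \<subseteq> stab S (f - {V})" "independent B" "card B = dim (stab S (f - {V}))"
      using basis_exists by metis
    have "f - (f - {V}) = {V}" using that by auto
    then have "dim (stab S (f - {V})) = sv V" using full_rank_dim[OF assms, of "f - {V}"] by simp
    then show ?thesis using B by auto
  qed
  then obtain B where B: "\<And>V. V \<in> f \<Longrightarrow> B V \<subseteq> stab S (f - {V}) \<and> independent (B V) \<and> card (B V) = sv V"
    by metis
  have finB: "finite (B V)" if "V \<in> f" for V using B[OF that] by (simp add: finiteI_independent)
  have fl0: "fl V' b = 0" if "V \<in> f" "V' \<in> f" "V' \<noteq> V" "b \<in> B V" for V V' b
  proof -
    have "b \<in> stab S (f - {V})" using B that by blast
    moreover have "f - {V} \<subseteq> directions S" using flag_sub[OF assms(2)] by blast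
    ultimately show ?thesis using that by (simp add: stab_eq)
  qed
  have BG: "B V \<subseteq> \<Gamma>" if "V \<in> f" for V using B[OF that] stab_subset by blast
  have disj: "B V \<inter> B V' = {}" if "V \<in> f" "V' \<in> f" "V \<noteq> V'" for V V'
  proof (rule ccontr)
    assume "B V \<inter> B V' \<noteq> {}"
    then obtain b where b: "b \<in> B V" "b \<in> B V'" by blast
    have "fl V'' b = 0" if "V'' \<in> f" for V''
      using fl0[OF \<open>V \<in> f\<close> that _ b(1)] fl0[OF \<open>V' \<in> f\<close> that _ b(2)] \<open>V \<noteq> V'\<close> by blast
    then have "b = 0" using flag_fl_zero[OF assms(2)] BG[OF that(1)] b(1) by blast
    then show False using B[OF that(1)] b(1) real_vector.dependent_zero by blast
  qed
  define U where "U = (\<Union>V\<in>f. B V)"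
  have finU: "finite U" using fin finB by (simp add: U_def)
  have UG: "U \<subseteq> \<Gamma>" using BG by (auto simp: U_def)
  have sumU: "(\<Sum>b\<in>U. g b) = (\<Sum>V\<in>f. \<Sum>b\<in>B V. g b)" for g :: "'a \<Rightarrow> 'a"
    unfolding U_def using fin finB disj by (intro sum.UNION_disjoint) auto
  have "zmod.independent U"
  proof
    assume "zmod.dependent U"
    then obtain u b0 where u: "(\<Sum>b\<in>U. of_int (u b) *\<^sub>R b) = 0" "b0 \<in> U" "u b0 \<noteq> (0::int)"
      using zmod.dependent_finite[OF finU] by auto
    obtain V0 where V0: "V0 \<in> f" "b0 \<in> B V0" using u(2) by (auto simp: U_def)
    define y where "y = (\<Sum>b\<in>B V0. of_int (u b) *\<^sub>R b)"
    have y: "y \<in> stab S (f - {V0})"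
      unfolding y_def using B[OF V0(1)] flag_sub[OF assms(2)]
      by (intro integral_combination_in stab_zsub) auto
    \<comment> \<open>Applying \<open>fl V0\<close> to the relation isolates block
      \<open>V0\<close>, because the other blocks lie in its kernel.\<close>
    have "fl V0 (\<Sum>b\<in>U. of_int (u b) *\<^sub>R b) = (\<Sum>V\<in>f. \<Sum>b\<in>B V. of_int (u b) * fl V0 b)"
      unfolding sumU by (simp add: fl_sum fl_scale)
    also have "\<dots> = (\<Sum>b\<in>B V0. of_int (u b) * fl V0 b)"
    proof -
      have "(\<Sum>b\<in>B V. of_int (u b) * fl V0 b) = 0" if "V \<in> f - {V0}" for V
        using fl0[of V V0] that V0(1) by (intro sum.neutral) auto
      then show ?thesis using sum.remove[OF fin V0(1), of "\<lambda>V. \<Sum>b\<in>B V. of_int (u b) * fl V0 b"] by simp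
    qed
    also have "\<dots> = fl V0 y" by (simp add: y_def fl_sum fl_scale)
    finally have "fl V0 y = 0" using u(1) by simp
    moreover have "fl V y = 0" if "V \<in> f" "V \<noteq> V0" for V
      using fl0[OF V0(1) that] by (simp add: y_def fl_sum fl_scale)
    ultimately have "y = 0" using flag_fl_zero[OF assms(2)] y stab_subset by blast
    then show False
      using real_vector.independentD[of "B V0" "B V0" "\<lambda>b. of_int (u b)" b0] B[OF V0(1)] finB[OF V0(1)] V0(2) u(3)
      by (simp add: y_def)
  qed
  then have ind: "independent U" using zindependent_imp_independent[OF zsub disc UG] by blast
  have "card U = (\<Sum>V\<in>f. card (B V))"
    unfolding U_def using fin finB disj by (intro card_UN_disjoint) auto
  also have "\<dots> = DIM('a)" using B assms by (simp add: full_rank_def)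
  finally have "UNIV \<subseteq> span U" using ind by (intro card_ge_dim_independent) auto
  then have span: "x \<in> span U" for x by auto
  obtain M :: nat where M: "M > 0" "\<forall>g\<in>\<Gamma> \<inter> span U. \<forall>b\<in>U. representation U (real M *\<^sub>R g) b \<in> \<int>"
    using integral_multiple_exists[OF zsub disc UG ind] by blast
  obtain C where C: "C > 0" "\<And>x b. x \<in> span U \<Longrightarrow> b \<in> U \<Longrightarrow> \<bar>representation U x b\<bar> \<le> C * norm x"
    using representation_bound[OF ind] by metis
  define D where "D = 1 + C * real M * (\<Sum>b\<in>U. norm b)"
  have D: "D > 0" unfolding D_def using C M(1) by (intro add_pos_nonneg mult_nonneg_nonneg sum_nonneg) auto
  show ?thesis
  proof (rule that[OF M(1) D])
    fix \<gamma> assume \<gamma>: "\<gamma> \<in> \<Gamma>"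
    define h where "h = (\<lambda>V. \<Sum>b\<in>B V. representation U (real M *\<^sub>R \<gamma>) b *\<^sub>R b)"
    have "h V \<in> stab S (f - {V})" if V: "V \<in> f" for V
      unfolding h_def
    proof (rule integral_combination_in)
      show "zmod.subspace (stab S (f - {V}))" using flag_sub[OF assms(2)] by (intro stab_zsub) auto
      show "B V \<subseteq> stab S (f - {V})" using B[OF V] by blast
      show "representation U (real M *\<^sub>R \<gamma>) b \<in> \<int>" if "b \<in> B V" for b
        using M(2) \<gamma> span that V by (auto simp: U_def)
    qed
    moreover have "norm (h V) \<le> D * norm \<gamma>" if V: "V \<in> f" for V
    proof -
      have "norm (h V) \<le> (\<Sum>b\<in>B V. norm (representation U (real M *\<^sub>R \<gamma>) b *\<^sub>R b))"
        unfolding h_def by (rule norm_sum)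
      also have "\<dots> \<le> (\<Sum>b\<in>U. norm (representation U (real M *\<^sub>R \<gamma>) b *\<^sub>R b))"
        using finU V by (intro sum_mono2) (auto simp: U_def)
      also have "\<dots> \<le> (\<Sum>b\<in>U. (C * (real M * norm \<gamma>)) * norm b)"
        using C(2)[OF span, of _ "real M *\<^sub>R \<gamma>"] by (intro sum_mono) (auto intro!: mult_right_mono)
      also have "\<dots> = (C * real M * (\<Sum>b\<in>U. norm b)) * norm \<gamma>"
        by (simp add: sum_distrib_left sum_distrib_right algebra_simps)
      also have "\<dots> \<le> D * norm \<gamma>" unfolding D_def by (intro mult_right_mono) auto
      finally show ?thesis .
    qed
    moreover have "real M *\<^sub>R \<gamma> = (\<Sum>V\<in>f. h V)"
      using real_vector.sum_representation_eq[OF ind span finU subset_refl, of "real M *\<^sub>R \<gamma>"]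
      unfolding h_def sumU[symmetric] by simp
    ultimately show "\<exists>h. (\<forall>V\<in>f. h V \<in> stab S (f - {V}) \<and> norm (h V) \<le> D * norm \<gamma>) \<and>
      real M *\<^sub>R \<gamma> = (\<Sum>V\<in>f. h V)" by blast
  qed
qed

lemma fl_line_sum:
  assumes "flag f" "V \<in> f" "\<And>V. V \<in> f \<Longrightarrow> h V \<in> stab S (f - {V})"
  shows "fl V (\<Sum>V\<in>f. h V) = fl V (h V)"
proof -
  have "fl V (h V') = 0" if "V' \<in> f" "V' \<noteq> V" for V'
  proof -
    have "f - {V'} \<subseteq> directions S" using flag_sub[OF assms(1)] by blast
    then show ?thesis using assms(3)[OF that(1)] that assms(2) by (simp add: stab_eq)
  qed
  then show ?thesis
    unfolding fl_sum using sum.remove[OF flag_finite[OF assms(1)] assms(2), of "\<lambda>V'. fl V (h V')"]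
    by simp
qed

text \<open>Up to the factor \<open>M\<close>, the value of \<open>fl V\<close> at a lattice point
  is its value at the component on the line of \<open>V\<close>, whose norm is not larger up to a
  constant.\<close>

lemma badly_approximable_from_line:
  assumes "full_rank" "flag f" "V \<in> f" "c > 0"
    and line: "\<And>h. h \<in> stab S (f - {V}) \<Longrightarrow> h \<noteq> 0 \<Longrightarrow> c \<le> \<bar>fl V h\<bar> * norm h ^ (sv V - 1)"
  shows "badly_approximable V"
proof -
  obtain M :: nat and C where MC: "M > 0" "C > 0"
    "\<And>\<gamma>. \<gamma> \<in> \<Gamma> \<Longrightarrow> \<exists>h. (\<forall>V\<in>f. h V \<in> stab S (f - {V}) \<and> norm (h V) \<le> C * norm \<gamma>) \<and>
      real M *\<^sub>R \<gamma> = (\<Sum>V\<in>f. h V)"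
    using line_decomposition[OF assms(1,2)] by blast
  let ?s = "sv V - 1"
  have "c / (real M * C ^ ?s) \<le> \<bar>fl V \<gamma>\<bar> * norm \<gamma> ^ ?s" if \<gamma>: "\<gamma> \<in> \<Gamma>" "fl V \<gamma> \<noteq> 0" for \<gamma>
  proof -
    obtain h where h: "\<And>V. V \<in> f \<Longrightarrow> h V \<in> stab S (f - {V}) \<and> norm (h V) \<le> C * norm \<gamma>"
      "real M *\<^sub>R \<gamma> = (\<Sum>V\<in>f. h V)" using MC(3)[OF \<gamma>(1)] by blast
    have eq: "real M * fl V \<gamma> = fl V (h V)"
    proof -
      have "real M * fl V \<gamma> = fl V (real M *\<^sub>R \<gamma>)" by (simp add: fl_scale)
      also have "\<dots> = fl V (\<Sum>V\<in>f. h V)" by (simp only: h(2))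
      also have "\<dots> = fl V (h V)" by (rule fl_line_sum[OF assms(2,3)]) (use h(1) in blast)
      finally show ?thesis .
    qed
    then have "h V \<noteq> 0" using \<gamma>(2) MC(1) by auto
    then have "c \<le> \<bar>fl V (h V)\<bar> * norm (h V) ^ ?s" using line h(1)[OF assms(3)] by blast
    also have "\<dots> \<le> (real M * \<bar>fl V \<gamma>\<bar>) * (C * norm \<gamma>) ^ ?s"
      unfolding eq[symmetric] using h(1)[OF assms(3)] by (intro mult_mono power_mono) (auto simp: abs_mult)
    also have "\<dots> = (real M * C ^ ?s) * (\<bar>fl V \<gamma>\<bar> * norm \<gamma> ^ ?s)" by (simp add: power_mult_distrib)
    finally show ?thesis using MC by (simp add: field_simps)
  qed
  then show ?thesis unfolding badly_approximable_def
    using MC assms(4) by (intro exI[of _ "c / (real M * C ^ ?s)"]) auto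
qed

text \<open>A direction of \<open>f\<close> whose normal has a nonzero coefficient in
  \<open>nv V\<close> can be exchanged for \<open>V\<close>. Both flags have the same sum of
  coranks, so the exchanged directions have the same corank.\<close>

lemma exchange_same_rank:
  assumes "full_rank" "flag f" "V \<in> directions S"
  shows "nv V \<in> span (nv ` {V' \<in> f. sv V' = sv V})"
proof -
  have f: "f \<subseteq> directions S" "independent (nv ` f)" "span (nv ` f) = E" using assms(2) by (auto simp: flag_def)
  have fin: "finite f" by (rule flag_finite[OF assms(2)])
  define r where "r = representation (nv ` f) (nv V)"
  have VE: "nv V \<in> span (nv ` f)" using nv_props(1)[OF assms(3)] f(3) by simp
  have same: "sv V' = sv V" if V': "V' \<in> f" "r (nv V') \<noteq> 0" for V'
  proof (cases "V \<in> f")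
    case True
    then have "r (nv V') = (if nv V' = nv V then 1 else 0)"
      unfolding r_def using real_vector.representation_basis[OF f(2), of "nv V"] by auto
    then have "nv V' = nv V" using V'(2) by presburger
    then show ?thesis using nv_inj f(1) V'(1) assms(3) by blast
  next
    case False
    define f' where "f' = insert V (f - {V'})"
    have "nv V \<notin> span (nv ` (f - {V'}))"
    proof
      assume *: "nv V \<in> span (nv ` (f - {V'}))"
      have "r = representation (nv ` (f - {V'})) (nv V)"
        unfolding r_def by (rule real_vector.representation_extend[OF f(2) *]) auto
      then have "nv V' \<in> nv ` (f - {V'})"
        using V'(2) real_vector.representation_ne_zero by metis
      then show False using nv_inj f(1) V'(1) by blast
    qed
    moreover have "independent (nv ` (f - {V'}))" by (rule real_vector.independent_mono[OF f(2)]) auto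
    ultimately have ind: "independent (nv ` f')"
      unfolding f'_def image_insert by (simp add: real_vector.independent_insert real_vector.span_base)
    have f'D: "f' \<subseteq> directions S" using f(1) assms(3) by (auto simp: f'_def)
    have "card f' = card f" unfolding f'_def using False fin V'(1)
      by (simp add: card_insert_if) (metis Suc_pred card_gt_0_iff empty_iff)
    then have "card (nv ` f') = dim E" using card_image[OF nv_inj_on[OF f'D]] flag_card[OF assms(2)] by simp
    then have "E \<subseteq> span (nv ` f')"
      using ind f'D nv_props(1) by (intro card_ge_dim_independent) auto
    moreover have "span (nv ` f') \<subseteq> E"
      using f'D nv_props(1) subE by (intro real_vector.span_minimal) auto
    ultimately have "flag f'" using ind f'D by (auto simp: flag_def)
    then have "(\<Sum>V\<in>f'. sv V) = (\<Sum>V\<in>f. sv V)" using assms(1,2) by (simp add: full_rank_def)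
    then show ?thesis
      unfolding f'_def using False fin V'(1) by (simp add: sum.remove[of f V'])
  qed
  have "nv V = (\<Sum>a\<in>nv ` f. r a *\<^sub>R a)"
    unfolding r_def using real_vector.sum_representation_eq[OF f(2) VE _ subset_refl] fin by simp
  also have "\<dots> \<in> span (nv ` {V' \<in> f. sv V' = sv V})"
  proof (rule real_vector.span_sum)
    fix a assume "a \<in> nv ` f"
    then obtain V' where V': "V' \<in> f" "a = nv V'" by auto
    show "r a *\<^sub>R a \<in> span (nv ` {V' \<in> f. sv V' = sv V})"
    proof (cases "r a = 0")
      case False
      then show ?thesis using same V' by (intro real_vector.span_scale real_vector.span_base) auto
    qed (simp add: real_vector.span_zero)
  qed
  finally show ?thesis .
qed

lemma fl_span_zero:
  assumes "nv V \<in> span (nv ` T)" "\<And>V'. V' \<in> T \<Longrightarrow> nv V' \<bullet> x = 0"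
  shows "nv V \<bullet> x = 0"
proof -
  have "subspace {y. y \<bullet> x = 0}" by (auto simp: subspace_def inner_simps)
  then have "span (nv ` T) \<subseteq> {y. y \<bullet> x = 0}" using assms(2) by (intro real_vector.span_minimal) auto
  then show ?thesis using assms(1) by blast
qed

lemma dim_common_flag:
  assumes "flag f" "T \<subseteq> f"
  shows "dim {x \<in> E. \<forall>V\<in>T. nv V \<bullet> x = 0} = card (f - T)" "subspace {x \<in> E. \<forall>V\<in>T. nv V \<bullet> x = 0}"
proof -
  have T: "nv ` T \<subseteq> E" using assms flag_sub nv_props(1) by blast
  have "dim {y \<in> E. \<forall>x\<in>span (nv ` T). orthogonal x y} + dim (span (nv ` T)) = dim E"
    by (intro dim_subspace_orthogonal_to_vectors real_vector.span_minimal T subE) simp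
  moreover have "{y \<in> E. \<forall>x\<in>span (nv ` T). orthogonal x y} = {x \<in> E. \<forall>V\<in>T. nv V \<bullet> x = 0}"
  proof (intro Collect_cong conj_cong refl iffI ballI)
    fix y V assume "\<forall>x\<in>span (nv ` T). orthogonal x y" "V \<in> T"
    then show "nv V \<bullet> y = 0" using real_vector.span_base[of "nv V" "nv ` T"] by (auto simp: orthogonal_def)
  next
    fix x y assume *: "\<forall>V\<in>T. nv V \<bullet> y = 0" and x: "x \<in> span (nv ` T)"
    have "subspace {z. z \<bullet> y = 0}" by (auto simp: subspace_def inner_simps)
    then have "span (nv ` T) \<subseteq> {z. z \<bullet> y = 0}" using * by (intro real_vector.span_minimal) auto
    then show "orthogonal x y" using x by (auto simp: orthogonal_def)
  qed
  moreover have "dim (span (nv ` T)) = card T"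
  proof -
    have "independent (nv ` T)" using assms real_vector.independent_mono[of "nv ` f" "nv ` T"] by (auto simp: flag_def)
    then have "dim (span (nv ` T)) = card (nv ` T)" by (simp add: dim_eq_card_independent)
    also have "\<dots> = card T" using assms flag_sub by (intro card_image nv_inj_on) auto
    finally show ?thesis .
  qed
  moreover have "card (f - T) + card T = card f"
    using assms flag_finite[OF assms(1)] by (simp add: card_Diff_subset card_mono finite_subset)
  ultimately show "dim {x \<in> E. \<forall>V\<in>T. nv V \<bullet> x = 0} = card (f - T)" using flag_card[OF assms(1)] by simp
  show "subspace {x \<in> E. \<forall>V\<in>T. nv V \<bullet> x = 0}" using subE by (auto simp: subspace_def inner_simps)
qed


subsection \<open>Diophantine subgroups\<close>

text \<open>The projection of \<open>L\<close> need not be discrete, so a basis of it may be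
  linearly dependent over the reals. Injectivity of \<open>pin\<close> on the lattice lifts it to a
  basis of \<open>L\<close>, where integral coordinates are real coordinates.\<close>

lemma zbasis_lift:
  assumes L: "L \<subseteq> \<Gamma>" "zmod.subspace L"
    and B: "finite B" "zmod.independent B" "zmod.span B = pin ` L"
  obtains \<beta> where "inj_on \<beta> B" "\<beta> ` B \<subseteq> L" "independent (\<beta> ` B)" "card B = dim L"
    "\<And>x. x \<in> L \<Longrightarrow> x = (\<Sum>b\<in>B. of_int (zmod.representation B (pin x) b) *\<^sub>R \<beta> b)"
proof -
  have "\<exists>g. g \<in> L \<and> pin g = b" if "b \<in> B" for b
    using zmod.span_base[OF that] B(3) by auto
  then obtain \<beta> where \<beta>: "\<And>b. b \<in> B \<Longrightarrow> \<beta> b \<in> L \<and> pin (\<beta> b) = b" by metis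
  have inj: "inj_on \<beta> B" using \<beta> by (metis inj_onI)
  have sub: "\<beta> ` B \<subseteq> L" using \<beta> by auto
  have "zmod.independent (\<beta> ` B)"
  proof
    assume "zmod.dependent (\<beta> ` B)"
    then obtain u v where u: "(\<Sum>x\<in>\<beta> ` B. of_int (u x) *\<^sub>R x) = 0" "v \<in> \<beta> ` B" "u v \<noteq> (0::int)"
      using zmod.dependent_finite[of "\<beta> ` B"] B(1) by auto
    have "pin (\<Sum>x\<in>\<beta> ` B. of_int (u x) *\<^sub>R x) = (\<Sum>b\<in>B. of_int (u (\<beta> b)) *\<^sub>R b)"
      using \<beta> inj by (simp add: sum.reindex linear_sum[OF linear_pin] pin_scale)
    then have "(\<Sum>b\<in>B. of_int (u (\<beta> b)) *\<^sub>R b) = 0" using u(1) by simp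
    then show False
      using zmod.independentD[OF B(2) B(1) subset_refl, of "\<lambda>b. u (\<beta> b)"] u(2,3) by auto
  qed
  then have ind: "independent (\<beta> ` B)"
    using zindependent_imp_independent[OF zsub disc, of "\<beta> ` B"] sub L(1) by blast
  have rep: "x = (\<Sum>b\<in>B. of_int (zmod.representation B (pin x) b) *\<^sub>R \<beta> b)" if x: "x \<in> L" for x
  proof -
    let ?y = "\<Sum>b\<in>B. of_int (zmod.representation B (pin x) b) *\<^sub>R \<beta> b"
    have "pin x \<in> zmod.span B" using x B(3) by blast
    then have "pin x = (\<Sum>b\<in>B. of_int (zmod.representation B (pin x) b) *\<^sub>R b)"
      using zmod.sum_representation_eq[OF B(2) _ B(1) subset_refl] by simp
    also have "\<dots> = pin ?y" using \<beta> by (simp add: linear_sum[OF linear_pin] pin_scale)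
    finally have "pin (x - ?y) = 0" by (simp add: pin_diff)
    moreover have "?y \<in> L"
    proof (rule zmod.subspace_sum[OF L(2)])
      show "of_int (zmod.representation B (pin x) b) *\<^sub>R \<beta> b \<in> L" if "b \<in> B" for b
        using zmod.subspace_scale[OF L(2)] \<beta>[OF that] by blast
    qed
    then have "x - ?y \<in> \<Gamma>" using x L zsubspace_diff by blast
    ultimately show ?thesis using pin_0D by fastforce
  qed
  have "L \<subseteq> span (\<beta> ` B)"
  proof
    fix x assume "x \<in> L"
    show "x \<in> span (\<beta> ` B)"
      by (subst rep[OF \<open>x \<in> L\<close>]) (intro real_vector.span_sum real_vector.span_scale real_vector.span_base imageI)
  qed
  then have "card (\<beta> ` B) = dim L" using sub ind by (intro basis_card_eq_dim)
  then have "card B = dim L" using card_image[OF inj] by simp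
  then show ?thesis using that inj sub ind rep by blast
qed

text \<open>The coordinate norm is comparable with the norm of the lattice point in the total space,
  not with that of its internal part, which may be arbitrarily small.\<close>

lemma zcoord_bounds:
  assumes L: "L \<subseteq> \<Gamma>" "zmod.subspace L"
    and B: "finite B" "zmod.independent B" "zmod.span B = pin ` L"
  obtains C where "C > 0"
    "\<And>x. x \<in> L \<Longrightarrow> x \<noteq> 0 \<Longrightarrow> 1 \<le> zcoord_norm B (pin x) \<and> norm x \<le> C * of_int (zcoord_norm B (pin x)) \<and> of_int (zcoord_norm B (pin x)) \<le> C * norm x"
proof -
  obtain \<beta> where \<beta>: "inj_on \<beta> B" "\<beta> ` B \<subseteq> L" "independent (\<beta> ` B)"
    "\<And>x. x \<in> L \<Longrightarrow> x = (\<Sum>b\<in>B. of_int (zmod.representation B (pin x) b) *\<^sub>R \<beta> b)"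
    by (rule zbasis_lift[OF L B], rule that)
  obtain C1 where C1: "C1 > 0" "\<And>x b. x \<in> span (\<beta> ` B) \<Longrightarrow> b \<in> \<beta> ` B \<Longrightarrow> \<bar>representation (\<beta> ` B) x b\<bar> \<le> C1 * norm x"
    using representation_bound[OF \<beta>(3)] by metis
  define C where "C = C1 + (\<Sum>b\<in>B. norm (\<beta> b))"
  have C: "C > 0" "C1 \<le> C" "(\<Sum>b\<in>B. norm (\<beta> b)) \<le> C"
    using C1(1) by (auto simp: C_def sum_nonneg add_pos_nonneg)
  have main: "1 \<le> zcoord_norm B (pin x) \<and> norm x \<le> C * of_int (zcoord_norm B (pin x)) \<and> of_int (zcoord_norm B (pin x)) \<le> C * norm x"
    if x: "x \<in> L" "x \<noteq> 0" for x
  proof -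
    define z where "z = zmod.representation B (pin x)"
    define N where "N = zcoord_norm B (pin x)"
    have xz: "x = (\<Sum>b\<in>B. of_int (z b) *\<^sub>R \<beta> b)" unfolding z_def by (rule \<beta>(4)[OF x(1)])
    have Bne: "B \<noteq> {}" using xz x(2) by auto
    have N: "N = Max ((\<lambda>b. \<bar>z b\<bar>) ` B)" by (simp add: N_def z_def zcoord_norm_def)
    have zN: "\<bar>z b\<bar> \<le> N" if "b \<in> B" for b unfolding N using that B(1) by (intro Max_ge) auto
    have "N \<in> (\<lambda>b. \<bar>z b\<bar>) ` B" unfolding N using B(1) Bne by (intro Max_in) auto
    then obtain b0 where b0: "b0 \<in> B" "N = \<bar>z b0\<bar>" by blast
    have "N \<noteq> 0"
    proof
      assume "N = 0"
      then have "\<And>b. b \<in> B \<Longrightarrow> z b = 0" using zN by force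
      then show False using xz x(2) by simp
    qed
    then have N1: "1 \<le> N" using b0(2) by linarith
    have "norm x \<le> (\<Sum>b\<in>B. norm (of_int (z b) *\<^sub>R \<beta> b))" by (subst xz) (rule norm_sum)
    also have "\<dots> \<le> (\<Sum>b\<in>B. of_int N * norm (\<beta> b))"
      using zN by (intro sum_mono) (auto intro!: mult_right_mono simp flip: of_int_abs)
    also have "\<dots> \<le> C * of_int N"
      using C(3) N1 by (simp add: sum_distrib_left[symmetric] mult.commute[of C] mult_left_mono)
    finally have 1: "norm x \<le> C * of_int N" .
    have "x = (\<Sum>v\<in>\<beta> ` B. of_int (z (the_inv_into B \<beta> v)) *\<^sub>R v)"
      by (subst xz) (simp add: sum.reindex[OF \<beta>(1)] the_inv_into_f_f[OF \<beta>(1)])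
    then have xs: "x \<in> span (\<beta> ` B)" and "representation (\<beta> ` B) x (\<beta> b0) = of_int (z b0)"
    proof -
      have "x \<in> span (\<beta> ` B)"
        by (subst xz) (intro real_vector.span_sum real_vector.span_scale real_vector.span_base imageI)
      then show "x \<in> span (\<beta> ` B)" .
      have "(\<Sum>b\<in>B. (representation (\<beta> ` B) x (\<beta> b) - of_int (z b)) *\<^sub>R \<beta> b) = 0"
        using real_vector.sum_representation_eq[OF \<beta>(3) \<open>x \<in> span (\<beta> ` B)\<close> finite_imageI[OF B(1)] subset_refl]
        by (simp add: scaleR_diff_left sum_subtractf sum.reindex[OF \<beta>(1)] flip: xz)
      then have "(\<Sum>v\<in>\<beta> ` B. (representation (\<beta> ` B) x v - of_int (z (the_inv_into B \<beta> v))) *\<^sub>R v) = 0"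
        by (simp add: sum.reindex[OF \<beta>(1)] the_inv_into_f_f[OF \<beta>(1)])
      from real_vector.independentD[OF \<beta>(3) finite_imageI[OF B(1)] subset_refl this, of "\<beta> b0"] b0(1)
      show "representation (\<beta> ` B) x (\<beta> b0) = of_int (z b0)"
        by (simp add: the_inv_into_f_f[OF \<beta>(1)])
    qed
    then have "real_of_int N = \<bar>representation (\<beta> ` B) x (\<beta> b0)\<bar>" using b0(2) by simp
    also have "\<dots> \<le> C1 * norm x" using C1(2)[OF xs] b0(1) by simp
    also have "\<dots> \<le> C * norm x" using C(2) by (intro mult_right_mono) auto
    finally show ?thesis using 1 N1 unfolding N_def by simp
  qed
  show ?thesis by (rule that[OF C(1) main])
qed

text \<open>Removes bases from the Diophantine condition: by the comparison of norms, the height of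
  a projected point can be measured by the norm of its lift.\<close>

lemma diophantine_iff:
  assumes L: "L \<subseteq> \<Gamma>" "zmod.subspace L" and X: "pin ` L \<subseteq> X"
    and d: "\<delta> = (real (dim L) - real (dim X)) / real (dim X)" "\<delta> \<ge> 0"
  shows "diophantine_in nrm' (pin ` L) X \<longleftrightarrow>
    (\<exists>c>0. \<forall>x\<in>L - {0}. c * norm x powr (- \<delta>) \<le> nrm' (pin x))"
proof
  assume "diophantine_in nrm' (pin ` L) X"
  then have "\<exists>B. finite B \<and> zmod.independent B \<and> zmod.span B = pin ` L \<and>
      (\<exists>c>0. \<forall>g\<in>pin ` L - {0}. nrm' g \<ge>
        c * of_int (zcoord_norm B g) powr (- ((real (card B) - real (dim X)) / real (dim X))))"
    by (simp only: diophantine_in_def Let_def)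
  then obtain B where B: "finite B" "zmod.independent B" "zmod.span B = pin ` L"
    and ex: "\<exists>c>0. \<forall>g\<in>pin ` L - {0}. nrm' g \<ge>
        c * of_int (zcoord_norm B g) powr (- ((real (card B) - real (dim X)) / real (dim X)))"
    by - (erule exE, (erule conjE)+, rule that)
  obtain c where c: "c > 0" "\<forall>g\<in>pin ` L - {0}. nrm' g \<ge>
        c * of_int (zcoord_norm B g) powr (- ((real (card B) - real (dim X)) / real (dim X)))"
    using ex by - (erule exE, erule conjE, rule that)
  have cB: "card B = dim L" by (rule zbasis_lift[OF L B])
  obtain C where C: "C > 0"
    "\<And>x. x \<in> L \<Longrightarrow> x \<noteq> 0 \<Longrightarrow> 1 \<le> zcoord_norm B (pin x) \<and> norm x \<le> C * of_int (zcoord_norm B (pin x)) \<and> of_int (zcoord_norm B (pin x)) \<le> C * norm x"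
    by (rule zcoord_bounds[OF L B], rule that)
  have "c * C powr (- \<delta>) * norm x powr (- \<delta>) \<le> nrm' (pin x)" if x: "x \<in> L" "x \<noteq> 0" for x
  proof -
    have "pin x \<noteq> 0" using pin_0D x L(1) by blast
    then have le: "c * of_int (zcoord_norm B (pin x)) powr (- \<delta>) \<le> nrm' (pin x)"
      using c(2)[rule_format, of "pin x"] x(1) by (simp add: cB d(1))
    have "(C * norm x) powr (- \<delta>) \<le> of_int (zcoord_norm B (pin x)) powr (- \<delta>)"
      using C(2)[OF x] d(2) by (intro powr_mono2') auto
    then have "c * (C * norm x) powr (- \<delta>) \<le> c * of_int (zcoord_norm B (pin x)) powr (- \<delta>)"
      using c(1) by (intro mult_left_mono) auto
    then show ?thesis using le C(1) by (simp add: powr_mult mult.assoc)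
  qed
  then show "\<exists>c>0. \<forall>x\<in>L - {0}. c * norm x powr (- \<delta>) \<le> nrm' (pin x)"
    using c(1) C(1) by (intro exI[of _ "c * C powr (- \<delta>)"]) auto
next
  assume "\<exists>c>0. \<forall>x\<in>L - {0}. c * norm x powr (- \<delta>) \<le> nrm' (pin x)"
  then obtain c where c: "c > 0" "\<And>x. x \<in> L \<Longrightarrow> x \<noteq> 0 \<Longrightarrow> c * norm x powr (- \<delta>) \<le> nrm' (pin x)" by blast
  obtain B0 where B0: "finite B0" "B0 \<subseteq> L" "independent B0" "zmod.span B0 = L"
    using zbasis_exists[OF L(2)] disc L(1) discrete_subset by blast
  interpret h: module_hom "\<lambda>(m::int) (x::'a). of_int m *\<^sub>R x" "\<lambda>(m::int) (x::'a). of_int m *\<^sub>R x" pin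
    by unfold_locales (auto simp: pin_add pin_scale)
  define B where "B = pin ` B0"
  have B: "finite B" "zmod.span B = pin ` L"
    using B0 h.span_image[of B0] by (auto simp: B_def)
  have "inj_on pin (zmod.span B0)" using inj_pin L(1) B0(4) inj_on_subset by blast
  then have indB: "zmod.independent B"
    unfolding B_def using independent_imp_zindependent[OF B0(3)] by (rule h.independent_injective_image[rotated])
  have cB: "card B = dim L" by (rule zbasis_lift[OF L B(1) indB B(2)])
  obtain C where C: "C > 0"
    "\<And>x. x \<in> L \<Longrightarrow> x \<noteq> 0 \<Longrightarrow> 1 \<le> zcoord_norm B (pin x) \<and> norm x \<le> C * of_int (zcoord_norm B (pin x)) \<and> of_int (zcoord_norm B (pin x)) \<le> C * norm x"
    by (rule zcoord_bounds[OF L B(1) indB B(2)], rule that)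
  have "c * C powr (- \<delta>) * of_int (zcoord_norm B g) powr (- \<delta>) \<le> nrm' g" if g: "g \<in> pin ` L - {0}" for g
  proof -
    obtain y where y: "y \<in> L" "g = pin y" using g by auto
    moreover have "y \<noteq> 0" using g y by auto
    ultimately obtain x where x: "x \<in> L" "x \<noteq> 0" "g = pin x" by blast
    have "(C * of_int (zcoord_norm B g)) powr (- \<delta>) \<le> norm x powr (- \<delta>)"
      using C(2)[OF x(1,2)] d(2) x by (intro powr_mono2') auto
    then have "c * (C * of_int (zcoord_norm B g)) powr (- \<delta>) \<le> c * norm x powr (- \<delta>)"
      using c(1) by (intro mult_left_mono) auto
    then show ?thesis using c(2)[OF x(1,2)] C x by (simp add: powr_mult mult.assoc)
  qed
  then show "diophantine_in nrm' (pin ` L) X"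
    unfolding diophantine_in_def Let_def
    using B indB X c(1) C(1)
    by (intro conjI exI[of _ B] exI[of _ "c * C powr (- \<delta>)"]) (auto simp: cB d(1))
qed

subsection \<open>The decomposition by stabiliser rank\<close>

text \<open>By the exchange property a normal with another corank than \<open>\<sigma>\<close> is
  spanned by those members of the flag with that same corank. So vanishing on the flag members
  outside the class gives vanishing on all directions outside it.\<close>

lemma rank_class_common_space:
  assumes "full_rank" "flag f"
  shows "common_space S {V \<in> directions S. sv V \<noteq> \<sigma>} = {x \<in> E. \<forall>V\<in>f - {V \<in> f. sv V = \<sigma>}. nv V \<bullet> x = 0}"
    "stab S {V \<in> directions S. sv V \<noteq> \<sigma>} = stab S (f - {V \<in> f. sv V = \<sigma>})"
proof -
  have sub: "{V \<in> directions S. sv V \<noteq> \<sigma>} \<subseteq> directions S" "f - {V \<in> f. sv V = \<sigma>} \<subseteq> directions S"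
    using flag_sub[OF assms(2)] by auto
  have key: "(\<forall>V\<in>{V \<in> directions S. sv V \<noteq> \<sigma>}. nv V \<bullet> x = 0) \<longleftrightarrow> (\<forall>V\<in>f - {V \<in> f. sv V = \<sigma>}. nv V \<bullet> x = 0)" for x
  proof
    assume *: "\<forall>V\<in>f - {V \<in> f. sv V = \<sigma>}. nv V \<bullet> x = 0"
    show "\<forall>V\<in>{V \<in> directions S. sv V \<noteq> \<sigma>}. nv V \<bullet> x = 0"
    proof
      fix V assume V: "V \<in> {V \<in> directions S. sv V \<noteq> \<sigma>}"
      then have "nv V \<in> span (nv ` {V' \<in> f. sv V' = sv V})" using exchange_same_rank[OF assms] by blast
      then show "nv V \<bullet> x = 0" by (rule fl_span_zero) (use * V in auto)
    qed
  qed (use flag_sub[OF assms(2)] in auto)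
  show "common_space S {V \<in> directions S. sv V \<noteq> \<sigma>} = {x \<in> E. \<forall>V\<in>f - {V \<in> f. sv V = \<sigma>}. nv V \<bullet> x = 0}"
    unfolding common_space_eq[OF sub(1)] key ..
  show "stab S {V \<in> directions S. sv V \<noteq> \<sigma>} = stab S (f - {V \<in> f. sv V = \<sigma>})"
    unfolding stab_eq[OF sub(1)] stab_eq[OF sub(2)] fl_def key ..
qed

lemma sv_pos: assumes "V \<in> directions S" shows "sv V \<ge> 1"
proof (rule ccontr)
  assume "\<not> sv V \<ge> 1"
  then have "dim (stab S {V}) = DIM('a)" using sv_dim[of V] by simp
  then have "span (stab S {V}) = UNIV" by (simp add: dim_eq_full)
  moreover have "span (stab S {V}) \<subseteq> {x. fl V x = 0}"
    using assms by (intro real_vector.span_minimal) (auto simp: stab_eq subspace_def fl_add fl_scale)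
  ultimately have "fl V (nv V) = 0" by auto
  then show False using nv_props[OF assms] by (simp add: fl_E)
qed

text \<open>If a flag has c members of corank \<open>\<sigma>\<close>, the block has dimension c and
  rank c * \<open>\<sigma>\<close>, whence its delta is \<open>\<sigma>\<close> - 1. Stabilising one
  more direction of the block leaves rank (c - 1) * \<open>\<sigma>\<close>, which is exactly the
  value demanded of a CSR decomposition.\<close>

lemma rank_class_decomposition:
  assumes "full_rank"
  defines "Q \<equiv> (\<lambda>\<sigma>. {V \<in> directions S. sv V \<noteq> \<sigma>}) ` sv ` directions S"
  shows "csr_decomposition S Q"
    and "\<And>V \<sigma>. V \<in> directions S \<Longrightarrow> \<sigma> = sv V \<Longrightarrow> delta S {V \<in> directions S. sv V \<noteq> \<sigma>} = real \<sigma> - 1"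
proof -
  let ?T = "\<lambda>\<sigma>. {V \<in> directions S. sv V \<noteq> \<sigma>}"
  have finQ: "finite Q" unfolding Q_def using finite_directions by simp
  have Qsub: "T \<subset> directions S" if "T \<in> Q" for T using that unfolding Q_def by auto
  have zs: "zmod.subspace (stab S T)" if "T \<in> Q" for T using Qsub[OF that] stab_zsub by blast
  have cs: "subspace (common_space S T)" if "T \<in> Q" for T
  proof -
    have "common_space S T = {x \<in> E. \<forall>V\<in>T. nv V \<bullet> x = 0}" using Qsub[OF that] common_space_eq by blast
    then show ?thesis using subE by (auto simp: subspace_def inner_simps)
  qed
  have dims: "dim (common_space S (?T \<sigma>)) = card {V' \<in> f. sv V' = \<sigma>}"
      "zrank (stab S (?T \<sigma>)) = card {V' \<in> f. sv V' = \<sigma>} * \<sigma>" if f: "flag f" for f \<sigma>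
  proof -
    have e: "f - (f - {V' \<in> f. sv V' = \<sigma>}) = {V' \<in> f. sv V' = \<sigma>}" by auto
    show "dim (common_space S (?T \<sigma>)) = card {V' \<in> f. sv V' = \<sigma>}"
      unfolding rank_class_common_space(1)[OF assms(1) f]
      using dim_common_flag(1)[OF f, of "f - {V' \<in> f. sv V' = \<sigma>}"] e by simp
    have "zrank (stab S (?T \<sigma>)) = dim (stab S (?T \<sigma>))" by (rule zrank_eq_dim[OF zsub disc stab_subset])
    also have "\<dots> = (\<Sum>V\<in>{V' \<in> f. sv V' = \<sigma>}. sv V)"
      unfolding rank_class_common_space(2)[OF assms(1) f]
      using full_rank_dim[OF assms(1) f, of "f - {V' \<in> f. sv V' = \<sigma>}"] e by simp
    also have "\<dots> = card {V' \<in> f. sv V' = \<sigma>} * \<sigma>" by simp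
    finally show "zrank (stab S (?T \<sigma>)) = card {V' \<in> f. sv V' = \<sigma>} * \<sigma>" .
  qed
  have del: "delta S (?T (sv V)) = real (sv V) - 1" if V: "V \<in> directions S" for V
  proof -
    obtain f where f: "flag f" "V \<in> f" using flag_containing[OF V] by blast
    have "card {V' \<in> f. sv V' = sv V} > 0" using f flag_finite by (auto simp: card_gt_0_iff)
    then show ?thesis unfolding delta_def dims[OF f(1)] by (simp add: field_simps)
  qed
  then show "\<And>V \<sigma>. V \<in> directions S \<Longrightarrow> \<sigma> = sv V \<Longrightarrow> delta S (?T \<sigma>) = real \<sigma> - 1" by blast
  have uniq: "\<exists>!T. T \<in> Q \<and> V \<notin> T" if V: "V \<in> directions S" for V
  proof (rule ex1I[of _ "?T (sv V)"])
    show "?T (sv V) \<in> Q \<and> V \<notin> ?T (sv V)" using V by (auto simp: Q_def)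
    show "T = ?T (sv V)" if "T \<in> Q \<and> V \<notin> T" for T using that V by (auto simp: Q_def)
  qed
  obtain f where f: "flag f" using flag_exists by blast
  have finf: "finite f" by (rule flag_finite[OF f])
  have fD: "f \<subseteq> directions S" by (rule flag_sub[OF f])
  define X where "X = (\<Sum>T\<in>Q. common_space S T)"
  have zcs: "zmod.subspace (common_space S T)" if "T \<in> Q" for T
    using cs[OF that] by (rule subspace_imp_zsubspace)
  have sumX: "zmod.subspace (\<Sum>T\<in>Q. common_space S T)"
    "\<And>T. T \<in> Q \<Longrightarrow> common_space S T \<subseteq> (\<Sum>T\<in>Q. common_space S T)"
    "\<And>G. zmod.subspace G \<Longrightarrow> (\<And>T. T \<in> Q \<Longrightarrow> common_space S T \<subseteq> G) \<Longrightarrow> (\<Sum>T\<in>Q. common_space S T) \<subseteq> G"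
    by (rule sum_zsubspace(1)[OF finQ zcs], assumption)
      (rule sum_zsubspace(2)[OF finQ zcs], assumption+, rule sum_zsubspace(3)[OF finQ zcs], assumption+)
  have "E = X"
  proof
    show "X \<subseteq> E" unfolding X_def
      by (intro sumX(3) subspace_imp_zsubspace subE) (auto simp: common_space_def)
    show "E \<subseteq> X"
    proof
      fix x assume x: "x \<in> E"
      \<comment> \<open>The component of \<open>x\<close> in block \<open>\<sigma>\<close>, built
        from the vectors dual to the normals of the flag.\<close>
      have "\<exists>y\<in>E. \<forall>V\<in>f. nv V \<bullet> y = (if sv V = \<sigma> then nv V \<bullet> x else 0)" for \<sigma>
      proof -
        have "\<exists>y\<in>span (nv ` f). \<forall>a\<in>nv ` f. a \<bullet> y = (if sv (the_inv_into f nv a) = \<sigma> then a \<bullet> x else 0)"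
          using f by (intro dual_vector_exists) (simp add: flag_def)
        then show ?thesis using f the_inv_into_f_f[OF nv_inj_on[OF fD]] by (auto simp: flag_def)
      qed
      then obtain y where y: "\<And>\<sigma>. y \<sigma> \<in> E" "\<And>\<sigma> V. V \<in> f \<Longrightarrow> nv V \<bullet> y \<sigma> = (if sv V = \<sigma> then nv V \<bullet> x else 0)"
        by metis
      have "x - (\<Sum>\<sigma>\<in>sv ` f. y \<sigma>) = 0"
      proof (rule flag_separates[OF f])
        show "x - (\<Sum>\<sigma>\<in>sv ` f. y \<sigma>) \<in> E" by (intro subspace_diff[OF subE] x subspace_sum[OF subE] y)
        fix V assume V: "V \<in> f"
        have "nv V \<bullet> (\<Sum>\<sigma>\<in>sv ` f. y \<sigma>) = (\<Sum>\<sigma>\<in>sv ` f. if sv V = \<sigma> then nv V \<bullet> x else 0)"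
          unfolding inner_sum_right using y(2)[OF V] by simp
        also have "\<dots> = nv V \<bullet> x" using V finf by simp
        finally show "nv V \<bullet> (x - (\<Sum>\<sigma>\<in>sv ` f. y \<sigma>)) = 0" by (simp add: inner_diff_right)
      qed
      then have "x = (\<Sum>\<sigma>\<in>sv ` f. y \<sigma>)" by simp
      also have "\<dots> \<in> X"
        unfolding X_def
      proof (rule zmod.subspace_sum[OF sumX(1)])
        fix \<sigma> assume "\<sigma> \<in> sv ` f"
        then have Q: "?T \<sigma> \<in> Q" using fD by (auto simp: Q_def)
        have "y \<sigma> \<in> common_space S (?T \<sigma>)"
          unfolding rank_class_common_space(1)[OF assms(1) f] using y by simp
        then show "y \<sigma> \<in> (\<Sum>T\<in>Q. common_space S T)" using sumX(2)[OF Q] by blast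
      qed
      finally show "x \<in> X" .
    qed
  qed
  then have dec: "decomposition S Q"
    unfolding decomposition_def X_def using finQ Qsub uniq by blast
  have fi: "finite_index (\<Sum>T\<in>Q. stab S T) \<Gamma>"
  proof -
    have sumG: "zmod.subspace (\<Sum>T\<in>Q. stab S T)" by (rule sum_zsubspace(1)[OF finQ zs])
    have sumG2: "stab S T \<subseteq> (\<Sum>T\<in>Q. stab S T)" if "T \<in> Q" for T
      by (rule sum_zsubspace(2)[OF finQ _ that]) (rule zs)
    obtain M :: nat and C where MC: "M > 0" "C > 0"
      "\<And>\<gamma>. \<gamma> \<in> \<Gamma> \<Longrightarrow> \<exists>h. (\<forall>V\<in>f. h V \<in> stab S (f - {V}) \<and> norm (h V) \<le> C * norm \<gamma>) \<and>
        real M *\<^sub>R \<gamma> = (\<Sum>V\<in>f. h V)"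
      using line_decomposition[OF assms(1) f] by blast
    show ?thesis
    proof (rule finite_index_if_multiples[OF zsub disc sumG _ MC(1)])
      show "(\<Sum>T\<in>Q. stab S T) \<subseteq> \<Gamma>" by (rule sum_zsubspace(3)[OF finQ zs zsub stab_subset])
      fix g assume "g \<in> \<Gamma>"
      then obtain h where h: "\<And>V. V \<in> f \<Longrightarrow> h V \<in> stab S (f - {V})" "real M *\<^sub>R g = (\<Sum>V\<in>f. h V)"
        using MC(3) by blast
      show "real M *\<^sub>R g \<in> (\<Sum>T\<in>Q. stab S T)"
        unfolding h(2)
      proof (rule zmod.subspace_sum[OF sumG])
        fix V assume V: "V \<in> f"
        have Q: "?T (sv V) \<in> Q" using V fD by (auto simp: Q_def)
        have "stab S (f - {V}) \<subseteq> stab S (f - {V' \<in> f. sv V' = sv V})"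
          using V unfolding stab_def by auto
        then have "h V \<in> stab S (?T (sv V))"
          using h(1)[OF V] rank_class_common_space(2)[OF assms(1) f] by blast
        then show "h V \<in> (\<Sum>T\<in>Q. stab S T)" using sumG2[OF Q] by blast
      qed
    qed
  qed
  have ranks: "real (zrank (stab S {V} \<inter> stab S T)) = real (zrank (stab S T)) - delta S T - 1"
    if T: "T \<in> Q" and V: "V \<in> directions S - T" for T V
  proof -
    have TV: "T = ?T (sv V)" using uniq[of V] T V by (auto simp: Q_def)
    obtain g where g: "flag g" "V \<in> g" using flag_containing V by blast
    let ?c = "{V' \<in> g. sv V' = sv V}"
    have fing: "finite ?c" using flag_finite[OF g(1)] by simp
    have Vc: "V \<in> ?c" using g(2) by simp
    have "stab S {V} \<inter> stab S T = stab S (insert V (g - ?c))"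
      unfolding TV rank_class_common_space(2)[OF assms(1) g(1)] using stab_Un[of "{V}" "g - ?c"] by simp
    then have "zrank (stab S {V} \<inter> stab S T) = dim (stab S (insert V (g - ?c)))"
      using zrank_eq_dim[OF zsub disc stab_subset] by simp
    also have "\<dots> = (\<Sum>V\<in>g - insert V (g - ?c). sv V)"
      using g by (intro full_rank_dim[OF assms(1) g(1)]) auto
    also have "g - insert V (g - ?c) = ?c - {V}" by auto
    also have "(\<Sum>V\<in>?c - {V}. sv V) = (card ?c - 1) * sv V" using fing Vc by simp
    finally have r: "zrank (stab S {V} \<inter> stab S T) = (card ?c - 1) * sv V" .
    have "card ?c \<ge> 1" using fing Vc by (metis One_nat_def Suc_leI card_gt_0_iff empty_iff)
    moreover have "zrank (stab S T) = card ?c * sv V" unfolding TV by (rule dims(2)[OF g(1)])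
    moreover have "delta S T = real (sv V) - 1" unfolding TV by (rule del) (use V in blast)
    ultimately show ?thesis unfolding r by (simp add: of_nat_diff algebra_simps)
  qed
  show "csr_decomposition S Q"
    unfolding csr_decomposition_def using dec fi ranks by blast
qed


lemma fl_powr_bound:
  assumes "badly_approximable V" "V \<in> directions S"
  obtains c where "c > 0" "\<And>\<gamma>. \<gamma> \<in> \<Gamma> \<Longrightarrow> fl V \<gamma> \<noteq> 0 \<Longrightarrow> c * norm \<gamma> powr (- (real (sv V) - 1)) \<le> \<bar>fl V \<gamma>\<bar>"
proof -
  obtain c where c: "c > 0" "\<And>\<gamma>. \<gamma> \<in> \<Gamma> \<Longrightarrow> fl V \<gamma> \<noteq> 0 \<Longrightarrow> c \<le> \<bar>fl V \<gamma>\<bar> * norm \<gamma> ^ (sv V - 1)"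
    using assms(1) unfolding badly_approximable_def by blast
  have "c * norm \<gamma> powr (- (real (sv V) - 1)) \<le> \<bar>fl V \<gamma>\<bar>" if \<gamma>: "\<gamma> \<in> \<Gamma>" "fl V \<gamma> \<noteq> 0" for \<gamma>
  proof -
    have "\<gamma> \<noteq> 0" using \<gamma>(2) by auto
    then have n: "norm \<gamma> > 0" by simp
    have "norm \<gamma> powr (real (sv V) - 1) = norm \<gamma> ^ (sv V - 1)"
      using n sv_pos[OF assms(2)] by (subst powr_realpow[symmetric]) (auto simp: of_nat_diff)
    then have "c \<le> \<bar>fl V \<gamma>\<bar> * norm \<gamma> powr (real (sv V) - 1)" using c(2)[OF \<gamma>] by simp
    then have "c / norm \<gamma> powr (real (sv V) - 1) \<le> \<bar>fl V \<gamma>\<bar>" using n by (simp add: pos_divide_le_eq)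
    then show ?thesis unfolding powr_minus_divide by simp
  qed
  then show ?thesis using that c(1) by blast
qed

text \<open>A nonzero element of the stabiliser of a block has a nonzero functional in the flag, and
  its direction must belong to that block. Its corank minus 1 is the Diophantine exponent of the
  block.\<close>

lemma diophantine_from_badly_approximable:
  assumes "full_rank" "\<And>V. V \<in> directions S \<Longrightarrow> badly_approximable V" and nrm': "norm_on E nrm'"
  shows "diophantine_cps S nrm'"
proof -
  define Q where "Q = (\<lambda>\<sigma>. {V \<in> directions S. sv V \<noteq> \<sigma>}) ` sv ` directions S"
  note csr = rank_class_decomposition[OF assms(1)]
  obtain a b where ab: "a > 0" "\<And>x. x \<in> E \<Longrightarrow> a * norm x \<le> nrm' x"
    using norm_on_equivalent[OF subE nrm'] by metis
  have "diophantine_in nrm' (pin ` stab S T) (common_space S T)" if "T \<in> Q" for T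
  proof -
    obtain V0 where V0: "V0 \<in> directions S" "T = {V \<in> directions S. sv V \<noteq> sv V0}" using \<open>T \<in> Q\<close> by (auto simp: Q_def)
    let ?\<sigma> = "sv V0"
    have TD: "T \<subseteq> directions S" using V0 by auto
    define \<delta> where "\<delta> = (real (dim (stab S T)) - real (dim (common_space S T))) / real (dim (common_space S T))"
    have \<delta>: "\<delta> = real ?\<sigma> - 1"
      using csr(2)[OF V0(1) refl] unfolding V0(2)[symmetric] delta_def \<delta>_def zrank_eq_dim[OF zsub disc stab_subset] .
    have \<delta>0: "\<delta> \<ge> 0" unfolding \<delta> using sv_pos[OF V0(1)] by simp
    have sub: "pin ` stab S T \<subseteq> common_space S T" using pin_in by (auto simp: stab_def common_space_def)
    have "\<exists>c>0. \<forall>x\<in>stab S T - {0}. c * norm x powr (- \<delta>) \<le> nrm' (pin x)"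
    proof -
      obtain f where f: "flag f" using flag_exists by blast
      have fD: "f \<subseteq> directions S" by (rule flag_sub[OF f])
      have "\<exists>c>0. \<forall>\<gamma>\<in>\<Gamma>. fl V \<gamma> \<noteq> 0 \<longrightarrow> c * norm \<gamma> powr (- (real (sv V) - 1)) \<le> \<bar>fl V \<gamma>\<bar>" if "V \<in> f" for V
      proof -
        have V: "V \<in> directions S" using that fD by blast
        obtain c where "c > 0" "\<And>\<gamma>. \<gamma> \<in> \<Gamma> \<Longrightarrow> fl V \<gamma> \<noteq> 0 \<Longrightarrow> c * norm \<gamma> powr (- (real (sv V) - 1)) \<le> \<bar>fl V \<gamma>\<bar>"
          by (rule fl_powr_bound[OF assms(2)[OF V] V], rule that)
        then show ?thesis by blast
      qed
      then obtain c where c: "\<And>V. V \<in> f \<Longrightarrow> c V > 0"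
        "\<And>V \<gamma>. V \<in> f \<Longrightarrow> \<gamma> \<in> \<Gamma> \<Longrightarrow> fl V \<gamma> \<noteq> 0 \<Longrightarrow> c V * norm \<gamma> powr (- (real (sv V) - 1)) \<le> \<bar>fl V \<gamma>\<bar>"
        by metis
      define m where "m = Min (c ` f)"
      have fne: "c ` f \<noteq> {}" "finite (c ` f)" using flag_nonempty[OF f] flag_finite[OF f] by auto
      have m: "m > 0" unfolding m_def using fne c(1) by (subst Min_gr_iff) auto
      obtain N where N: "N > 0" "\<And>V x. V \<in> directions S \<Longrightarrow> \<bar>fl V x\<bar> \<le> N * norm (pin x)"
        using fl_bound by metis
      have "a * m / N * norm x powr (- \<delta>) \<le> nrm' (pin x)" if x: "x \<in> stab S T" "x \<noteq> 0" for x
      proof -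
        have x': "x \<in> stab S (f - {V \<in> f. sv V = ?\<sigma>})"
          using x(1) unfolding V0(2) rank_class_common_space(2)[OF assms(1) f] .
        have xG: "x \<in> \<Gamma>" using x(1) stab_subset by blast
        obtain V where V: "V \<in> f" "fl V x \<noteq> 0" using flag_fl_zero[OF f xG] x(2) by blast
        have "f - {V \<in> f. sv V = ?\<sigma>} \<subseteq> directions S" using fD by blast
        then have "sv V = ?\<sigma>" using x' V by (auto simp: stab_eq)
        then have "c V * norm x powr (- \<delta>) \<le> \<bar>fl V x\<bar>" using c(2)[OF V(1) xG V(2)] by (simp add: \<delta>)
        moreover have "m \<le> c V" unfolding m_def using fne V(1) by (intro Min_le) auto
        then have "m * norm x powr (- \<delta>) \<le> c V * norm x powr (- \<delta>)" by (intro mult_right_mono) auto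
        ultimately have "m * norm x powr (- \<delta>) \<le> N * norm (pin x)"
          using N(2)[of V x] V(1) fD by fastforce
        then have "m / N * norm x powr (- \<delta>) \<le> norm (pin x)" using N(1) by (simp add: field_simps)
        then have "a * (m / N * norm x powr (- \<delta>)) \<le> a * norm (pin x)" using ab(1) by (intro mult_left_mono) auto
        then show ?thesis using ab(2)[OF pin_in, of x] by simp
      qed
      then show ?thesis using ab(1) m N(1) by (intro exI[of _ "a * m / N"]) auto
    qed
    then show ?thesis
      using diophantine_iff[OF stab_subset stab_zsub[OF TD] sub \<delta>_def \<delta>0] by blast
  qed
  then show ?thesis unfolding diophantine_cps_def using csr(1) unfolding Q_def by blast
qed

subsection \<open>From a CSR decomposition to ranks\<close>

text \<open>Everything follows from equality in counts. The common spaces must have the dimensions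
  predicted by the flag; the rank equations bound each \<open>sv V\<close> from above by delta + 1,
  and the sum of these bounds over the flag is k, which is also a lower bound for the sum of the
  coranks.\<close>

lemma csr_decomposition_structure:
  assumes csr: "csr_decomposition S Q" and f: "flag f"
  shows "full_rank" and "\<And>T. T \<in> Q \<Longrightarrow> dim (common_space S T) = card (f - T)"
    and "\<And>T. T \<in> Q \<Longrightarrow> stab S T = stab S (f \<inter> T)"
    and "\<And>T V. T \<in> Q \<Longrightarrow> V \<in> f - T \<Longrightarrow> real (sv V) = delta S T + 1"
proof -
  have dec: "decomposition S Q" and fi: "finite_index (\<Sum>T\<in>Q. stab S T) \<Gamma>"
    and ranks: "\<And>T V. T \<in> Q \<Longrightarrow> V \<in> directions S - T \<Longrightarrow>
        real (zrank (stab S {V} \<inter> stab S T)) = real (zrank (stab S T)) - delta S T - 1"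
    using csr by (auto simp: csr_decomposition_def)
  have finQ: "finite Q" and Qsub: "\<And>T. T \<in> Q \<Longrightarrow> T \<subset> directions S"
    and uniq0: "\<forall>V\<in>directions S. \<exists>!T. T \<in> Q \<and> V \<notin> T"
    and Esum: "E = (\<Sum>T\<in>Q. common_space S T)"
    using dec by (auto simp: decomposition_def)
  have ex: "\<exists>T\<in>Q. V \<notin> T" if "V \<in> directions S" for V using uniq0 that by blast
  have un: "T = T'" if "V \<in> directions S" "T \<in> Q" "V \<notin> T" "T' \<in> Q" "V \<notin> T'" for V T T'
    using uniq0 that by blast
  have cover: "(\<Union>T\<in>Q. g - T) = g" if g: "flag g" for g
  proof -
    have "\<exists>T\<in>Q. V \<notin> T" if "V \<in> g" for V using ex flag_sub[OF g] that by blast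
    then show ?thesis by auto
  qed
  have disjoint: "(g - T) \<inter> (g - T') = {}" if "flag g" "T \<in> Q" "T' \<in> Q" "T \<noteq> T'" for g T T'
  proof (rule ccontr)
    assume "(g - T) \<inter> (g - T') \<noteq> {}"
    then obtain V where "V \<in> g" "V \<notin> T" "V \<notin> T'" by blast
    then show False using un[of V T T'] flag_sub[OF that(1)] that by blast
  qed
  have rank_dim: "zrank A = dim A" if "A \<subseteq> \<Gamma>" for A by (rule zrank_eq_dim[OF zsub disc that])
  have cse: "common_space S T = {x \<in> E. \<forall>V\<in>T. nv V \<bullet> x = 0}" if "T \<in> Q" for T
    using Qsub[OF that] common_space_eq by blast
  have part: "(\<Sum>T\<in>Q. card (g - T)) = card g" if g: "flag g" for g
  proof -
    have "card (\<Union>T\<in>Q. g - T) = (\<Sum>T\<in>Q. card (g - T))"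
    proof (rule card_UN_disjoint[OF finQ])
      show "\<forall>T\<in>Q. finite (g - T)" using flag_finite[OF g] by auto
      show "\<forall>T\<in>Q. \<forall>T'\<in>Q. T \<noteq> T' \<longrightarrow> (g - T) \<inter> (g - T') = {}" using disjoint[OF g] by blast
    qed
    then show ?thesis using cover[OF g] by simp
  qed
  have struct: "dim (common_space S T) = card (g - T) \<and> common_space S T = {x \<in> E. \<forall>V\<in>g \<inter> T. nv V \<bullet> x = 0}"
    if g: "flag g" and T: "T \<in> Q" for g T
  proof -
    define Y where "Y = (\<lambda>T. {x \<in> E. \<forall>V\<in>g \<inter> T. nv V \<bullet> x = 0})"
    have Y: "dim (Y T) = card (g - T)" "subspace (Y T)" for T
      using dim_common_flag[OF g, of "g \<inter> T"] by (auto simp: Y_def Diff_Int)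
    have le: "dim (common_space S T) \<le> card (g - T)" "common_space S T \<subseteq> Y T" if "T \<in> Q" for T
    proof -
      show "common_space S T \<subseteq> Y T" unfolding cse[OF that] Y_def by auto
      then show "dim (common_space S T) \<le> card (g - T)" using dim_subset Y(1) by metis
    qed
    have sub: "subspace (common_space S T)" if "T \<in> Q" for T
      unfolding cse[OF that] using subE by (auto simp: subspace_def inner_simps)
    \<comment> \<open>The common spaces sum to \<open>E\<close>, whose dimension is also the sum of
      the upper bounds \<open>card (g - T)\<close>. So each bound is attained, and the members of
      \<open>T\<close> in the flag alone cut out the common space.\<close>
    have "dim E \<le> (\<Sum>T\<in>Q. dim (common_space S T))"
    proof -
      have "subspace (\<Sum>T\<in>Q. common_space S T) \<and> dim (\<Sum>T\<in>Q. common_space S T) \<le> (\<Sum>T\<in>Q. dim (common_space S T))"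
        by (rule dim_sum_le[OF finQ]) (rule sub)
      then show ?thesis using Esum by simp
    qed
    then have eq: "(\<Sum>T\<in>Q. dim (common_space S T)) = (\<Sum>T\<in>Q. card (g - T))"
      using part[OF g] flag_card[OF g] sum_mono[of Q "\<lambda>T. dim (common_space S T)" "\<lambda>T. card (g - T)"] le(1) by fastforce
    have dimT: "dim (common_space S T) = card (g - T)"
      using sum_mono_inv[OF eq le(1) T finQ] by blast
    have "common_space S T = Y T"
      by (rule subspace_dim_equal[OF sub[OF T] Y(2) le(2)[OF T]]) (simp add: dimT Y(1))
    then show ?thesis using dimT by (simp add: Y_def)
  qed
  have stabT: "stab S T = stab S (g \<inter> T)" if g: "flag g" and T: "T \<in> Q" for g T
  proof -
    have D: "T \<subseteq> directions S" "g \<inter> T \<subseteq> directions S" using Qsub[OF T] by auto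
    have "(\<forall>V\<in>T. fl V x = 0) \<longleftrightarrow> (\<forall>V\<in>g \<inter> T. fl V x = 0)" for x
    proof -
      have "pin x \<in> common_space S T \<longleftrightarrow> (\<forall>V\<in>T. fl V x = 0)" unfolding cse[OF T] by (auto simp: fl_def pin_in)
      moreover have "pin x \<in> common_space S T \<longleftrightarrow> (\<forall>V\<in>g \<inter> T. fl V x = 0)"
        using struct[OF g T] by (auto simp: fl_def pin_in)
      ultimately show ?thesis by blast
    qed
    then show ?thesis unfolding stab_eq[OF D(1)] stab_eq[OF D(2)] by blast
  qed
  show "\<And>T. T \<in> Q \<Longrightarrow> dim (common_space S T) = card (f - T)" using struct[OF f] by blast
  show "\<And>T. T \<in> Q \<Longrightarrow> stab S T = stab S (f \<inter> T)" using stabT[OF f] by blast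
  have zs: "zmod.subspace (stab S T)" if "T \<in> Q" for T using Qsub[OF that] stab_zsub by blast
  have sum_ge: "DIM('a) \<le> (\<Sum>T\<in>Q. dim (stab S T))"
  proof -
    have "subspace (\<Sum>T\<in>Q. span (stab S T)) \<and> dim (\<Sum>T\<in>Q. span (stab S T)) \<le> (\<Sum>T\<in>Q. dim (span (stab S T)))"
      by (rule dim_sum_le[OF finQ]) simp
    then have sp: "subspace (\<Sum>T\<in>Q. span (stab S T))" "dim (\<Sum>T\<in>Q. span (stab S T)) \<le> (\<Sum>T\<in>Q. dim (stab S T))"
      by auto
    have zspan: "zmod.subspace (span (stab S T))" for T by (intro subspace_imp_zsubspace) simp
    have "(\<Sum>T\<in>Q. stab S T) \<subseteq> (\<Sum>T\<in>Q. span (stab S T))"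
    proof (rule sum_zsubspace(3)[OF finQ zs])
      show "zmod.subspace (\<Sum>T\<in>Q. span (stab S T))" by (rule sum_zsubspace(1)[OF finQ zspan])
      show "stab S T \<subseteq> (\<Sum>T\<in>Q. span (stab S T))" if "T \<in> Q" for T
      proof -
        have "span (stab S T) \<subseteq> (\<Sum>T\<in>Q. span (stab S T))"
          by (rule sum_zsubspace(2)[OF finQ _ that]) (rule zspan)
        then show ?thesis using real_vector.span_superset[of "stab S T"] by (rule order_trans[rotated])
      qed
    qed
    then have "span (\<Sum>T\<in>Q. stab S T) \<subseteq> (\<Sum>T\<in>Q. span (stab S T))"
      using sp(1) by (rule real_vector.span_minimal)
    moreover have "\<Gamma> \<subseteq> span (\<Sum>T\<in>Q. stab S T)"
    proof (rule finite_index_span[OF zsub fi])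
      show "zmod.subspace (\<Sum>T\<in>Q. stab S T)" by (rule sum_zsubspace(1)[OF finQ]) (rule zs)
    qed
    ultimately have "dim \<Gamma> \<le> dim (\<Sum>T\<in>Q. span (stab S T))" by (intro dim_subset) auto
    then show ?thesis using sp(2) dim_lattice by simp
  qed
  \<comment> \<open>Superadditivity iterated over blocks. Each direction fails to lie in just one
    member of \<open>Q\<close>, so at every stage the two sets of directions cover the whole
    flag.\<close>
  have stab_part: "dim (stab S (g \<inter> T1)) + (\<Sum>T\<in>R. dim (stab S (g \<inter> T))) \<le> dim (stab S (g \<inter> T1 \<inter> \<Inter>R))"
    if g: "flag g" and R: "finite R" "R \<subseteq> Q" and T1: "\<And>T. T \<in> R \<Longrightarrow> g \<subseteq> T1 \<union> T" for g T1 R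
    using R T1
  proof (induction R rule: finite_induct)
    case (insert T R)
    have "dim (stab S (g \<inter> T1)) + (\<Sum>T\<in>R. dim (stab S (g \<inter> T))) \<le> dim (stab S (g \<inter> T1 \<inter> \<Inter>R))"
      using insert by auto
    moreover have "(g \<inter> T1 \<inter> \<Inter>R) \<union> (g \<inter> T) = g"
    proof
      show "g \<subseteq> (g \<inter> T1 \<inter> \<Inter>R) \<union> (g \<inter> T)"
      proof
        fix V assume V: "V \<in> g"
        then have VD: "V \<in> directions S" using flag_sub[OF g] by blast
        show "V \<in> (g \<inter> T1 \<inter> \<Inter>R) \<union> (g \<inter> T)"
        proof (cases "V \<in> T")
          case False
          then have "V \<in> T1" using insert.prems(2)[of T] V by blast
          moreover have "V \<in> T'" if "T' \<in> R" for T'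
            using un[OF VD, of T T'] False that insert.prems(1) insert.hyps(2) by blast
          ultimately show ?thesis using V by blast
        qed (use V in blast)
      qed
    qed auto
    then have "dim (stab S (g \<inter> T1 \<inter> \<Inter>R)) + dim (stab S (g \<inter> T)) \<le> dim (stab S ((g \<inter> T1 \<inter> \<Inter>R) \<inter> (g \<inter> T)))"
      by (rule stab_superadditive[OF g])
    moreover have "(g \<inter> T1 \<inter> \<Inter>R) \<inter> (g \<inter> T) = g \<inter> T1 \<inter> \<Inter>(insert T R)" by auto
    ultimately show ?case using insert.hyps by simp
  qed simp
  \<comment> \<open>The stabiliser of \<open>V\<close> contains independent copies of the
    stabilisers of all other blocks and of the part of its own block that fixes \<open>V\<close>.
    The rank equation gives the rank of the latter, and finite index makes the sum of all block
    ranks at least k.\<close>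
  have sv_le: "real (sv V) \<le> delta S T + 1 \<and> (\<Sum>T\<in>Q. dim (stab S T)) \<le> DIM('a)"
    if g: "flag g" and T: "T \<in> Q" and V: "V \<in> g - T" for g T V
  proof -
    have TV: "stab S {V} \<inter> stab S T = stab S (g \<inter> insert V T)"
      unfolding stabT[OF g T] using stab_Un[of "{V}" "g \<inter> T"] V by (simp add: Int_insert_right)
    have rest: "V \<in> T'" "g \<subseteq> T \<union> T'" if "T' \<in> Q - {T}" for T'
    proof -
      have *: "U \<in> T'" if "U \<in> g" "U \<notin> T" for U
        using un[of U T T'] flag_sub[OF g] that \<open>T' \<in> Q - {T}\<close> T by blast
      show "V \<in> T'" using * V by blast
      show "g \<subseteq> T \<union> T'" using * by blast
    qed
    have "dim (stab S (g \<inter> insert V T)) + (\<Sum>T\<in>Q - {T}. dim (stab S (g \<inter> T))) \<le> dim (stab S (g \<inter> insert V T \<inter> \<Inter>(Q - {T})))"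
      using finQ rest by (intro stab_part[OF g]) auto
    also have "\<dots> \<le> dim (stab S {V})"
    proof (rule dim_subset)
      have "V \<in> g \<inter> insert V T \<inter> \<Inter>(Q - {T})" using V rest by blast
      then show "stab S (g \<inter> insert V T \<inter> \<Inter>(Q - {T})) \<subseteq> stab S {V}" unfolding stab_def by blast
    qed
    also have "(\<Sum>T\<in>Q - {T}. dim (stab S (g \<inter> T))) = (\<Sum>T\<in>Q - {T}. dim (stab S T))"
      using stabT[OF g] by (intro sum.cong) auto
    finally have 1: "dim (stab S (g \<inter> insert V T)) + (\<Sum>T\<in>Q - {T}. dim (stab S T)) \<le> dim (stab S {V})" .
    have "V \<in> directions S - T" using V flag_sub[OF g] by blast
    from ranks[OF T this] have 2: "real (dim (stab S (g \<inter> insert V T))) = real (dim (stab S T)) - delta S T - 1"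
      unfolding TV rank_dim[OF stab_subset] .
    have 3: "(\<Sum>T\<in>Q. dim (stab S T)) = dim (stab S T) + (\<Sum>T\<in>Q - {T}. dim (stab S T))"
      by (rule sum.remove[OF finQ T])
    have "dim (stab S (g \<inter> T)) + (\<Sum>T\<in>Q - {T}. dim (stab S (g \<inter> T))) \<le> dim (stab S (g \<inter> T \<inter> \<Inter>(Q - {T})))"
      using finQ rest by (intro stab_part[OF g]) auto
    then have 4: "dim (stab S (g \<inter> T)) + (\<Sum>T\<in>Q - {T}. dim (stab S (g \<inter> T))) \<le> DIM('a)"
      using dim_stab_le order_trans by blast
    have 5: "dim (stab S (g \<inter> T)) + (\<Sum>T\<in>Q - {T}. dim (stab S (g \<inter> T))) = (\<Sum>T\<in>Q. dim (stab S T))"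
      unfolding 3 using stabT[OF g] T by (intro arg_cong2[of _ _ _ _ "(+)"] sum.cong) auto
    have "real (dim (stab S T)) - delta S T - 1 + real (\<Sum>T\<in>Q - {T}. dim (stab S T)) \<le> real (dim (stab S {V}))"
      using 1 2 by linarith
    moreover have "real (sv V) + real (dim (stab S {V})) = real DIM('a)" using sv_dim[of V] by linarith
    ultimately have "real (sv V) \<le> delta S T + 1" using 3 sum_ge by linarith
    then show ?thesis using 4 5 by simp
  qed
  have total: "(\<Sum>V\<in>g. sv V) = DIM('a) \<and> (\<forall>T\<in>Q. \<forall>V\<in>g - T. real (sv V) = delta S T + 1)" if g: "flag g" for g
  proof -
    have split: "(\<Sum>V\<in>g. F V) = (\<Sum>T\<in>Q. \<Sum>V\<in>g - T. F V)" for F :: "'a set \<Rightarrow> real"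
    proof -
      have "(\<Sum>V\<in>(\<Union>T\<in>Q. g - T). F V) = (\<Sum>T\<in>Q. \<Sum>V\<in>g - T. F V)"
      proof (rule sum.UNION_disjoint[OF finQ])
        show "\<forall>T\<in>Q. finite (g - T)" using flag_finite[OF g] by auto
        show "\<forall>T\<in>Q. \<forall>T'\<in>Q. T \<noteq> T' \<longrightarrow> (g - T) \<inter> (g - T') = {}" using disjoint[OF g] by blast
      qed
      then show ?thesis using cover[OF g] by simp
    qed
    obtain V0 where V0: "V0 \<in> g" using flag_nonempty[OF g] by blast
    obtain T0 where T0: "T0 \<in> Q" "V0 \<notin> T0" using ex[of V0] flag_sub[OF g] V0 by blast
    have le: "(\<Sum>T\<in>Q. dim (stab S T)) \<le> DIM('a)" using sv_le[OF g T0(1)] V0 T0(2) by blast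
    \<comment> \<open>The definition of delta, multiplied out. A block has positive dimension
      because it misses some direction, which lies in some flag, and the number of flag members in
      the block does not depend on the flag.\<close>
    have comp: "(\<Sum>V\<in>g - T. delta S T + 1) = real (dim (stab S T))" if T: "T \<in> Q" for T
    proof -
      obtain V where V: "V \<in> directions S" "V \<notin> T" using Qsub[OF T] by blast
      obtain g' where g': "flag g'" "V \<in> g'" using flag_containing[OF V(1)] by blast
      have "card (g' - T) > 0" using g' V flag_finite by (auto simp: card_gt_0_iff)
      moreover have "card (g' - T) = card (g - T)" using conjunct1[OF struct[OF g'(1) T]] conjunct1[OF struct[OF g T]] by simp
      ultimately have n: "card (g - T) > 0" by simp
      have "delta S T = (real (dim (stab S T)) - real (card (g - T))) / real (card (g - T))"
        unfolding delta_def rank_dim[OF stab_subset] using conjunct1[OF struct[OF g T]] by simp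
      then show ?thesis using n by (simp add: field_simps)
    qed
    have "(\<Sum>V\<in>g. real (sv V)) = (\<Sum>T\<in>Q. \<Sum>V\<in>g - T. real (sv V))" by (rule split)
    have "(\<Sum>T\<in>Q. \<Sum>V\<in>g - T. delta S T + 1) = real (\<Sum>T\<in>Q. dim (stab S T))"
      using comp by simp
    also have "\<dots> \<le> real DIM('a)" using le by linarith
    also have "\<dots> \<le> real (\<Sum>V\<in>g. sv V)"
    proof -
      have "dim (stab S g) = 0" using stab_flag[OF g] by (simp add: dim_eq_0)
      then have "DIM('a) \<le> (\<Sum>V\<in>g. sv V)" using codim_stab[OF flag_sub[OF g]] by linarith
      then show ?thesis by (simp only: of_nat_le_iff)
    qed
    also have "\<dots> = (\<Sum>T\<in>Q. \<Sum>V\<in>g - T. real (sv V))" using split[of "\<lambda>V. real (sv V)"] by simp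
    finally have ge: "(\<Sum>T\<in>Q. \<Sum>V\<in>g - T. delta S T + 1) \<le> (\<Sum>T\<in>Q. \<Sum>V\<in>g - T. real (sv V))" .
    have term_le: "(\<Sum>V\<in>g - T. real (sv V)) \<le> (\<Sum>V\<in>g - T. delta S T + 1)" if "T \<in> Q" for T
      using sv_le[OF g that] by (intro sum_mono) blast
    have eqQ: "(\<Sum>T\<in>Q. \<Sum>V\<in>g - T. real (sv V)) = (\<Sum>T\<in>Q. \<Sum>V\<in>g - T. delta S T + 1)"
      by (rule antisym[OF sum_mono[OF term_le] ge])
    have "real (sv V) = delta S T + 1" if T: "T \<in> Q" and V: "V \<in> g - T" for T V
    proof -
      have "(\<Sum>V\<in>g - T. real (sv V)) = (\<Sum>V\<in>g - T. delta S T + 1)"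
        by (rule sum_mono_inv[OF eqQ _ T finQ]) (rule term_le)
      then show ?thesis
        by (rule sum_mono_inv[OF _ _ V]) (use sv_le[OF g T] flag_finite[OF g] in auto)
    qed
    moreover have "real (\<Sum>V\<in>g. sv V) = real DIM('a)"
    proof -
      have "real (\<Sum>V\<in>g. sv V) = (\<Sum>T\<in>Q. \<Sum>V\<in>g - T. delta S T + 1)" using split[of "\<lambda>V. real (sv V)"] eqQ by simp
      also have "\<dots> = real (\<Sum>T\<in>Q. dim (stab S T))" using comp by simp
      also have "\<dots> = real DIM('a)" using le sum_ge by linarith
      finally show ?thesis .
    qed
    then have "(\<Sum>V\<in>g. sv V) = DIM('a)" by linarith
    ultimately show ?thesis by blast
  qed
  show "full_rank" unfolding full_rank_def using total by blast
  show "\<And>T V. T \<in> Q \<Longrightarrow> V \<in> f - T \<Longrightarrow> real (sv V) = delta S T + 1" using total[OF f] by blast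
qed

text \<open>Only points on the line of \<open>V\<close> in a flag have to be treated. They lie in
  the stabiliser of the block of \<open>V\<close>, and there the internal norm is bounded by a
  multiple of the single nonzero functional \<open>fl V\<close>.\<close>

lemma badly_approximable_from_diophantine:
  assumes "diophantine_cps S nrm'" and nrm': "norm_on E nrm'"
  shows "full_rank" "\<And>V. V \<in> directions S \<Longrightarrow> badly_approximable V"
proof -
  obtain Q where Q: "csr_decomposition S Q"
    "\<And>T. T \<in> Q \<Longrightarrow> diophantine_in nrm' (pin ` stab S T) (common_space S T)"
    using assms(1) unfolding diophantine_cps_def by blast
  obtain f0 where "flag f0" using flag_exists by blast
  then show fr: "full_rank" using csr_decomposition_structure(1)[OF Q(1)] by blast
  fix V assume V: "V \<in> directions S"
  obtain f where f: "flag f" "V \<in> f" using flag_containing[OF V] by blast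
  note st = csr_decomposition_structure[OF Q(1) f(1)]
  obtain T where T: "T \<in> Q" "V \<notin> T"
    using V Q(1) unfolding csr_decomposition_def decomposition_def by blast
  have TD: "T \<subseteq> directions S" using T(1) Q(1) unfolding csr_decomposition_def decomposition_def by blast
  have VfT: "V \<in> f - T" using f T by blast
  define \<delta> where "\<delta> = (real (dim (stab S T)) - real (dim (common_space S T))) / real (dim (common_space S T))"
  have "\<delta> = delta S T" unfolding \<delta>_def delta_def zrank_eq_dim[OF zsub disc stab_subset] ..
  then have \<delta>: "\<delta> = real (sv V) - 1" using st(4)[OF T(1) VfT] by simp
  have \<delta>0: "\<delta> \<ge> 0" unfolding \<delta> using sv_pos[OF V] by simp
  have sub: "pin ` stab S T \<subseteq> common_space S T" using pin_in by (auto simp: stab_def common_space_def)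
  have "\<exists>c>0. \<forall>x\<in>stab S T - {0}. c * norm x powr (- \<delta>) \<le> nrm' (pin x)"
    using Q(2)[OF T(1)] diophantine_iff[OF stab_subset stab_zsub[OF TD] sub \<delta>_def \<delta>0] by blast
  then obtain c where c: "c > 0" "\<And>x. x \<in> stab S T \<Longrightarrow> x \<noteq> 0 \<Longrightarrow> c * norm x powr (- \<delta>) \<le> nrm' (pin x)" by blast
  obtain b where b: "b > 0" "\<And>x. x \<in> E \<Longrightarrow> nrm' x \<le> b * norm x"
    using norm_on_equivalent[OF subE nrm'] by metis
  obtain C where C: "C > 0" "\<And>x t. t \<ge> 0 \<Longrightarrow> (\<And>V. V \<in> f \<Longrightarrow> \<bar>fl V x\<bar> \<le> t) \<Longrightarrow> norm (pin x) \<le> C * t"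
    using flag_norm_bound[OF f(1)] by metis
  show "badly_approximable V"
  proof (rule badly_approximable_from_line[OF fr f, of "c / (b * C)"])
    show "c / (b * C) > 0" using c b C by simp
    fix h assume h: "h \<in> stab S (f - {V})" "h \<noteq> 0"
    have fD: "f - {V} \<subseteq> directions S" using flag_sub[OF f(1)] by blast
    have "h \<in> stab S (f \<inter> T)" using h(1) T(2) unfolding stab_def by blast
    then have hT: "h \<in> stab S T" using st(3)[OF T(1)] by simp
    have "\<bar>fl V' h\<bar> \<le> \<bar>fl V h\<bar>" if "V' \<in> f" for V' using h(1) that by (cases "V' = V") (auto simp: stab_eq[OF fD])
    then have "norm (pin h) \<le> C * \<bar>fl V h\<bar>" using C(2)[of "\<bar>fl V h\<bar>" h] by simp
    then have "b * norm (pin h) \<le> b * (C * \<bar>fl V h\<bar>)" using b(1) by (intro mult_left_mono) auto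
    then have "c * norm h powr (- \<delta>) \<le> (b * C) * \<bar>fl V h\<bar>"
      using c(2)[OF hT h(2)] b(2)[OF pin_in, of h] by simp
    moreover have "norm h powr (- \<delta>) = 1 / norm h ^ (sv V - 1)"
    proof -
      have "norm h powr \<delta> = norm h ^ (sv V - 1)"
        unfolding \<delta> using h(2) sv_pos[OF V] by (subst powr_realpow[symmetric]) (auto simp: of_nat_diff)
      then show ?thesis by (simp add: powr_minus_divide)
    qed
    ultimately show "c / (b * C) \<le> \<bar>fl V h\<bar> * norm h ^ (sv V - 1)"
      using b C h(2) by (simp add: field_simps)
  qed
qed

section \<open>Patches\<close>

lemma star_pv: "\<gamma> \<in> \<Gamma> \<Longrightarrow> star S (pv \<gamma>) = pin \<gamma>"
proof -
  assume g: "\<gamma> \<in> \<Gamma>"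
  have "(THE \<delta>. \<delta> \<in> \<Gamma> \<and> pv \<delta> = pv \<gamma>) = \<gamma>"
    using g pv_inj by (intro the_equality) auto
  then show ?thesis by (simp add: star_def)
qed

lemma Lambda_iff: "x \<in> \<Lambda> \<longleftrightarrow> (\<exists>\<gamma>\<in>\<Gamma>. x = pv \<gamma> \<and> pin \<gamma> \<in> W)"
  unfolding cut_project_set_def using star_pv by auto

lemma Lambda_pv: "\<gamma> \<in> \<Gamma> \<Longrightarrow> pin \<gamma> \<in> W \<Longrightarrow> pv \<gamma> \<in> \<Lambda>"
  using Lambda_iff by blast

lemma Lambda_E: "x \<in> \<Lambda> \<Longrightarrow> (\<And>\<gamma>. \<gamma> \<in> \<Gamma> \<Longrightarrow> x = pv \<gamma> \<Longrightarrow> pin \<gamma> \<in> W \<Longrightarrow> thesis) \<Longrightarrow> thesis"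
  using Lambda_iff by blast

lemma patch_eq:
  assumes g: "g \<in> \<Gamma>"
  shows "patch S nrm r (pv g) = {(pv (g + \<gamma>), i) |\<gamma> i. \<gamma> \<in> \<Gamma> \<and> nrm (pv \<gamma>) \<le> r \<and> i \<in> labels S \<and> pin (g + \<gamma>) \<in> piece S i}"
    (is "_ = ?R")
proof (intro equalityI subsetI)
  fix p assume "p \<in> patch S nrm r (pv g)"
  then obtain y i where p: "p = (y, i)" "y \<in> \<Lambda>" "nrm (y - pv g) \<le> r" "i \<in> labels S" "star S y \<in> piece S i"
    by (auto simp: patch_def)
  obtain \<delta> where \<delta>: "\<delta> \<in> \<Gamma>" "y = pv \<delta>" using p(2) by (rule Lambda_E)
  define \<gamma> where "\<gamma> = \<delta> - g"
  have "\<gamma> \<in> \<Gamma>" using zsubspace_diff[OF zsub \<delta>(1) g] by (simp add: \<gamma>_def)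
  moreover have "g + \<gamma> = \<delta>" by (simp add: \<gamma>_def)
  moreover have "nrm (pv \<gamma>) \<le> r" using p(3) \<delta>(2) by (simp add: \<gamma>_def pv_diff)
  moreover have "pin \<delta> \<in> piece S i" using p(5) star_pv[OF \<delta>(1)] \<delta>(2) by simp
  ultimately show "p \<in> ?R" using p(1,4) \<delta>(2) by (auto intro!: exI[of _ \<gamma>])
next
  fix p assume "p \<in> ?R"
  then obtain \<gamma> i where p: "p = (pv (g + \<gamma>), i)" "\<gamma> \<in> \<Gamma>" "nrm (pv \<gamma>) \<le> r" "i \<in> labels S" "pin (g + \<gamma>) \<in> piece S i"
    by blast
  have gG: "g + \<gamma> \<in> \<Gamma>" by (rule zsubspace_add[OF zsub g p(2)])
  have "pin (g + \<gamma>) \<in> W" using W_eq p(4,5) by blast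
  then have "pv (g + \<gamma>) \<in> \<Lambda>" by (rule Lambda_pv[OF gG])
  moreover have "pv (g + \<gamma>) - pv g = pv \<gamma>" by (simp add: pv_add)
  ultimately show "p \<in> patch S nrm r (pv g)"
    unfolding patch_def p(1) using p(3-5) star_pv[OF gG] by simp
qed

text \<open>The dictionary between patches and the internal space: displacements by lattice points
  are tested against the pieces, so equal patches mean internal positions in the same cell of
  translated pieces.\<close>

lemma same_patch_iff:
  assumes g: "g \<in> \<Gamma>" and h: "h \<in> \<Gamma>"
  shows "same_patch S nrm r (pv g) (pv h) \<longleftrightarrow>
    (\<forall>\<gamma>\<in>\<Gamma>. nrm (pv \<gamma>) \<le> r \<longrightarrow> (\<forall>i\<in>labels S. pin (g + \<gamma>) \<in> piece S i \<longleftrightarrow> pin (h + \<gamma>) \<in> piece S i))"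
proof -
  define A where "A = (\<lambda>g. {(\<gamma>, i). \<gamma> \<in> \<Gamma> \<and> nrm (pv \<gamma>) \<le> r \<and> i \<in> labels S \<and> pin (g + \<gamma>) \<in> piece S i})"
  define F where "F = (\<lambda>(\<gamma>, i :: 'l). (pv (h + \<gamma>), i))"
  have im: "(\<lambda>(z, i). (z + (pv h - pv g), i)) ` patch S nrm r (pv g) = F ` A g"
  proof -
    have "patch S nrm r (pv g) = (\<lambda>(\<gamma>, i). (pv (g + \<gamma>), i)) ` A g"
      unfolding patch_eq[OF g] A_def by auto
    then have "(\<lambda>(z, i). (z + (pv h - pv g), i)) ` patch S nrm r (pv g)
        = (\<lambda>p. (\<lambda>(z, i). (z + (pv h - pv g), i)) ((\<lambda>(\<gamma>, i). (pv (g + \<gamma>), i)) p)) ` A g"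
      by (simp only: image_image)
    also have "\<dots> = F ` A g"
      by (intro image_cong refl) (auto simp: F_def pv_add)
    finally show ?thesis .
  qed
  have "patch S nrm r (pv h) = F ` A h"
    unfolding patch_eq[OF h] A_def F_def by auto
  then have "same_patch S nrm r (pv g) (pv h) \<longleftrightarrow> F ` A g = F ` A h"
    unfolding same_patch_def im by simp
  also have "\<dots> \<longleftrightarrow> A g = A h"
  proof (rule inj_on_image_eq_iff)
    show "inj_on F (\<Gamma> \<times> labels S)"
    proof (rule inj_onI, clarsimp simp: F_def)
      fix \<gamma> \<gamma>' assume *: "\<gamma> \<in> \<Gamma>" "\<gamma>' \<in> \<Gamma>" "pv (h + \<gamma>) = pv (h + \<gamma>')"
      have "h + \<gamma> = h + \<gamma>'" by (rule pv_inj[OF _ _ *(3)]) (use * h zsubspace_add[OF zsub] in auto)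
      then show "\<gamma> = \<gamma>'" by simp
    qed
  qed (auto simp: A_def)
  also have "\<dots> \<longleftrightarrow> (\<forall>\<gamma>\<in>\<Gamma>. nrm (pv \<gamma>) \<le> r \<longrightarrow> (\<forall>i\<in>labels S. pin (g + \<gamma>) \<in> piece S i \<longleftrightarrow> pin (h + \<gamma>) \<in> piece S i))"
    unfolding A_def by (auto simp: set_eq_iff)
  finally show ?thesis .
qed

lemma same_patch_window:
  assumes "g \<in> \<Gamma>" "h \<in> \<Gamma>" "same_patch S nrm r (pv g) (pv h)" "\<gamma> \<in> \<Gamma>" "nrm (pv \<gamma>) \<le> r"
  shows "pin (g + \<gamma>) \<in> W \<longleftrightarrow> pin (h + \<gamma>) \<in> W"
  using assms(3) unfolding same_patch_iff[OF assms(1,2)] W_eq using assms(4,5) by blast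

lemma center_in_patch:
  assumes "z \<in> \<Lambda>" "r \<ge> 0" "patch S nrm r z \<subseteq> patch S nrm R y"
  shows "nrm (z - y) \<le> R"
proof -
  obtain \<gamma> where \<gamma>: "\<gamma> \<in> \<Gamma>" "z = pv \<gamma>" "pin \<gamma> \<in> W" using assms(1) by (rule Lambda_E)
  obtain i where i: "i \<in> labels S" "pin \<gamma> \<in> piece S i" using \<gamma>(3) W_eq by blast
  have "(z, i) \<in> patch S nrm r z"
    using assms(1,2) i star_pv[OF \<gamma>(1)] \<gamma>(2) by (simp add: patch_def nrm_0)
  then show ?thesis using assms(3) by (auto simp: patch_def)
qed

lemma W_interior:
  obtains x0 e where "x0 \<in> W" "e > 0" "\<And>z. z \<in> E \<Longrightarrow> norm (z - x0) < e \<Longrightarrow> z \<in> W"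
proof -
  obtain w where "w \<in> W" using W_nonempty by blast
  then obtain y d where "y \<in> W" "d > 0" "\<forall>z\<in>E. norm (z - y) < d \<longrightarrow> z \<in> W"
    using polytopal_interior_near[OF W_polytopal, of w 1] by auto
  then show ?thesis using that by blast
qed

lemma W_sub: "W \<subseteq> E"
  by (rule polytopal_subset[OF W_polytopal])

lemma W_bounded:
  obtains K where "K > 0" "\<And>w. w \<in> W \<Longrightarrow> norm w \<le> K"
proof -
  obtain B where B: "\<forall>x\<in>W. norm x \<le> B"
    using compact_imp_bounded[OF polytopal_compact[OF W_polytopal]] by (auto simp: bounded_iff)
  have "norm w \<le> max B 1" if "w \<in> W" for w using B that by (simp add: le_max_iff_disj)
  then show ?thesis using that[of "max B 1"] by auto
qed

lemma Lambda_relatively_dense: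
  obtains R where "R > 0" "\<And>x. \<exists>\<gamma>\<in>\<Gamma>. norm (pv \<gamma> - pv x) \<le> R \<and> pin \<gamma> \<in> W"
proof -
  obtain x0 e where x0: "x0 \<in> W" "e > 0" "\<And>z. z \<in> E \<Longrightarrow> norm (z - x0) < e \<Longrightarrow> z \<in> W" by (rule W_interior, rule that)
  have "\<exists>R>0. \<forall>x. \<exists>\<gamma>\<in>\<Gamma>. norm (pv \<gamma> - pv x) \<le> R \<and> pin \<gamma> \<in> ball x0 e"
    using x0(1,2) W_sub by (intro hit[of _ x0]) auto
  then obtain R where R: "R > 0" "\<forall>x. \<exists>\<gamma>\<in>\<Gamma>. norm (pv \<gamma> - pv x) \<le> R \<and> pin \<gamma> \<in> ball x0 e" by (elim exE conjE)
  have "\<exists>\<gamma>\<in>\<Gamma>. norm (pv \<gamma> - pv x) \<le> R \<and> pin \<gamma> \<in> W" for x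
  proof -
    obtain \<gamma> where \<gamma>: "\<gamma> \<in> \<Gamma>" "norm (pv \<gamma> - pv x) \<le> R" "pin \<gamma> \<in> ball x0 e" using R(2) by blast
    then have "pin \<gamma> \<in> W" using x0(3)[OF pin_in] by (simp add: dist_norm norm_minus_commute)
    then show ?thesis using \<gamma> by blast
  qed
  then show ?thesis using that R(1) by blast
qed

subsection \<open>Counting lattice points\<close>

text \<open>Pairings with a basis of the intersection of \<open>span L\<close> with the physical
  space range over intervals of length of order r, those with \<open>J\<close> over bounded ones;
  together they separate \<open>span L\<close>. The exponent is therefore the dimension of that
  intersection.\<close>

lemma count_bound:
  assumes L: "L \<subseteq> \<Gamma>" "zmod.subspace L" and J: "finite J"
    and sep: "\<And>x. x \<in> span L \<Longrightarrow> (\<And>c. c \<in> J \<Longrightarrow> c \<bullet> pin x = 0) \<Longrightarrow> pin x = 0"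
    and K: "K \<ge> 0" and q: "dim (span L \<inter> P) \<le> q"
  shows "\<exists>C>0. \<forall>r\<ge>1. finite {\<gamma>\<in>L. norm (pv \<gamma>) \<le> r \<and> norm (pin \<gamma>) \<le> K} \<and>
     real (card {\<gamma>\<in>L. norm (pv \<gamma>) \<le> r \<and> norm (pin \<gamma>) \<le> K}) \<le> C * r ^ q"
proof -
  obtain A where A: "A \<subseteq> span L \<inter> P" "independent A" "span L \<inter> P \<subseteq> span A" "card A = dim (span L \<inter> P)"
    using basis_exists by metis
  have finA: "finite A" using A(2) by (simp add: finiteI_independent)
  define I where "I = ({True} \<times> A) \<union> ({False} \<times> J)"
  define \<phi> where "\<phi> = (\<lambda>(t, c) x. if t then c \<bullet> pv x else c \<bullet> pin x)"
  have finI: "finite I" using finA J by (simp add: I_def)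
  have lin: "linear (\<phi> i)" for i
    by (cases i) (auto simp: \<phi>_def linear_iff pv_add pin_add pv_scale pin_scale inner_simps)
  have "\<exists>C>0. \<forall>R. (\<forall>i\<in>I. R i \<ge> 0) \<longrightarrow> finite {g\<in>L. \<forall>i\<in>I. \<bar>\<phi> i g\<bar> \<le> R i} \<and>
    real (card {g\<in>L. \<forall>i\<in>I. \<bar>\<phi> i g\<bar> \<le> R i}) \<le> (\<Prod>i\<in>I. C * R i + 2)"
  proof (rule lattice_count_bound[OF L(2) discrete_subset[OF disc L(1)] _ _ finI lin])
    show "subspace (span L)" by simp
    show "L \<subseteq> span L" by (rule real_vector.span_superset)
    fix x assume x: "x \<in> span L" "\<And>i. i \<in> I \<Longrightarrow> \<phi> i x = 0"
    have "c \<bullet> pin x = 0" if "c \<in> J" for c using x(2)[of "(False, c)"] that by (simp add: I_def \<phi>_def)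
    then have "pin x = 0" using sep[OF x(1)] by blast
    then have xP: "pv x = x" using pv_pin[of x] by simp
    then have "x \<in> P" using pv_in[of x] by simp
    then have xA: "x \<in> span A" using x(1) A(3) by blast
    have "a \<bullet> x = 0" if "a \<in> A" for a using x(2)[of "(True, a)"] that xP by (simp add: I_def \<phi>_def)
    then have "A \<subseteq> {y. y \<bullet> x = 0}" by auto
    moreover have "subspace {y. y \<bullet> x = 0}" by (auto simp: subspace_def inner_simps)
    ultimately have "span A \<subseteq> {y. y \<bullet> x = 0}" by (rule real_vector.span_minimal)
    then have "x \<bullet> x = 0" using xA by blast
    then show "x = 0" by simp
  qed
  then obtain C where C: "C > 0" "\<forall>R. (\<forall>i\<in>I. R i \<ge> 0) \<longrightarrow> finite {g\<in>L. \<forall>i\<in>I. \<bar>\<phi> i g\<bar> \<le> R i} \<and>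
    real (card {g\<in>L. \<forall>i\<in>I. \<bar>\<phi> i g\<bar> \<le> R i}) \<le> (\<Prod>i\<in>I. C * R i + 2)" by (elim exE conjE)
  define D where "D = (\<Prod>a\<in>A. C * norm a + 2) * (\<Prod>c\<in>J. C * (norm c * K) + 2)"
  have D: "D > 0" unfolding D_def using C(1) K by (intro mult_pos_pos prod_pos) (auto intro!: add_nonneg_pos)
  have "finite {\<gamma>\<in>L. norm (pv \<gamma>) \<le> r \<and> norm (pin \<gamma>) \<le> K} \<and>
     real (card {\<gamma>\<in>L. norm (pv \<gamma>) \<le> r \<and> norm (pin \<gamma>) \<le> K}) \<le> D * r ^ q" if r: "r \<ge> 1" for r
  proof -
    define R where "R = (\<lambda>(t, c). if t then norm (c::'a) * r else norm c * K)"
    have R0: "\<forall>i\<in>I. R i \<ge> 0" using r K by (auto simp: R_def)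
    have sub: "{\<gamma>\<in>L. norm (pv \<gamma>) \<le> r \<and> norm (pin \<gamma>) \<le> K} \<subseteq> {g\<in>L. \<forall>i\<in>I. \<bar>\<phi> i g\<bar> \<le> R i}"
    proof clarify
      fix \<gamma> t c assume *: "norm (pv \<gamma>) \<le> r" "norm (pin \<gamma>) \<le> K"
      have "\<bar>c \<bullet> pv \<gamma>\<bar> \<le> norm c * r"
        using Cauchy_Schwarz_ineq2[of c "pv \<gamma>"] mult_left_mono[OF *(1), of "norm c"] by simp
      moreover have "\<bar>c \<bullet> pin \<gamma>\<bar> \<le> norm c * K"
        using Cauchy_Schwarz_ineq2[of c "pin \<gamma>"] mult_left_mono[OF *(2), of "norm c"] by simp
      ultimately show "\<bar>\<phi> (t, c) \<gamma>\<bar> \<le> R (t, c)" by (simp add: \<phi>_def R_def)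
    qed
    have fin: "finite {g\<in>L. \<forall>i\<in>I. \<bar>\<phi> i g\<bar> \<le> R i}"
      and le: "real (card {g\<in>L. \<forall>i\<in>I. \<bar>\<phi> i g\<bar> \<le> R i}) \<le> (\<Prod>i\<in>I. C * R i + 2)"
      using C(2) R0 by blast+
    have "(\<Prod>i\<in>I. C * R i + 2) = (\<Prod>a\<in>A. C * (norm a * r) + 2) * (\<Prod>c\<in>J. C * (norm c * K) + 2)"
    proof -
      have "(\<Prod>i\<in>I. C * R i + 2) = (\<Prod>i\<in>{True} \<times> A. C * R i + 2) * (\<Prod>i\<in>{False} \<times> J. C * R i + 2)"
        unfolding I_def using finA J by (intro prod.union_disjoint) auto
      moreover have "{t} \<times> X = Pair t ` X" for t :: bool and X :: "'a set" by auto
      ultimately show ?thesis by (simp add: prod.reindex inj_on_def R_def)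
    qed
    also have "\<dots> \<le> ((\<Prod>a\<in>A. C * norm a + 2) * r ^ card A) * (\<Prod>c\<in>J. C * (norm c * K) + 2)"
    proof (rule mult_right_mono)
      have "(\<Prod>a\<in>A. C * (norm a * r) + 2) \<le> (\<Prod>a\<in>A. (C * norm a + 2) * r)"
        using C(1) r by (intro prod_mono) (auto simp: algebra_simps)
      also have "\<dots> = (\<Prod>a\<in>A. C * norm a + 2) * r ^ card A" by (simp add: prod.distrib)
      finally show "(\<Prod>a\<in>A. C * (norm a * r) + 2) \<le> (\<Prod>a\<in>A. C * norm a + 2) * r ^ card A" .
      show "(\<Prod>c\<in>J. C * (norm c * K) + 2) \<ge> 0" using C(1) K by (intro prod_nonneg) auto
    qed
    also have "\<dots> = D * r ^ card A" by (simp add: D_def)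
    also have "\<dots> \<le> D * r ^ q" using D r q A(4) by (intro mult_left_mono power_increasing) auto
    finally have "(\<Prod>i\<in>I. C * R i + 2) \<le> D * r ^ q" .
    then show ?thesis using finite_subset[OF sub fin] card_mono[OF fin sub] le by linarith
  qed
  then show ?thesis using D by blast
qed

lemma count_box:
  assumes K: "K \<ge> 0"
  shows "\<exists>C>0. \<forall>r\<ge>1. finite {\<gamma>\<in>\<Gamma>. norm (pv \<gamma>) \<le> r \<and> norm (pin \<gamma>) \<le> K} \<and>
     real (card {\<gamma>\<in>\<Gamma>. norm (pv \<gamma>) \<le> r \<and> norm (pin \<gamma>) \<le> K}) \<le> C * r ^ dim P"
proof (rule count_bound[OF subset_refl zsub finite_Basis _ K])
  fix x assume "\<And>c. c \<in> Basis \<Longrightarrow> c \<bullet> pin x = 0"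
  then show "pin x = 0" by (metis euclidean_all_zero_iff inner_commute)
qed (simp add: spanG)

text \<open>The rank drops by 1 in the exponent because a nonzero lattice point never lies in the
  physical space, so that space meets the span of the line stabiliser in a proper subspace.\<close>

lemma count_line:
  assumes f: "flag f" "V \<in> f" and ne: "stab S (f - {V}) \<noteq> {0}" and K: "K \<ge> 0"
  shows "\<exists>C>0. \<forall>r\<ge>1. finite {\<gamma>\<in>stab S (f - {V}). norm (pv \<gamma>) \<le> r \<and> norm (pin \<gamma>) \<le> K} \<and>
     real (card {\<gamma>\<in>stab S (f - {V}). norm (pv \<gamma>) \<le> r \<and> norm (pin \<gamma>) \<le> K}) \<le> C * r ^ (dim (stab S (f - {V})) - 1)"
proof -
  let ?L = "stab S (f - {V})"
  have fD: "f - {V} \<subseteq> directions S" using flag_sub[OF f(1)] by blast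
  have spL: "fl V' x = 0" if "x \<in> span ?L" "V' \<in> f" "V' \<noteq> V" for x V'
  proof -
    have "span ?L \<subseteq> {x. fl V' x = 0}"
      using that(2,3) by (intro real_vector.span_minimal) (auto simp: stab_eq[OF fD] subspace_def fl_add fl_scale)
    then show ?thesis using that(1) by blast
  qed
  have zero: "pin x = 0" if "x \<in> span ?L" "fl V x = 0" for x
  proof (rule flag_separates[OF f(1) pin_in])
    fix V' assume "V' \<in> f"
    then show "nv V' \<bullet> pin x = 0" using spL[OF that(1), of V'] that(2) by (cases "V' = V") (auto simp: fl_def)
  qed
  obtain l where l: "l \<in> ?L" "l \<noteq> 0" using ne zmod.subspace_0[OF stab_zsub[OF fD]] by blast
  have "l \<notin> P" using pin_P[of l] pin_0D[of l] l stab_subset by blast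
  moreover have "l \<in> span ?L" using l(1) by (rule real_vector.span_base)
  ultimately have "span ?L \<inter> P \<subset> span ?L" by blast
  moreover have e1: "span (span ?L \<inter> P) = span ?L \<inter> P"
    by (subst real_vector.span_eq_iff) (simp add: subspace_inter subP)
  moreover have e2: "span (span ?L) = span ?L" by (rule real_vector.span_span)
  ultimately have "span (span ?L \<inter> P) \<subset> span (span ?L)" by (simp only: e1 e2)
  then have "dim (span ?L \<inter> P) < dim (span ?L)" by (rule dim_psubset)
  then have q: "dim (span ?L \<inter> P) \<le> dim ?L - 1" by simp
  show ?thesis
  proof (rule count_bound[OF stab_subset stab_zsub[OF fD] _ _ K q, of "{nv V}"])
    fix x assume "x \<in> span ?L" "\<And>c. c \<in> {nv V} \<Longrightarrow> c \<bullet> pin x = 0"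
    then show "pin x = 0" using zero[of x] by (simp add: fl_def)
  qed simp
qed

section \<open>Linear repetitivity bounds the number of patches\<close>

lemma linearly_repetitive_imp_low_complexity:
  assumes "linearly_repetitive S nrm"
  shows "low_complexity S nrm"
proof -
  obtain C where C: "C > 0" and ev: "\<forall>\<^sub>F r in at_top. \<forall>y\<in>\<Lambda>. \<forall>x\<in>\<Lambda>.
        \<exists>z\<in>\<Lambda>. same_patch S nrm r x z \<and> patch S nrm r z \<subseteq> patch S nrm (C * r) y"
    using assms unfolding linearly_repetitive_def by blast
  obtain a b where ab: "a > 0" "\<And>x. a * norm (pv x) \<le> nrm (pv x)" using nrm_bounds by metis
  obtain K where K: "K > 0" "\<And>w. w \<in> W \<Longrightarrow> norm w \<le> K" by (rule W_bounded, rule that)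
  obtain g0 where g0: "g0 \<in> \<Gamma>" "pin g0 \<in> W" using Lambda_relatively_dense by blast
  define y where "y = pv g0"
  have y: "y \<in> \<Lambda>" using Lambda_pv[OF g0] by (simp add: y_def)
  obtain D where D: "D > 0" "\<forall>r\<ge>1. finite {\<gamma>\<in>\<Gamma>. norm (pv \<gamma>) \<le> r \<and> norm (pin \<gamma>) \<le> K} \<and>
     real (card {\<gamma>\<in>\<Gamma>. norm (pv \<gamma>) \<le> r \<and> norm (pin \<gamma>) \<le> K}) \<le> D * r ^ dim P"
    using count_box[of K] K(1) by (auto simp: less_imp_le)
  \<comment> \<open>All patches of radius r have copies centred in one patch of radius
    \<open>C * r\<close> about \<open>y\<close>; \<open>B * r\<close> bounds the distance of these
    centres from the origin.\<close>
  define B where "B = C / a + norm y + 1"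
  have B1: "B \<ge> 1" using C ab(1) by (simp add: B_def)
  have main: "real (num_patches S nrm r) \<le> D * B ^ dim P * r ^ dim P"
    if r: "r \<ge> 1" and rep: "\<forall>y\<in>\<Lambda>. \<forall>x\<in>\<Lambda>. \<exists>z\<in>\<Lambda>. same_patch S nrm r x z \<and> patch S nrm r z \<subseteq> patch S nrm (C * r) y" for r
  proof -
    let ?rel = "{(x, y). x \<in> \<Lambda> \<and> y \<in> \<Lambda> \<and> same_patch S nrm r x y}"
    define Z where "Z = pv ` {\<gamma>\<in>\<Gamma>. norm (pv \<gamma>) \<le> B * r \<and> norm (pin \<gamma>) \<le> K}"
    have Br: "B * r \<ge> 1" using B1 r mult_mono[of 1 B 1 r] by simp
    have fin: "finite {\<gamma>\<in>\<Gamma>. norm (pv \<gamma>) \<le> B * r \<and> norm (pin \<gamma>) \<le> K}"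
      and le: "real (card {\<gamma>\<in>\<Gamma>. norm (pv \<gamma>) \<le> B * r \<and> norm (pin \<gamma>) \<le> K}) \<le> D * (B * r) ^ dim P"
      using D(2) Br by blast+
    have finZ: "finite Z" unfolding Z_def using fin by simp
    have sp: "same_patch S nrm r u v \<longleftrightarrow> same_patch S nrm r v u" "same_patch S nrm r u u"
      "same_patch S nrm r u v \<Longrightarrow> same_patch S nrm r v w \<Longrightarrow> same_patch S nrm r u w"
      if uvw: "u \<in> \<Lambda>" "v \<in> \<Lambda>" "w \<in> \<Lambda>" for u v w
    proof -
      obtain a b c where abc: "a \<in> \<Gamma>" "b \<in> \<Gamma>" "c \<in> \<Gamma>" "u = pv a" "v = pv b" "w = pv c"
        using uvw Lambda_iff by metis
      show "same_patch S nrm r u v \<longleftrightarrow> same_patch S nrm r v u" "same_patch S nrm r u u"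
        "same_patch S nrm r u v \<Longrightarrow> same_patch S nrm r v w \<Longrightarrow> same_patch S nrm r u w"
        unfolding abc(4-6) using abc(1-3) by (auto simp: same_patch_iff)
    qed
    have "\<Lambda> // ?rel \<subseteq> (\<lambda>z. ?rel `` {z}) ` Z"
    proof
      fix c assume "c \<in> \<Lambda> // ?rel"
      then obtain x where x: "x \<in> \<Lambda>" "c = ?rel `` {x}" by (auto simp: quotient_def)
      obtain z where z: "z \<in> \<Lambda>" "same_patch S nrm r x z" "patch S nrm r z \<subseteq> patch S nrm (C * r) y"
        using rep y x(1) by blast
      have "?rel `` {x} = ?rel `` {z}"
        using x(1) z(1,2) sp by blast
      moreover have "z \<in> Z"
      proof -
        obtain \<gamma> where \<gamma>: "\<gamma> \<in> \<Gamma>" "z = pv \<gamma>" "pin \<gamma> \<in> W" using z(1) by (rule Lambda_E)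
        have "nrm (z - y) \<le> C * r" using center_in_patch[OF z(1) _ z(3)] r by simp
        then have "a * norm (pv \<gamma> - y) \<le> C * r"
          using ab(2)[of "\<gamma> - g0"] by (simp add: \<gamma>(2) y_def pv_diff)
        then have "norm (pv \<gamma> - y) \<le> C / a * r" using ab(1) by (simp add: field_simps)
        then have "norm (pv \<gamma>) \<le> C / a * r + norm y" using norm_triangle_sub[of "pv \<gamma>" y] by simp
        also have "\<dots> \<le> B * r" using r mult_left_mono[of 1 r "norm y"] by (simp add: B_def algebra_simps)
        finally show ?thesis using \<gamma> K(2) by (auto simp: Z_def)
      qed
      ultimately show "c \<in> (\<lambda>z. ?rel `` {z}) ` Z" using x(2) by blast
    qed
    then have "num_patches S nrm r \<le> card ((\<lambda>z. ?rel `` {z}) ` Z)"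
      unfolding num_patches_def using finZ by (intro card_mono) auto
    also have "\<dots> \<le> card Z" by (rule card_image_le[OF finZ])
    also have "\<dots> \<le> card {\<gamma>\<in>\<Gamma>. norm (pv \<gamma>) \<le> B * r \<and> norm (pin \<gamma>) \<le> K}"
      unfolding Z_def by (rule card_image_le[OF fin])
    finally show ?thesis using le by (simp add: power_mult_distrib mult.assoc)
  qed
  have "\<forall>\<^sub>F r in at_top. real (num_patches S nrm r) \<le> D * B ^ dim P * r ^ dim P"
    using ev eventually_ge_at_top[of "1::real"] by eventually_elim (rule main)
  then show ?thesis unfolding low_complexity_def using D(1) B1 by (intro exI[of _ "D * B ^ dim P"]) auto
qed

subsection \<open>Patches determine the internal position\<close>

text \<open>A point of the window extremal in direction \<open>u\<close> has interior points of the
  window nearby, and shifting one of them by \<open>u\<close> passes the maximum of the pairing with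
  \<open>u\<close>. The outer radius \<open>2 * d\<close> tolerates errors in both the position and
  the displacement.\<close>

lemma window_separates:
  assumes u: "u \<in> E" "u \<noteq> 0"
  shows "\<exists>p d. p \<in> E \<and> d > 0 \<and> (\<forall>z\<in>E. norm (z - p) < d \<longrightarrow> z \<in> W) \<and> (\<forall>z. norm (z - (p + u)) < 2 * d \<longrightarrow> z \<notin> W)"
proof -
  have comp: "compact W" by (rule polytopal_compact[OF W_polytopal])
  have "continuous_on W (\<lambda>w. u \<bullet> w)" by (intro continuous_intros)
  then obtain w where w: "w \<in> W" "\<forall>v\<in>W. u \<bullet> v \<le> u \<bullet> w"
    using continuous_attains_sup[OF comp W_nonempty] by blast
  have nu: "norm u > 0" using u(2) by simp
  obtain y d where y: "y \<in> W" "norm (y - w) < norm u" "d > 0" "\<forall>z\<in>E. norm (z - y) < d \<longrightarrow> z \<in> W"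
    using polytopal_interior_near[OF W_polytopal w(1) nu] by blast
  have "u \<bullet> (w - y) \<le> norm u * norm (w - y)" by (rule norm_cauchy_schwarz)
  also have "\<dots> < norm u * norm u" using y(2) nu by (simp add: norm_minus_commute)
  also have "\<dots> = u \<bullet> u" by (simp add: power2_norm_eq_inner flip: power2_eq_square)
  finally have "u \<bullet> w < u \<bullet> (y + u)" by (simp add: inner_simps)
  then have "y + u \<notin> W" using w(2) by force
  then obtain d' where d': "d' > 0" "\<forall>z. norm (z - (y + u)) < d' \<longrightarrow> z \<notin> W"
    using outside_ball[OF polytopal_closed[OF W_polytopal]] by blast
  show ?thesis
    using y d' W_sub by (intro exI[of _ y] exI[of _ "min d (d' / 2)"]) auto
qed

text \<open>Internal displacements of norm between \<open>e\<close> and \<open>2 * K\<close> form a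
  compact set, covered by finitely many of the balls of \<open>window_separates\<close>. A bounded
  lattice displacement then puts one of the two points inside the window and the other
  outside.\<close>

lemma patch_determines_position:
  assumes e: "e > 0"
  obtains r0 where "r0 > 0" "\<And>g h r. g \<in> \<Gamma> \<Longrightarrow> h \<in> \<Gamma> \<Longrightarrow> pin g \<in> W \<Longrightarrow> pin h \<in> W \<Longrightarrow> r \<ge> r0 \<Longrightarrow>
     same_patch S nrm r (pv g) (pv h) \<Longrightarrow> norm (pin h - pin g) < e"
proof -
  obtain K where K: "K > 0" "\<And>w. w \<in> W \<Longrightarrow> norm w \<le> K" by (rule W_bounded, rule that)
  obtain a b where ab: "b > 0" "\<And>x. nrm (pv x) \<le> b * norm (pv x)" using nrm_bounds by metis
  define U where "U = E \<inter> (cball 0 (2 * K) - ball 0 e)"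
  have compU: "compact U" unfolding U_def
    by (intro closed_Int_compact closed_subspace subE compact_diff compact_cball open_ball)
  have "\<exists>p d. u \<in> U \<longrightarrow> p \<in> E \<and> d > 0 \<and> (\<forall>z\<in>E. norm (z - p) < d \<longrightarrow> z \<in> W) \<and> (\<forall>z. norm (z - (p + u)) < 2 * d \<longrightarrow> z \<notin> W)" for u
  proof (cases "u \<in> U")
    case True
    then have "u \<in> E" "u \<noteq> 0" using e by (auto simp: U_def)
    then show ?thesis using window_separates[of u] by blast
  qed auto
  then obtain p d where pd: "\<And>u. u \<in> U \<Longrightarrow> p u \<in> E \<and> d u > 0 \<and> (\<forall>z\<in>E. norm (z - p u) < d u \<longrightarrow> z \<in> W) \<and>
      (\<forall>z. norm (z - (p u + u)) < 2 * d u \<longrightarrow> z \<notin> W)" by metis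
  have "U \<subseteq> (\<Union>u\<in>U. ball u (d u))" using pd by auto
  then obtain F where F: "F \<subseteq> U" "finite F" "U \<subseteq> (\<Union>u\<in>F. ball u (d u))"
    using compactE_image[OF compU, of U "\<lambda>u. ball u (d u)"] by auto
  have "\<exists>R>0. \<forall>q\<in>E. norm q \<le> K \<longrightarrow> (\<exists>\<gamma>\<in>\<Gamma>. norm (pv \<gamma>) \<le> R \<and> q + pin \<gamma> \<in> ball (p u) (d u))" if "u \<in> U" for u
    using pd[OF that] by (intro hit_bounded[of _ "p u"]) auto
  then obtain R where R: "\<And>u. u \<in> U \<Longrightarrow> R u > 0 \<and> (\<forall>q\<in>E. norm q \<le> K \<longrightarrow> (\<exists>\<gamma>\<in>\<Gamma>. norm (pv \<gamma>) \<le> R u \<and> q + pin \<gamma> \<in> ball (p u) (d u)))"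
    by metis
  define r0 where "r0 = 1 + b * (\<Sum>u\<in>F. R u)"
  have Rpos: "R u \<ge> 0" if "u \<in> F" for u using R[of u] that F(1) by (auto intro: less_imp_le)
  have r0: "r0 > 0" unfolding r0_def using ab(1) Rpos by (intro add_pos_nonneg mult_nonneg_nonneg sum_nonneg) auto
  show ?thesis
  proof (rule that[OF r0])
    fix g h r assume gh: "g \<in> \<Gamma>" "h \<in> \<Gamma>" "pin g \<in> W" "pin h \<in> W" "r \<ge> r0" "same_patch S nrm r (pv g) (pv h)"
    show "norm (pin h - pin g) < e"
    proof (rule ccontr)
      assume ge: "\<not> norm (pin h - pin g) < e"
      define v where "v = pin h - pin g"
      have "norm v \<le> 2 * K" using norm_triangle_ineq4[of "pin h" "pin g"] K(2)[OF gh(3)] K(2)[OF gh(4)]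
        unfolding v_def by linarith
      moreover have "v \<in> E" unfolding v_def by (rule subspace_diff[OF subE pin_in pin_in])
      moreover have "\<not> norm v < e" using ge by (simp add: v_def)
      ultimately have "v \<in> U" by (simp add: U_def)
      then obtain u where u: "u \<in> F" "norm (v - u) < d u"
        using F(3) by (auto simp: dist_norm norm_minus_commute)
      have uU: "u \<in> U" using u(1) F(1) by blast
      obtain \<gamma> where \<gamma>: "\<gamma> \<in> \<Gamma>" "norm (pv \<gamma>) \<le> R u" "pin g + pin \<gamma> \<in> ball (p u) (d u)"
        using R[OF uU] pin_in K(2)[OF gh(3)] by blast
      have near: "norm (pin g + pin \<gamma> - p u) < d u" using \<gamma>(3) by (simp add: dist_norm norm_minus_commute)
      then have inW: "pin (g + \<gamma>) \<in> W" using pd[OF uU] subspace_add[OF subE pin_in pin_in] by (simp add: pin_add)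
      have eq: "pin (h + \<gamma>) - (p u + u) = (pin g + pin \<gamma> - p u) + (v - u)" by (simp add: v_def pin_add)
      then have "norm (pin (h + \<gamma>) - (p u + u)) < 2 * d u"
        unfolding eq using norm_triangle_ineq[of "pin g + pin \<gamma> - p u" "v - u"] near u(2) by linarith
      then have notW: "pin (h + \<gamma>) \<notin> W" using pd[OF uU] by blast
      have "nrm (pv \<gamma>) \<le> b * norm (pv \<gamma>)" by (rule ab(2))
      also have "\<dots> \<le> b * (\<Sum>u\<in>F. R u)"
        using \<gamma>(2) member_le_sum[of u F R] u(1) Rpos F(2) ab(1) by (intro mult_left_mono) auto
      also have "\<dots> \<le> r" using gh(5) by (simp add: r0_def)
      finally have "nrm (pv \<gamma>) \<le> r" .
      then show False using same_patch_window[OF gh(1,2,6) \<gamma>(1)] inW notW by blast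
    qed
  qed
qed

section \<open>Consequences of linear repetitivity\<close>

lemma flag_prescribed:
  assumes "flag f"
  shows "\<exists>p\<in>E. \<forall>V\<in>f. nv V \<bullet> p = c V"
proof -
  have fD: "f \<subseteq> directions S" by (rule flag_sub[OF assms])
  have "\<exists>p\<in>span (nv ` f). \<forall>a\<in>nv ` f. a \<bullet> p = c (the_inv_into f nv a)"
    using assms by (intro dual_vector_exists) (simp add: flag_def)
  then show ?thesis using assms the_inv_into_f_f[OF nv_inj_on[OF fD]] by (auto simp: flag_def)
qed

lemma flag_slab_hit:
  assumes f: "flag f" and lt: "\<And>V. V \<in> f \<Longrightarrow> lo V < up V"
  shows "\<exists>\<gamma>\<in>\<Gamma>. \<forall>V\<in>f. lo V < fl V \<gamma> \<and> fl V \<gamma> < up V"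
proof -
  define U where "U = (\<Inter>V\<in>f. {p. lo V < nv V \<bullet> p} \<inter> {p. nv V \<bullet> p < up V})"
  have "open U"
    unfolding U_def by (intro open_INT flag_finite[OF f] ballI open_Int open_halfspace_gt open_halfspace_lt)
  moreover obtain p where p: "p \<in> E" "\<forall>V\<in>f. nv V \<bullet> p = (lo V + up V) / 2"
    using flag_prescribed[OF f, of "\<lambda>V. (lo V + up V) / 2"] by blast
  have "lo V < nv V \<bullet> p \<and> nv V \<bullet> p < up V" if "V \<in> f" for V
  proof -
    have "nv V \<bullet> p = (lo V + up V) / 2" using p(2) that by blast
    then have "nv V \<bullet> p * 2 = lo V + up V" by simp
    then show ?thesis using lt[OF that] by linarith
  qed
  then have "p \<in> U" unfolding U_def by auto
  ultimately obtain \<gamma> where "\<gamma> \<in> \<Gamma>" "pin \<gamma> \<in> U" using dense[of U p] p(1) by blast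
  then show ?thesis by (intro bexI[of _ \<gamma>]) (auto simp: U_def fl_def)
qed

text \<open>Hyperplanes of the directions in a flag cut out parallelepipeds. By linear repetitivity the
  points of the cut and project set with internal position in such a parallelepiped are
  \<open>O(r)\<close>-dense, and so are those in any of its translates. Packing disjoint translates into a bounded
  region shows that the volume is at least of order \<open>r\<^sup>-\<^sup>d\<close>.\<close>

lemma translates_bound:
  assumes f: "flag f" and q: "q \<ge> 0"
  shows "\<exists>c>0. \<forall>R\<ge>1. \<forall>lo up. (\<forall>V\<in>f. 0 < up V - lo V \<and> up V - lo V \<le> 1 \<and> \<bar>lo V\<bar> \<le> q) \<longrightarrow>
    (\<forall>x. \<exists>h\<in>\<Gamma>. norm (pv h - pv x) \<le> R \<and> (\<forall>V\<in>f. lo V \<le> fl V h \<and> fl V h \<le> up V)) \<longrightarrow>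
    c \<le> R ^ dim P * (\<Prod>V\<in>f. up V - lo V)"
proof -
  have finf: "finite f" by (rule flag_finite[OF f])
  obtain Cf where Cf: "Cf > 0" "\<And>x t. t \<ge> 0 \<Longrightarrow> (\<And>V. V \<in> f \<Longrightarrow> \<bar>fl V x\<bar> \<le> t) \<Longrightarrow> norm (pin x) \<le> Cf * t"
    using flag_norm_bound[OF f] by metis
  define K where "K = Cf * (q + 10)"
  have K: "K \<ge> 0" using Cf(1) q by (simp add: K_def)
  obtain D where D: "D > 0" "\<forall>r\<ge>1. finite {\<gamma>\<in>\<Gamma>. norm (pv \<gamma>) \<le> r \<and> norm (pin \<gamma>) \<le> K} \<and>
     real (card {\<gamma>\<in>\<Gamma>. norm (pv \<gamma>) \<le> r \<and> norm (pin \<gamma>) \<le> K}) \<le> D * r ^ dim P"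
    using count_box[OF K] by blast
  have main: "1 / D \<le> R ^ dim P * (\<Prod>V\<in>f. up V - lo V)"
    if R: "R \<ge> 1" and lu: "\<forall>V\<in>f. 0 < up V - lo V \<and> up V - lo V \<le> 1 \<and> \<bar>lo V\<bar> \<le> q"
      and hit: "\<forall>x. \<exists>h\<in>\<Gamma>. norm (pv h - pv x) \<le> R \<and> (\<forall>V\<in>f. lo V \<le> fl V h \<and> fl V h \<le> up V)"
    for R lo up
  proof -
    define w where "w = (\<lambda>V. up V - lo V)"
    have w: "0 < w V" "w V \<le> 1" "\<bar>lo V\<bar> \<le> q" if "V \<in> f" for V using lu that by (auto simp: w_def)
    define m where "m = (\<lambda>V. nat \<lceil>1 / w V\<rceil>)"
    define \<F> where "\<F> = Pi\<^sub>E f (\<lambda>V. {..<m V})"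
    \<comment> \<open>A grid with spacing twice the width, approximated by lattice points up to half
      a width: the translated slabs have length \<open>3 / 2\<close> widths and stay
      disjoint.\<close>
    have "\<exists>\<tau>\<in>\<Gamma>. \<forall>V\<in>f. 2 * real (j V) * w V < fl V \<tau> \<and> fl V \<tau> < 2 * real (j V) * w V + w V / 2" for j :: "'a set \<Rightarrow> nat"
      using w by (intro flag_slab_hit[OF f]) auto
    then obtain \<tau> where \<tau>: "\<And>j. \<tau> j \<in> \<Gamma>"
      "\<And>j V. V \<in> f \<Longrightarrow> 2 * real (j V) * w V < fl V (\<tau> j) \<and> fl V (\<tau> j) < 2 * real (j V) * w V + w V / 2" by metis
    \<comment> \<open>The translation \<open>\<tau> j\<close> may be far away in the physical space.
      Looking for a visit near \<open>- \<tau> j\<close> brings the translated point back to within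
      \<open>R\<close> of the origin, so all of them are counted in one region.\<close>
    have "\<exists>h\<in>\<Gamma>. norm (pv h - pv (- \<tau> j)) \<le> R \<and> (\<forall>V\<in>f. lo V \<le> fl V h \<and> fl V h \<le> up V)" for j
      using hit by blast
    then obtain h where h: "\<And>j. h j \<in> \<Gamma>" "\<And>j. norm (pv (h j) - pv (- \<tau> j)) \<le> R"
      "\<And>j V. V \<in> f \<Longrightarrow> lo V \<le> fl V (h j) \<and> fl V (h j) \<le> up V" by metis
    define k where "k = (\<lambda>j. h j + \<tau> j)"
    have k_fl: "lo V + 2 * real (j V) * w V < fl V (k j) \<and> fl V (k j) < lo V + 2 * real (j V) * w V + 3 / 2 * w V" if "V \<in> f" for V j
      using h(3)[OF that, of j] \<tau>(2)[OF that, of j] by (simp add: k_def fl_add w_def field_simps)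
    have k_in: "k j \<in> {\<gamma>\<in>\<Gamma>. norm (pv \<gamma>) \<le> R \<and> norm (pin \<gamma>) \<le> K}" if j: "j \<in> \<F>" for j
    proof -
      have "norm (pv (k j)) \<le> R" using h(2)[of j] by (simp add: k_def pv_add pv_minus)
      moreover have "norm (pin (k j)) \<le> K"
        unfolding K_def
      proof (rule Cf(2))
        fix V assume V: "V \<in> f"
        have "real (j V) < real (m V)" using j V by (auto simp: \<F>_def)
        also have "real (m V) \<le> 1 / w V + 1" using w(1)[OF V] unfolding m_def by (simp add: less_imp_le)
        finally have "real (j V) * w V \<le> (1 / w V + 1) * w V" using w(1)[OF V] by (intro mult_right_mono) auto
        also have "\<dots> \<le> 2" using w(1,2)[OF V] by (simp add: field_simps)
        finally have a: "real (j V) * w V \<le> 2" .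
        have b: "0 \<le> real (j V) * w V" using w(1)[OF V] by simp
        have X: "2 * real (j V) * w V = 2 * (real (j V) * w V)" by simp
        show "\<bar>fl V (k j)\<bar> \<le> q + 10"
          using k_fl[OF V, of j] w[OF V] a b unfolding X by linarith
      qed (use q in simp)
      ultimately show ?thesis using zsubspace_add[OF zsub h(1) \<tau>(1)] by (simp add: k_def)
    qed
    have k_inj: "inj_on k \<F>"
    proof (rule inj_onI)
      have less: False if V: "V \<in> f" and lt: "j V < j' V" and eq: "k j = k j'" for j j' V
      proof -
        have "real (j V) + 1 \<le> real (j' V)" using lt by linarith
        then have "(real (j V) + 1) * w V \<le> real (j' V) * w V" using w(1)[OF V] by (intro mult_right_mono) auto
        then have "real (j V) * w V + w V \<le> real (j' V) * w V" by (simp add: distrib_right)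
        moreover have "2 * real (i V) * w V = 2 * (real (i V) * w V)" for i :: "'a set \<Rightarrow> nat" by simp
        ultimately show False using k_fl[OF V, of j] k_fl[OF V, of j'] w(1)[OF V] unfolding eq by linarith
      qed
      fix j j' assume j: "j \<in> \<F>" "j' \<in> \<F>" "k j = k j'"
      have "j V = j' V" if "V \<in> f" for V
        using less[OF that, of j j'] less[OF that, of j' j] j(3) by (metis linorder_neqE_nat)
      then show "j = j'" using j(1,2) unfolding \<F>_def by (intro PiE_ext) auto
    qed
    have fin: "finite {\<gamma>\<in>\<Gamma>. norm (pv \<gamma>) \<le> R \<and> norm (pin \<gamma>) \<le> K}"
      and le: "real (card {\<gamma>\<in>\<Gamma>. norm (pv \<gamma>) \<le> R \<and> norm (pin \<gamma>) \<le> K}) \<le> D * R ^ dim P"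
      using D(2) R by blast+
    have "card \<F> \<le> card {\<gamma>\<in>\<Gamma>. norm (pv \<gamma>) \<le> R \<and> norm (pin \<gamma>) \<le> K}"
      using k_inj k_in fin by (intro card_inj_on_le[of k]) auto
    then have "real (card \<F>) \<le> D * R ^ dim P" using le by linarith
    moreover have "real (card \<F>) = (\<Prod>V\<in>f. real (m V))" unfolding \<F>_def by (simp add: card_PiE finf)
    moreover have "(\<Prod>V\<in>f. 1 / w V) \<le> (\<Prod>V\<in>f. real (m V))"
      using w(1) by (intro prod_mono) (auto simp: m_def less_imp_le real_nat_ceiling_ge)
    ultimately have "(\<Prod>V\<in>f. 1 / w V) \<le> D * R ^ dim P" by linarith
    moreover have "(\<Prod>V\<in>f. w V) > 0" using w(1) by (intro prod_pos) auto
    ultimately have "1 \<le> D * R ^ dim P * (\<Prod>V\<in>f. w V)" by (simp add: prod_dividef field_simps)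
    then show ?thesis using D(1) by (simp add: w_def field_simps)
  qed
  show ?thesis
    using D(1) main by (intro exI[of _ "1 / D"]) auto
qed

text \<open>The lattice displacements \<open>a V\<close> and \<open>b V\<close> translate a facet
  with direction \<open>V\<close> into the two walls of a slab. A patch of radius of order r records
  on which side of each wall its centre lies, so all its copies have internal position in the same
  parallelepiped.\<close>

lemma slab_product_bound:
  assumes LR: "linearly_repetitive S nrm" and f: "flag f"
  shows "\<exists>\<eta>>0. \<exists>c>0. \<exists>r1\<ge>1. \<forall>r\<ge>r1. \<forall>a b.
    (\<forall>V\<in>f. a V \<in> \<Gamma> \<and> b V \<in> \<Gamma> \<and> norm (pin (a V)) < \<eta> \<and> norm (pin (b V)) < \<eta> \<and>
        norm (pv (a V)) \<le> r \<and> norm (pv (b V)) \<le> r \<and> fl V (a V) < fl V (b V)) \<longrightarrow>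
    c \<le> r ^ dim P * (\<Prod>V\<in>f. fl V (b V) - fl V (a V))"
proof -
  have finf: "finite f" by (rule flag_finite[OF f])
  have fD: "f \<subseteq> directions S" by (rule flag_sub[OF f])
  have fne: "f \<noteq> {}" by (rule flag_nonempty[OF f])
  obtain C r0 where C: "C > 0" and rep: "\<And>r. r \<ge> r0 \<Longrightarrow> \<forall>y\<in>\<Lambda>. \<forall>x\<in>\<Lambda>.
        \<exists>z\<in>\<Lambda>. same_patch S nrm r x z \<and> patch S nrm r z \<subseteq> patch S nrm (C * r) y"
    using LR unfolding linearly_repetitive_def eventually_at_top_linorder by blast
  obtain x0 e0 where x0: "x0 \<in> W" "e0 > 0" "\<And>z. z \<in> E \<Longrightarrow> norm (z - x0) < e0 \<Longrightarrow> z \<in> W" by (rule W_interior, rule that)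
  have x0E: "x0 \<in> E" using x0(1) W_sub by blast
  have "\<exists>i l w d. i \<in> labels S \<and> l \<noteq> 0 \<and> w \<in> E \<and> d > 0 \<and>
      (\<forall>x\<in>E. norm (x - w) < d \<longrightarrow> (x \<in> piece S i \<longleftrightarrow> l * (nv V \<bullet> x - nv V \<bullet> w) \<le> 0))" if "V \<in> f" for V
  proof -
    obtain H where H: "H \<in> hyperplanes S" "V = direction H" using \<open>V \<in> f\<close> fD by (auto simp: directions_def)
    obtain i l b w d where h: "i \<in> labels S" "l \<noteq> 0" "w \<in> E" "nv (direction H) \<bullet> w = b"
      "\<forall>x. x \<in> H \<longleftrightarrow> x \<in> E \<and> nv (direction H) \<bullet> x = b" "d > 0"
      "\<forall>x\<in>E. norm (x - w) < d \<longrightarrow> (x \<in> piece S i \<longleftrightarrow> l * (nv (direction H) \<bullet> x - b) \<le> 0)"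
      by (rule hyperplane_form[OF H(1)], rule that)
    show ?thesis
      using h(1-3,6,7) unfolding h(4)[symmetric] H(2) by blast
  qed
  then have "\<forall>V\<in>f. \<exists>p. fst p \<in> labels S \<and> fst (snd p) \<noteq> 0 \<and> fst (snd (snd p)) \<in> E \<and> snd (snd (snd p)) > 0 \<and>
      (\<forall>x\<in>E. norm (x - fst (snd (snd p))) < snd (snd (snd p)) \<longrightarrow>
        (x \<in> piece S (fst p) \<longleftrightarrow> fst (snd p) * (nv V \<bullet> x - nv V \<bullet> fst (snd (snd p))) \<le> 0))"
    by simp
  then obtain p where p: "\<forall>V\<in>f. fst (p V) \<in> labels S \<and> fst (snd (p V)) \<noteq> 0 \<and> fst (snd (snd (p V))) \<in> E \<and> snd (snd (snd (p V))) > 0 \<and>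
      (\<forall>x\<in>E. norm (x - fst (snd (snd (p V)))) < snd (snd (snd (p V))) \<longrightarrow>
        (x \<in> piece S (fst (p V)) \<longleftrightarrow> fst (snd (p V)) * (nv V \<bullet> x - nv V \<bullet> fst (snd (snd (p V)))) \<le> 0))"
    by (elim bchoice[THEN exE])
  define i where "i = (\<lambda>V. fst (p V))"
  define l where "l = (\<lambda>V. fst (snd (p V)))"
  define w where "w = (\<lambda>V. fst (snd (snd (p V))))"
  define d where "d = (\<lambda>V. snd (snd (snd (p V))))"
  have h: "\<And>V. V \<in> f \<Longrightarrow> i V \<in> labels S" "\<And>V. V \<in> f \<Longrightarrow> l V \<noteq> 0" "\<And>V. V \<in> f \<Longrightarrow> w V \<in> E"
    "\<And>V. V \<in> f \<Longrightarrow> d V > 0"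
    "\<And>V x. V \<in> f \<Longrightarrow> x \<in> E \<Longrightarrow> norm (x - w V) < d V \<Longrightarrow> x \<in> piece S (i V) \<longleftrightarrow> l V * (nv V \<bullet> x - nv V \<bullet> w V) \<le> 0"
    using p unfolding i_def l_def w_def d_def by blast+
  define \<delta> where "\<delta> = min e0 (Min (d ` f))"
  have \<delta>: "\<delta> > 0" unfolding \<delta>_def using x0(2) h(4) finf fne by simp
  have \<delta>d: "\<delta> \<le> d V" if "V \<in> f" for V
    unfolding \<delta>_def using finf that by (simp add: min_le_iff_disj)
  have \<delta>e: "\<delta> \<le> e0" by (simp add: \<delta>_def)
  obtain N where N: "N > 0" "\<And>V x. V \<in> directions S \<Longrightarrow> \<bar>fl V x\<bar> \<le> N * norm (pin x)"
    using fl_bound by metis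
  obtain Cf where Cf: "Cf > 0" "\<And>x t. t \<ge> 0 \<Longrightarrow> (\<And>V. V \<in> f \<Longrightarrow> \<bar>fl V x\<bar> \<le> t) \<Longrightarrow> norm (pin x) \<le> Cf * t"
    using flag_norm_bound[OF f] by metis
  obtain c1 c2 where c12: "c1 > 0" "c2 > 0" "\<And>x. c1 * norm (pv x) \<le> nrm (pv x)" "\<And>x. nrm (pv x) \<le> c2 * norm (pv x)"
    using nrm_bounds by metis
  \<comment> \<open>The three bounds keep the displacements in the neighbourhood where the pieces
    are half-spaces, place the parallelepiped within \<open>\<delta> / 8\<close> of
    \<open>x0\<close>, and make its widths at most 1.\<close>
  define \<eta> where "\<eta> = min (\<delta> / 8) (min (\<delta> / (16 * Cf * N)) (1 / (2 * N)))"
  have \<eta>: "\<eta> > 0" "\<eta> \<le> \<delta> / 8" "\<eta> \<le> \<delta> / (16 * Cf * N)" "\<eta> \<le> 1 / (2 * N)"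
    using \<delta> Cf(1) N(1) by (auto simp: \<eta>_def)
  have \<eta>N: "Cf * (2 * (N * \<eta>)) \<le> \<delta> / 8" "2 * (N * \<eta>) \<le> 1"
    using \<eta>(3,4) Cf(1) N(1) by (simp_all add: field_simps)
  \<comment> \<open>The facets used need not be near each other. The displacement \<open>g V\<close>
    carries a neighbourhood of the common base point \<open>x0\<close> to the facet point
    \<open>w V\<close>.\<close>
  have "\<exists>g\<in>\<Gamma>. norm (pin g - (w V - x0)) < \<eta>" if "V \<in> f" for V
    using dense[of "ball (w V - x0) \<eta>" "w V - x0"] \<eta>(1) subspace_diff[OF subE h(3)[OF that] x0E]
    by (auto simp: dist_norm norm_minus_commute)
  then obtain g where g: "\<And>V. V \<in> f \<Longrightarrow> g V \<in> \<Gamma>" "\<And>V. V \<in> f \<Longrightarrow> norm (pin (g V) - (w V - x0)) < \<eta>" by metis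
  \<comment> \<open>The level of the facet pulled back by \<open>g V\<close>; it agrees with the
    level of \<open>x0\<close> up to an error \<open>N * \<eta>\<close>.\<close>
  define t where "t = (\<lambda>V. nv V \<bullet> w V - fl V (g V))"
  have t: "\<bar>t V - nv V \<bullet> x0\<bar> \<le> N * \<eta>" if V: "V \<in> f" for V
  proof -
    have "w V - x0 - pin (g V) \<in> E" using subspace_diff[OF subE] h(3)[OF V] x0E pin_in by blast
    then have "t V - nv V \<bullet> x0 = fl V (w V - x0 - pin (g V))" and p: "pin (w V - x0 - pin (g V)) = w V - x0 - pin (g V)"
      by (simp_all add: t_def fl_def pin_E inner_simps)
    then have "\<bar>t V - nv V \<bullet> x0\<bar> \<le> N * norm (w V - x0 - pin (g V))"
      using N(2)[of V "w V - x0 - pin (g V)"] V fD by auto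
    also have "\<dots> \<le> N * \<eta>" using g(2)[OF V] N(1) by (intro mult_left_mono) (auto simp: norm_minus_commute)
    finally show ?thesis .
  qed
  have d8: "\<delta> / 8 > 0" using \<delta> by simp
  obtain \<rho>0 where \<rho>0: "\<rho>0 > 0" "\<And>g h r. g \<in> \<Gamma> \<Longrightarrow> h \<in> \<Gamma> \<Longrightarrow> pin g \<in> W \<Longrightarrow> pin h \<in> W \<Longrightarrow> r \<ge> \<rho>0 \<Longrightarrow>
     same_patch S nrm r (pv g) (pv h) \<Longrightarrow> norm (pin h - pin g) < \<delta> / 8"
    by (rule patch_determines_position[OF d8], rule that)
  define G0 where "G0 = (\<Sum>V\<in>f. norm (pv (g V)))"
  have G0: "norm (pv (g V)) \<le> G0" if "V \<in> f" for V
    unfolding G0_def using finf that member_le_sum[of V f "\<lambda>V. norm (pv (g V))"] by simp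
  have G0n: "G0 \<ge> 0" by (simp add: G0_def sum_nonneg)
  obtain R0 where R0: "R0 > 0" "\<And>x. \<exists>\<gamma>\<in>\<Gamma>. norm (pv \<gamma> - pv x) \<le> R0 \<and> pin \<gamma> \<in> W"
    by (rule Lambda_relatively_dense, rule that)
  define q where "q = N * norm x0 + 2"
  have q: "q \<ge> 0" using N(1) by (simp add: q_def)
  obtain cc where cc: "cc > 0" and translates: "\<And>R lo up. R \<ge> 1 \<Longrightarrow> (\<forall>V\<in>f. 0 < up V - lo V \<and> up V - lo V \<le> 1 \<and> \<bar>lo V\<bar> \<le> q) \<Longrightarrow>
    (\<forall>x. \<exists>h\<in>\<Gamma>. norm (pv h - pv x) \<le> R \<and> (\<forall>V\<in>f. lo V \<le> fl V h \<and> fl V h \<le> up V)) \<Longrightarrow>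
    cc \<le> R ^ dim P * (\<Prod>V\<in>f. up V - lo V)"
    using translates_bound[OF f q] by blast
  define A where "A = C * (c2 * (1 + G0) + \<bar>r0\<bar> + \<rho>0) / c1 + R0 + 1"
  have A: "A \<ge> 1" using C c12 G0n \<rho>0(1) R0(1) by (simp add: A_def)
  have main: "cc / A ^ dim P \<le> r ^ dim P * (\<Prod>V\<in>f. fl V (b V) - fl V (a V))"
    if r: "r \<ge> 1" and ab: "\<forall>V\<in>f. a V \<in> \<Gamma> \<and> b V \<in> \<Gamma> \<and> norm (pin (a V)) < \<eta> \<and> norm (pin (b V)) < \<eta> \<and>
        norm (pv (a V)) \<le> r \<and> norm (pv (b V)) \<le> r \<and> fl V (a V) < fl V (b V)" for r a b
  proof -
    define lo where "lo = (\<lambda>V. t V - fl V (b V))"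
    define up where "up = (\<lambda>V. t V - fl V (a V))"
    have flab: "\<bar>fl V (a V)\<bar> \<le> N * \<eta>" "\<bar>fl V (b V)\<bar> \<le> N * \<eta>" if V: "V \<in> f" for V
    proof -
      have "N * norm (pin (a V)) \<le> N * \<eta>" "N * norm (pin (b V)) \<le> N * \<eta>"
        using ab V N(1) by (auto intro!: mult_left_mono less_imp_le)
      then show "\<bar>fl V (a V)\<bar> \<le> N * \<eta>" "\<bar>fl V (b V)\<bar> \<le> N * \<eta>"
        using N(2)[of V "a V"] N(2)[of V "b V"] V fD by fastforce+
    qed
    obtain g0 where g0: "g0 \<in> \<Gamma>" "\<And>V. V \<in> f \<Longrightarrow> lo V < fl V g0 \<and> fl V g0 < up V"
      using flag_slab_hit[OF f, of lo up] ab by (auto simp: lo_def up_def)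
    have near: "norm (pin g0 - x0) \<le> \<delta> / 8"
    proof -
      have p: "pin (pin g0 - x0) = pin g0 - x0" using pin_E subspace_diff[OF subE pin_in x0E] by blast
      have "norm (pin (pin g0 - x0)) \<le> Cf * (2 * (N * \<eta>))"
      proof (rule Cf(2))
        fix V assume V: "V \<in> f"
        have "fl V (pin g0 - x0) = fl V g0 - nv V \<bullet> x0" by (simp add: fl_diff fl_E[OF x0E])
        then show "\<bar>fl V (pin g0 - x0)\<bar> \<le> 2 * (N * \<eta>)"
          using g0(2)[OF V] flab[OF V] t[OF V] by (simp add: lo_def up_def abs_le_iff)
      qed (use N(1) \<eta>(1) in simp)
      then show ?thesis using \<eta>N(1) p by simp
    qed
    have "norm (pin g0 - x0) < e0" using near \<delta> \<delta>e by linarith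
    then have g0W: "pin g0 \<in> W" by (rule x0(3)[OF pin_in])
    \<comment> \<open>Large enough to see all displacements \<open>g V + a V\<close> and
      \<open>g V + b V\<close>, to be in the range of repetitivity, and to determine the position up
      to \<open>\<delta> / 8\<close>.\<close>
    define r' where "r' = c2 * (r + G0) + \<bar>r0\<bar> + \<rho>0"
    have r': "r' \<ge> r0" "r' \<ge> \<rho>0" "r' \<ge> 0" "c2 * (r + G0) \<le> r'"
    proof -
      have "c2 * (r + G0) \<ge> 0" using c12(2) r G0n by simp
      then show "r' \<ge> r0" "r' \<ge> \<rho>0" "r' \<ge> 0" "c2 * (r + G0) \<le> r'"
        using \<rho>0(1) unfolding r'_def by linarith+
    qed
    have "\<exists>h\<in>\<Gamma>. norm (pv h - pv x) \<le> A * r \<and> (\<forall>V\<in>f. lo V \<le> fl V h \<and> fl V h \<le> up V)" for x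
    proof -
      obtain \<gamma>y where y: "\<gamma>y \<in> \<Gamma>" "norm (pv \<gamma>y - pv x) \<le> R0" "pin \<gamma>y \<in> W" using R0(2) by blast
      obtain z where z: "z \<in> \<Lambda>" "same_patch S nrm r' (pv g0) z" "patch S nrm r' z \<subseteq> patch S nrm (C * r') (pv \<gamma>y)"
        using rep[OF r'(1)] Lambda_pv[OF g0(1) g0W] Lambda_pv[OF y(1,3)] by blast
      obtain h' where h': "h' \<in> \<Gamma>" "z = pv h'" "pin h' \<in> W" using z(1) by (rule Lambda_E)
      have "nrm (pv h' - pv \<gamma>y) \<le> C * r'" using center_in_patch[OF z(1) r'(3) z(3)] h'(2) by simp
      then have "c1 * norm (pv h' - pv \<gamma>y) \<le> C * r'" using c12(3)[of "h' - \<gamma>y"] by (simp add: pv_diff)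
      then have "norm (pv h' - pv \<gamma>y) \<le> C * r' / c1" using c12(1) by (simp add: field_simps)
      then have "norm (pv h' - pv x) \<le> C * r' / c1 + R0"
        using norm_triangle_ineq[of "pv h' - pv \<gamma>y" "pv \<gamma>y - pv x"] y(2) by simp
      also have "\<dots> \<le> A * r"
      proof -
        have "r' \<le> (c2 * (1 + G0) + \<bar>r0\<bar> + \<rho>0) * r"
        proof -
          define Z where "Z = c2 * G0 + \<bar>r0\<bar> + \<rho>0"
          have "Z \<ge> 0" using c12(2) G0n \<rho>0(1) by (simp add: Z_def)
          then have "Z * 1 \<le> Z * r" using r by (intro mult_left_mono) auto
          moreover have "r' = c2 * r + Z" by (simp add: r'_def Z_def algebra_simps)
          moreover have "(c2 * (1 + G0) + \<bar>r0\<bar> + \<rho>0) * r = c2 * r + Z * r" by (simp add: Z_def algebra_simps)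
          ultimately show ?thesis by linarith
        qed
        then have "C * r' / c1 \<le> C * ((c2 * (1 + G0) + \<bar>r0\<bar> + \<rho>0) * r) / c1"
          using C c12(1) by (intro divide_right_mono mult_left_mono) auto
        moreover have "R0 \<le> R0 * r" using mult_left_mono[OF r, of R0] R0(1) by simp
        ultimately show ?thesis unfolding A_def using r by (simp add: algebra_simps)
      qed
      finally have dist: "norm (pv h' - pv x) \<le> A * r" .
      have close: "norm (pin h' - pin g0) < \<delta> / 8"
        using \<rho>0(2)[OF g0(1) h'(1) g0W h'(3) r'(2)] z(2) h'(2) by simp
      \<comment> \<open>Both internal positions, after displacement, lie within
        \<open>\<delta> / 2\<close> of \<open>w V\<close>, where the piece is a half-space. So
        membership in the piece is the sign condition, and equal patches transfer it.\<close>
      have side: "l V * (fl V g0 + fl V \<gamma> - t V) \<le> 0 \<longleftrightarrow> l V * (fl V h' + fl V \<gamma> - t V) \<le> 0"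
        if V: "V \<in> f" and \<gamma>: "\<gamma> \<in> \<Gamma>" "norm (pin \<gamma>) < \<eta>" "norm (pv \<gamma>) \<le> r" for V \<gamma>
      proof -
        have gG: "g V + \<gamma> \<in> \<Gamma>" by (rule zsubspace_add[OF zsub g(1)[OF V] \<gamma>(1)])
        have "norm (pv (g V + \<gamma>)) \<le> r + G0"
          using norm_triangle_ineq[of "pv (g V)" "pv \<gamma>"] \<gamma>(3) G0[OF V] by (simp add: pv_add)
        then have "c2 * norm (pv (g V + \<gamma>)) \<le> c2 * (r + G0)" using c12(2) by (intro mult_left_mono) auto
        then have "nrm (pv (g V + \<gamma>)) \<le> r'" using c12(4)[of "g V + \<gamma>"] r'(4) by linarith
        then have iff: "pin (g0 + (g V + \<gamma>)) \<in> piece S (i V) \<longleftrightarrow> pin (h' + (g V + \<gamma>)) \<in> piece S (i V)"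
          using z(2) same_patch_iff[OF g0(1) h'(1), of r'] gG h(1)[OF V] h'(2) by blast
        have e1: "pin (g0 + (g V + \<gamma>)) - w V = (pin g0 - x0) + (pin (g V) - (w V - x0)) + pin \<gamma>"
          by (simp add: pin_add)
        have n1: "norm (pin (g0 + (g V + \<gamma>)) - w V) < \<delta> / 8 + \<delta> / 8 + \<delta> / 8"
          unfolding e1 using norm_triangle_ineq[of "(pin g0 - x0) + (pin (g V) - (w V - x0))" "pin \<gamma>"]
            norm_triangle_ineq[of "pin g0 - x0" "pin (g V) - (w V - x0)"] near g(2)[OF V] \<gamma>(2) \<eta>(2) by linarith
        have e2: "pin (h' + (g V + \<gamma>)) - w V = (pin (g0 + (g V + \<gamma>)) - w V) + (pin h' - pin g0)"
          by (simp add: pin_add)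
        have n2: "norm (pin (h' + (g V + \<gamma>)) - w V) < \<delta> / 8 + \<delta> / 8 + \<delta> / 8 + \<delta> / 8"
          unfolding e2 using norm_triangle_ineq[of "pin (g0 + (g V + \<gamma>)) - w V" "pin h' - pin g0"] n1 close by linarith
        have lt: "norm (pin (g0 + (g V + \<gamma>)) - w V) < d V" "norm (pin (h' + (g V + \<gamma>)) - w V) < d V"
          using n1 n2 \<delta>d[OF V] \<delta> by linarith+
        have v: "nv V \<bullet> pin (x + (g V + \<gamma>)) - nv V \<bullet> w V = fl V x + fl V \<gamma> - t V" for x
          by (simp add: t_def fl_def pin_add inner_add_right)
        show ?thesis
          using iff h(5)[OF V pin_in lt(1)] h(5)[OF V pin_in lt(2)] unfolding v by blast
      qed
      have "lo V \<le> fl V h' \<and> fl V h' \<le> up V" if V: "V \<in> f" for V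
      proof -
        have sa: "l V * (fl V g0 + fl V (a V) - t V) \<le> 0 \<longleftrightarrow> l V * (fl V h' + fl V (a V) - t V) \<le> 0"
          and sb: "l V * (fl V g0 + fl V (b V) - t V) \<le> 0 \<longleftrightarrow> l V * (fl V h' + fl V (b V) - t V) \<le> 0"
          using ab V side[OF V, of "a V"] side[OF V, of "b V"] by blast+
        have neg: "fl V g0 + fl V (a V) - t V < 0" and pos: "fl V g0 + fl V (b V) - t V > 0"
          using g0(2)[OF V] by (auto simp: lo_def up_def)
        \<comment> \<open>Which of the two walls belongs to the slab depends on the sign of
          \<open>l V\<close>, so the conclusion is about the closed slab.\<close>
        have "fl V h' + fl V (a V) - t V \<le> 0 \<and> fl V h' + fl V (b V) - t V \<ge> 0"
          using sa sb neg pos h(2)[OF V] by (auto simp: mult_le_0_iff)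
        then show ?thesis by (simp add: lo_def up_def)
      qed
      then show ?thesis using dist h'(1) by blast
    qed
    moreover have "\<forall>V\<in>f. 0 < up V - lo V \<and> up V - lo V \<le> 1 \<and> \<bar>lo V\<bar> \<le> q"
    proof
      fix V assume V: "V \<in> f"
      have "\<bar>nv V \<bullet> x0\<bar> \<le> N * norm x0" using N(2)[of V x0] V fD by (auto simp: fl_E[OF x0E] pin_E[OF x0E])
      then show "0 < up V - lo V \<and> up V - lo V \<le> 1 \<and> \<bar>lo V\<bar> \<le> q"
        using flab[OF V] ab V \<eta>N(2) t[OF V] by (auto simp: up_def lo_def q_def abs_le_iff)
    qed
    moreover have "A * r \<ge> 1" using A r mult_mono[of 1 A 1 r] by simp
    ultimately have "cc \<le> (A * r) ^ dim P * (\<Prod>V\<in>f. up V - lo V)" using translates by blast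
    also have "\<dots> = A ^ dim P * (r ^ dim P * (\<Prod>V\<in>f. fl V (b V) - fl V (a V)))"
      by (simp add: up_def lo_def power_mult_distrib)
    finally show ?thesis using A by (simp add: field_simps)
  qed
  show ?thesis
    using \<eta>(1) cc A main by (intro exI[of _ \<eta>] conjI exI[of _ "cc / A ^ dim P"] exI[of _ "1::real"]) auto
qed

section \<open>Lattice points with bounded internal part and values of functionals\<close>

definition lbox :: "real \<Rightarrow> real \<Rightarrow> 'a set" where
  "lbox \<eta> r = {\<gamma>\<in>\<Gamma>. norm (pv \<gamma>) \<le> r \<and> norm (pin \<gamma>) < \<eta>}"

lemma box_finite: "finite (lbox \<eta> r)"
proof -
  have "lbox \<eta> r \<subseteq> {g \<in> \<Gamma>. norm g \<le> r + \<eta>}"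
  proof
    fix x assume "x \<in> lbox \<eta> r"
    then show "x \<in> {g \<in> \<Gamma>. norm g \<le> r + \<eta>}" using norm_le_split[of x] by (auto simp: lbox_def)
  qed
  then show ?thesis using discrete_subgroup_finite[OF zsub disc] finite_subset by blast
qed

text \<open>Each point of a grid in the physical space has a lattice point with small internal part
  within \<open>R0\<close>; a wide enough grid makes these distinct.\<close>

lemma box_count_lower:
  assumes \<eta>: "\<eta> > 0"
  obtains c r2 where "c > 0" "r2 \<ge> 1" "\<And>r. r \<ge> r2 \<Longrightarrow> c * r ^ dim P \<le> real (card (lbox \<eta> r))"
proof -
  obtain B where B: "B \<subseteq> P" "independent B" "P \<subseteq> span B" "card B = dim P"
    using basis_exists by metis
  have finB: "finite B" using B(2) by (simp add: finiteI_independent)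
  obtain C where C: "C > 0" "\<And>x b. x \<in> span B \<Longrightarrow> b \<in> B \<Longrightarrow> \<bar>representation B x b\<bar> \<le> C * norm x"
    using representation_bound[OF B(2)] by metis
  have "\<exists>R>0. \<forall>x. \<exists>\<gamma>\<in>\<Gamma>. norm (pv \<gamma> - pv x) \<le> R \<and> pin \<gamma> \<in> ball 0 \<eta>"
    using \<eta> subspace_0[OF subE] by (intro hit[of _ 0]) auto
  then obtain R0 where R0: "R0 > 0" "\<forall>x. \<exists>\<gamma>\<in>\<Gamma>. norm (pv \<gamma> - pv x) \<le> R0 \<and> pin \<gamma> \<in> ball 0 \<eta>" by (elim exE conjE)
  \<comment> \<open>Grid points sharing a lattice point are at most \<open>2 * R0\<close> apart, so
    their coordinates differ by at most \<open>2 * R0 * C\<close>, less than one grid step.\<close>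
  define D where "D = 2 * R0 * C + 1"
  have D: "D > 0" using R0(1) C(1) by (simp add: D_def add_pos_pos)
  define s where "s = (\<Sum>b\<in>B. norm b)"
  have "B \<noteq> {}" using B(4) dimP by (metis card.empty not_one_le_zero)
  moreover have "norm b > 0" if "b \<in> B" for b using B(2) that real_vector.dependent_zero by auto
  ultimately have s: "s > 0" unfolding s_def using finB by (intro sum_pos) auto
  define q where "q = 2 * D * s"
  have q: "q > 0" using D s by (simp add: q_def)
  have main: "(1 / q ^ dim P) * r ^ dim P \<le> real (card (lbox \<eta> r))" if r: "r \<ge> 2 * R0 + 1" for r
  proof -
    define M where "M = nat \<lfloor>(r - R0) / (D * s)\<rfloor>"
    have nn: "(r - R0) / (D * s) \<ge> 0" using r R0(1) D s by simp
    have M: "real M \<le> (r - R0) / (D * s)" "(r - R0) / (D * s) < real M + 1"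
      using nn by (simp_all add: M_def)
    define \<F> where "\<F> = Pi\<^sub>E B (\<lambda>_. {..M})"
    define x where "x = (\<lambda>j. \<Sum>b\<in>B. (real (j b) * D) *\<^sub>R b)"
    have xP: "x j \<in> P" for j unfolding x_def using B(1) by (intro subspace_sum[OF subP] subspace_scale[OF subP]) auto
    have "\<exists>\<gamma>\<in>\<Gamma>. norm (pv \<gamma> - x j) \<le> R0 \<and> norm (pin \<gamma>) < \<eta>" for j
      using R0(2)[rule_format, of "x j"] pv_P[OF xP[of j]] by auto
    then obtain g where g: "\<And>j. g j \<in> \<Gamma>" "\<And>j. norm (pv (g j) - x j) \<le> R0" "\<And>j. norm (pin (g j)) < \<eta>" by metis
    have gb: "g j \<in> lbox \<eta> r" if j: "j \<in> \<F>" for j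
    proof -
      have "norm (x j) \<le> (\<Sum>b\<in>B. norm ((real (j b) * D) *\<^sub>R b))" unfolding x_def by (rule norm_sum)
      also have "\<dots> \<le> (\<Sum>b\<in>B. (real M * D) * norm b)"
        using j D by (intro sum_mono) (auto simp: \<F>_def PiE_iff abs_mult intro!: mult_right_mono)
      also have "\<dots> = real M * (D * s)" by (simp add: s_def sum_distrib_left mult.assoc)
      also have "\<dots> \<le> r - R0" using M(1) D s by (simp add: pos_le_divide_eq)
      finally have "norm (pv (g j)) \<le> r"
        using g(2)[of j] norm_triangle_ineq[of "pv (g j) - x j" "x j"] by simp
      then show ?thesis using g by (simp add: lbox_def)
    qed
    have ginj: "inj_on g \<F>"
    proof (rule inj_onI)
      fix j j' assume j: "j \<in> \<F>" "j' \<in> \<F>" "g j = g j'"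
      have diff: "x j - x j' = (\<Sum>b\<in>B. ((real (j b) - real (j' b)) * D) *\<^sub>R b)"
        by (simp add: x_def sum_subtractf left_diff_distrib scaleR_diff_left)
      have "norm (x j - x j') \<le> 2 * R0"
        using norm_triangle_ineq4[of "pv (g j') - x j'" "pv (g j) - x j"] g(2)[of j] g(2)[of j'] j(3) by simp
      moreover have sp: "x j - x j' \<in> span B" using xP subspace_diff[OF subP] B(3) by blast
      have "j b = j' b" if b: "b \<in> B" for b
      proof -
        have "representation B (x j - x j') b = (real (j b) - real (j' b)) * D"
          unfolding diff by (rule representation_sum_coeff[OF B(2) finB b])
        then have "\<bar>real (j b) - real (j' b)\<bar> * D = \<bar>representation B (x j - x j') b\<bar>"
          using D by (simp add: abs_mult)
        also have "\<dots> \<le> C * norm (x j - x j')" by (rule C(2)[OF sp b])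
        also have "\<dots> \<le> C * (2 * R0)" using C(1) \<open>norm (x j - x j') \<le> 2 * R0\<close> by (intro mult_left_mono) auto
        also have "\<dots> < 1 * D" by (simp add: D_def)
        finally have "\<bar>real (j b) - real (j' b)\<bar> < 1" using D by (simp only: mult_less_cancel_right)
        then show ?thesis by linarith
      qed
      then show "j = j'" using j(1,2) unfolding \<F>_def by (intro PiE_ext) auto
    qed
    have "card \<F> \<le> card (lbox \<eta> r)" using ginj gb box_finite by (intro card_inj_on_le[of g]) auto
    moreover have "card \<F> = (M + 1) ^ dim P" by (simp add: \<F>_def card_PiE finB B(4))
    ultimately have "real (M + 1) ^ dim P \<le> real (card (lbox \<eta> r))" by (metis of_nat_le_iff of_nat_power)
    moreover have "(r / q) ^ dim P \<le> real (M + 1) ^ dim P"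
    proof (rule power_mono)
      have "r / q \<le> (r - R0) / (D * s)" using r D s by (simp add: q_def field_simps)
      then show "r / q \<le> real (M + 1)" using M(2) by simp
      show "0 \<le> r / q" using r R0(1) q by simp
    qed
    ultimately show ?thesis by (simp add: power_divide)
  qed
  show ?thesis
    by (rule that[of "1 / q ^ dim P" "2 * R0 + 1"]) (use q R0(1) main in auto)
qed

text \<open>The first multiples of one lattice point with tiny internal part and positive
  \<open>fl V\<close> all lie in the box and have different values.\<close>

lemma box_values_unbounded:
  assumes V: "V \<in> directions S" and \<eta>: "\<eta> > 0"
  shows "\<exists>r0. \<forall>r\<ge>r0. m \<le> card (fl V ` lbox \<eta> r)"
proof -
  define e where "e = \<eta> / (real m + 1)"
  have e: "e > 0" using \<eta> by (simp add: e_def)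
  have n: "norm (nv V) > 0" using nv_props(2)[OF V] by simp
  define p where "p = (e / (2 * norm (nv V))) *\<^sub>R nv V"
  have "p \<in> E" unfolding p_def using nv_props(1)[OF V] subspace_scale[OF subE] by blast
  moreover have "p \<in> ball 0 e \<inter> {x. nv V \<bullet> x > 0}" using e n by (auto simp: p_def)
  moreover have "open (ball 0 e \<inter> {x. nv V \<bullet> x > 0})" by (intro open_Int open_ball open_halfspace_gt)
  ultimately obtain g where g: "g \<in> \<Gamma>" "norm (pin g) < e" "fl V g > 0"
    using dense[of "ball 0 e \<inter> {x. nv V \<bullet> x > 0}" p] by (auto simp: fl_def)
  have "m \<le> card (fl V ` lbox \<eta> r)" if r: "r \<ge> real m * norm (pv g)" for r
  proof -
    have "(\<lambda>j. real j * fl V g) ` {..<m} \<subseteq> fl V ` lbox \<eta> r"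
    proof
      fix y assume "y \<in> (\<lambda>j. real j * fl V g) ` {..<m}"
      then obtain j where j: "j < m" "y = real j * fl V g" by auto
      have "real j * norm (pv g) \<le> real m * norm (pv g)" using j(1) by (intro mult_right_mono) auto
      moreover have "real j * norm (pin g) < \<eta>"
      proof -
        have "real j * norm (pin g) \<le> real m * e" using j(1) g(2) by (intro mult_mono) auto
        also have "\<dots> < \<eta>" using \<eta> by (simp add: e_def field_simps)
        finally show ?thesis .
      qed
      ultimately have "real j *\<^sub>R g \<in> lbox \<eta> r"
        using r zsubspace_of_nat[OF zsub g(1)] by (auto simp: lbox_def pv_scale pin_scale)
      then show "y \<in> fl V ` lbox \<eta> r" using j(2) by (intro image_eqI[of _ _ "real j *\<^sub>R g"]) (auto simp: fl_scale)
    qed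
    then have "card ((\<lambda>j. real j * fl V g) ` {..<m}) \<le> card (fl V ` lbox \<eta> r)"
      using box_finite by (intro card_mono) auto
    moreover have "inj_on (\<lambda>j. real j * fl V g) {..<m}" using g(3) by (auto simp: inj_on_def)
    ultimately show ?thesis by (simp add: card_image)
  qed
  then show ?thesis by blast
qed

lemma box_le_values:
  assumes f: "flag f"
  shows "card (lbox \<eta> r) \<le> (\<Prod>V\<in>f. card (fl V ` lbox \<eta> r))"
proof -
  have finf: "finite f" by (rule flag_finite[OF f])
  have "card (lbox \<eta> r) \<le> card (Pi\<^sub>E f (\<lambda>V. fl V ` lbox \<eta> r))"
  proof (rule card_inj_on_le[of "\<lambda>\<gamma>. restrict (\<lambda>V. fl V \<gamma>) f"])
    show "inj_on (\<lambda>\<gamma>. restrict (\<lambda>V. fl V \<gamma>) f) (lbox \<eta> r)"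
    proof (rule inj_onI)
      fix x y assume xy: "x \<in> lbox \<eta> r" "y \<in> lbox \<eta> r" "restrict (\<lambda>V. fl V x) f = restrict (\<lambda>V. fl V y) f"
      have "fl V (x - y) = 0" if "V \<in> f" for V using fun_cong[OF xy(3), of V] that by (simp add: fl_diff)
      moreover have "x - y \<in> \<Gamma>" using xy zsubspace_diff[OF zsub] by (auto simp: lbox_def)
      ultimately show "x = y" using flag_fl_zero[OF f, of "x - y"] by simp
    qed
    show "finite (Pi\<^sub>E f (\<lambda>V. fl V ` lbox \<eta> r))" using finf box_finite by (intro finite_PiE) auto
  qed auto
  then show ?thesis by (simp add: card_PiE finf)
qed

text \<open>Sort the box by the values of the functionals other than \<open>fl V0\<close>.
  Differences inside a fibre lie in the line stabiliser, and taking differences doubles both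
  radii.\<close>

lemma box_le_values_line:
  assumes f: "flag f" and V0: "V0 \<in> f"
  shows "card (lbox \<eta> r) \<le> (\<Prod>V\<in>f - {V0}. card (fl V ` lbox \<eta> r)) *
     card {\<gamma>\<in>stab S (f - {V0}). norm (pv \<gamma>) \<le> 2 * r \<and> norm (pin \<gamma>) \<le> 2 * \<eta>}"
proof -
  let ?L = "{\<gamma>\<in>stab S (f - {V0}). norm (pv \<gamma>) \<le> 2 * r \<and> norm (pin \<gamma>) \<le> 2 * \<eta>}"
  have fD: "f - {V0} \<subseteq> directions S" using flag_sub[OF f] by blast
  have finf: "finite (f - {V0})" using flag_finite[OF f] by simp
  have finL: "finite ?L"
  proof (rule finite_subset)
    show "?L \<subseteq> {g \<in> \<Gamma>. norm g \<le> 2 * r + 2 * \<eta>}"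
    proof
      fix x assume "x \<in> ?L"
      then show "x \<in> {g \<in> \<Gamma>. norm g \<le> 2 * r + 2 * \<eta>}"
        using norm_le_split[of x] stab_subset[of "f - {V0}"] by auto
    qed
  qed (rule discrete_subgroup_finite[OF zsub disc])
  define \<psi> where "\<psi> = (\<lambda>\<gamma>. restrict (\<lambda>V. fl V \<gamma>) (f - {V0}))"
  define T where "T = Pi\<^sub>E (f - {V0}) (\<lambda>V. fl V ` lbox \<eta> r)"
  have finT: "finite T" unfolding T_def using finf box_finite by (intro finite_PiE) auto
  have "lbox \<eta> r \<subseteq> (\<Union>y\<in>T. {x \<in> lbox \<eta> r. \<psi> x = y})" by (auto simp: T_def \<psi>_def)
  then have "card (lbox \<eta> r) \<le> card (\<Union>y\<in>T. {x \<in> lbox \<eta> r. \<psi> x = y})"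
    using box_finite finT by (intro card_mono) auto
  also have "\<dots> \<le> (\<Sum>y\<in>T. card {x \<in> lbox \<eta> r. \<psi> x = y})" by (rule card_UN_le[OF finT])
  also have "\<dots> \<le> (\<Sum>y\<in>T. card ?L)"
  proof (rule sum_mono)
    fix y
    show "card {x \<in> lbox \<eta> r. \<psi> x = y} \<le> card ?L"
    proof (cases "{x \<in> lbox \<eta> r. \<psi> x = y} = {}")
      case True
      show ?thesis unfolding True by simp
    next
      case False
      then obtain x0 where x0: "x0 \<in> lbox \<eta> r" "\<psi> x0 = y" by blast
      show ?thesis
      proof (rule card_inj_on_le[of "\<lambda>x. x - x0"])
        show "inj_on (\<lambda>x. x - x0) {x \<in> lbox \<eta> r. \<psi> x = y}" by (auto simp: inj_on_def)
        show "(\<lambda>x. x - x0) ` {x \<in> lbox \<eta> r. \<psi> x = y} \<subseteq> ?L"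
        proof
          fix z assume "z \<in> (\<lambda>x. x - x0) ` {x \<in> lbox \<eta> r. \<psi> x = y}"
          then obtain x where x: "x \<in> lbox \<eta> r" "\<psi> x = y" "z = x - x0" by auto
          have e\<psi>: "\<psi> x = \<psi> x0" using x(2) x0(2) by simp
          have "fl V x = fl V x0" if "V \<in> f - {V0}" for V
            using fun_cong[OF e\<psi>, of V] that by (simp add: \<psi>_def)
          then have "z \<in> stab S (f - {V0})"
            using x(1,3) x0(1) zsubspace_diff[OF zsub] by (auto simp: stab_eq[OF fD] fl_diff lbox_def)
          moreover have "norm (pv z) \<le> 2 * r" "norm (pin z) \<le> 2 * \<eta>"
            using norm_triangle_ineq4[of "pv x" "pv x0"] norm_triangle_ineq4[of "pin x" "pin x0"] x x0
            by (auto simp: lbox_def pv_diff pin_diff)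
          ultimately show "z \<in> ?L" by simp
        qed
      qed (rule finL)
    qed
  qed
  also have "\<dots> = (\<Prod>V\<in>f - {V0}. card (fl V ` lbox \<eta> r)) * card ?L" by (simp add: T_def card_PiE[OF finf])
  finally show ?thesis .
qed

lemma line_ranks_superadditive:
  assumes f: "flag f" and T: "T \<subseteq> f"
  shows "(\<Sum>V\<in>T. dim (stab S (f - {V}))) \<le> dim (stab S (f - T))"
proof -
  have "finite T" using flag_finite[OF f] T finite_subset by blast
  then show ?thesis using T
  proof (induction T rule: finite_induct)
    case (insert V T)
    have "(f - {V}) \<union> (f - T) = f" using insert.hyps(2) insert.prems by blast
    then have "dim (stab S (f - {V})) + dim (stab S (f - T)) \<le> dim (stab S ((f - {V}) \<inter> (f - T)))"
      by (rule stab_superadditive[OF f])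
    moreover have "(f - {V}) \<inter> (f - T) = f - insert V T" by blast
    ultimately show ?case using insert by simp
  qed simp
qed

text \<open>Let N be the number of values of \<open>fl V\<close> on the box. Pigeonhole makes two of
  them at most K / N apart, so the slab bound makes the product of the N at most of order r^d. The
  box itself has order r^d points, so each N is at most of the order of the count on its line.
  Comparing the exponents with d pins down all the ranks.\<close>

lemma linearly_repetitive_flag:
  assumes LR: "linearly_repetitive S nrm" and f: "flag f"
  shows "(\<Sum>V\<in>f. sv V) = DIM('a)"
    and "\<And>V. V \<in> f \<Longrightarrow> \<exists>c>0. \<forall>h\<in>stab S (f - {V}). h \<noteq> 0 \<longrightarrow> c \<le> \<bar>fl V h\<bar> * norm h ^ (sv V - 1)"
proof -
  let ?d = "dim P"
  have finf: "finite f" by (rule flag_finite[OF f])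
  have fD: "f \<subseteq> directions S" by (rule flag_sub[OF f])
  obtain \<eta> c1 r1 where slab: "\<eta> > 0" "c1 > 0" "r1 \<ge> 1" "\<And>r a b. r \<ge> r1 \<Longrightarrow>
    (\<forall>V\<in>f. a V \<in> \<Gamma> \<and> b V \<in> \<Gamma> \<and> norm (pin (a V)) < \<eta> \<and> norm (pin (b V)) < \<eta> \<and>
        norm (pv (a V)) \<le> r \<and> norm (pv (b V)) \<le> r \<and> fl V (a V) < fl V (b V)) \<Longrightarrow>
    c1 \<le> r ^ ?d * (\<Prod>V\<in>f. fl V (b V) - fl V (a V))"
    using slab_product_bound[OF LR f] by blast
  define N where "N = (\<lambda>V r. card (fl V ` lbox \<eta> r))"
  define t where "t = (\<lambda>V. dim (stab S (f - {V})))"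
  obtain c0 r2 where c0: "c0 > 0" "r2 \<ge> 1" "\<And>r. r \<ge> r2 \<Longrightarrow> c0 * r ^ ?d \<le> real (card (lbox \<eta> r))"
    by (rule box_count_lower[OF slab(1)], rule that)
  have "\<exists>r0. \<forall>r\<ge>r0. 2 \<le> N V r" if "V \<in> f" for V
    unfolding N_def using box_values_unbounded[OF _ slab(1)] that fD by blast
  then obtain r3 where r3: "\<And>V r. V \<in> f \<Longrightarrow> r \<ge> r3 V \<Longrightarrow> 2 \<le> N V r" by metis
  obtain A where A: "A > 0" "\<And>V x. V \<in> directions S \<Longrightarrow> \<bar>fl V x\<bar> \<le> A * norm (pin x)"
    using fl_bound by metis
  define K where "K = 8 * (A * \<eta>)"
  have K: "K > 0" using A(1) slab(1) by (simp add: K_def)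
  define r4 where "r4 = max (max r1 r2) (\<Sum>V\<in>f. \<bar>r3 V\<bar>)"
  have r4: "r4 \<ge> r1" "r4 \<ge> r2" "r4 \<ge> 1" using slab(3) by (auto simp: r4_def)
  have r43: "r4 \<ge> r3 V" if "V \<in> f" for V
    using member_le_sum[of V f "\<lambda>V. \<bar>r3 V\<bar>"] that finf unfolding r4_def by fastforce
  have N2: "2 \<le> N V r" if "V \<in> f" "r \<ge> r4" for V r
  proof (rule r3[OF that(1)])
    show "r \<ge> r3 V" using r43[OF that(1)] that(2) by linarith
  qed
  have gap: "\<exists>a b. a \<in> lbox \<eta> r \<and> b \<in> lbox \<eta> r \<and> fl V a < fl V b \<and> fl V b - fl V a \<le> K / real (N V r)"
    if V: "V \<in> f" and r: "r \<ge> r4" for V r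
  proof -
    have "\<exists>a\<in>fl V ` lbox \<eta> r. \<exists>b\<in>fl V ` lbox \<eta> r. a < b \<and> b - a \<le> 8 * (A * \<eta>) / real (card (fl V ` lbox \<eta> r))"
    proof (rule close_pair_exists)
      show "finite (fl V ` lbox \<eta> r)" using box_finite by simp
      show "2 \<le> card (fl V ` lbox \<eta> r)" using N2[OF V r] by (simp add: N_def)
      fix y assume "y \<in> fl V ` lbox \<eta> r"
      then obtain g where g: "g \<in> lbox \<eta> r" "y = fl V g" by blast
      have "\<bar>fl V g\<bar> \<le> A * norm (pin g)" using A(2) V fD by blast
      also have "\<dots> \<le> A * \<eta>" using g(1) A(1) by (intro mult_left_mono) (auto simp: lbox_def)
      finally show "\<bar>y\<bar> \<le> A * \<eta>" using g(2) by simp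
    qed
    then show ?thesis unfolding K_def N_def by blast
  qed
  \<comment> \<open>At \<open>V0\<close> an arbitrary pair replaces the pigeonhole pair: again a
    pigeonhole pair for the rank count, the pair of 0 and \<open>h\<close> or \<open>- h\<close> for
    the approximation bound.\<close>
  have slab': "c1 \<le> r ^ ?d * ((fl V0 b0 - fl V0 a0) * (\<Prod>V\<in>f - {V0}. K / real (N V r)))"
    if V0: "V0 \<in> f" and r: "r \<ge> r4" and ab: "a0 \<in> lbox \<eta> r" "b0 \<in> lbox \<eta> r" "fl V0 a0 < fl V0 b0" for V0 r a0 b0
  proof -
    obtain a b where g: "\<And>V. V \<in> f \<Longrightarrow> a V \<in> lbox \<eta> r \<and> b V \<in> lbox \<eta> r \<and> fl V (a V) < fl V (b V) \<and> fl V (b V) - fl V (a V) \<le> K / real (N V r)"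
      using gap[OF _ r] by metis
    define a' where "a' = a(V0 := a0)"
    define b' where "b' = b(V0 := b0)"
    have g': "a' V \<in> lbox \<eta> r \<and> b' V \<in> lbox \<eta> r \<and> fl V (a' V) < fl V (b' V)" if "V \<in> f" for V
      using g[OF that] ab by (auto simp: a'_def b'_def)
    have rr1: "r \<ge> r1" using r r4(1) by linarith
    have "c1 \<le> r ^ ?d * (\<Prod>V\<in>f. fl V (b' V) - fl V (a' V))"
      using g' by (intro slab(4)[OF rr1]) (auto simp: lbox_def)
    also have "(\<Prod>V\<in>f. fl V (b' V) - fl V (a' V)) = (fl V0 b0 - fl V0 a0) * (\<Prod>V\<in>f - {V0}. fl V (b' V) - fl V (a' V))"
      using prod.remove[OF finf V0, of "\<lambda>V. fl V (b' V) - fl V (a' V)"] by (simp add: a'_def b'_def)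
    also have "(\<Prod>V\<in>f - {V0}. fl V (b' V) - fl V (a' V)) \<le> (\<Prod>V\<in>f - {V0}. K / real (N V r))"
      using g g' by (intro prod_mono) (auto simp: a'_def b'_def less_imp_le)
    finally show ?thesis
      using ab(3) r r4(3) by (simp add: mult_left_mono)
  qed
  have prod_upper: "(\<Prod>V\<in>f. real (N V r)) \<le> K ^ card f / c1 * r ^ ?d" if r: "r \<ge> r4" for r
  proof -
    obtain V0 where V0: "V0 \<in> f" using flag_nonempty[OF f] by blast
    obtain a0 b0 where ab: "a0 \<in> lbox \<eta> r" "b0 \<in> lbox \<eta> r" "fl V0 a0 < fl V0 b0" "fl V0 b0 - fl V0 a0 \<le> K / real (N V0 r)"
      using gap[OF V0 r] by blast
    have pn: "(\<Prod>V\<in>f - {V0}. K / real (N V r)) \<ge> 0" using K by (intro prod_nonneg) auto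
    have "c1 \<le> r ^ ?d * ((fl V0 b0 - fl V0 a0) * (\<Prod>V\<in>f - {V0}. K / real (N V r)))"
      by (rule slab'[OF V0 r ab(1-3)])
    also have "\<dots> \<le> r ^ ?d * (K / real (N V0 r) * (\<Prod>V\<in>f - {V0}. K / real (N V r)))"
      using ab(4) pn r r4(3) by (intro mult_left_mono mult_right_mono) auto
    also have "\<dots> = r ^ ?d * (\<Prod>V\<in>f. K / real (N V r))" using prod.remove[OF finf V0, of "\<lambda>V. K / real (N V r)"] by simp
    also have "\<dots> = r ^ ?d * (K ^ card f / (\<Prod>V\<in>f. real (N V r)))" by (simp add: prod_dividef)
    finally have *: "c1 \<le> r ^ ?d * (K ^ card f / (\<Prod>V\<in>f. real (N V r)))" .
    have "(\<Prod>V\<in>f. real (N V r)) > 0" using N2[OF _ r] by (intro prod_pos) fastforce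
    then show ?thesis using * slab(2) by (simp add: field_simps)
  qed
  define Lc where "Lc = (\<lambda>V r. card {\<gamma>\<in>stab S (f - {V}). norm (pv \<gamma>) \<le> 2 * r \<and> norm (pin \<gamma>) \<le> 2 * \<eta>})"
  define C6 where "C6 = K ^ card f / c1 / c0"
  have C6: "C6 > 0" using K slab(2) c0(1) by (simp add: C6_def)
  \<comment> \<open>The lower bound for the box and the upper bound for the whole product have the
    same order, so in the fibre estimate everything cancels except the factor of \<open>V\<close>
    and its line.\<close>
  have N_Lc: "real (N V r) \<le> C6 * real (Lc V r)" if V: "V \<in> f" and r: "r \<ge> r4" for V r
  proof -
    have "r \<ge> r2" using r r4(2) by linarith
    then have "c0 * r ^ ?d \<le> real (card (lbox \<eta> r))" by (rule c0(3))
    also have "\<dots> \<le> real ((\<Prod>V\<in>f - {V}. N V r) * Lc V r)"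
      using box_le_values_line[OF f V, of \<eta> r] unfolding N_def Lc_def by (simp only: of_nat_le_iff)
    finally have "c0 * r ^ ?d * real (N V r) \<le> (real (\<Prod>V\<in>f - {V}. N V r) * real (Lc V r)) * real (N V r)"
      by (intro mult_right_mono) auto
    also have "\<dots> = (\<Prod>V\<in>f. real (N V r)) * real (Lc V r)"
      using prod.remove[OF finf V, of "\<lambda>V. real (N V r)"] by simp
    also have "\<dots> \<le> (K ^ card f / c1 * r ^ ?d) * real (Lc V r)" using prod_upper[OF r] by (intro mult_right_mono) auto
    finally have "r ^ ?d * (c0 * real (N V r)) \<le> r ^ ?d * (K ^ card f / c1 * real (Lc V r))" by (simp add: mult_ac)
    moreover have "r ^ ?d > 0" using r r4(3) by simp
    ultimately have "c0 * real (N V r) \<le> K ^ card f / c1 * real (Lc V r)" by (rule mult_left_le_imp_le)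
    then have "real (N V r) \<le> (K ^ card f / c1 * real (Lc V r)) / c0"
      using c0(1) by (intro mult_imp_le_div_pos) (auto simp: mult.commute)
    also have "\<dots> = C6 * real (Lc V r)" by (simp add: C6_def)
    finally show ?thesis .
  qed
  \<comment> \<open>On a trivial line the count would be 1, and the number of values of
    \<open>fl V\<close> would stay bounded.\<close>
  have nontrivial: "stab S (f - {V}) \<noteq> {0}" if V: "V \<in> f" for V
  proof
    assume z: "stab S (f - {V}) = {0}"
    define m where "m = nat \<lceil>C6\<rceil> + 1"
    have VD: "V \<in> directions S" using V fD by blast
    obtain r0 where r0: "\<forall>r\<ge>r0. m \<le> card (fl V ` lbox \<eta> r)" using box_values_unbounded[OF VD slab(1)] by blast
    define r where "r = max r0 r4"
    have r: "r \<ge> r0" "r \<ge> r4" by (auto simp: r_def)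
    have "Lc V r \<le> card {0::'a}" unfolding Lc_def z by (intro card_mono) auto
    then have "C6 * real (Lc V r) \<le> C6 * 1" using C6 by (intro mult_left_mono) auto
    then have "real (N V r) \<le> C6" using N_Lc[OF V r(2)] by simp
    moreover have "real m \<le> real (N V r)" using r0 r(1) by (simp add: N_def)
    moreover have "real m > C6" unfolding m_def using C6 by (simp add: ceiling_less_iff) linarith
    ultimately show False by linarith
  qed
  have "\<exists>C>0. \<forall>r\<ge>r4. real (N V r) \<le> C * r ^ (t V - 1)" if V: "V \<in> f" for V
  proof -
    have "2 * \<eta> \<ge> 0" using slab(1) by simp
    then obtain C where C: "C > 0" "\<forall>r\<ge>1. finite {\<gamma>\<in>stab S (f - {V}). norm (pv \<gamma>) \<le> r \<and> norm (pin \<gamma>) \<le> 2 * \<eta>} \<and>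
     real (card {\<gamma>\<in>stab S (f - {V}). norm (pv \<gamma>) \<le> r \<and> norm (pin \<gamma>) \<le> 2 * \<eta>}) \<le> C * r ^ (t V - 1)"
      unfolding t_def using count_line[OF f V nontrivial[OF V]] by blast
    have "real (N V r) \<le> (C6 * C * 2 ^ (t V - 1)) * r ^ (t V - 1)" if r: "r \<ge> r4" for r
    proof -
      have "real (Lc V r) \<le> C * (2 * r) ^ (t V - 1)" unfolding Lc_def using C(2)[rule_format, of "2 * r"] r r4(3) by simp
      then have "C6 * real (Lc V r) \<le> C6 * (C * (2 * r) ^ (t V - 1))" using C6 by (intro mult_left_mono) auto
      then show ?thesis using N_Lc[OF V r] by (simp add: power_mult_distrib mult_ac)
    qed
    then show ?thesis using C6 C(1) by (intro exI[of _ "C6 * C * 2 ^ (t V - 1)"]) auto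
  qed
  then obtain C8 where C8: "\<And>V. V \<in> f \<Longrightarrow> C8 V > 0" "\<And>V r. V \<in> f \<Longrightarrow> r \<ge> r4 \<Longrightarrow> real (N V r) \<le> C8 V * r ^ (t V - 1)" by metis
  have lower: "c0 * r ^ ?d \<le> (\<Prod>V\<in>f. real (N V r))" if r: "r \<ge> r4" for r
  proof -
    have "r \<ge> r2" using r r4(2) by linarith
    then have "c0 * r ^ ?d \<le> real (card (lbox \<eta> r))" by (rule c0(3))
    also have "\<dots> \<le> real (\<Prod>V\<in>f. N V r)" using box_le_values[OF f, of \<eta> r] unfolding N_def by (simp only: of_nat_le_iff)
    finally show ?thesis by simp
  qed
  \<comment> \<open>The exponent obtained for the product of all N; comparison with the lower bound
    of order r^d forces it to be at least d.\<close>
  define e where "e = (\<Sum>V\<in>f. t V - 1)"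
  have growth: "c0 * r ^ ?d \<le> (\<Prod>V\<in>f. C8 V) * r ^ e" if r: "r \<ge> r4" for r
  proof -
    have "(\<Prod>V\<in>f. real (N V r)) \<le> (\<Prod>V\<in>f. C8 V * r ^ (t V - 1))" using C8(2)[OF _ r] by (intro prod_mono) auto
    also have "\<dots> = (\<Prod>V\<in>f. C8 V) * r ^ e" by (simp add: prod.distrib e_def power_sum)
    finally show ?thesis using lower[OF r] by linarith
  qed
  have de: "?d \<le> e"
  proof (rule ccontr)
    assume "\<not> ?d \<le> e"
    then have lt: "e + 1 \<le> ?d" by simp
    define B where "B = (\<Prod>V\<in>f. C8 V)"
    define r where "r = max r4 (B / c0 + 1)"
    have r: "r \<ge> r4" "r \<ge> B / c0 + 1" "r \<ge> 1" using r4(3) by (auto simp: r_def)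
    have "c0 * (r ^ e * r) \<le> c0 * r ^ ?d"
    proof (rule mult_left_mono)
      have "r ^ (e + 1) \<le> r ^ ?d" using lt r(3) by (rule power_increasing)
      then show "r ^ e * r \<le> r ^ ?d" by (simp add: mult.commute)
    qed (use c0(1) in simp)
    also have "\<dots> \<le> B * r ^ e" using growth[OF r(1)] by (simp add: B_def)
    finally have "r ^ e * (c0 * r) \<le> r ^ e * B" by (simp add: mult_ac)
    moreover have "r ^ e > 0" using r(3) by simp
    ultimately have "c0 * r \<le> B" by (rule mult_left_le_imp_le)
    then have "r \<le> B / c0" using c0(1) by (simp add: field_simps)
    then show False using r(2) by linarith
  qed
  have t1: "t V \<ge> 1" if V: "V \<in> f" for V
  proof (rule ccontr)
    assume "\<not> t V \<ge> 1"
    then have "t V = 0" by simp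
    then have "stab S (f - {V}) \<subseteq> {0}" unfolding t_def by (simp only: dim_eq_0)
    moreover have "0 \<in> stab S (f - {V})" using fD by (intro zmod.subspace_0 stab_zsub) auto
    ultimately show False using nontrivial[OF V] by blast
  qed
  have "e + card f = (\<Sum>V\<in>f. t V)"
  proof -
    have "e + card f = (\<Sum>V\<in>f. (t V - 1) + 1)" unfolding e_def sum.distrib by simp
    also have "\<dots> = (\<Sum>V\<in>f. t V)"
    proof (rule sum.cong[OF refl])
      show "t V - 1 + 1 = t V" if "V \<in> f" for V using t1[OF that] by simp
    qed
    finally show ?thesis .
  qed
  \<comment> \<open>Adding back one for each of the n members of the flag turns the bound d into d +
    n = k.\<close>
  then have tsum_ge: "DIM('a) \<le> (\<Sum>V\<in>f. t V)" using de flag_card[OF f] dim_PE by linarith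
  have "(\<Sum>V\<in>f. t V) \<le> DIM('a)"
    using line_ranks_superadditive[OF f subset_refl] dim_stab_le[of "f - f"] unfolding t_def by linarith
  then have tsum: "(\<Sum>V\<in>f. t V) = DIM('a)" using tsum_ge by simp
  \<comment> \<open>The line ranks add up to k. The stabiliser of \<open>V\<close> contains the
    lines of the other directions and is independent of the line of \<open>V\<close>, so its rank is
    exactly k minus that of this line.\<close>
  have sv_t: "sv V = t V" if V: "V \<in> f" for V
  proof -
    have "(\<Sum>V\<in>f - {V}. t V) \<le> dim (stab S (f - (f - {V})))"
      unfolding t_def by (rule line_ranks_superadditive[OF f]) auto
    moreover have "f - (f - {V}) = {V}" using V by blast
    ultimately have 1: "(\<Sum>V\<in>f - {V}. t V) \<le> dim (stab S {V})" by simp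
    have "{V} \<union> (f - {V}) = f" using V by blast
    then have "dim (stab S {V}) + t V \<le> DIM('a)"
      unfolding t_def using stab_superadditive[OF f, of "{V}" "f - {V}"] dim_stab_le order_trans by blast
    then show ?thesis using 1 tsum sum.remove[OF finf V, of t] sv_dim[of V] by linarith
  qed
  then show "(\<Sum>V\<in>f. sv V) = DIM('a)" using tsum by simp
  show "\<exists>c>0. \<forall>h\<in>stab S (f - {V}). h \<noteq> 0 \<longrightarrow> c \<le> \<bar>fl V h\<bar> * norm h ^ (sv V - 1)" if V: "V \<in> f" for V
  proof -
    obtain e0 where e0: "e0 > 0" "\<And>g. g \<in> \<Gamma> \<Longrightarrow> norm g < e0 \<Longrightarrow> g = 0"
      by (rule discrete_subgroup_separated[OF zsub disc], rule that)
    obtain Cf where Cf: "Cf > 0" "\<And>x t. t \<ge> 0 \<Longrightarrow> (\<And>V. V \<in> f \<Longrightarrow> \<bar>fl V x\<bar> \<le> t) \<Longrightarrow> norm (pin x) \<le> Cf * t"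
      using flag_norm_bound[OF f] by metis
    obtain Cp where Cp: "Cp \<ge> 1" "\<And>x. norm (pv x) \<le> Cp * norm x" using proj_bound by metis
    let ?s = "t V - 1"
    have fVD: "f - {V} \<subseteq> directions S" using fD by blast
    \<comment> \<open>Chosen so that the radius \<open>Q * norm h\<close> exceeds both the physical
      norm of \<open>h\<close> and the threshold \<open>r4\<close>, since
      \<open>norm h \<ge> e0\<close>.\<close>
    define Q where "Q = Cp + r4 / e0"
    have Q: "Q > 0" using Cp(1) r4(3) e0(1) by (simp add: Q_def add_pos_nonneg)
    define k1 where "k1 = c1 * c0 / (K ^ card (f - {V}) * C8 V)"
    have k1: "k1 > 0" using slab(2) c0(1) K C8(1)[OF V] by (simp add: k1_def)
    \<comment> \<open>The second entry serves \<open>h\<close> with internal norm at least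
      \<open>\<eta>\<close>; on the line this norm is controlled by \<open>fl V h\<close> alone,
      which is then bounded below.\<close>
    define k where "k = min (k1 / Q ^ ?s) (\<eta> / Cf * e0 ^ ?s)"
    have k: "k > 0" using k1 Q slab(1) Cf(1) e0(1) by (simp add: k_def)
    have "k \<le> \<bar>fl V h\<bar> * norm h ^ ?s" if h: "h \<in> stab S (f - {V})" "h \<noteq> 0" for h
    proof -
      have hG: "h \<in> \<Gamma>" using h(1) stab_subset by blast
      have he: "norm h \<ge> e0" using e0(2)[OF hG] h(2) by force
      have hz: "fl V' h = 0" if "V' \<in> f" "V' \<noteq> V" for V' using h(1) that by (simp add: stab_eq[OF fVD])
      have hV: "fl V h \<noteq> 0" using flag_fl_zero[OF f hG] h(2) hz by metis
      show ?thesis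
      proof (cases "norm (pin h) < \<eta>")
        case True
        define r where "r = Q * norm h"
        have "r4 / e0 * e0 \<le> r4 / e0 * norm h" using he r4(3) e0(1) by (intro mult_left_mono) auto
        then have r: "r \<ge> r4" "norm (pv h) \<le> r"
          using Cp(2)[of h] Cp(1) e0(1) r4(3) by (simp_all add: r_def Q_def distrib_right add_increasing add_increasing2)
        have zero: "0 \<in> lbox \<eta> r" using slab(1) r(1) r4(3) zmod.subspace_0[OF zsub] by (simp add: lbox_def)
        have hb: "h \<in> lbox \<eta> r" "- h \<in> lbox \<eta> r"
          using True r(2) hG zmod.subspace_neg[OF zsub hG] by (auto simp: lbox_def pv_minus pin_minus)
        define b where "b = (if fl V h > 0 then h else - h)"
        have b: "b \<in> lbox \<eta> r" "fl V b = \<bar>fl V h\<bar>" "fl V b > 0" using hb hV by (auto simp: b_def fl_minus)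
        have "c1 \<le> r ^ ?d * ((fl V b - fl V 0) * (\<Prod>V\<in>f - {V}. K / real (N V r)))"
          using b(3) by (intro slab'[OF V r(1) zero b(1)]) simp
        then have c1: "c1 \<le> r ^ ?d * (\<bar>fl V h\<bar> * (\<Prod>V\<in>f - {V}. K / real (N V r)))" using b(2) by simp
        define Pr where "Pr = (\<Prod>V\<in>f - {V}. real (N V r))"
        have Pr: "Pr > 0" unfolding Pr_def using N2[OF _ r(1)] by (intro prod_pos) fastforce
        have "c1 \<le> r ^ ?d * (\<bar>fl V h\<bar> * (K ^ card (f - {V}) / Pr))" using c1 by (simp add: prod_dividef Pr_def)
        then have 1: "c1 * Pr \<le> r ^ ?d * (\<bar>fl V h\<bar> * K ^ card (f - {V}))" using Pr by (simp add: field_simps)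
        have rs: "r ^ ?s > 0" "r ^ ?d > 0" using r(1) r4(3) by auto
        \<comment> \<open>The remaining product \<open>Pr\<close> is at least of order r^d divided
          by the bound for \<open>N V r\<close>; inserted in the slab bound, this leaves just the
          power \<open>sv V - 1\<close> of r.\<close>
        have "c0 * r ^ ?d \<le> real (N V r) * Pr" using lower[OF r(1)] prod.remove[OF finf V, of "\<lambda>V. real (N V r)"] by (simp add: Pr_def)
        also have "\<dots> \<le> (C8 V * r ^ ?s) * Pr" using C8(2)[OF V r(1)] Pr by (intro mult_right_mono) auto
        finally have "c1 * (c0 * r ^ ?d) \<le> c1 * ((C8 V * r ^ ?s) * Pr)" using slab(2) by (intro mult_left_mono) auto
        also have "\<dots> = (C8 V * r ^ ?s) * (c1 * Pr)" by simp
        also have "\<dots> \<le> (C8 V * r ^ ?s) * (r ^ ?d * (\<bar>fl V h\<bar> * K ^ card (f - {V})))"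
          using 1 C8(1)[OF V] rs by (intro mult_left_mono) auto
        finally have "r ^ ?d * (c1 * c0) \<le> r ^ ?d * ((C8 V * K ^ card (f - {V})) * (\<bar>fl V h\<bar> * r ^ ?s))" by (simp add: mult_ac)
        then have "c1 * c0 \<le> (C8 V * K ^ card (f - {V})) * (\<bar>fl V h\<bar> * r ^ ?s)" using rs(2) by (rule mult_left_le_imp_le)
        then have "k1 \<le> \<bar>fl V h\<bar> * r ^ ?s" using K C8(1)[OF V] by (simp add: k1_def field_simps)
        also have "\<dots> = Q ^ ?s * (\<bar>fl V h\<bar> * norm h ^ ?s)" by (simp add: r_def power_mult_distrib)
        finally have "k1 / Q ^ ?s \<le> \<bar>fl V h\<bar> * norm h ^ ?s" using Q by (simp add: field_simps)
        then show ?thesis by (simp add: k_def)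
      next
        case False
        have "\<bar>fl V' h\<bar> \<le> \<bar>fl V h\<bar>" if "V' \<in> f" for V' using hz that by (cases "V' = V") auto
        then have "norm (pin h) \<le> Cf * \<bar>fl V h\<bar>" using Cf(2)[of "\<bar>fl V h\<bar>" h] by simp
        then have "\<eta> / Cf \<le> \<bar>fl V h\<bar>" using False Cf(1) by (simp add: field_simps)
        moreover have "e0 ^ ?s \<le> norm h ^ ?s" using he e0(1) by (intro power_mono) auto
        ultimately have "\<eta> / Cf * e0 ^ ?s \<le> \<bar>fl V h\<bar> * norm h ^ ?s"
          using e0(1) by (intro mult_mono) auto
        then show ?thesis by (simp add: k_def)
      qed
    qed
    then show ?thesis using k sv_t[OF V] by (intro exI[of _ k]) simp
  qed
qed

lemma linearly_repetitive_imp: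
  assumes LR: "linearly_repetitive S nrm"
  shows "full_rank" "\<And>V. V \<in> directions S \<Longrightarrow> badly_approximable V"
proof -
  show fr: "full_rank"
    unfolding full_rank_def using linearly_repetitive_flag(1)[OF LR] by blast
  fix V assume "V \<in> directions S"
  then obtain f where f: "flag f" "V \<in> f" using flag_containing by blast
  obtain c where c: "c > 0" "\<forall>h\<in>stab S (f - {V}). h \<noteq> 0 \<longrightarrow> c \<le> \<bar>fl V h\<bar> * norm h ^ (sv V - 1)"
    using linearly_repetitive_flag(2)[OF LR f] by blast
  show "badly_approximable V"
    by (rule badly_approximable_from_line[OF fr f c(1)]) (use c(2) in blast)
qed

section \<open>Transference\<close>

text \<open>With exponent 0 the nonzero values of \<open>fl V\<close> on the lattice would stay away
  from 0, contradicting density. This later makes errors shrink when the radius grows.\<close>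

lemma sv_ge_2:
  assumes "V \<in> directions S" "badly_approximable V"
  shows "sv V \<ge> 2"
proof (rule ccontr)
  assume "\<not> sv V \<ge> 2"
  then have s: "sv V - 1 = 0" by simp
  obtain c where c: "c > 0" "\<And>\<gamma>. \<gamma> \<in> \<Gamma> \<Longrightarrow> fl V \<gamma> \<noteq> 0 \<Longrightarrow> c \<le> \<bar>fl V \<gamma>\<bar>"
    using assms(2) unfolding badly_approximable_def s by auto
  obtain f where f: "flag f" "V \<in> f" using flag_containing[OF assms(1)] by blast
  obtain \<gamma> where "\<gamma> \<in> \<Gamma>" "\<forall>V\<in>f. 0 < fl V \<gamma> \<and> fl V \<gamma> < c"
    using flag_slab_hit[OF f(1), of "\<lambda>_. 0" "\<lambda>_. c"] c(1) by auto
  then show False using c(2)[of \<gamma>] f(2) by force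
qed

text \<open>The box with sides r along the physical space and \<open>c' / r ^ (sv V - 1)\<close>
  along the flag has volume of constant order. Bad approximability keeps it free of nonzero lattice
  points, so the covering lemma applies with a constant independent of r.\<close>

lemma transference_flag:
  assumes fr: "full_rank" and ba: "\<And>V. V \<in> directions S \<Longrightarrow> badly_approximable V" and f: "flag f"
  shows "\<exists>C>0. \<forall>r\<ge>1. \<forall>p\<in>E. \<exists>\<gamma>\<in>\<Gamma>. norm (pv \<gamma>) \<le> C * r \<and> (\<forall>V\<in>f. \<bar>fl V (\<gamma> - p)\<bar> \<le> C / r ^ (sv V - 1))"
proof -
  have finf: "finite f" by (rule flag_finite[OF f])
  have fD: "f \<subseteq> directions S" by (rule flag_sub[OF f])
  obtain A where A: "A \<subseteq> P" "independent A" "P \<subseteq> span A" "card A = dim P"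
    using basis_exists by metis
  have finA: "finite A" using A(2) by (simp add: finiteI_independent)
  have "\<exists>C>0. \<forall>x\<in>P. \<forall>t\<ge>0. (\<forall>a\<in>A. \<bar>a \<bullet> x\<bar> \<le> t) \<longrightarrow> norm x \<le> C * t"
  proof (rule linear_family_bound[OF finA _ subP])
    show "linear (\<lambda>x. a \<bullet> x)" for a :: 'a by (auto simp: linear_iff inner_simps)
    fix x assume x: "x \<in> P" "\<And>a. a \<in> A \<Longrightarrow> a \<bullet> x = 0"
    have "subspace {y. y \<bullet> x = 0}" by (auto simp: subspace_def inner_simps)
    then have "span A \<subseteq> {y. y \<bullet> x = 0}" using x(2) by (intro real_vector.span_minimal) auto
    then have "x \<bullet> x = 0" using x(1) A(3) by blast
    then show "x = 0" by simp
  qed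
  then obtain CA where CA: "CA > 0" "\<forall>x\<in>P. \<forall>t\<ge>0. (\<forall>a\<in>A. \<bar>a \<bullet> x\<bar> \<le> t) \<longrightarrow> norm x \<le> CA * t" by blast
  obtain Cf where Cf: "Cf > 0" "\<And>x t. t \<ge> 0 \<Longrightarrow> (\<And>V. V \<in> f \<Longrightarrow> \<bar>fl V x\<bar> \<le> t) \<Longrightarrow> norm (pin x) \<le> Cf * t"
    using flag_norm_bound[OF f] by metis
  define H where "H = CA + Cf"
  have H: "H > 0" using CA(1) Cf(1) by (simp add: H_def)
  obtain c where c: "\<And>V. V \<in> f \<Longrightarrow> c V > 0" "\<And>V \<gamma>. V \<in> f \<Longrightarrow> \<gamma> \<in> \<Gamma> \<Longrightarrow> fl V \<gamma> \<noteq> 0 \<Longrightarrow> c V \<le> \<bar>fl V \<gamma>\<bar> * norm \<gamma> ^ (sv V - 1)"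
    using ba fD unfolding badly_approximable_def by (metis subsetD)
  \<comment> \<open>A lattice point of the box has norm at most \<open>H * r\<close>; with this
    \<open>c'\<close> a nonzero value of \<open>fl V\<close> at it would violate bad
    approximability.\<close>
  define c' where "c' = min 1 (Min ((\<lambda>V. c V / H ^ (sv V - 1)) ` f))"
  have c': "c' > 0" "c' \<le> 1" unfolding c'_def using finf flag_nonempty[OF f] c(1) H by auto
  have c'V: "c' \<le> c V / H ^ (sv V - 1)" if "V \<in> f" for V
    unfolding c'_def using finf that by (simp add: min_le_iff_disj)
  define I where "I = A <+> f"
  define \<phi> where "\<phi> = case_sum (\<lambda>a x. a \<bullet> pv x) fl"
  have II: "a \<in> A \<Longrightarrow> Inl a \<in> I" "V \<in> f \<Longrightarrow> Inr V \<in> I" for a V by (auto simp: I_def)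
  have finI: "finite I" using finA finf by (simp add: I_def)
  have cardI: "card I = DIM('a)" using finA finf A(4) flag_card[OF f] dim_PE by (simp add: I_def card_Plus)
  have lin: "linear (\<phi> i)" for i
    by (cases i) (auto simp: \<phi>_def fl_add fl_scale linear_iff pv_add pv_scale inner_simps)
  have \<kappa>: "c' ^ card f > 0" using c'(1) by simp
  have "\<exists>C>0. \<forall>\<rho>. (\<forall>i\<in>I. \<rho> i > 0) \<longrightarrow> (\<Prod>i\<in>I. \<rho> i) \<ge> c' ^ card f \<longrightarrow>
    (\<forall>g\<in>\<Gamma>. (\<forall>i\<in>I. \<bar>\<phi> i g\<bar> < \<rho> i) \<longrightarrow> g = 0) \<longrightarrow> (\<forall>x. \<exists>g\<in>\<Gamma>. \<forall>i\<in>I. \<bar>\<phi> i (x - g)\<bar> \<le> C * \<rho> i)"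
    by (rule lattice_covering_radius[OF zsub spanG finI cardI lin \<kappa>])
  then obtain C where C: "C > 0" "\<And>\<rho>. (\<forall>i\<in>I. \<rho> i > 0) \<Longrightarrow> (\<Prod>i\<in>I. \<rho> i) \<ge> c' ^ card f \<Longrightarrow>
    (\<forall>g\<in>\<Gamma>. (\<forall>i\<in>I. \<bar>\<phi> i g\<bar> < \<rho> i) \<longrightarrow> g = 0) \<Longrightarrow> (\<forall>x. \<exists>g\<in>\<Gamma>. \<forall>i\<in>I. \<bar>\<phi> i (x - g)\<bar> \<le> C * \<rho> i)" by blast
  have sum1: "(\<Sum>V\<in>f. sv V - 1) = dim P"
  proof -
    have "(\<Sum>V\<in>f. sv V - 1) + card f = (\<Sum>V\<in>f. (sv V - 1) + 1)" unfolding sum.distrib by simp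
    also have "\<dots> = (\<Sum>V\<in>f. sv V)"
    proof (rule sum.cong[OF refl])
      show "sv V - 1 + 1 = sv V" if "V \<in> f" for V using sv_pos[of V] that fD by auto
    qed
    also have "\<dots> = DIM('a)" using fr f by (simp add: full_rank_def)
    finally show ?thesis using flag_card[OF f] dim_PE by linarith
  qed
  define C' where "C' = max (CA * C) C"
  have main: "\<exists>\<gamma>\<in>\<Gamma>. norm (pv \<gamma>) \<le> C' * r \<and> (\<forall>V\<in>f. \<bar>fl V (\<gamma> - p)\<bar> \<le> C' / r ^ (sv V - 1))"
    if r: "r \<ge> 1" and p: "p \<in> E" for r p
  proof -
    define \<rho> where "\<rho> = case_sum (\<lambda>a::'a. r) (\<lambda>V. c' / r ^ (sv V - 1))"
    have pos: "\<forall>i\<in>I. \<rho> i > 0" using r c'(1) by (auto simp: I_def \<rho>_def)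
    have "(\<Prod>i\<in>I. \<rho> i) = r ^ card A * (\<Prod>V\<in>f. c' / r ^ (sv V - 1))"
      unfolding I_def using prod.Plus[OF finA finf, of \<rho>] by (simp add: \<rho>_def)
    also have "(\<Prod>V\<in>f. c' / r ^ (sv V - 1)) = c' ^ card f / r ^ dim P"
      by (simp add: prod_dividef sum1[symmetric] power_sum)
    finally have prod: "(\<Prod>i\<in>I. \<rho> i) \<ge> c' ^ card f" using r A(4) by simp
    have sep: "\<forall>g\<in>\<Gamma>. (\<forall>i\<in>I. \<bar>\<phi> i g\<bar> < \<rho> i) \<longrightarrow> g = 0"
    proof (intro ballI impI)
      fix g assume g: "g \<in> \<Gamma>" "\<forall>i\<in>I. \<bar>\<phi> i g\<bar> < \<rho> i"
      have gA: "\<bar>a \<bullet> pv g\<bar> < r" if "a \<in> A" for a using g(2)[rule_format, OF II(1)[OF that]] by (simp add: \<phi>_def \<rho>_def)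
      have gf: "\<bar>fl V g\<bar> < c' / r ^ (sv V - 1)" if "V \<in> f" for V using g(2)[rule_format, OF II(2)[OF that]] by (simp add: \<phi>_def \<rho>_def)
      have n1: "norm (pv g) \<le> CA * r" using CA(2)[rule_format, OF pv_in, of r g] gA r by (simp add: less_imp_le)
      have n2: "norm (pin g) \<le> Cf * 1"
      proof (rule Cf(2))
        fix V assume V: "V \<in> f"
        have "c' / r ^ (sv V - 1) \<le> 1" using c'(1,2) r by (simp add: divide_le_eq order_trans[OF c'(2)])
        then show "\<bar>fl V g\<bar> \<le> 1" using gf[OF V] by linarith
      qed simp
      have "Cf * 1 \<le> Cf * r" using r Cf(1) by (intro mult_left_mono) auto
      then have nH: "norm g \<le> H * r" using norm_le_split[of g] n1 n2 by (simp add: H_def algebra_simps)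
      have "fl V g = 0" if V: "V \<in> f" for V
      proof (rule ccontr)
        assume nz: "fl V g \<noteq> 0"
        let ?s = "sv V - 1"
        have "c V \<le> \<bar>fl V g\<bar> * norm g ^ ?s" by (rule c(2)[OF V g(1) nz])
        also have "\<dots> \<le> \<bar>fl V g\<bar> * (H * r) ^ ?s" using nH by (intro mult_left_mono power_mono) auto
        also have "\<dots> < (c' / r ^ ?s) * (H * r) ^ ?s" using gf[OF V] H r by (intro mult_strict_right_mono) auto
        also have "\<dots> = c' * H ^ ?s" using r by (simp add: power_mult_distrib)
        also have "\<dots> \<le> c V"
        proof -
          have "H ^ ?s > 0" using H by simp
          then show ?thesis using c'V[OF V] pos_le_divide_eq by blast
        qed
        finally show False by simp
      qed
      then show "g = 0" using flag_fl_zero[OF f g(1)] by blast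
    qed
    obtain g where g: "g \<in> \<Gamma>" "\<forall>i\<in>I. \<bar>\<phi> i (p - g)\<bar> \<le> C * \<rho> i"
      using C(2)[OF pos prod sep] by blast
    have "\<bar>a \<bullet> pv g\<bar> \<le> C * r" if "a \<in> A" for a
      using g(2)[rule_format, OF II(1)[OF that]] pv_E[OF p] by (simp add: \<phi>_def \<rho>_def pv_diff)
    then have "norm (pv g) \<le> CA * (C * r)" using CA(2)[rule_format, OF pv_in, of "C * r" g] C(1) r by simp
    also have "\<dots> \<le> C' * r" using r by (simp add: C'_def mult.assoc[symmetric])
    finally have n: "norm (pv g) \<le> C' * r" .
    have "\<bar>fl V (g - p)\<bar> \<le> C' / r ^ (sv V - 1)" if V: "V \<in> f" for V
    proof -
      have "\<bar>fl V (p - g)\<bar> \<le> C * (c' / r ^ (sv V - 1))"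
        using g(2)[rule_format, OF II(2)[OF V]] by (simp add: \<phi>_def \<rho>_def)
      also have "\<dots> = C * c' / r ^ (sv V - 1)" by simp
      also have "\<dots> \<le> C' / r ^ (sv V - 1)"
      proof (rule divide_right_mono)
        have "C * c' \<le> C * 1" using c'(2) C(1) by (intro mult_left_mono) auto
        then show "C * c' \<le> C'" by (simp add: C'_def)
      qed (use r in simp)
      finally show ?thesis by (simp add: fl_diff abs_minus_commute)
    qed
    then show ?thesis using g(1) n by blast
  qed
  show ?thesis using main C(1) by (intro exI[of _ C']) (auto simp: C'_def)
qed

text \<open>Other normals are combinations of flag normals with the same corank, so the bound passes
  to them with the same power of r.\<close>

lemma transference:
  assumes fr: "full_rank" and ba: "\<And>V. V \<in> directions S \<Longrightarrow> badly_approximable V"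
  shows "\<exists>C>0. \<forall>r\<ge>1. \<forall>p\<in>E. \<exists>\<gamma>\<in>\<Gamma>. norm (pv \<gamma>) \<le> C * r \<and> (\<forall>V\<in>directions S. \<bar>fl V (\<gamma> - p)\<bar> \<le> C / r ^ (sv V - 1))"
proof -
  obtain f where f: "flag f" using flag_exists by blast
  have finf: "finite f" by (rule flag_finite[OF f])
  obtain C where C: "C > 0" "\<forall>r\<ge>1. \<forall>p\<in>E. \<exists>\<gamma>\<in>\<Gamma>. norm (pv \<gamma>) \<le> C * r \<and> (\<forall>V\<in>f. \<bar>fl V (\<gamma> - p)\<bar> \<le> C / r ^ (sv V - 1))"
    using transference_flag[OF fr ba f] by blast
  have "\<forall>V\<in>directions S. \<exists>D>0. \<forall>x. \<forall>t\<ge>0. (\<forall>a\<in>nv ` {V' \<in> f. sv V' = sv V}. \<bar>a \<bullet> x\<bar> \<le> t) \<longrightarrow> \<bar>nv V \<bullet> x\<bar> \<le> D * t"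
    using finf by (intro ballI span_inner_bound exchange_same_rank fr f) auto
  from bchoice[OF this] obtain D where D: "\<And>V. V \<in> directions S \<Longrightarrow> D V > 0"
    "\<And>V x t. V \<in> directions S \<Longrightarrow> t \<ge> 0 \<Longrightarrow> (\<forall>a\<in>nv ` {V' \<in> f. sv V' = sv V}. \<bar>a \<bullet> x\<bar> \<le> t) \<Longrightarrow> \<bar>nv V \<bullet> x\<bar> \<le> D V * t"
    by blast
  define B where "B = 1 + (\<Sum>V\<in>directions S. D V)"
  have Dn: "D V \<ge> 0" if "V \<in> directions S" for V using D(1)[OF that] by simp
  have B1: "B \<ge> 1" unfolding B_def using Dn by (simp add: sum_nonneg)
  have DB: "D V \<le> B" if "V \<in> directions S" for V
    unfolding B_def using member_le_sum[of V "directions S" D] that Dn finite_directions by auto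
  have "\<exists>\<gamma>\<in>\<Gamma>. norm (pv \<gamma>) \<le> (B * C) * r \<and> (\<forall>V\<in>directions S. \<bar>fl V (\<gamma> - p)\<bar> \<le> (B * C) / r ^ (sv V - 1))"
    if r: "r \<ge> 1" and p: "p \<in> E" for r p
  proof -
    obtain \<gamma> where \<gamma>: "\<gamma> \<in> \<Gamma>" "norm (pv \<gamma>) \<le> C * r" "\<forall>V\<in>f. \<bar>fl V (\<gamma> - p)\<bar> \<le> C / r ^ (sv V - 1)"
      using C(2) r p by blast
    have "C * r \<le> B * (C * r)" using mult_right_mono[OF B1, of "C * r"] C(1) r by simp
    then have "norm (pv \<gamma>) \<le> (B * C) * r" using \<gamma>(2) by (simp add: mult.assoc)
    moreover have "\<bar>fl V (\<gamma> - p)\<bar> \<le> (B * C) / r ^ (sv V - 1)" if V: "V \<in> directions S" for V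
    proof -
      have t: "C / r ^ (sv V - 1) \<ge> 0" using C(1) r by simp
      have "\<bar>nv V \<bullet> pin (\<gamma> - p)\<bar> \<le> D V * (C / r ^ (sv V - 1))"
      proof (rule D(2)[OF V t])
        show "\<forall>a\<in>nv ` {V' \<in> f. sv V' = sv V}. \<bar>a \<bullet> pin (\<gamma> - p)\<bar> \<le> C / r ^ (sv V - 1)"
          using \<gamma>(3) by (auto simp: fl_def)
      qed
      also have "\<dots> \<le> B * (C / r ^ (sv V - 1))" using DB[OF V] t by (intro mult_right_mono) auto
      finally show ?thesis by (simp add: fl_def)
    qed
    ultimately show ?thesis using \<gamma>(1) by blast
  qed
  then show ?thesis using B1 C(1) by (intro exI[of _ "B * C"]) auto
qed

section \<open>Vertices of the cells\<close>

text \<open>Split each \<open>g V\<close> along the lines of the flag and add up the components of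
  \<open>g V\<close> on the line of \<open>V\<close>: every functional of the flag sees only its own
  summand.\<close>

lemma common_vertex:
  assumes fr: "full_rank" and f: "flag f"
  shows "\<exists>M::nat. \<exists>C>0. M > 0 \<and> (\<forall>g t. t \<ge> 0 \<longrightarrow> (\<forall>V\<in>f. g V \<in> \<Gamma> \<and> norm (g V) \<le> t) \<longrightarrow>
    (\<exists>\<gamma>\<in>\<Gamma>. norm \<gamma> \<le> C * t \<and> (\<forall>V\<in>f. fl V \<gamma> = real M * fl V (g V))))"
proof -
  have finf: "finite f" by (rule flag_finite[OF f])
  obtain M :: nat and C where MC: "M > 0" "C > 0"
    "\<And>\<gamma>. \<gamma> \<in> \<Gamma> \<Longrightarrow> \<exists>h. (\<forall>V\<in>f. h V \<in> stab S (f - {V}) \<and> norm (h V) \<le> C * norm \<gamma>) \<and>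
      real M *\<^sub>R \<gamma> = (\<Sum>V\<in>f. h V)"
    using line_decomposition[OF fr f] by blast
  have "\<exists>\<gamma>\<in>\<Gamma>. norm \<gamma> \<le> (real (card f) * C) * t \<and> (\<forall>V\<in>f. fl V \<gamma> = real M * fl V (g V))"
    if t: "t \<ge> 0" and g: "\<forall>V\<in>f. g V \<in> \<Gamma> \<and> norm (g V) \<le> t" for g t
  proof -
    have "\<exists>h. V \<in> f \<longrightarrow> (\<forall>U\<in>f. h U \<in> stab S (f - {U}) \<and> norm (h U) \<le> C * norm (g V)) \<and> real M *\<^sub>R g V = (\<Sum>U\<in>f. h U)" for V
      using MC(3) g by blast
    then obtain h where h: "\<And>V. V \<in> f \<Longrightarrow> (\<forall>U\<in>f. h V U \<in> stab S (f - {U}) \<and> norm (h V U) \<le> C * norm (g V)) \<and> real M *\<^sub>R g V = (\<Sum>U\<in>f. h V U)"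
      by metis
    define \<gamma> where "\<gamma> = (\<Sum>V\<in>f. h V V)"
    have "\<gamma> \<in> \<Gamma>" unfolding \<gamma>_def using h stab_subset by (intro zmod.subspace_sum[OF zsub]) blast
    moreover have "norm \<gamma> \<le> (real (card f) * C) * t"
    proof -
      have "norm (h V V) \<le> C * t" if V: "V \<in> f" for V
      proof -
        have "norm (h V V) \<le> C * norm (g V)" using h[OF V] V by blast
        also have "\<dots> \<le> C * t" using g V MC(2) by (intro mult_left_mono) auto
        finally show ?thesis .
      qed
      then have "norm \<gamma> \<le> (\<Sum>V\<in>f. C * t)" unfolding \<gamma>_def by (intro sum_norm_le) auto
      then show ?thesis by simp
    qed
    moreover have "fl V \<gamma> = real M * fl V (g V)" if V: "V \<in> f" for V
    proof -
      have "fl V \<gamma> = fl V (h V V)" unfolding \<gamma>_def by (rule fl_line_sum[OF f V]) (use h in blast)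
      also have "\<dots> = fl V (\<Sum>U\<in>f. h V U)" by (rule fl_line_sum[OF f V, symmetric]) (use h[OF V] in blast)
      also have "\<dots> = fl V (real M *\<^sub>R g V)" using h[OF V] by simp
      finally show ?thesis by (simp add: fl_scale)
    qed
    ultimately show ?thesis by blast
  qed
  moreover have "real (card f) * C > 0" using MC(2) flag_nonempty[OF f] finf by (simp add: card_gt_0_iff)
  ultimately show ?thesis using MC(1) by blast
qed

text \<open>Relative to \<open>o'\<close> the vertex is the projection of a lattice point of norm
  O(r) divided by a fixed integer. Its distance to another level is a value of \<open>fl V'\<close>
  at a lattice point, again up to a fixed denominator, and bad approximability bounds it.\<close>

lemma vertex_gap:
  assumes fr: "full_rank" and ba: "\<And>V. V \<in> directions S \<Longrightarrow> badly_approximable V" and N: "N > 0" and o': "o' \<in> E"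
  shows "\<exists>c>0. \<forall>r\<ge>1. \<forall>f d v V' d'. flag f \<longrightarrow> v \<in> E \<longrightarrow>
     (\<forall>V\<in>f. d V \<in> \<Gamma> \<and> norm (d V) \<le> r \<and> nv V \<bullet> v = nv V \<bullet> o' + fl V (d V) / real N) \<longrightarrow>
     V' \<in> directions S \<longrightarrow> d' \<in> \<Gamma> \<longrightarrow> norm d' \<le> r \<longrightarrow>
     nv V' \<bullet> v = nv V' \<bullet> o' + fl V' d' / real N \<or> c / r ^ (sv V' - 1) \<le> \<bar>nv V' \<bullet> v - (nv V' \<bullet> o' + fl V' d' / real N)\<bar>"
proof -
  have "\<exists>c>0. \<forall>r\<ge>1. \<forall>d v d'. v \<in> E \<longrightarrow>
     (\<forall>V\<in>f. d V \<in> \<Gamma> \<and> norm (d V) \<le> r \<and> nv V \<bullet> v = nv V \<bullet> o' + fl V (d V) / real N) \<longrightarrow>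
     d' \<in> \<Gamma> \<longrightarrow> norm d' \<le> r \<longrightarrow>
     nv V' \<bullet> v = nv V' \<bullet> o' + fl V' d' / real N \<or> c / r ^ (sv V' - 1) \<le> \<bar>nv V' \<bullet> v - (nv V' \<bullet> o' + fl V' d' / real N)\<bar>"
    if f: "flag f" and V': "V' \<in> directions S" for f V'
  proof -
    obtain M :: nat and C where MC: "M > 0" "C > 0" "\<And>g t. t \<ge> 0 \<Longrightarrow> (\<forall>V\<in>f. g V \<in> \<Gamma> \<and> norm (g V) \<le> t) \<Longrightarrow>
      (\<exists>\<gamma>\<in>\<Gamma>. norm \<gamma> \<le> C * t \<and> (\<forall>V\<in>f. fl V \<gamma> = real M * fl V (g V)))"
      using common_vertex[OF fr f] by blast
    obtain c where c: "c > 0" "\<And>\<gamma>. \<gamma> \<in> \<Gamma> \<Longrightarrow> fl V' \<gamma> \<noteq> 0 \<Longrightarrow> c \<le> \<bar>fl V' \<gamma>\<bar> * norm \<gamma> ^ (sv V' - 1)"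
      using ba[OF V'] unfolding badly_approximable_def by blast
    let ?s = "sv V' - 1"
    define c2 where "c2 = c / ((C + real M) ^ ?s * (real M * real N))"
    have CM: "C + real M > 0" using MC(2) by simp
    have c2: "c2 > 0" using c(1) CM MC(1) N by (simp add: c2_def)
    have "nv V' \<bullet> v = nv V' \<bullet> o' + fl V' d' / real N \<or> c2 / r ^ ?s \<le> \<bar>nv V' \<bullet> v - (nv V' \<bullet> o' + fl V' d' / real N)\<bar>"
      if r: "r \<ge> 1" and v: "v \<in> E" and d: "\<forall>V\<in>f. d V \<in> \<Gamma> \<and> norm (d V) \<le> r \<and> nv V \<bullet> v = nv V \<bullet> o' + fl V (d V) / real N"
        and d': "d' \<in> \<Gamma>" "norm d' \<le> r" for r d v d'
    proof -
      have "r \<ge> 0" using r by simp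
      then obtain \<gamma> where \<gamma>: "\<gamma> \<in> \<Gamma>" "norm \<gamma> \<le> C * r" "\<forall>V\<in>f. fl V \<gamma> = real M * fl V (d V)"
        using MC(3)[of r d] d by blast
      \<comment> \<open>\<open>M\<close> makes the vertex integral and \<open>N\<close> is the
        denominator of weak homogeneity.\<close>
      define k where "k = 1 / (real M * real N)"
      have k: "k > 0" using MC(1) N by (simp add: k_def)
      have "v - o' - k *\<^sub>R pin \<gamma> = 0"
      proof (rule flag_separates[OF f])
        show "v - o' - k *\<^sub>R pin \<gamma> \<in> E" using v o' pin_in subE by (intro subspace_diff subspace_scale) auto
        fix V assume V: "V \<in> f"
        have "nv V \<bullet> (v - o' - k *\<^sub>R pin \<gamma>) = fl V (d V) / real N - k * fl V \<gamma>"
          using d V by (simp add: inner_diff_right fl_def)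
        also have "\<dots> = 0" using \<gamma>(3) V MC(1) N by (simp add: k_def)
        finally show "nv V \<bullet> (v - o' - k *\<^sub>R pin \<gamma>) = 0" .
      qed
      then have v: "v = o' + k *\<^sub>R pin \<gamma>" by (simp add: algebra_simps)
      define \<mu> where "\<mu> = \<gamma> - real M *\<^sub>R d'"
      have \<mu>G: "\<mu> \<in> \<Gamma>" unfolding \<mu>_def by (intro zsubspace_diff[OF zsub] \<gamma>(1) zsubspace_of_nat[OF zsub] d'(1))
      have diff: "nv V' \<bullet> v - (nv V' \<bullet> o' + fl V' d' / real N) = k * fl V' \<mu>"
        using MC(1) N unfolding v \<mu>_def by (simp add: inner_add_right fl_def[symmetric] fl_diff fl_scale k_def field_simps)
      show ?thesis
      proof (cases "fl V' \<mu> = 0")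
        case True
        then show ?thesis using diff by simp
      next
        case False
        have "norm \<mu> \<le> norm \<gamma> + real M * norm d'"
          unfolding \<mu>_def using norm_triangle_ineq4[of \<gamma> "real M *\<^sub>R d'"] by simp
        also have "\<dots> \<le> C * r + real M * r" using \<gamma>(2) d'(2) by (intro add_mono mult_left_mono) auto
        finally have n: "norm \<mu> \<le> (C + real M) * r" by (simp add: algebra_simps)
        have "c \<le> \<bar>fl V' \<mu>\<bar> * norm \<mu> ^ ?s" by (rule c(2)[OF \<mu>G False])
        also have "\<dots> \<le> \<bar>fl V' \<mu>\<bar> * ((C + real M) * r) ^ ?s" using n by (intro mult_left_mono power_mono) auto
        finally have "c \<le> \<bar>fl V' \<mu>\<bar> * ((C + real M) ^ ?s * r ^ ?s)" by (simp add: power_mult_distrib)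
        then have "c2 / r ^ ?s \<le> k * \<bar>fl V' \<mu>\<bar>"
          unfolding c2_def k_def using CM MC(1) N r by (simp add: field_simps)
        then show ?thesis unfolding diff using k by (simp add: abs_mult)
      qed
    qed
    then show ?thesis using c2 by blast
  qed
  then obtain c where c: "\<And>f V'. flag f \<Longrightarrow> V' \<in> directions S \<Longrightarrow> c f V' > 0 \<and> (\<forall>r\<ge>1. \<forall>d v d'. v \<in> E \<longrightarrow>
     (\<forall>V\<in>f. d V \<in> \<Gamma> \<and> norm (d V) \<le> r \<and> nv V \<bullet> v = nv V \<bullet> o' + fl V (d V) / real N) \<longrightarrow>
     d' \<in> \<Gamma> \<longrightarrow> norm d' \<le> r \<longrightarrow>
     nv V' \<bullet> v = nv V' \<bullet> o' + fl V' d' / real N \<or> c f V' / r ^ (sv V' - 1) \<le> \<bar>nv V' \<bullet> v - (nv V' \<bullet> o' + fl V' d' / real N)\<bar>)"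
    by metis
  \<comment> \<open>There are finitely many flags and directions, so one constant serves all of
    them.\<close>
  define X where "X = {f. flag f} \<times> directions S"
  have "{f. flag f} \<subseteq> Pow (directions S)" using flag_sub by blast
  then have finX: "finite X" unfolding X_def using finite_directions finite_subset by blast
  obtain f0 where f0: "flag f0" using flag_exists by blast
  obtain V0 where V0: "V0 \<in> directions S" using flag_nonempty[OF f0] flag_sub[OF f0] by blast
  have Xne: "X \<noteq> {}" using f0 V0 by (auto simp: X_def)
  define cc where "cc = Min ((\<lambda>(f, V). c f V) ` X)"
  have "cc > 0" unfolding cc_def using finX Xne c by (auto simp: X_def)
  moreover have le: "cc \<le> c f V" if "flag f" "V \<in> directions S" for f V
    unfolding cc_def using finX that by (intro Min_le) (auto simp: X_def)
  have "nv V' \<bullet> v = nv V' \<bullet> o' + fl V' d' / real N \<or> cc / r ^ (sv V' - 1) \<le> \<bar>nv V' \<bullet> v - (nv V' \<bullet> o' + fl V' d' / real N)\<bar>"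
    if A: "r \<ge> 1" "flag f" "v \<in> E" "\<forall>V\<in>f. d V \<in> \<Gamma> \<and> norm (d V) \<le> r \<and> nv V \<bullet> v = nv V \<bullet> o' + fl V (d V) / real N"
      "V' \<in> directions S" "d' \<in> \<Gamma>" "norm d' \<le> r" for r f d v V' d'
  proof -
    have "nv V' \<bullet> v = nv V' \<bullet> o' + fl V' d' / real N \<or> c f V' / r ^ (sv V' - 1) \<le> \<bar>nv V' \<bullet> v - (nv V' \<bullet> o' + fl V' d' / real N)\<bar>"
      using c[OF A(2,5)] A(1,3,4,6,7) by blast
    moreover have "cc / r ^ (sv V' - 1) \<le> c f V' / r ^ (sv V' - 1)" using le[OF A(2,5)] A(1) by (intro divide_right_mono) auto
    ultimately show ?thesis by linarith
  qed
  ultimately show ?thesis by blast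
qed

section \<open>Linear repetitivity from bad approximability\<close>

text \<open>Relative to the common point \<open>o'\<close> every hyperplane has its level given by a
  lattice point over \<open>N\<close>, so all displaced levels are of the same kind.\<close>

lemma weakly_homogeneous_values:
  assumes "weakly_homogeneous S"
  obtains N :: nat and o' gam where "N > 0" "o' \<in> E" "\<And>H. H \<in> hyperplanes S \<Longrightarrow> gam H \<in> \<Gamma>"
    "\<And>H x. H \<in> hyperplanes S \<Longrightarrow>
       x \<in> H \<longleftrightarrow> x \<in> E \<and> nv (direction H) \<bullet> x = nv (direction H) \<bullet> o' + fl (direction H) (gam H) / real N"
proof -
  obtain N :: nat and g o' where N: "N > 0"
    and g: "\<forall>H\<in>hyperplanes S. g H \<in> (\<lambda>\<gamma>. (1 / real N) *\<^sub>R \<gamma>) ` \<Gamma>"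
    and o': "o' \<in> (\<Inter>H\<in>hyperplanes S. (\<lambda>x. x - pin (g H)) ` H)"
    using assms unfolding weakly_homogeneous_def by blast
  have "\<forall>H\<in>hyperplanes S. \<exists>\<gamma>. \<gamma> \<in> \<Gamma> \<and> g H = (1 / real N) *\<^sub>R \<gamma>" using g by blast
  from bchoice[OF this] obtain gam where gam: "\<forall>H\<in>hyperplanes S. gam H \<in> \<Gamma> \<and> g H = (1 / real N) *\<^sub>R gam H" by blast
  have oH: "o' + pin (g H) \<in> H" if "H \<in> hyperplanes S" for H
    using o' that by (force simp: image_iff)
  have val: "x \<in> H \<longleftrightarrow> x \<in> E \<and> nv (direction H) \<bullet> x = nv (direction H) \<bullet> o' + fl (direction H) (gam H) / real N"
    if H: "H \<in> hyperplanes S" for H x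
  proof -
    obtain b where b: "\<forall>x. x \<in> H \<longleftrightarrow> x \<in> E \<and> nv (direction H) \<bullet> x = b" using hyperplane_value[OF H] by blast
    have "b = nv (direction H) \<bullet> o' + fl (direction H) (g H)"
      using b oH[OF H] by (simp add: inner_add_right fl_def)
    also have "fl (direction H) (g H) = fl (direction H) (gam H) / real N" using gam H by (simp add: fl_scale)
    finally show ?thesis using b by simp
  qed
  obtain f where f: "flag f" using flag_exists by blast
  obtain V where "V \<in> directions S" using flag_nonempty[OF f] flag_sub[OF f] by blast
  then obtain H where H: "H \<in> hyperplanes S" by (auto simp: directions_def)
  have "o' + pin (g H) \<in> E" using val[OF H] oH[OF H] by blast
  then have "o' \<in> E" using subspace_diff[OF subE _ pin_in[of "g H"], of "o' + pin (g H)"] by simp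
  then show ?thesis using that[of N o' gam] N gam val by blast
qed

text \<open>Half-spaces are convex, so the segment meets no hyperplane, hence no frontier, and lies
  inside or outside the piece as a whole.\<close>

lemma segment_same_piece:
  assumes val: "\<And>H x. H \<in> hyperplanes S \<Longrightarrow> x \<in> H \<longleftrightarrow> x \<in> E \<and> nv (direction H) \<bullet> x = val H"
    and uv: "u \<in> E" "v \<in> E"
    and side: "\<And>H. H \<in> hyperplanes S \<Longrightarrow> nv (direction H) \<bullet> u < val H \<and> nv (direction H) \<bullet> v < val H \<or>
        val H < nv (direction H) \<bullet> u \<and> val H < nv (direction H) \<bullet> v"
    and i: "i \<in> labels S"
  shows "u \<in> piece S i \<longleftrightarrow> v \<in> piece S i"
proof (rule connected_no_frontier)
  show "closed_segment u v \<subseteq> E"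
    using uv subE by (intro closed_segment_subset subspace_imp_convex)
  show "closed_segment u v \<inter> top_of_set E frontier_of piece S i = {}"
  proof (rule ccontr)
    assume "\<not> ?thesis"
    then obtain x H where x: "x \<in> closed_segment u v" "x \<in> H" "H \<in> hyperplanes S"
      using frontier_in_hyperplanes[OF i] by blast
    let ?n = "nv (direction H)"
    have eq: "?n \<bullet> x = val H" using val[OF x(3)] x(2) by blast
    consider "u \<in> {y. ?n \<bullet> y < val H} \<and> v \<in> {y. ?n \<bullet> y < val H}" | "u \<in> {y. ?n \<bullet> y > val H} \<and> v \<in> {y. ?n \<bullet> y > val H}"
      using side[OF x(3)] by auto
    then show False
    proof cases
      case 1
      then have "closed_segment u v \<subseteq> {y. ?n \<bullet> y < val H}" by (intro closed_segment_subset convex_halfspace_lt) auto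
      then show False using x(1) eq by auto
    next
      case 2
      then have "closed_segment u v \<subseteq> {y. ?n \<bullet> y > val H}" by (intro closed_segment_subset convex_halfspace_gt) auto
      then show False using x(1) eq by auto
    qed
  qed
qed auto

text \<open>A hyperplane may extend beyond its facet, so \<open>pin g\<close> can lie on a translate
  of it even in a non-singular scheme. Since the tested points avoid the frontiers, a small generic
  move leaves all these hyperplanes without changing any membership.\<close>

lemma generic_representative:
  assumes g: "g \<in> \<Gamma>" and B: "finite B" "B \<subseteq> \<Gamma>" and J: "finite J" "\<And>a b. (a, b) \<in> J \<Longrightarrow> a \<in> E \<and> a \<noteq> 0"
  shows "\<exists>q\<in>E. (\<forall>\<gamma>\<in>B. \<forall>i\<in>labels S. q + pin \<gamma> \<in> piece S i \<longleftrightarrow> pin (g + \<gamma>) \<in> piece S i) \<and> (\<forall>(a, b)\<in>J. a \<bullet> q \<noteq> b)"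
proof -
  define X where "X = B \<times> labels S"
  have finX: "finite X" using B finite_labels by (simp add: X_def)
  have "\<forall>x\<in>X. \<exists>d>0. \<forall>y\<in>E. norm (y - pin (g + fst x)) < d \<longrightarrow> (y \<in> piece S (snd x) \<longleftrightarrow> pin (g + fst x) \<in> piece S (snd x))"
  proof
    fix x assume "x \<in> X"
    then have x: "g + fst x \<in> \<Gamma>" "snd x \<in> labels S" using B g zmod.subspace_add[OF zsub] by (auto simp: X_def)
    show "\<exists>d>0. \<forall>y\<in>E. norm (y - pin (g + fst x)) < d \<longrightarrow> (y \<in> piece S (snd x) \<longleftrightarrow> pin (g + fst x) \<in> piece S (snd x))"
    proof (cases "pin (g + fst x) \<in> piece S (snd x)")
      case True
      then show ?thesis
        using off_frontier_ball[OF polytopal_subset[OF piece_polytopal[OF x(2)]] True nonsingular[OF x]] by auto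
    next
      case False
      then show ?thesis
        using outside_ball[OF polytopal_closed[OF piece_polytopal[OF x(2)]] False] by auto
    qed
  qed
  from bchoice[OF this] obtain d where d: "\<forall>x\<in>X. d x > 0 \<and> (\<forall>y\<in>E. norm (y - pin (g + fst x)) < d x \<longrightarrow>
      (y \<in> piece S (snd x) \<longleftrightarrow> pin (g + fst x) \<in> piece S (snd x)))" by blast
  define e where "e = Min (insert 1 (d ` X))"
  have e: "e > 0" unfolding e_def using finX d by auto
  have eX: "e \<le> d x" if "x \<in> X" for x unfolding e_def using finX that by (intro Min_le) auto
  have "\<exists>v\<in>E. norm v < e \<and> (\<forall>(a, b)\<in>J. a \<bullet> (pin g + v) \<noteq> b)"
  proof (rule generic_point_exists[OF subE J(1) _ e])
    fix a b assume "(a, b) \<in> J"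
    then have a: "a \<in> E" "a \<noteq> 0" using J(2) by blast+
    show "\<exists>v\<in>E. a \<bullet> (pin g + v) \<noteq> b"
    proof (cases "a \<bullet> pin g = b")
      case True
      then show ?thesis using a by (intro bexI[of _ a]) (auto simp: inner_add_right)
    next
      case False
      then show ?thesis using subspace_0[OF subE] by (intro bexI[of _ 0]) auto
    qed
  qed
  then obtain v where v: "v \<in> E" "norm v < e" "\<forall>(a, b)\<in>J. a \<bullet> (pin g + v) \<noteq> b" by blast
  have "pin g + v + pin \<gamma> \<in> piece S i \<longleftrightarrow> pin (g + \<gamma>) \<in> piece S i" if "\<gamma> \<in> B" "i \<in> labels S" for \<gamma> i
  proof -
    have x: "(\<gamma>, i) \<in> X" using that by (simp add: X_def)
    have yE: "pin g + v + pin \<gamma> \<in> E" using v(1) pin_in subspace_add[OF subE] by blast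
    have "norm (pin g + v + pin \<gamma> - pin (g + \<gamma>)) < d (\<gamma>, i)" using v(2) eX[OF x] by (simp add: pin_add)
    then show ?thesis using d[rule_format, OF x] yE by simp
  qed
  moreover have "pin g + v \<in> E" using v(1) pin_in subspace_add[OF subE] by blast
  ultimately show ?thesis using v(3) by (intro bexI[of _ "pin g + v"]) auto
qed

lemma linearly_repetitive_if:
  assumes fr: "full_rank" and ba: "\<And>V. V \<in> directions S \<Longrightarrow> badly_approximable V" and wh: "weakly_homogeneous S"
  shows "linearly_repetitive S nrm"
proof -
  obtain N :: nat and o' gam where N: "N > 0" and o': "o' \<in> E" and gam: "\<And>H. H \<in> hyperplanes S \<Longrightarrow> gam H \<in> \<Gamma>"
    and val: "\<And>H x. H \<in> hyperplanes S \<Longrightarrow>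
       x \<in> H \<longleftrightarrow> x \<in> E \<and> nv (direction H) \<bullet> x = nv (direction H) \<bullet> o' + fl (direction H) (gam H) / real N"
    using weakly_homogeneous_values[OF wh] by blast
  define b where "b H = nv (direction H) \<bullet> o' + fl (direction H) (gam H) / real N" for H
  obtain c1 c2 where c1: "c1 > 0" "\<And>x. c1 * norm (pv x) \<le> nrm (pv x)"
    and c2: "c2 > 0" "\<And>x. nrm (pv x) \<le> c2 * norm (pv x)"
    using nrm_bounds by metis
  obtain K where K: "K > 0" "\<And>w. w \<in> W \<Longrightarrow> norm w \<le> K" using W_bounded by blast
  define D where "D = directions S"
  have finD: "finite D" by (simp add: D_def finite_directions)
  obtain f0 where f0: "flag f0" using flag_exists by blast
  have Dne: "D \<noteq> {}" using flag_nonempty[OF f0] flag_sub[OF f0] by (auto simp: D_def)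
  define m where "m = real (2 * card D)"
  have m: "m > 0" using finD Dne by (simp add: m_def card_gt_0_iff)
  obtain CT where CT: "CT > 0" "\<And>r p. r \<ge> 1 \<Longrightarrow> p \<in> E \<Longrightarrow>
      \<exists>\<gamma>\<in>\<Gamma>. norm (pv \<gamma>) \<le> CT * r \<and> (\<forall>V\<in>D. \<bar>fl V (\<gamma> - p)\<bar> \<le> CT / r ^ (sv V - 1))"
    unfolding D_def using transference[OF fr ba] by blast
  obtain cv where cv: "cv > 0" "\<And>r f d v V' d'. r \<ge> 1 \<Longrightarrow> flag f \<Longrightarrow> v \<in> E \<Longrightarrow>
     (\<forall>V\<in>f. d V \<in> \<Gamma> \<and> norm (d V) \<le> r \<and> nv V \<bullet> v = nv V \<bullet> o' + fl V (d V) / real N) \<Longrightarrow>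
     V' \<in> directions S \<Longrightarrow> d' \<in> \<Gamma> \<Longrightarrow> norm d' \<le> r \<Longrightarrow>
     nv V' \<bullet> v = nv V' \<bullet> o' + fl V' d' / real N \<or> cv / r ^ (sv V' - 1) \<le> \<bar>nv V' \<bullet> v - (nv V' \<bullet> o' + fl V' d' / real N)\<bar>"
    using vertex_gap[OF fr ba N o'] by blast
  define G where "G = (\<Sum>H\<in>hyperplanes S. norm (gam H))"
  have G: "norm (gam H) \<le> G" if "H \<in> hyperplanes S" for H
    unfolding G_def using member_le_sum[of H "hyperplanes S" "\<lambda>H. norm (gam H)"] that finite_hyperplanes by auto
  have G0: "G \<ge> 0" by (simp add: G_def sum_nonneg)
  \<comment> \<open>Levels at radius r come from lattice points of norm at most
    \<open>C1 * r\<close>, where \<open>vertex_gap\<close> is applied.\<close>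
  define C1 where "C1 = 1 + (G + real N * (1 / c1 + 2 * K))"
  have C1: "C1 \<ge> 1" unfolding C1_def using G0 c1(1) K(1) by (simp add: add_nonneg_nonneg)
  \<comment> \<open>Enlarging the search radius by \<open>\<kappa>0\<close> brings the transference
    error below the half-width \<open>\<epsilon> V / m\<close> of the box in the cell.\<close>
  define \<kappa>0 where "\<kappa>0 = 1 + CT * m / cv"
  have \<kappa>0: "\<kappa>0 \<ge> 1" using CT(1) m cv(1) by (simp add: \<kappa>0_def)
  define \<kappa> where "\<kappa> = C1 * \<kappa>0"
  have \<kappa>: "\<kappa> \<ge> 1" unfolding \<kappa>_def using mult_mono[OF C1 \<kappa>0] C1 by simp
  define CC where "CC = 1 + c2 * (CT * \<kappa>)"
  have CC: "CC > 0" unfolding CC_def using c2(1) CT(1) \<kappa> by (simp add: add_pos_nonneg)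
  have main: "\<exists>z\<in>\<Lambda>. same_patch S nrm r x z \<and> patch S nrm r z \<subseteq> patch S nrm (CC * r) y"
    if r: "r \<ge> 1" and x: "x \<in> \<Lambda>" and y: "y \<in> \<Lambda>" for r x y
  proof -
    obtain g where g: "g \<in> \<Gamma>" "x = pv g" "pin g \<in> W" using Lambda_E[OF x] by blast
    obtain h where h: "h \<in> \<Gamma>" "y = pv h" "pin h \<in> W" using Lambda_E[OF y] by blast
    \<comment> \<open>Displacements relevant for the patch: those with internal norm above
      \<open>2 * K\<close> carry every point of the window out of it.\<close>
    define B where "B = {\<gamma>\<in>\<Gamma>. norm (pv \<gamma>) \<le> r / c1 \<and> norm (pin \<gamma>) \<le> 2 * K}"
    have BG: "B \<subseteq> \<Gamma>" by (auto simp: B_def)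
    have normB: "norm \<gamma> \<le> r / c1 + 2 * K" if "\<gamma> \<in> B" for \<gamma>
      using that norm_le_split[of \<gamma>] by (auto simp: B_def)
    have "B \<subseteq> {\<gamma>\<in>\<Gamma>. norm \<gamma> \<le> r / c1 + 2 * K}" using BG normB by blast
    then have finB: "finite B" using discrete_subgroup_finite[OF zsub disc] finite_subset by blast
    have B0: "0 \<in> B" using zmod.subspace_0[OF zsub] r c1(1) K(1) by (simp add: B_def)
    \<comment> \<open>The levels at which displaced copies of the hyperplanes of direction
      \<open>V\<close> cut the internal space.\<close>
    define A where "A V = (\<lambda>(H, \<gamma>). b H - fl V \<gamma>) ` ({H \<in> hyperplanes S. direction H = V} \<times> B)" for V
    have finA: "finite (A V)" for V using finite_hyperplanes finB by (simp add: A_def)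
    have AI: "b H - fl (direction H) \<gamma> \<in> A (direction H)" if "H \<in> hyperplanes S" "\<gamma> \<in> B" for H \<gamma>
      using that by (force simp: A_def)
    have Aform: "\<exists>\<delta>\<in>\<Gamma>. norm \<delta> \<le> C1 * r \<and> a = nv V \<bullet> o' + fl V \<delta> / real N" if a: "a \<in> A V" for a V
    proof -
      obtain H \<gamma> where H: "H \<in> hyperplanes S" "direction H = V" "\<gamma> \<in> B" "a = b H - fl V \<gamma>"
        using a by (auto simp: A_def)
      define \<delta> where "\<delta> = gam H - real N *\<^sub>R \<gamma>"
      have "\<delta> \<in> \<Gamma>" unfolding \<delta>_def using H(3) BG
        by (intro zsubspace_diff[OF zsub] zsubspace_of_nat[OF zsub] gam H(1)) auto
      moreover have "norm \<delta> \<le> C1 * r"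
      proof -
        have "norm \<delta> \<le> norm (gam H) + real N * norm \<gamma>"
          unfolding \<delta>_def using norm_triangle_ineq4[of "gam H" "real N *\<^sub>R \<gamma>"] by simp
        also have "\<dots> \<le> G + real N * (r / c1 + 2 * K)" using G[OF H(1)] normB[OF H(3)] by (intro add_mono mult_left_mono) auto
        also have "\<dots> \<le> G * r + real N * (r / c1 + 2 * K * r)"
        proof (intro add_mono mult_left_mono)
          show "G \<le> G * r" using mult_left_mono[OF r G0] by simp
          show "2 * K \<le> 2 * K * r" using mult_left_mono[OF r, of "2 * K"] K(1) by simp
        qed auto
        also have "\<dots> \<le> C1 * r" using r by (simp add: C1_def algebra_simps)
        finally show ?thesis .
      qed
      moreover have "a = nv V \<bullet> o' + fl V \<delta> / real N"
        using H(2,4) N by (simp add: b_def \<delta>_def fl_diff fl_scale diff_divide_distrib)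
      ultimately show ?thesis by blast
    qed
    define J where "J = (\<Union>V\<in>D. (\<lambda>a. (nv V, a)) ` A V)"
    have finJ: "finite J" using finD finA by (simp add: J_def)
    have JE: "a \<in> E \<and> a \<noteq> 0" if "(a, t) \<in> J" for a t
      using that nv_props(1,2) by (auto simp: J_def D_def)
    have "\<exists>q\<in>E. (\<forall>\<gamma>\<in>B. \<forall>i\<in>labels S. q + pin \<gamma> \<in> piece S i \<longleftrightarrow> pin (g + \<gamma>) \<in> piece S i) \<and> (\<forall>(a, t)\<in>J. a \<bullet> q \<noteq> t)"
      by (rule generic_representative[OF g(1) finB BG finJ]) (erule JE)
    then obtain q where q: "q \<in> E" and qB: "\<And>\<gamma> i. \<gamma> \<in> B \<Longrightarrow> i \<in> labels S \<Longrightarrow> q + pin \<gamma> \<in> piece S i \<longleftrightarrow> pin (g + \<gamma>) \<in> piece S i"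
      and qJ: "\<forall>(a, t)\<in>J. a \<bullet> q \<noteq> t"
      by blast
    have qA: "nv V \<bullet> q \<noteq> a" if "V \<in> D" "a \<in> A V" for V a
      using qJ that by (auto simp: J_def)
    have same: "p + pin \<gamma> \<in> piece S i \<longleftrightarrow> pin (g + \<gamma>) \<in> piece S i"
      if p: "p \<in> E" and cell: "\<And>V a. V \<in> D \<Longrightarrow> a \<in> A V \<Longrightarrow> (a < nv V \<bullet> q \<longrightarrow> a < nv V \<bullet> p) \<and> (nv V \<bullet> q < a \<longrightarrow> nv V \<bullet> p < a)"
        and \<gamma>: "\<gamma> \<in> B" and i: "i \<in> labels S" for p \<gamma> i
    proof -
      have "q + pin \<gamma> \<in> piece S i \<longleftrightarrow> p + pin \<gamma> \<in> piece S i"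
      proof (rule segment_same_piece[where val = b, OF _ _ _ _ i])
        show "x \<in> H \<longleftrightarrow> x \<in> E \<and> nv (direction H) \<bullet> x = b H" if "H \<in> hyperplanes S" for H x
          using val[OF that] by (simp add: b_def)
        show "q + pin \<gamma> \<in> E" "p + pin \<gamma> \<in> E" using q p pin_in subspace_add[OF subE] by blast+
        fix H assume H: "H \<in> hyperplanes S"
        have V: "direction H \<in> D" using hyperplane_direction[OF H] by (simp add: D_def)
        have a: "b H - fl (direction H) \<gamma> \<in> A (direction H)" by (rule AI[OF H \<gamma>])
        show "nv (direction H) \<bullet> (q + pin \<gamma>) < b H \<and> nv (direction H) \<bullet> (p + pin \<gamma>) < b H \<or>
          b H < nv (direction H) \<bullet> (q + pin \<gamma>) \<and> b H < nv (direction H) \<bullet> (p + pin \<gamma>)"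
          using cell[OF V a] qA[OF V a] by (auto simp: inner_add_right fl_def)
      qed
      then show ?thesis using qB[OF \<gamma> i] by simp
    qed
    have inW: "p \<in> W"
      if p: "p \<in> E" and cell: "\<And>V a. V \<in> D \<Longrightarrow> a \<in> A V \<Longrightarrow> (a < nv V \<bullet> q \<longrightarrow> a < nv V \<bullet> p) \<and> (nv V \<bullet> q < a \<longrightarrow> nv V \<bullet> p < a)" for p
    proof -
      obtain i where i: "i \<in> labels S" "pin g \<in> piece S i" using g(3) W_eq by blast
      have "p + pin 0 \<in> piece S i" using same[OF p cell B0 i(1)] i(2) by simp
      then show ?thesis using i(1) W_eq by auto
    qed
    define \<epsilon> where "\<epsilon> V = cv / (C1 * r) ^ (sv V - 1)" for V
    have C1r: "C1 * r \<ge> 1" using mult_mono[OF C1 r] C1 by simp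
    have "\<exists>p\<in>E. \<forall>V\<in>D. \<forall>a\<in>A V. (a < nv V \<bullet> q \<longrightarrow> a + \<epsilon> V / real (2 * card D) \<le> nv V \<bullet> p) \<and>
       (nv V \<bullet> q < a \<longrightarrow> nv V \<bullet> p \<le> a - \<epsilon> V / real (2 * card D))"
    proof (rule cell_inner_point[OF subE finD Dne finA q qA])
      show "bounded {p \<in> E. \<forall>V\<in>D. \<forall>a\<in>A V. (a < nv V \<bullet> q \<longrightarrow> a \<le> nv V \<bullet> p) \<and> (nv V \<bullet> q < a \<longrightarrow> nv V \<bullet> p \<le> a)}"
      proof (rule boundedI)
        fix p assume "p \<in> {p \<in> E. \<forall>V\<in>D. \<forall>a\<in>A V. (a < nv V \<bullet> q \<longrightarrow> a \<le> nv V \<bullet> p) \<and> (nv V \<bullet> q < a \<longrightarrow> nv V \<bullet> p \<le> a)}"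
        then have p: "p \<in> E" "\<And>V a. V \<in> D \<Longrightarrow> a \<in> A V \<Longrightarrow> (a < nv V \<bullet> q \<longrightarrow> a \<le> nv V \<bullet> p) \<and> (nv V \<bullet> q < a \<longrightarrow> nv V \<bullet> p \<le> a)"
          by blast+
        \<comment> \<open>The closed cell is bounded because the midpoint of \<open>q\<close> and
          any of its points satisfies the strict inequalities, so it lies in the open cell, which is
          contained in the window.\<close>
        have "(1 / 2) *\<^sub>R (q + p) \<in> W"
        proof (rule inW)
          show "(1 / 2) *\<^sub>R (q + p) \<in> E" using q p(1) subspace_scale[OF subE subspace_add[OF subE]] by blast
          show "(a < nv V \<bullet> q \<longrightarrow> a < nv V \<bullet> ((1 / 2) *\<^sub>R (q + p))) \<and> (nv V \<bullet> q < a \<longrightarrow> nv V \<bullet> ((1 / 2) *\<^sub>R (q + p)) < a)"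
            if "V \<in> D" "a \<in> A V" for V a
            using p(2)[OF that] by (auto simp: inner_add_right)
        qed
        then have "norm (q + p) \<le> 2 * K" using K(2) by fastforce
        moreover have "norm p \<le> norm (q + p) + norm q" using norm_triangle_ineq4[of "q + p" q] by simp
        ultimately show "norm p \<le> 2 * K + norm q" by linarith
      qed
      fix v V a
      assume v: "v \<in> E" "\<And>x. x \<in> E \<Longrightarrow> (\<And>V. V \<in> D \<Longrightarrow> nv V \<bullet> v \<in> A V \<Longrightarrow> nv V \<bullet> x = 0) \<Longrightarrow> x = 0"
        and V: "V \<in> D" and a: "a \<in> A V"
      \<comment> \<open>The directions active at a vertex separate the points of \<open>E\<close>,
        so they contain a flag, and its levels determine the vertex.\<close>
      have "\<exists>f. flag f \<and> {} \<subseteq> f \<and> f \<subseteq> {V \<in> D. nv V \<bullet> v \<in> A V}"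
        by (rule flag_extension) (use v(2) real_vector.independent_empty in \<open>auto simp: D_def\<close>)
      then obtain f where f: "flag f" "f \<subseteq> {V \<in> D. nv V \<bullet> v \<in> A V}" by blast
      have "\<forall>V\<in>f. \<exists>\<delta>. \<delta> \<in> \<Gamma> \<and> norm \<delta> \<le> C1 * r \<and> nv V \<bullet> v = nv V \<bullet> o' + fl V \<delta> / real N"
        using Aform f(2) by blast
      from bchoice[OF this] obtain d where d: "\<forall>V\<in>f. d V \<in> \<Gamma> \<and> norm (d V) \<le> C1 * r \<and> nv V \<bullet> v = nv V \<bullet> o' + fl V (d V) / real N"
        by blast
      obtain d' where d': "d' \<in> \<Gamma>" "norm d' \<le> C1 * r" "a = nv V \<bullet> o' + fl V d' / real N" using Aform[OF a] by blast
      show "nv V \<bullet> v = a \<or> \<epsilon> V \<le> \<bar>nv V \<bullet> v - a\<bar>"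
        unfolding d'(3) \<epsilon>_def by (rule cv(2)[OF C1r f(1) v(1) d _ d'(1,2)]) (use V in \<open>simp add: D_def\<close>)
    qed
    then obtain p where p: "p \<in> E" "\<And>V a. V \<in> D \<Longrightarrow> a \<in> A V \<Longrightarrow> (a < nv V \<bullet> q \<longrightarrow> a + \<epsilon> V / m \<le> nv V \<bullet> p) \<and>
       (nv V \<bullet> q < a \<longrightarrow> nv V \<bullet> p \<le> a - \<epsilon> V / m)" unfolding m_def by blast
    have \<kappa>r: "\<kappa> * r \<ge> 1" using mult_mono[OF \<kappa> r] \<kappa> by simp
    have pE: "p - pin h \<in> E" using p(1) pin_in subspace_diff[OF subE] by blast
    \<comment> \<open>Transference is applied relative to the given centre: the displacement
      \<open>\<gamma>\<close> is O(r) and moves \<open>pin h\<close> into the box around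
      \<open>p\<close>.\<close>
    obtain \<gamma> where \<gamma>: "\<gamma> \<in> \<Gamma>" "norm (pv \<gamma>) \<le> CT * (\<kappa> * r)"
      "\<forall>V\<in>D. \<bar>fl V (\<gamma> - (p - pin h))\<bar> \<le> CT / (\<kappa> * r) ^ (sv V - 1)"
      using CT(2)[OF \<kappa>r pE] by blast
    define z where "z = h + \<gamma>"
    have zG: "z \<in> \<Gamma>" unfolding z_def by (rule zmod.subspace_add[OF zsub h(1) \<gamma>(1)])
    have near: "\<bar>nv V \<bullet> pin z - nv V \<bullet> p\<bar> < \<epsilon> V / m" if V: "V \<in> D" for V
    proof -
      let ?s = "sv V - 1"
      \<comment> \<open>With exponent at least 1 the factor \<open>\<kappa>0\<close> is not lost
        when it is raised to this power.\<close>
      have s: "?s \<ge> 1" using sv_ge_2[of V] ba V by (force simp: D_def)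
      have "pin (\<gamma> - (p - pin h)) = pin z - p" using pin_E[OF pE] by (simp add: z_def pin_add pin_diff)
      then have "fl V (\<gamma> - (p - pin h)) = nv V \<bullet> pin z - nv V \<bullet> p" by (simp add: fl_def inner_diff_right)
      then have "\<bar>nv V \<bullet> pin z - nv V \<bullet> p\<bar> \<le> CT / (\<kappa> * r) ^ ?s" using \<gamma>(3) V by force
      also have "\<dots> < \<epsilon> V / m"
      proof -
        define R where "R = (C1 * r) ^ ?s"
        have R: "R > 0" unfolding R_def using C1r by simp
        have "(\<kappa> * r) ^ ?s = R * \<kappa>0 ^ ?s" by (simp add: R_def \<kappa>_def power_mult_distrib)
        moreover have "\<kappa>0 \<le> \<kappa>0 ^ ?s" using power_increasing[OF s \<kappa>0] by simp
        ultimately have ge: "(\<kappa> * r) ^ ?s \<ge> R * \<kappa>0" using R by simp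
        have R0: "R * \<kappa>0 > 0" using R \<kappa>0 by simp
        have "CT * m < cv * \<kappa>0" using cv(1) by (simp add: \<kappa>0_def distrib_left)
        then have "CT / (R * \<kappa>0) < cv / R / m" using R \<kappa>0 m by (simp add: divide_simps mult.commute)
        moreover have "CT / (\<kappa> * r) ^ ?s \<le> CT / (R * \<kappa>0)" using ge R0 CT(1) by (intro divide_left_mono) auto
        ultimately show ?thesis by (simp add: \<epsilon>_def R_def)
      qed
      finally show ?thesis .
    qed
    have cellz: "(a < nv V \<bullet> q \<longrightarrow> a < nv V \<bullet> pin z) \<and> (nv V \<bullet> q < a \<longrightarrow> nv V \<bullet> pin z < a)" if "V \<in> D" "a \<in> A V" for V a
      using p(2)[OF that] near[OF that(1)] by linarith
    have zW: "pin z \<in> W" using inW[OF pin_in cellz] by blast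
    have sp: "same_patch S nrm r (pv g) (pv z)"
      unfolding same_patch_iff[OF g(1) zG]
    proof (intro ballI impI)
      fix \<gamma>' i assume \<gamma>': "\<gamma>' \<in> \<Gamma>" "nrm (pv \<gamma>') \<le> r" and i: "i \<in> labels S"
      have "c1 * norm (pv \<gamma>') \<le> r" using c1(2)[of \<gamma>'] \<gamma>'(2) by linarith
      then have n: "norm (pv \<gamma>') \<le> r / c1" using c1(1) by (simp add: pos_le_divide_eq mult.commute)
      show "pin (g + \<gamma>') \<in> piece S i \<longleftrightarrow> pin (z + \<gamma>') \<in> piece S i"
      proof (cases "norm (pin \<gamma>') \<le> 2 * K")
        case True
        then have \<gamma>B: "\<gamma>' \<in> B" using \<gamma>'(1) n by (simp add: B_def)
        have "pin z + pin \<gamma>' \<in> piece S i \<longleftrightarrow> pin (g + \<gamma>') \<in> piece S i" by (rule same[OF pin_in _ \<gamma>B i]) (rule cellz)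
        then show ?thesis by (simp add: pin_add)
      next
        case False
        have "w + pin \<gamma>' \<notin> piece S i" if w: "w \<in> W" for w
        proof
          assume "w + pin \<gamma>' \<in> piece S i"
          then have "w + pin \<gamma>' \<in> W" using i W_eq by blast
          then have "norm (w + pin \<gamma>') \<le> K" "norm w \<le> K" using K(2) w by blast+
          then show False using norm_triangle_ineq4[of "w + pin \<gamma>'" w] False by simp
        qed
        then show ?thesis using g(3) zW by (simp add: pin_add)
      qed
    qed
    have sub: "patch S nrm r (pv z) \<subseteq> patch S nrm (CC * r) y"
    proof -
      have "nrm (u - y) \<le> CC * r" if u: "u \<in> \<Lambda>" "nrm (u - pv z) \<le> r" for u
      proof -
        obtain \<mu> where \<mu>: "u = pv \<mu>" using Lambda_E[OF u(1)] by blast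
        have uz: "u - pv z = pv (\<mu> - z)" by (simp add: \<mu> pv_diff)
        have "u - y = pv (\<mu> - z) + pv \<gamma>" by (simp add: \<mu> h(2) z_def pv_diff pv_add)
        then have "nrm (u - y) \<le> nrm (pv (\<mu> - z)) + nrm (pv \<gamma>)" using nrm_tri[OF pv_in pv_in] by simp
        also have "\<dots> \<le> r + c2 * (CT * (\<kappa> * r))"
          using u(2) c2(2)[of \<gamma>] mult_left_mono[OF \<gamma>(2), of c2] c2(1) unfolding uz by linarith
        also have "\<dots> = CC * r" by (simp add: CC_def algebra_simps)
        finally show ?thesis .
      qed
      then show ?thesis by (auto simp: patch_def)
    qed
    show ?thesis using Lambda_pv[OF zG zW] sp sub g(2) by blast
  qed
  have "\<forall>\<^sub>F r in at_top. \<forall>y\<in>\<Lambda>. \<forall>x\<in>\<Lambda>. \<exists>z\<in>\<Lambda>. same_patch S nrm r x z \<and> patch S nrm r z \<subseteq> patch S nrm (CC * r) y"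
    using eventually_ge_at_top[of "1::real"] by (rule eventually_mono) (use main in blast)
  then show ?thesis unfolding linearly_repetitive_def using CC by blast
qed

end

theorem theorem1:
  fixes S :: "('a::euclidean_space, 'l) cps"
    and nrm_phys nrm_int :: "'a \<Rightarrow> real"
  assumes "polytopal_cps S"
    and "weakly_homogeneous S"
    and "norm_on (phys S) nrm_phys"
    and "norm_on (internal S) nrm_int"
  shows "linearly_repetitive S nrm_phys \<longleftrightarrow>
    low_complexity S nrm_phys \<and> diophantine_cps S nrm_int"
proof -
  interpret scheme S nrm_phys using assms(1,3) by unfold_locales
  show ?thesis
  proof (intro iffI conjI)
    assume LR: "linearly_repetitive S nrm_phys"
    show "low_complexity S nrm_phys" by (rule linearly_repetitive_imp_low_complexity[OF LR])
    show "diophantine_cps S nrm_int"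
      by (rule diophantine_from_badly_approximable[OF linearly_repetitive_imp(1)[OF LR] _ assms(4)])
        (rule linearly_repetitive_imp(2)[OF LR])
  next
    assume "low_complexity S nrm_phys \<and> diophantine_cps S nrm_int"
    then have D: "diophantine_cps S nrm_int" by blast
    show "linearly_repetitive S nrm_phys"
      by (rule linearly_repetitive_if[OF badly_approximable_from_diophantine(1)[OF D assms(4)] _ assms(2)])
        (rule badly_approximable_from_diophantine(2)[OF D assms(4)])
  qed
qed

end
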